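(* Let $H$ be a weak Hopf algebra over a commutative ring $k$ with bijective antipode. Then there are isomorphisms of braided monoidal categories $${}_H^H\mathcal{YD}\;\cong\;({}_H\mathcal{YD}^H)^{\rm in}\;\cong\;\overline{\mathcal{YD}_H^H}\;\cong\;(\overline{{}^H\mathcal{YD}_H})^{\rm in}.$$
   Context: All modules are over the commutative ring $k$, $\otimes=\otimes_k$. A weak $k$-bialgebra is a $k$-module $H$ with a unital associative algebra structure and a coassociative counital coalgebra structure $(\Delta,\varepsilon)$, $\Delta(h)=h_{(1)}\otimes h_{(2)}$, such that $\Delta(hk)=\Delta(h)\Delta(k)$, $(\Delta\otimes H)\Delta(1)=1_{(1)}\otimes 1_{(2)}1_{(1')}\otimes 1_{(2')}=1_{(1)}\otimes 1_{(1')}1_{(2)}\otimes 1_{(2')}$, $\varepsilon(hkl)=\varepsilon(hk_{(1)})\varepsilon(k_{(2)}l)=\varepsilon(hk_{(2)})\varepsilon(k_{(1)}l)$. Put $\varepsilon_t(h)=\varepsilon(1_{(1)}h)1_{(2)}$, $\varepsilon_s(h)=1_{(1)}\varepsilon(h1_{(2)})$, $\overline{\varepsilon}_s(h)=\varepsilon(1_{(2)}h)1_{(1)}$, $\overline{\varepsilon}_t(h)=\varepsilon(h1_{(1)})1_{(2)}$, $H_t=\mathrm{Im}(\varepsilon_t)$, $H_s=\mathrm{Im}(\varepsilon_s)$. A weak Hopf algebra is a weak bialgebra with a $k$-linear antipode $S:H\to H$ such that $S(h_{(1)})h_{(2)}=\varepsilon_s(h)$, $h_{(1)}S(h_{(2)})=\varepsilon_t(h)$,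 $S(h_{(1)})h_{(2)}S(h_{(3)})=S(h)$. Monoidal categories of modules. For left $H$-modules $M,N$: $M\otimes_tN=\Delta(1)(M\otimes N)\subset M\otimes N$ with diagonal action; unit object $H_t$ with $h\rightharpoonup z=\varepsilon_t(hz)$; natural associativity constraints; unit constraints $l_M(1_{(1)}\rightharpoonup z\otimes 1_{(2)}m)=zm$, $r_M(1_{(1)}m\otimes 1_{(2)}\rightharpoonup z)=\overline{\varepsilon}_s(z)m$. For right $H$-modules $M,N$: $M\otimes_sN=(M\otimes N)\Delta(1)\subset M\otimes N$ with diagonal action; unit object $H_s$ with $y\leftharpoonup h=\varepsilon_s(yh)$; natural associativity constraints; unit constraints $r_M(m1_{(1)}\otimes y\leftharpoonup 1_{(2)})=my$, $l_M(y\leftharpoonup 1_{(1)}\otimes m1_{(2)})=m\overline{\varepsilon}_t(y)$. Yetter-Drinfeld categories. In each case objects are $k$-modules $M$ with an $H$-action and a (coassociative, counital) $H$-coaction on the indicated sides satisfying the two stated conditions for all $m\in M$, $h\in H$; morphisms are the $H$-linear $H$-colinear maps. Left coactions are written $\lambda(m)=m_{[-1]}\otimes m_{[0]}$, right ones $\rho(m)=m_{[0]}\otimes m_{[1]}$. (LL) ${}_H^H\mathcal{YD}$ (left action, left coaction): $\lambda(m)\in H\otimes_tM$ and $h_{(1)}m_{[-1]}\otimes h_{(2)}m_{[0]}=(h_{(1)}m)_{[-1]}h_{(2)}\otimes(h_{(1)}m)_{[0]}$. Tensor product $M\otimes_tN$ with coaction $\lambda(1_{(1)}m\otimes 1_{(2)}n)=m_{[-1]}n_{[-1]}\otimes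 m_{[0]}\otimes n_{[0]}$; unit $H_t$ with coaction $\Delta$; braiding $M\otimes_tN\to N\otimes_tM$, $1_{(1)}m\otimes 1_{(2)}n\mapsto m_{[-1]}n\otimes m_{[0]}$. (LR) ${}_H\mathcal{YD}^H$ (left action, right coaction): $\rho(m)\in M\otimes_tH$ and $h_{(1)}m_{[0]}\otimes h_{(2)}m_{[1]}=(h_{(2)}m)_{[0]}\otimes(h_{(2)}m)_{[1]}h_{(1)}$. Tensor product $M\otimes_tN$ with $\rho(1_{(1)}m\otimes 1_{(2)}n)=m_{[0]}\otimes n_{[0]}\otimes n_{[1]}m_{[1]}$; unit $H_t$ with $\rho(z)=z_{(2)}\otimes S^{-1}(z_{(1)})$; braiding $M\otimes_tN\to N\otimes_tM$, $1_{(1)}m\otimes 1_{(2)}n\mapsto n_{[0]}\otimes n_{[1]}m$. (RR) $\mathcal{YD}_H^H$ (right action, right coaction): $\rho(m)\in M\otimes_sH$ and $m_{[0]}h_{(1)}\otimes m_{[1]}h_{(2)}=(mh_{(2)})_{[0]}\otimes h_{(1)}(mh_{(2)})_{[1]}$. Tensor product $M\otimes_sN$ with $\rho(m1_{(1)}\otimes n1_{(2)})=m_{[0]}\otimes n_{[0]}\otimes m_{[1]}n_{[1]}$; unit $H_s$ with coaction $\Delta$; braiding $M\otimes_sN\to N\otimes_sM$, $m1_{(1)}\otimes n1_{(2)}\mapsto n_{[0]}\otimes mn_{[1]}$. (RL) ${}^H\mathcal{YD}_H$ (right action, left coaction): $\lambda(m)\in H\otimes_sM$ and $h_{(2)}(mh_{(1)})_{[-1]}\otimes(mh_{(1)})_{[0]}=m_{[-1]}h_{(1)}\otimes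 m_{[0]}h_{(2)}$. Tensor product $M\otimes_sN$ with $\lambda(m1_{(1)}\otimes n1_{(2)})=n_{[-1]}m_{[-1]}\otimes m_{[0]}\otimes n_{[0]}$; unit $H_s$ with $\lambda(y)=S^{-1}(y_{(2)})\otimes y_{(1)}$; braiding $M\otimes_sN\to N\otimes_sM$, $m1_{(1)}\otimes n1_{(2)}\mapsto nm_{[-1]}\otimes m_{[0]}$. Notation. For a braided monoidal category $\mathcal{C}$ with braiding $c$: $\mathcal{C}^{\rm in}$ is the same monoidal category with braiding $\tilde c_{M,N}=c_{N,M}^{-1}$; $\overline{\mathcal{C}}$ is the same category with reversed tensor product $M\,\overline{\otimes}\,N=N\otimes M$, associativity $\overline{a}_{M,N,X}=a^{-1}_{X,N,M}$, same unit object with $l$ and $r$ interchanged, and braiding $\overline{c}_{M,N}=c_{N,M}$. An isomorphism of braided monoidal categories is a strong braided monoidal functor that is an isomorphism of categories. *)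

theory Defs
  imports "HOL-Algebra.Module"
begin

section \<open>Tensor products over a commutative ring\<close>

text \<open>
  All modules have their carrier in one type \<open>'u\<close>, which plays the role of the universe of sets.
  For infinite \<open>'u\<close> there is an injection of the type of lists of pairs into \<open>'u\<close>; we fix one
  and use it to realise tensor products of such modules again on subsets of \<open>'u\<close>.

  A list \<open>[(m\<^sub>1,n\<^sub>1), \<dots>, (m\<^sub>p,n\<^sub>p)]\<close> stands for the formal sum
  \<open>m\<^sub>1 \<otimes> n\<^sub>1 + \<dots> + m\<^sub>p \<otimes> n\<^sub>p\<close>.  The relation below is the congruence on formal sums generated
  by commutativity and by the bilinear balanced relations.  (Additive inverses exist in the quotient
  because \<open>m \<otimes> n + (-m) \<otimes> n = 0 \<otimes> n = 0\<close>.)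
\<close>

definition encode :: "('u \<times> 'u) list \<Rightarrow> 'u" where
  "encode = (SOME f. inj f)"

definition decode :: "'u \<Rightarrow> ('u \<times> 'u) list" where
  "decode = inv_into UNIV encode"

inductive tensor_eq ::
    "('k, 'r) ring_scheme \<Rightarrow> ('k, 'u, 'm) module_scheme \<Rightarrow> ('k, 'u, 'n) module_scheme
      \<Rightarrow> ('u \<times> 'u) list \<Rightarrow> ('u \<times> 'u) list \<Rightarrow> bool"
  for R M N where
    refl: "xs \<in> lists (carrier M \<times> carrier N) \<Longrightarrow> tensor_eq R M N xs xs"
  | sym: "tensor_eq R M N xs ys \<Longrightarrow> tensor_eq R M N ys xs"
  | trans: "tensor_eq R M N xs ys \<Longrightarrow> tensor_eq R M N ys zs \<Longrightarrow> tensor_eq R M N xs zs"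
  | cong: "tensor_eq R M N xs ys \<Longrightarrow> zs \<in> lists (carrier M \<times> carrier N)
      \<Longrightarrow> tensor_eq R M N (zs @ xs) (zs @ ys)"
  | comm: "xs \<in> lists (carrier M \<times> carrier N) \<Longrightarrow> ys \<in> lists (carrier M \<times> carrier N)
      \<Longrightarrow> tensor_eq R M N (xs @ ys) (ys @ xs)"
  | zero: "n \<in> carrier N \<Longrightarrow> tensor_eq R M N [(\<zero>\<^bsub>M\<^esub>, n)] []"
  | add_left: "m \<in> carrier M \<Longrightarrow> m' \<in> carrier M \<Longrightarrow> n \<in> carrier N
      \<Longrightarrow> tensor_eq R M N [(m \<oplus>\<^bsub>M\<^esub> m', n)] [(m, n), (m', n)]"
  | add_right: "m \<in> carrier M \<Longrightarrow> n \<in> carrier N \<Longrightarrow> n' \<in> carrier N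
      \<Longrightarrow> tensor_eq R M N [(m, n \<oplus>\<^bsub>N\<^esub> n')] [(m, n), (m, n')]"
  | balanced: "r \<in> carrier R \<Longrightarrow> m \<in> carrier M \<Longrightarrow> n \<in> carrier N
      \<Longrightarrow> tensor_eq R M N [(r \<odot>\<^bsub>M\<^esub> m, n)] [(m, r \<odot>\<^bsub>N\<^esub> n)]"

text \<open>Each class of formal sums is represented by a chosen member, coded as an element of \<open>'u\<close>.\<close>

definition tensor_class ::
    "('k, 'r) ring_scheme \<Rightarrow> ('k, 'u, 'm) module_scheme \<Rightarrow> ('k, 'u, 'n) module_scheme
      \<Rightarrow> ('u \<times> 'u) list \<Rightarrow> 'u" where
  "tensor_class R M N xs = encode (SOME ys. tensor_eq R M N xs ys)"

text \<open>Modules are HOL-Algebra records, whose ring multiplication and unit are unused here.\<close>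

definition tensor ::
    "('k, 'r) ring_scheme \<Rightarrow> ('k, 'u, 'm) module_scheme \<Rightarrow> ('k, 'u, 'n) module_scheme
      \<Rightarrow> ('k, 'u) module" where
  "tensor R M N =
    \<lparr> carrier = tensor_class R M N ` lists (carrier M \<times> carrier N),
      mult = (\<lambda>_ _. undefined),
      one = undefined,
      zero = tensor_class R M N [],
      add = (\<lambda>x y. tensor_class R M N (decode x @ decode y)),
      smult = (\<lambda>r x. tensor_class R M N (map (\<lambda>(m, n). (r \<odot>\<^bsub>M\<^esub> m, n)) (decode x))) \<rparr>"

definition pure_tensor ::
    "('k, 'r) ring_scheme \<Rightarrow> ('k, 'u, 'm) module_scheme \<Rightarrow> ('k, 'u, 'n) module_scheme
      \<Rightarrow> 'u \<Rightarrow> 'u \<Rightarrow> 'u" where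
  "pure_tensor R M N m n = tensor_class R M N [(m, n)]"

text \<open>
  Sweedler sums: if \<open>x = m\<^sub>1 \<otimes> n\<^sub>1 + \<dots> + m\<^sub>p \<otimes> n\<^sub>p\<close>, then \<open>sweedler P x f\<close> is
  \<open>f m\<^sub>1 n\<^sub>1 + \<dots> + f m\<^sub>p n\<^sub>p\<close> in \<open>P\<close>.  It is only used for bilinear balanced \<open>f\<close>, where it is the
  value at \<open>x\<close> of the linear map out of the tensor product that \<open>f\<close> induces.
\<close>

definition sweedler :: "('p, 'q) ring_scheme \<Rightarrow> 'u \<Rightarrow> ('u \<Rightarrow> 'u \<Rightarrow> 'p) \<Rightarrow> 'p" where
  "sweedler P x f = foldr (\<lambda>(a, b) s. f a b \<oplus>\<^bsub>P\<^esub> s) (decode x) \<zero>\<^bsub>P\<^esub>"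

definition lin_map ::
    "('k, 'r) ring_scheme \<Rightarrow> ('k, 'u, 'm) module_scheme \<Rightarrow> ('k, 'v, 'n) module_scheme
      \<Rightarrow> ('u \<Rightarrow> 'v) set" where
  "lin_map R M N = {f \<in> hom (add_monoid M) (add_monoid N).
     \<forall>r \<in> carrier R. \<forall>x \<in> carrier M. f (r \<odot>\<^bsub>M\<^esub> x) = r \<odot>\<^bsub>N\<^esub> f x}"

definition restrict2 :: "'a set \<Rightarrow> 'b set \<Rightarrow> ('a \<Rightarrow> 'b \<Rightarrow> 'c) \<Rightarrow> 'a \<Rightarrow> 'b \<Rightarrow> 'c" where
  "restrict2 A B f = (\<lambda>x y. if x \<in> A \<and> y \<in> B then f x y else undefined)"

definition submod ::
    "('k, 'r) ring_scheme \<Rightarrow> ('k, 'u, 'm) module_scheme \<Rightarrow> 'u set \<Rightarrow> ('k, 'u) module" where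
  "submod R M A =
    \<lparr> carrier = A,
      mult = (\<lambda>_ _. undefined),
      one = undefined,
      zero = \<zero>\<^bsub>M\<^esub>,
      add = restrict2 A A (add M),
      smult = restrict2 (carrier R) A (smult M) \<rparr>"

text \<open>
  For submodules \<open>A' \<subseteq> A\<close> and \<open>B' \<subseteq> B\<close>, elements of \<open>A' \<otimes> B'\<close> and \<open>A \<otimes> B\<close> are different as
  elements of \<open>'u\<close>, and there is a canonical map \<open>A' \<otimes> B' \<rightarrow> A \<otimes> B\<close>, \<open>a \<otimes> b \<mapsto> a \<otimes> b\<close>.  In all uses
  below it is injective (the submodules are direct summands), and \<open>corestrict R A' B' A B y\<close> is
  the element \<open>y\<close> of \<open>A \<otimes> B\<close> regarded as an element of \<open>A' \<otimes> B'\<close>.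
\<close>

definition corestrict ::
    "('k, 'r) ring_scheme \<Rightarrow> ('k, 'u, 'a) module_scheme \<Rightarrow> ('k, 'u, 'b) module_scheme
      \<Rightarrow> ('k, 'u, 'c) module_scheme \<Rightarrow> ('k, 'u, 'd) module_scheme \<Rightarrow> 'u \<Rightarrow> 'u" where
  "corestrict R A' B' A B y =
    (THE x. x \<in> carrier (tensor R A' B') \<and> sweedler (tensor R A B) x (pure_tensor R A B) = y)"


section \<open>Weak bialgebras and weak Hopf algebras\<close>

record ('k, 'u) weak_hopf = "('k, 'u) module" +
  comult :: "'u \<Rightarrow> 'u"
  counit :: "'u \<Rightarrow> 'k"
  antipode :: "'u \<Rightarrow> 'u"

locale weak_bialgebra = module R H + ring H
  for R :: "('k, 'r) ring_scheme" and H :: "('k, 'u, 'z) weak_hopf_scheme" +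
  assumes smult_mult_left:
      "\<And>r g h. r \<in> carrier R \<Longrightarrow> g \<in> carrier H \<Longrightarrow> h \<in> carrier H
        \<Longrightarrow> (r \<odot>\<^bsub>H\<^esub> g) \<otimes>\<^bsub>H\<^esub> h = r \<odot>\<^bsub>H\<^esub> (g \<otimes>\<^bsub>H\<^esub> h)"
    and smult_mult_right:
      "\<And>r g h. r \<in> carrier R \<Longrightarrow> g \<in> carrier H \<Longrightarrow> h \<in> carrier H
        \<Longrightarrow> g \<otimes>\<^bsub>H\<^esub> (r \<odot>\<^bsub>H\<^esub> h) = r \<odot>\<^bsub>H\<^esub> (g \<otimes>\<^bsub>H\<^esub> h)"
    and comult_linear: "comult H \<in> lin_map R H (tensor R H H)"
    and counit_additive: "counit H \<in> hom (add_monoid H) (add_monoid R)"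
    and counit_smult:
      "\<And>r h. r \<in> carrier R \<Longrightarrow> h \<in> carrier H
        \<Longrightarrow> counit H (r \<odot>\<^bsub>H\<^esub> h) = r \<otimes>\<^bsub>R\<^esub> counit H h"
    and coassociative:
      "\<And>h. h \<in> carrier H \<Longrightarrow>
        sweedler (tensor R H (tensor R H H)) (comult H h) (\<lambda>a b.
          sweedler (tensor R H (tensor R H H)) (comult H a) (\<lambda>a\<^sub>1 a\<^sub>2.
            pure_tensor R H (tensor R H H) a\<^sub>1 (pure_tensor R H H a\<^sub>2 b)))
        = sweedler (tensor R H (tensor R H H)) (comult H h) (\<lambda>a b.
            pure_tensor R H (tensor R H H) a (comult H b))"
    and counit_left:
      "\<And>h. h \<in> carrier H \<Longrightarrow> sweedler H (comult H h) (\<lambda>a b. counit H a \<odot>\<^bsub>H\<^esub> b) = h"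
    and counit_right:
      "\<And>h. h \<in> carrier H \<Longrightarrow> sweedler H (comult H h) (\<lambda>a b. counit H b \<odot>\<^bsub>H\<^esub> a) = h"
    and comult_mult:
      "\<And>g h. g \<in> carrier H \<Longrightarrow> h \<in> carrier H \<Longrightarrow>
        comult H (g \<otimes>\<^bsub>H\<^esub> h) =
          sweedler (tensor R H H) (comult H g) (\<lambda>a b.
            sweedler (tensor R H H) (comult H h) (\<lambda>c d.
              pure_tensor R H H (a \<otimes>\<^bsub>H\<^esub> c) (b \<otimes>\<^bsub>H\<^esub> d)))"
    and comult_one_1:
      "sweedler (tensor R H (tensor R H H)) (comult H \<one>\<^bsub>H\<^esub>) (\<lambda>a b.
          sweedler (tensor R H (tensor R H H)) (comult H a) (\<lambda>a\<^sub>1 a\<^sub>2.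
            pure_tensor R H (tensor R H H) a\<^sub>1 (pure_tensor R H H a\<^sub>2 b)))
        = sweedler (tensor R H (tensor R H H)) (comult H \<one>\<^bsub>H\<^esub>) (\<lambda>a b.
            sweedler (tensor R H (tensor R H H)) (comult H \<one>\<^bsub>H\<^esub>) (\<lambda>a' b'.
              pure_tensor R H (tensor R H H) a (pure_tensor R H H (b \<otimes>\<^bsub>H\<^esub> a') b')))"
    and comult_one_2:
      "sweedler (tensor R H (tensor R H H)) (comult H \<one>\<^bsub>H\<^esub>) (\<lambda>a b.
          sweedler (tensor R H (tensor R H H)) (comult H a) (\<lambda>a\<^sub>1 a\<^sub>2.
            pure_tensor R H (tensor R H H) a\<^sub>1 (pure_tensor R H H a\<^sub>2 b)))
        = sweedler (tensor R H (tensor R H H)) (comult H \<one>\<^bsub>H\<^esub>) (\<lambda>a b.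
            sweedler (tensor R H (tensor R H H)) (comult H \<one>\<^bsub>H\<^esub>) (\<lambda>a' b'.
              pure_tensor R H (tensor R H H) a (pure_tensor R H H (a' \<otimes>\<^bsub>H\<^esub> b) b')))"
    and counit_mult_1:
      "\<And>h g l. h \<in> carrier H \<Longrightarrow> g \<in> carrier H \<Longrightarrow> l \<in> carrier H \<Longrightarrow>
        counit H (h \<otimes>\<^bsub>H\<^esub> g \<otimes>\<^bsub>H\<^esub> l) =
          sweedler R (comult H g) (\<lambda>a b. counit H (h \<otimes>\<^bsub>H\<^esub> a) \<otimes>\<^bsub>R\<^esub> counit H (b \<otimes>\<^bsub>H\<^esub> l))"
    and counit_mult_2:
      "\<And>h g l. h \<in> carrier H \<Longrightarrow> g \<in> carrier H \<Longrightarrow> l \<in> carrier H \<Longrightarrow>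
        counit H (h \<otimes>\<^bsub>H\<^esub> g \<otimes>\<^bsub>H\<^esub> l) =
          sweedler R (comult H g) (\<lambda>a b. counit H (h \<otimes>\<^bsub>H\<^esub> b) \<otimes>\<^bsub>R\<^esub> counit H (a \<otimes>\<^bsub>H\<^esub> l))"

definition eps_t :: "('k, 'u, 'z) weak_hopf_scheme \<Rightarrow> 'u \<Rightarrow> 'u" where
  "eps_t H h = sweedler H (comult H \<one>\<^bsub>H\<^esub>) (\<lambda>a b. counit H (a \<otimes>\<^bsub>H\<^esub> h) \<odot>\<^bsub>H\<^esub> b)"

definition eps_s :: "('k, 'u, 'z) weak_hopf_scheme \<Rightarrow> 'u \<Rightarrow> 'u" where
  "eps_s H h = sweedler H (comult H \<one>\<^bsub>H\<^esub>) (\<lambda>a b. counit H (h \<otimes>\<^bsub>H\<^esub> b) \<odot>\<^bsub>H\<^esub> a)"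

definition eps_s_bar :: "('k, 'u, 'z) weak_hopf_scheme \<Rightarrow> 'u \<Rightarrow> 'u" where
  "eps_s_bar H h = sweedler H (comult H \<one>\<^bsub>H\<^esub>) (\<lambda>a b. counit H (b \<otimes>\<^bsub>H\<^esub> h) \<odot>\<^bsub>H\<^esub> a)"

definition eps_t_bar :: "('k, 'u, 'z) weak_hopf_scheme \<Rightarrow> 'u \<Rightarrow> 'u" where
  "eps_t_bar H h = sweedler H (comult H \<one>\<^bsub>H\<^esub>) (\<lambda>a b. counit H (h \<otimes>\<^bsub>H\<^esub> a) \<odot>\<^bsub>H\<^esub> b)"

definition target :: "('k, 'u, 'z) weak_hopf_scheme \<Rightarrow> 'u set" where
  "target H = eps_t H ` carrier H"

definition source :: "('k, 'u, 'z) weak_hopf_scheme \<Rightarrow> 'u set" where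
  "source H = eps_s H ` carrier H"

locale weak_hopf_algebra = weak_bialgebra R H
  for R :: "('k, 'r) ring_scheme" and H :: "('k, 'u, 'z) weak_hopf_scheme" +
  assumes antipode_linear: "antipode H \<in> lin_map R H H"
    and antipode_left:
      "\<And>h. h \<in> carrier H
        \<Longrightarrow> sweedler H (comult H h) (\<lambda>a b. antipode H a \<otimes>\<^bsub>H\<^esub> b) = eps_s H h"
    and antipode_right:
      "\<And>h. h \<in> carrier H
        \<Longrightarrow> sweedler H (comult H h) (\<lambda>a b. a \<otimes>\<^bsub>H\<^esub> antipode H b) = eps_t H h"
    and antipode_middle:
      "\<And>h. h \<in> carrier H \<Longrightarrow>
        sweedler H (comult H h) (\<lambda>a b. sweedler H (comult H b) (\<lambda>b\<^sub>1 b\<^sub>2.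
          antipode H a \<otimes>\<^bsub>H\<^esub> b\<^sub>1 \<otimes>\<^bsub>H\<^esub> antipode H b\<^sub>2)) = antipode H h"

definition antipode_inv :: "('k, 'u, 'z) weak_hopf_scheme \<Rightarrow> 'u \<Rightarrow> 'u" where
  "antipode_inv H = inv_into (carrier H) (antipode H)"


section \<open>Modules with an action and a coaction\<close>

text \<open>
  For left \<open>H\<close>-modules \<open>act M h m\<close> is \<open>hm\<close>; for right \<open>H\<close>-modules \<open>act M m h\<close> is \<open>mh\<close>.
  A left coaction takes values in \<open>H \<otimes> M\<close>, a right one in \<open>M \<otimes> H\<close>.
\<close>

record ('k, 'u) yd_module = "('k, 'u) module" +
  act :: "'u \<Rightarrow> 'u \<Rightarrow> 'u"
  coact :: "'u \<Rightarrow> 'u"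

text \<open>
  All operations are undefined outside the carriers, so that two records are equal iff they have the
  same underlying set and the same structure on it.
\<close>

definition extensional_module ::
    "('k, 'r) ring_scheme \<Rightarrow> ('k, 'u) yd_module \<Rightarrow> bool" where
  "extensional_module R M \<longleftrightarrow>
     mult M = (\<lambda>_ _. undefined) \<and> one M = undefined \<and>
     add M = restrict2 (carrier M) (carrier M) (add M) \<and>
     smult M = restrict2 (carrier R) (carrier M) (smult M) \<and>
     coact M \<in> extensional (carrier M)"

definition left_module ::
    "('k, 'r) ring_scheme \<Rightarrow> ('k, 'u, 'z) weak_hopf_scheme \<Rightarrow> ('k, 'u) yd_module \<Rightarrow> bool" where
  "left_module R H M \<longleftrightarrow>
     module R M \<and> extensional_module R M \<and>
     act M = restrict2 (carrier H) (carrier M) (act M) \<and>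
     (\<forall>h \<in> carrier H. act M h \<in> lin_map R M M) \<and>
     (\<forall>m \<in> carrier M. (\<lambda>h. act M h m) \<in> lin_map R H M) \<and>
     (\<forall>g \<in> carrier H. \<forall>h \<in> carrier H. \<forall>m \<in> carrier M.
        act M (g \<otimes>\<^bsub>H\<^esub> h) m = act M g (act M h m)) \<and>
     (\<forall>m \<in> carrier M. act M \<one>\<^bsub>H\<^esub> m = m)"

definition right_module ::
    "('k, 'r) ring_scheme \<Rightarrow> ('k, 'u, 'z) weak_hopf_scheme \<Rightarrow> ('k, 'u) yd_module \<Rightarrow> bool" where
  "right_module R H M \<longleftrightarrow>
     module R M \<and> extensional_module R M \<and>
     act M = restrict2 (carrier M) (carrier H) (act M) \<and>
     (\<forall>h \<in> carrier H. (\<lambda>m. act M m h) \<in> lin_map R M M) \<and>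
     (\<forall>m \<in> carrier M. act M m \<in> lin_map R H M) \<and>
     (\<forall>g \<in> carrier H. \<forall>h \<in> carrier H. \<forall>m \<in> carrier M.
        act M m (g \<otimes>\<^bsub>H\<^esub> h) = act M (act M m g) h) \<and>
     (\<forall>m \<in> carrier M. act M m \<one>\<^bsub>H\<^esub> = m)"

definition left_comodule ::
    "('k, 'r) ring_scheme \<Rightarrow> ('k, 'u, 'z) weak_hopf_scheme \<Rightarrow> ('k, 'u) yd_module \<Rightarrow> bool" where
  "left_comodule R H M \<longleftrightarrow>
     coact M \<in> lin_map R M (tensor R H M) \<and>
     (\<forall>m \<in> carrier M.
        sweedler (tensor R H (tensor R H M)) (coact M m) (\<lambda>a m\<^sub>0.
          sweedler (tensor R H (tensor R H M)) (comult H a) (\<lambda>a\<^sub>1 a\<^sub>2.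
            pure_tensor R H (tensor R H M) a\<^sub>1 (pure_tensor R H M a\<^sub>2 m\<^sub>0)))
        = sweedler (tensor R H (tensor R H M)) (coact M m) (\<lambda>a m\<^sub>0.
            pure_tensor R H (tensor R H M) a (coact M m\<^sub>0))) \<and>
     (\<forall>m \<in> carrier M. sweedler M (coact M m) (\<lambda>a m\<^sub>0. counit H a \<odot>\<^bsub>M\<^esub> m\<^sub>0) = m)"

definition right_comodule ::
    "('k, 'r) ring_scheme \<Rightarrow> ('k, 'u, 'z) weak_hopf_scheme \<Rightarrow> ('k, 'u) yd_module \<Rightarrow> bool" where
  "right_comodule R H M \<longleftrightarrow>
     coact M \<in> lin_map R M (tensor R M H) \<and>
     (\<forall>m \<in> carrier M.
        sweedler (tensor R (tensor R M H) H) (coact M m) (\<lambda>m\<^sub>0 a.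
          pure_tensor R (tensor R M H) H (coact M m\<^sub>0) a)
        = sweedler (tensor R (tensor R M H) H) (coact M m) (\<lambda>m\<^sub>0 a.
            sweedler (tensor R (tensor R M H) H) (comult H a) (\<lambda>a\<^sub>1 a\<^sub>2.
              pure_tensor R (tensor R M H) H (pure_tensor R M H m\<^sub>0 a\<^sub>1) a\<^sub>2))) \<and>
     (\<forall>m \<in> carrier M. sweedler M (coact M m) (\<lambda>m\<^sub>0 a. counit H a \<odot>\<^bsub>M\<^esub> m\<^sub>0) = m)"

text \<open>
  The componentwise action of an element of \<open>H \<otimes> H\<close> on \<open>M \<otimes> N\<close>.  The actions \<open>\<alpha>\<close> on \<open>M\<close> and \<open>\<beta>\<close> on \<open>N\<close>
  are passed explicitly because \<open>H\<close> itself, with its multiplication as action, also occurs as a factor.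
\<close>

definition left_diag ::
    "('k, 'r) ring_scheme \<Rightarrow> ('k, 'u, 'm) module_scheme \<Rightarrow> ('u \<Rightarrow> 'u \<Rightarrow> 'u)
      \<Rightarrow> ('k, 'u, 'n) module_scheme \<Rightarrow> ('u \<Rightarrow> 'u \<Rightarrow> 'u) \<Rightarrow> 'u \<Rightarrow> 'u \<Rightarrow> 'u" where
  "left_diag R M \<alpha> N \<beta> u x =
     sweedler (tensor R M N) u (\<lambda>a b. sweedler (tensor R M N) x (\<lambda>m n.
       pure_tensor R M N (\<alpha> a m) (\<beta> b n)))"

definition right_diag ::
    "('k, 'r) ring_scheme \<Rightarrow> ('k, 'u, 'm) module_scheme \<Rightarrow> ('u \<Rightarrow> 'u \<Rightarrow> 'u)
      \<Rightarrow> ('k, 'u, 'n) module_scheme \<Rightarrow> ('u \<Rightarrow> 'u \<Rightarrow> 'u) \<Rightarrow> 'u \<Rightarrow> 'u \<Rightarrow> 'u" where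
  "right_diag R M \<alpha> N \<beta> x u =
     sweedler (tensor R M N) x (\<lambda>m n. sweedler (tensor R M N) u (\<lambda>a b.
       pure_tensor R M N (\<alpha> m a) (\<beta> n b)))"

definition tensor_t ::
    "('k, 'r) ring_scheme \<Rightarrow> ('k, 'u, 'z) weak_hopf_scheme
      \<Rightarrow> ('k, 'u, 'm) module_scheme \<Rightarrow> ('u \<Rightarrow> 'u \<Rightarrow> 'u)
      \<Rightarrow> ('k, 'u, 'n) module_scheme \<Rightarrow> ('u \<Rightarrow> 'u \<Rightarrow> 'u) \<Rightarrow> 'u set" where
  "tensor_t R H M \<alpha> N \<beta> =
     (\<lambda>x. left_diag R M \<alpha> N \<beta> (comult H \<one>\<^bsub>H\<^esub>) x) ` carrier (tensor R M N)"

definition tensor_s ::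
    "('k, 'r) ring_scheme \<Rightarrow> ('k, 'u, 'z) weak_hopf_scheme
      \<Rightarrow> ('k, 'u, 'm) module_scheme \<Rightarrow> ('u \<Rightarrow> 'u \<Rightarrow> 'u)
      \<Rightarrow> ('k, 'u, 'n) module_scheme \<Rightarrow> ('u \<Rightarrow> 'u \<Rightarrow> 'u) \<Rightarrow> 'u set" where
  "tensor_s R H M \<alpha> N \<beta> =
     (\<lambda>x. right_diag R M \<alpha> N \<beta> x (comult H \<one>\<^bsub>H\<^esub>)) ` carrier (tensor R M N)"


section \<open>Yetter-Drinfeld modules\<close>

definition yd_LL ::
    "('k, 'r) ring_scheme \<Rightarrow> ('k, 'u, 'z) weak_hopf_scheme \<Rightarrow> ('k, 'u) yd_module \<Rightarrow> bool" where
  "yd_LL R H M \<longleftrightarrow>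
     left_module R H M \<and> left_comodule R H M \<and>
     (\<forall>m \<in> carrier M. coact M m \<in> tensor_t R H H (mult H) M (act M)) \<and>
     (\<forall>m \<in> carrier M. \<forall>h \<in> carrier H.
        sweedler (tensor R H M) (comult H h) (\<lambda>h\<^sub>1 h\<^sub>2.
          sweedler (tensor R H M) (coact M m) (\<lambda>a m\<^sub>0.
            pure_tensor R H M (h\<^sub>1 \<otimes>\<^bsub>H\<^esub> a) (act M h\<^sub>2 m\<^sub>0)))
        = sweedler (tensor R H M) (comult H h) (\<lambda>h\<^sub>1 h\<^sub>2.
            sweedler (tensor R H M) (coact M (act M h\<^sub>1 m)) (\<lambda>a m\<^sub>0.
              pure_tensor R H M (a \<otimes>\<^bsub>H\<^esub> h\<^sub>2) m\<^sub>0)))"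

definition yd_LR ::
    "('k, 'r) ring_scheme \<Rightarrow> ('k, 'u, 'z) weak_hopf_scheme \<Rightarrow> ('k, 'u) yd_module \<Rightarrow> bool" where
  "yd_LR R H M \<longleftrightarrow>
     left_module R H M \<and> right_comodule R H M \<and>
     (\<forall>m \<in> carrier M. coact M m \<in> tensor_t R H M (act M) H (mult H)) \<and>
     (\<forall>m \<in> carrier M. \<forall>h \<in> carrier H.
        sweedler (tensor R M H) (comult H h) (\<lambda>h\<^sub>1 h\<^sub>2.
          sweedler (tensor R M H) (coact M m) (\<lambda>m\<^sub>0 a.
            pure_tensor R M H (act M h\<^sub>1 m\<^sub>0) (h\<^sub>2 \<otimes>\<^bsub>H\<^esub> a)))
        = sweedler (tensor R M H) (comult H h) (\<lambda>h\<^sub>1 h\<^sub>2.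
            sweedler (tensor R M H) (coact M (act M h\<^sub>2 m)) (\<lambda>m\<^sub>0 a.
              pure_tensor R M H m\<^sub>0 (a \<otimes>\<^bsub>H\<^esub> h\<^sub>1))))"

definition yd_RR ::
    "('k, 'r) ring_scheme \<Rightarrow> ('k, 'u, 'z) weak_hopf_scheme \<Rightarrow> ('k, 'u) yd_module \<Rightarrow> bool" where
  "yd_RR R H M \<longleftrightarrow>
     right_module R H M \<and> right_comodule R H M \<and>
     (\<forall>m \<in> carrier M. coact M m \<in> tensor_s R H M (act M) H (mult H)) \<and>
     (\<forall>m \<in> carrier M. \<forall>h \<in> carrier H.
        sweedler (tensor R M H) (comult H h) (\<lambda>h\<^sub>1 h\<^sub>2.
          sweedler (tensor R M H) (coact M m) (\<lambda>m\<^sub>0 a.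
            pure_tensor R M H (act M m\<^sub>0 h\<^sub>1) (a \<otimes>\<^bsub>H\<^esub> h\<^sub>2)))
        = sweedler (tensor R M H) (comult H h) (\<lambda>h\<^sub>1 h\<^sub>2.
            sweedler (tensor R M H) (coact M (act M m h\<^sub>2)) (\<lambda>m\<^sub>0 a.
              pure_tensor R M H m\<^sub>0 (h\<^sub>1 \<otimes>\<^bsub>H\<^esub> a))))"

definition yd_RL ::
    "('k, 'r) ring_scheme \<Rightarrow> ('k, 'u, 'z) weak_hopf_scheme \<Rightarrow> ('k, 'u) yd_module \<Rightarrow> bool" where
  "yd_RL R H M \<longleftrightarrow>
     right_module R H M \<and> left_comodule R H M \<and>
     (\<forall>m \<in> carrier M. coact M m \<in> tensor_s R H H (mult H) M (act M)) \<and>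
     (\<forall>m \<in> carrier M. \<forall>h \<in> carrier H.
        sweedler (tensor R H M) (comult H h) (\<lambda>h\<^sub>1 h\<^sub>2.
          sweedler (tensor R H M) (coact M (act M m h\<^sub>1)) (\<lambda>a m\<^sub>0.
            pure_tensor R H M (h\<^sub>2 \<otimes>\<^bsub>H\<^esub> a) m\<^sub>0))
        = sweedler (tensor R H M) (comult H h) (\<lambda>h\<^sub>1 h\<^sub>2.
            sweedler (tensor R H M) (coact M m) (\<lambda>a m\<^sub>0.
              pure_tensor R H M (a \<otimes>\<^bsub>H\<^esub> h\<^sub>1) (act M m\<^sub>0 h\<^sub>2))))"

text \<open>Arrows are triples of domain, extensional function, codomain.\<close>

type_synonym ('k, 'u) yd_arrow = "('k, 'u) yd_module \<times> ('u \<Rightarrow> 'u) \<times> ('k, 'u) yd_module"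

definition left_linear ::
    "('k, 'r) ring_scheme \<Rightarrow> ('k, 'u, 'z) weak_hopf_scheme \<Rightarrow> ('k, 'u) yd_arrow \<Rightarrow> bool" where
  "left_linear R H = (\<lambda>(M, f, N). f \<in> lin_map R M N \<and>
     (\<forall>h \<in> carrier H. \<forall>m \<in> carrier M. f (act M h m) = act N h (f m)))"

definition right_linear ::
    "('k, 'r) ring_scheme \<Rightarrow> ('k, 'u, 'z) weak_hopf_scheme \<Rightarrow> ('k, 'u) yd_arrow \<Rightarrow> bool" where
  "right_linear R H = (\<lambda>(M, f, N). f \<in> lin_map R M N \<and>
     (\<forall>h \<in> carrier H. \<forall>m \<in> carrier M. f (act M m h) = act N (f m) h))"

definition left_colinear ::
    "('k, 'r) ring_scheme \<Rightarrow> ('k, 'u, 'z) weak_hopf_scheme \<Rightarrow> ('k, 'u) yd_arrow \<Rightarrow> bool" where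
  "left_colinear R H = (\<lambda>(M, f, N). \<forall>m \<in> carrier M.
     coact N (f m) =
       sweedler (tensor R H N) (coact M m) (\<lambda>a m\<^sub>0. pure_tensor R H N a (f m\<^sub>0)))"

definition right_colinear ::
    "('k, 'r) ring_scheme \<Rightarrow> ('k, 'u, 'z) weak_hopf_scheme \<Rightarrow> ('k, 'u) yd_arrow \<Rightarrow> bool" where
  "right_colinear R H = (\<lambda>(M, f, N). \<forall>m \<in> carrier M.
     coact N (f m) =
       sweedler (tensor R N H) (coact M m) (\<lambda>m\<^sub>0 a. pure_tensor R N H (f m\<^sub>0) a))"

definition yd_arrows ::
    "(('k, 'u) yd_module \<Rightarrow> bool) \<Rightarrow> (('k, 'u) yd_arrow \<Rightarrow> bool) \<Rightarrow> (('k, 'u) yd_arrow \<Rightarrow> bool)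
      \<Rightarrow> ('k, 'u) yd_arrow set" where
  "yd_arrows obj linear colinear =
     {(M, f, N). obj M \<and> obj N \<and> f \<in> extensional (carrier M) \<and>
        linear (M, f, N) \<and> colinear (M, f, N)}"

text \<open>The object on the \<open>R\<close>-submodule \<open>A\<close> of \<open>M\<close> with the given action and coaction.\<close>

definition left_object ::
    "('k, 'r) ring_scheme \<Rightarrow> ('k, 'u, 'z) weak_hopf_scheme \<Rightarrow> ('k, 'u, 'm) module_scheme
      \<Rightarrow> 'u set \<Rightarrow> ('u \<Rightarrow> 'u \<Rightarrow> 'u) \<Rightarrow> ('u \<Rightarrow> 'u) \<Rightarrow> ('k, 'u) yd_module" where
  "left_object R H M A \<alpha> \<rho> = module.extend (submod R M A)
     \<lparr> act = restrict2 (carrier H) A \<alpha>, coact = restrict \<rho> A \<rparr>"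

definition right_object ::
    "('k, 'r) ring_scheme \<Rightarrow> ('k, 'u, 'z) weak_hopf_scheme \<Rightarrow> ('k, 'u, 'm) module_scheme
      \<Rightarrow> 'u set \<Rightarrow> ('u \<Rightarrow> 'u \<Rightarrow> 'u) \<Rightarrow> ('u \<Rightarrow> 'u) \<Rightarrow> ('k, 'u) yd_module" where
  "right_object R H M A \<alpha> \<rho> = module.extend (submod R M A)
     \<lparr> act = restrict2 A (carrier H) \<alpha>, coact = restrict \<rho> A \<rparr>"

subsection \<open>Units\<close>

definition unit_LL ::
    "('k, 'r) ring_scheme \<Rightarrow> ('k, 'u, 'z) weak_hopf_scheme \<Rightarrow> ('k, 'u) yd_module" where
  "unit_LL R H = left_object R H H (target H)
     (\<lambda>h z. eps_t H (h \<otimes>\<^bsub>H\<^esub> z))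
     (\<lambda>z. corestrict R H (submod R H (target H)) H H (comult H z))"

definition unit_LR ::
    "('k, 'r) ring_scheme \<Rightarrow> ('k, 'u, 'z) weak_hopf_scheme \<Rightarrow> ('k, 'u) yd_module" where
  "unit_LR R H = left_object R H H (target H)
     (\<lambda>h z. eps_t H (h \<otimes>\<^bsub>H\<^esub> z))
     (\<lambda>z. corestrict R (submod R H (target H)) H H H
        (sweedler (tensor R H H) (comult H z) (\<lambda>z\<^sub>1 z\<^sub>2.
          pure_tensor R H H z\<^sub>2 (antipode_inv H z\<^sub>1))))"

definition unit_RR ::
    "('k, 'r) ring_scheme \<Rightarrow> ('k, 'u, 'z) weak_hopf_scheme \<Rightarrow> ('k, 'u) yd_module" where
  "unit_RR R H = right_object R H H (source H)
     (\<lambda>y h. eps_s H (y \<otimes>\<^bsub>H\<^esub> h))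
     (\<lambda>y. corestrict R (submod R H (source H)) H H H (comult H y))"

definition unit_RL ::
    "('k, 'r) ring_scheme \<Rightarrow> ('k, 'u, 'z) weak_hopf_scheme \<Rightarrow> ('k, 'u) yd_module" where
  "unit_RL R H = right_object R H H (source H)
     (\<lambda>y h. eps_s H (y \<otimes>\<^bsub>H\<^esub> h))
     (\<lambda>y. corestrict R H (submod R H (source H)) H H
        (sweedler (tensor R H H) (comult H y) (\<lambda>y\<^sub>1 y\<^sub>2.
          pure_tensor R H H (antipode_inv H y\<^sub>2) y\<^sub>1)))"

subsection \<open>Tensor products\<close>

text \<open>
  An element \<open>x\<close> of \<open>M \<otimes>\<^sub>t N\<close> satisfies \<open>x = \<Delta>(1)x\<close>, so a formula prescribing a linear map on the elements
  \<open>1\<^sub>(\<^sub>1\<^sub>)m \<otimes> 1\<^sub>(\<^sub>2\<^sub>)n\<close> in terms of \<open>m\<close> and \<open>n\<close> determines its value at \<open>x\<close> by evaluating the formula on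
  any presentation of \<open>x\<close> as a sum of elements \<open>m \<otimes> n\<close>; similarly for \<open>M \<otimes>\<^sub>s N\<close>.  All coactions, unit
  constraints and braidings below are written in this way.
\<close>

definition left_tensor ::
    "('k, 'r) ring_scheme \<Rightarrow> ('k, 'u, 'z) weak_hopf_scheme \<Rightarrow> ('u \<Rightarrow> 'u)
      \<Rightarrow> ('k, 'u) yd_module \<Rightarrow> ('k, 'u) yd_module \<Rightarrow> ('k, 'u) yd_module" where
  "left_tensor R H \<rho> M N = left_object R H (tensor R M N) (tensor_t R H M (act M) N (act N))
     (\<lambda>h x. left_diag R M (act M) N (act N) (comult H h) x) \<rho>"

definition right_tensor ::
    "('k, 'r) ring_scheme \<Rightarrow> ('k, 'u, 'z) weak_hopf_scheme \<Rightarrow> ('u \<Rightarrow> 'u)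
      \<Rightarrow> ('k, 'u) yd_module \<Rightarrow> ('k, 'u) yd_module \<Rightarrow> ('k, 'u) yd_module" where
  "right_tensor R H \<rho> M N = right_object R H (tensor R M N) (tensor_s R H M (act M) N (act N))
     (\<lambda>x h. right_diag R M (act M) N (act N) x (comult H h)) \<rho>"

definition tensor_LL ::
    "('k, 'r) ring_scheme \<Rightarrow> ('k, 'u, 'z) weak_hopf_scheme
      \<Rightarrow> ('k, 'u) yd_module \<Rightarrow> ('k, 'u) yd_module \<Rightarrow> ('k, 'u) yd_module" where
  "tensor_LL R H M N = left_tensor R H
     (\<lambda>x. corestrict R H (submod R (tensor R M N) (tensor_t R H M (act M) N (act N)))
            H (tensor R M N)
        (sweedler (tensor R H (tensor R M N)) x (\<lambda>m n.
          sweedler (tensor R H (tensor R M N)) (coact M m) (\<lambda>a m\<^sub>0.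
            sweedler (tensor R H (tensor R M N)) (coact N n) (\<lambda>b n\<^sub>0.
              pure_tensor R H (tensor R M N) (a \<otimes>\<^bsub>H\<^esub> b) (pure_tensor R M N m\<^sub>0 n\<^sub>0)))))) M N"

definition tensor_LR ::
    "('k, 'r) ring_scheme \<Rightarrow> ('k, 'u, 'z) weak_hopf_scheme
      \<Rightarrow> ('k, 'u) yd_module \<Rightarrow> ('k, 'u) yd_module \<Rightarrow> ('k, 'u) yd_module" where
  "tensor_LR R H M N = left_tensor R H
     (\<lambda>x. corestrict R (submod R (tensor R M N) (tensor_t R H M (act M) N (act N))) H
            (tensor R M N) H
        (sweedler (tensor R (tensor R M N) H) x (\<lambda>m n.
          sweedler (tensor R (tensor R M N) H) (coact M m) (\<lambda>m\<^sub>0 a.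
            sweedler (tensor R (tensor R M N) H) (coact N n) (\<lambda>n\<^sub>0 b.
              pure_tensor R (tensor R M N) H (pure_tensor R M N m\<^sub>0 n\<^sub>0) (b \<otimes>\<^bsub>H\<^esub> a)))))) M N"

definition tensor_RR ::
    "('k, 'r) ring_scheme \<Rightarrow> ('k, 'u, 'z) weak_hopf_scheme
      \<Rightarrow> ('k, 'u) yd_module \<Rightarrow> ('k, 'u) yd_module \<Rightarrow> ('k, 'u) yd_module" where
  "tensor_RR R H M N = right_tensor R H
     (\<lambda>x. corestrict R (submod R (tensor R M N) (tensor_s R H M (act M) N (act N))) H
            (tensor R M N) H
        (sweedler (tensor R (tensor R M N) H) x (\<lambda>m n.
          sweedler (tensor R (tensor R M N) H) (coact M m) (\<lambda>m\<^sub>0 a.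
            sweedler (tensor R (tensor R M N) H) (coact N n) (\<lambda>n\<^sub>0 b.
              pure_tensor R (tensor R M N) H (pure_tensor R M N m\<^sub>0 n\<^sub>0) (a \<otimes>\<^bsub>H\<^esub> b)))))) M N"

definition tensor_RL ::
    "('k, 'r) ring_scheme \<Rightarrow> ('k, 'u, 'z) weak_hopf_scheme
      \<Rightarrow> ('k, 'u) yd_module \<Rightarrow> ('k, 'u) yd_module \<Rightarrow> ('k, 'u) yd_module" where
  "tensor_RL R H M N = right_tensor R H
     (\<lambda>x. corestrict R H (submod R (tensor R M N) (tensor_s R H M (act M) N (act N)))
            H (tensor R M N)
        (sweedler (tensor R H (tensor R M N)) x (\<lambda>m n.
          sweedler (tensor R H (tensor R M N)) (coact M m) (\<lambda>a m\<^sub>0.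
            sweedler (tensor R H (tensor R M N)) (coact N n) (\<lambda>b n\<^sub>0.
              pure_tensor R H (tensor R M N) (b \<otimes>\<^bsub>H\<^esub> a) (pure_tensor R M N m\<^sub>0 n\<^sub>0)))))) M N"

text \<open>
  In the following definitions \<open>T\<close> is one of the four tensor products of objects above.  The
  associativity constraint is \<open>(m \<otimes> n) \<otimes> p \<mapsto> m \<otimes> (n \<otimes> p)\<close>, read through the inclusions
  \<open>T (T M N) P \<subseteq> T M N \<otimes> P\<close>, \<open>T M N \<subseteq> M \<otimes> N\<close> and \<open>T N P \<subseteq> N \<otimes> P\<close>.
\<close>

definition tensor_arrow ::
    "('k, 'r) ring_scheme \<Rightarrow> (('k, 'u) yd_module \<Rightarrow> ('k, 'u) yd_module \<Rightarrow> ('k, 'u) yd_module)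
      \<Rightarrow> ('k, 'u) yd_arrow \<Rightarrow> ('k, 'u) yd_arrow \<Rightarrow> ('k, 'u) yd_arrow" where
  "tensor_arrow R T = (\<lambda>(M, f, M') (N, g, N').
     (T M N,
      \<lambda>x \<in> carrier (T M N).
        sweedler (tensor R M' N') x (\<lambda>m n. pure_tensor R M' N' (f m) (g n)),
      T M' N'))"

definition assoc_arrow ::
    "('k, 'r) ring_scheme \<Rightarrow> (('k, 'u) yd_module \<Rightarrow> ('k, 'u) yd_module \<Rightarrow> ('k, 'u) yd_module)
      \<Rightarrow> ('k, 'u) yd_module \<Rightarrow> ('k, 'u) yd_module \<Rightarrow> ('k, 'u) yd_module
      \<Rightarrow> ('k, 'u) yd_arrow" where
  "assoc_arrow R T M N P =
     (T (T M N) P,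
      \<lambda>x \<in> carrier (T (T M N) P). corestrict R M (T N P) M (tensor R N P)
        (sweedler (tensor R M (tensor R N P)) x (\<lambda>y p.
          sweedler (tensor R M (tensor R N P)) y (\<lambda>m n.
            pure_tensor R M (tensor R N P) m (pure_tensor R N P n p)))),
      T M (T N P))"

definition left_lunit ::
    "(('k, 'u) yd_module \<Rightarrow> ('k, 'u) yd_module \<Rightarrow> ('k, 'u) yd_module) \<Rightarrow> ('k, 'u) yd_module
      \<Rightarrow> ('k, 'u) yd_module \<Rightarrow> ('k, 'u) yd_arrow" where
  "left_lunit T I M =
     (T I M, \<lambda>x \<in> carrier (T I M). sweedler M x (\<lambda>z m. act M z m), M)"

definition left_runit ::
    "('k, 'u, 'z) weak_hopf_scheme
      \<Rightarrow> (('k, 'u) yd_module \<Rightarrow> ('k, 'u) yd_module \<Rightarrow> ('k, 'u) yd_module) \<Rightarrow> ('k, 'u) yd_module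
      \<Rightarrow> ('k, 'u) yd_module \<Rightarrow> ('k, 'u) yd_arrow" where
  "left_runit H T I M =
     (T M I, \<lambda>x \<in> carrier (T M I). sweedler M x (\<lambda>m z. act M (eps_s_bar H z) m), M)"

definition right_lunit ::
    "('k, 'u, 'z) weak_hopf_scheme
      \<Rightarrow> (('k, 'u) yd_module \<Rightarrow> ('k, 'u) yd_module \<Rightarrow> ('k, 'u) yd_module) \<Rightarrow> ('k, 'u) yd_module
      \<Rightarrow> ('k, 'u) yd_module \<Rightarrow> ('k, 'u) yd_arrow" where
  "right_lunit H T I M =
     (T I M, \<lambda>x \<in> carrier (T I M). sweedler M x (\<lambda>y m. act M m (eps_t_bar H y)), M)"

definition right_runit ::
    "(('k, 'u) yd_module \<Rightarrow> ('k, 'u) yd_module \<Rightarrow> ('k, 'u) yd_module) \<Rightarrow> ('k, 'u) yd_module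
      \<Rightarrow> ('k, 'u) yd_module \<Rightarrow> ('k, 'u) yd_arrow" where
  "right_runit T I M =
     (T M I, \<lambda>x \<in> carrier (T M I). sweedler M x (\<lambda>m y. act M m y), M)"

subsection \<open>Braidings\<close>

definition braid_LL ::
    "('k, 'r) ring_scheme \<Rightarrow> (('k, 'u) yd_module \<Rightarrow> ('k, 'u) yd_module \<Rightarrow> ('k, 'u) yd_module)
      \<Rightarrow> ('k, 'u) yd_module \<Rightarrow> ('k, 'u) yd_module \<Rightarrow> ('k, 'u) yd_arrow" where
  "braid_LL R T M N =
     (T M N,
      \<lambda>x \<in> carrier (T M N). sweedler (tensor R N M) x (\<lambda>m n.
        sweedler (tensor R N M) (coact M m) (\<lambda>a m\<^sub>0. pure_tensor R N M (act N a n) m\<^sub>0)),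
      T N M)"

definition braid_LR ::
    "('k, 'r) ring_scheme \<Rightarrow> (('k, 'u) yd_module \<Rightarrow> ('k, 'u) yd_module \<Rightarrow> ('k, 'u) yd_module)
      \<Rightarrow> ('k, 'u) yd_module \<Rightarrow> ('k, 'u) yd_module \<Rightarrow> ('k, 'u) yd_arrow" where
  "braid_LR R T M N =
     (T M N,
      \<lambda>x \<in> carrier (T M N). sweedler (tensor R N M) x (\<lambda>m n.
        sweedler (tensor R N M) (coact N n) (\<lambda>n\<^sub>0 b. pure_tensor R N M n\<^sub>0 (act M b m))),
      T N M)"

definition braid_RR ::
    "('k, 'r) ring_scheme \<Rightarrow> (('k, 'u) yd_module \<Rightarrow> ('k, 'u) yd_module \<Rightarrow> ('k, 'u) yd_module)
      \<Rightarrow> ('k, 'u) yd_module \<Rightarrow> ('k, 'u) yd_module \<Rightarrow> ('k, 'u) yd_arrow" where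
  "braid_RR R T M N =
     (T M N,
      \<lambda>x \<in> carrier (T M N). sweedler (tensor R N M) x (\<lambda>m n.
        sweedler (tensor R N M) (coact N n) (\<lambda>n\<^sub>0 b. pure_tensor R N M n\<^sub>0 (act M m b))),
      T N M)"

definition braid_RL ::
    "('k, 'r) ring_scheme \<Rightarrow> (('k, 'u) yd_module \<Rightarrow> ('k, 'u) yd_module \<Rightarrow> ('k, 'u) yd_module)
      \<Rightarrow> ('k, 'u) yd_module \<Rightarrow> ('k, 'u) yd_module \<Rightarrow> ('k, 'u) yd_arrow" where
  "braid_RL R T M N =
     (T M N,
      \<lambda>x \<in> carrier (T M N). sweedler (tensor R N M) x (\<lambda>m n.
        sweedler (tensor R N M) (coact M m) (\<lambda>a m\<^sub>0. pure_tensor R N M (act N n a) m\<^sub>0)),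
      T N M)"


section \<open>Braided monoidal categories\<close>

text \<open>\<open>Comp C g f\<close> is the composite \<open>g \<circ> f\<close>.\<close>

record ('o, 'a) braided_cat =
  Obj :: "'o set"
  Arr :: "'a set"
  Dom :: "'a \<Rightarrow> 'o"
  Cod :: "'a \<Rightarrow> 'o"
  Id :: "'o \<Rightarrow> 'a"
  Comp :: "'a \<Rightarrow> 'a \<Rightarrow> 'a"
  TensO :: "'o \<Rightarrow> 'o \<Rightarrow> 'o"
  TensA :: "'a \<Rightarrow> 'a \<Rightarrow> 'a"
  Unit :: "'o"
  Assoc :: "'o \<Rightarrow> 'o \<Rightarrow> 'o \<Rightarrow> 'a"
  LUnit :: "'o \<Rightarrow> 'a"
  RUnit :: "'o \<Rightarrow> 'a"
  Braid :: "'o \<Rightarrow> 'o \<Rightarrow> 'a"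

definition Hom :: "('o, 'a) braided_cat \<Rightarrow> 'o \<Rightarrow> 'o \<Rightarrow> 'a set" where
  "Hom C M N = {f \<in> Arr C. Dom C f = M \<and> Cod C f = N}"

definition inverse_arrows :: "('o, 'a) braided_cat \<Rightarrow> 'a \<Rightarrow> 'a \<Rightarrow> bool" where
  "inverse_arrows C f g \<longleftrightarrow>
     f \<in> Arr C \<and> g \<in> Hom C (Cod C f) (Dom C f) \<and>
     Comp C g f = Id C (Dom C f) \<and> Comp C f g = Id C (Cod C f)"

definition Iso :: "('o, 'a) braided_cat \<Rightarrow> 'o \<Rightarrow> 'o \<Rightarrow> 'a set" where
  "Iso C M N = {f \<in> Hom C M N. \<exists>g. inverse_arrows C f g}"

definition Inv :: "('o, 'a) braided_cat \<Rightarrow> 'a \<Rightarrow> 'a" where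
  "Inv C f = (THE g. inverse_arrows C f g)"

locale category =
  fixes C :: "('o, 'a) braided_cat"
  assumes dom_obj: "f \<in> Arr C \<Longrightarrow> Dom C f \<in> Obj C"
    and cod_obj: "f \<in> Arr C \<Longrightarrow> Cod C f \<in> Obj C"
    and id_hom: "M \<in> Obj C \<Longrightarrow> Id C M \<in> Hom C M M"
    and comp_hom: "f \<in> Hom C M N \<Longrightarrow> g \<in> Hom C N P \<Longrightarrow> Comp C g f \<in> Hom C M P"
    and comp_id_right: "f \<in> Hom C M N \<Longrightarrow> Comp C f (Id C M) = f"
    and comp_id_left: "f \<in> Hom C M N \<Longrightarrow> Comp C (Id C N) f = f"
    and comp_assoc:
      "f \<in> Hom C M N \<Longrightarrow> g \<in> Hom C N P \<Longrightarrow> h \<in> Hom C P Q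
        \<Longrightarrow> Comp C h (Comp C g f) = Comp C (Comp C h g) f"

locale monoidal_category = category C for C :: "('o, 'a) braided_cat" +
  assumes tens_obj: "M \<in> Obj C \<Longrightarrow> N \<in> Obj C \<Longrightarrow> TensO C M N \<in> Obj C"
    and tens_hom:
      "f \<in> Hom C M M' \<Longrightarrow> g \<in> Hom C N N'
        \<Longrightarrow> TensA C f g \<in> Hom C (TensO C M N) (TensO C M' N')"
    and tens_id:
      "M \<in> Obj C \<Longrightarrow> N \<in> Obj C \<Longrightarrow> TensA C (Id C M) (Id C N) = Id C (TensO C M N)"
    and tens_comp:
      "f \<in> Hom C M M' \<Longrightarrow> f' \<in> Hom C M' M'' \<Longrightarrow> g \<in> Hom C N N' \<Longrightarrow> g' \<in> Hom C N' N''
        \<Longrightarrow> TensA C (Comp C f' f) (Comp C g' g) = Comp C (TensA C f' g') (TensA C f g)"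
    and unit_obj: "Unit C \<in> Obj C"
    and assoc_iso:
      "M \<in> Obj C \<Longrightarrow> N \<in> Obj C \<Longrightarrow> P \<in> Obj C
        \<Longrightarrow> Assoc C M N P \<in> Iso C (TensO C (TensO C M N) P) (TensO C M (TensO C N P))"
    and assoc_natural:
      "f \<in> Hom C M M' \<Longrightarrow> g \<in> Hom C N N' \<Longrightarrow> h \<in> Hom C P P'
        \<Longrightarrow> Comp C (Assoc C M' N' P') (TensA C (TensA C f g) h)
          = Comp C (TensA C f (TensA C g h)) (Assoc C M N P)"
    and lunit_iso: "M \<in> Obj C \<Longrightarrow> LUnit C M \<in> Iso C (TensO C (Unit C) M) M"
    and lunit_natural:
      "f \<in> Hom C M N
        \<Longrightarrow> Comp C (LUnit C N) (TensA C (Id C (Unit C)) f) = Comp C f (LUnit C M)"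
    and runit_iso: "M \<in> Obj C \<Longrightarrow> RUnit C M \<in> Iso C (TensO C M (Unit C)) M"
    and runit_natural:
      "f \<in> Hom C M N
        \<Longrightarrow> Comp C (RUnit C N) (TensA C f (Id C (Unit C))) = Comp C f (RUnit C M)"
    and pentagon:
      "M \<in> Obj C \<Longrightarrow> N \<in> Obj C \<Longrightarrow> P \<in> Obj C \<Longrightarrow> Q \<in> Obj C
        \<Longrightarrow> Comp C (TensA C (Id C M) (Assoc C N P Q))
             (Comp C (Assoc C M (TensO C N P) Q) (TensA C (Assoc C M N P) (Id C Q)))
          = Comp C (Assoc C M N (TensO C P Q)) (Assoc C (TensO C M N) P Q)"
    and triangle:
      "M \<in> Obj C \<Longrightarrow> N \<in> Obj C
        \<Longrightarrow> Comp C (TensA C (Id C M) (LUnit C N)) (Assoc C M (Unit C) N)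
          = TensA C (RUnit C M) (Id C N)"

locale braided_monoidal_category = monoidal_category C for C :: "('o, 'a) braided_cat" +
  assumes braid_iso:
      "M \<in> Obj C \<Longrightarrow> N \<in> Obj C \<Longrightarrow> Braid C M N \<in> Iso C (TensO C M N) (TensO C N M)"
    and braid_natural:
      "f \<in> Hom C M M' \<Longrightarrow> g \<in> Hom C N N'
        \<Longrightarrow> Comp C (Braid C M' N') (TensA C f g) = Comp C (TensA C g f) (Braid C M N)"
    and hexagon_1:
      "M \<in> Obj C \<Longrightarrow> N \<in> Obj C \<Longrightarrow> P \<in> Obj C
        \<Longrightarrow> Comp C (Assoc C N P M) (Comp C (Braid C M (TensO C N P)) (Assoc C M N P))
          = Comp C (TensA C (Id C N) (Braid C M P))
             (Comp C (Assoc C N M P) (TensA C (Braid C M N) (Id C P)))"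
    and hexagon_2:
      "M \<in> Obj C \<Longrightarrow> N \<in> Obj C \<Longrightarrow> P \<in> Obj C
        \<Longrightarrow> Comp C (Inv C (Assoc C P M N))
             (Comp C (Braid C (TensO C M N) P) (Inv C (Assoc C M N P)))
          = Comp C (TensA C (Braid C M P) (Id C N))
             (Comp C (Inv C (Assoc C M P N)) (TensA C (Id C M) (Braid C N P)))"

definition cat_in :: "('o, 'a) braided_cat \<Rightarrow> ('o, 'a) braided_cat" where
  "cat_in C = C \<lparr> Braid := \<lambda>M N. Inv C (Braid C N M) \<rparr>"

definition cat_bar :: "('o, 'a) braided_cat \<Rightarrow> ('o, 'a) braided_cat" where
  "cat_bar C = C
     \<lparr> TensO := \<lambda>M N. TensO C N M,
       TensA := \<lambda>f g. TensA C g f,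
       Assoc := \<lambda>M N P. Inv C (Assoc C P N M),
       LUnit := RUnit C,
       RUnit := LUnit C,
       Braid := \<lambda>M N. Braid C N M \<rparr>"

text \<open>
  Strong braided monoidal functors, with object map \<open>Fo\<close>, arrow map \<open>Fa\<close> and the structure isomorphisms
  \<open>phi0 : Unit D \<rightarrow> Fo (Unit C)\<close> and \<open>phi M N : Fo M \<otimes> Fo N \<rightarrow> Fo (M \<otimes> N)\<close>.
\<close>

locale braided_monoidal_functor =
  C: braided_monoidal_category C + D: braided_monoidal_category D
  for C :: "('o, 'a) braided_cat" and D :: "('p, 'b) braided_cat" +
  fixes Fo :: "'o \<Rightarrow> 'p" and Fa :: "'a \<Rightarrow> 'b" and phi0 :: 'b and phi :: "'o \<Rightarrow> 'o \<Rightarrow> 'b"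
  assumes functor_obj: "M \<in> Obj C \<Longrightarrow> Fo M \<in> Obj D"
    and functor_hom: "f \<in> Hom C M N \<Longrightarrow> Fa f \<in> Hom D (Fo M) (Fo N)"
    and functor_id: "M \<in> Obj C \<Longrightarrow> Fa (Id C M) = Id D (Fo M)"
    and functor_comp:
      "f \<in> Hom C M N \<Longrightarrow> g \<in> Hom C N P \<Longrightarrow> Fa (Comp C g f) = Comp D (Fa g) (Fa f)"
    and phi0_iso: "phi0 \<in> Iso D (Unit D) (Fo (Unit C))"
    and phi_iso:
      "M \<in> Obj C \<Longrightarrow> N \<in> Obj C
        \<Longrightarrow> phi M N \<in> Iso D (TensO D (Fo M) (Fo N)) (Fo (TensO C M N))"
    and phi_natural:
      "f \<in> Hom C M M' \<Longrightarrow> g \<in> Hom C N N'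
        \<Longrightarrow> Comp D (phi M' N') (TensA D (Fa f) (Fa g)) = Comp D (Fa (TensA C f g)) (phi M N)"
    and phi_assoc:
      "M \<in> Obj C \<Longrightarrow> N \<in> Obj C \<Longrightarrow> P \<in> Obj C
        \<Longrightarrow> Comp D (Fa (Assoc C M N P))
             (Comp D (phi (TensO C M N) P) (TensA D (phi M N) (Id D (Fo P))))
          = Comp D (phi M (TensO C N P))
             (Comp D (TensA D (Id D (Fo M)) (phi N P)) (Assoc D (Fo M) (Fo N) (Fo P)))"
    and phi_lunit:
      "M \<in> Obj C
        \<Longrightarrow> Comp D (Fa (LUnit C M)) (Comp D (phi (Unit C) M) (TensA D phi0 (Id D (Fo M))))
          = LUnit D (Fo M)"
    and phi_runit:
      "M \<in> Obj C
        \<Longrightarrow> Comp D (Fa (RUnit C M)) (Comp D (phi M (Unit C)) (TensA D (Id D (Fo M)) phi0))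
          = RUnit D (Fo M)"
    and phi_braid:
      "M \<in> Obj C \<Longrightarrow> N \<in> Obj C
        \<Longrightarrow> Comp D (Fa (Braid C M N)) (phi M N)
          = Comp D (phi N M) (Braid D (Fo M) (Fo N))"

definition braided_monoidal_isomorphic ::
    "('o, 'a) braided_cat \<Rightarrow> ('p, 'b) braided_cat \<Rightarrow> bool" (infix \<open>\<cong>\<^sub>b\<^sub>r\<close> 50) where
  "C \<cong>\<^sub>b\<^sub>r D \<longleftrightarrow> (\<exists>Fo Fa phi0 phi. braided_monoidal_functor C D Fo Fa phi0 phi \<and>
     bij_betw Fo (Obj C) (Obj D) \<and> bij_betw Fa (Arr C) (Arr D))"


section \<open>The four braided categories of Yetter-Drinfeld modules\<close>

definition yd_id :: "('k, 'u) yd_module \<Rightarrow> ('k, 'u) yd_arrow" where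
  "yd_id M = (M, \<lambda>x \<in> carrier M. x, M)"

definition yd_comp ::
    "('k, 'u) yd_arrow \<Rightarrow> ('k, 'u) yd_arrow \<Rightarrow> ('k, 'u) yd_arrow" where
  "yd_comp = (\<lambda>(N, g, P) (M, f, N'). (M, compose (carrier M) g f, P))"

definition YD_LL ::
    "('k, 'r) ring_scheme \<Rightarrow> ('k, 'u, 'z) weak_hopf_scheme
      \<Rightarrow> (('k, 'u) yd_module, ('k, 'u) yd_arrow) braided_cat" where
  "YD_LL R H =
    \<lparr> Obj = Collect (yd_LL R H),
      Arr = yd_arrows (yd_LL R H) (left_linear R H) (left_colinear R H),
      Dom = fst, Cod = snd \<circ> snd, Id = yd_id, Comp = yd_comp,
      TensO = tensor_LL R H, TensA = tensor_arrow R (tensor_LL R H),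
      Unit = unit_LL R H,
      Assoc = assoc_arrow R (tensor_LL R H),
      LUnit = left_lunit (tensor_LL R H) (unit_LL R H),
      RUnit = left_runit H (tensor_LL R H) (unit_LL R H),
      Braid = braid_LL R (tensor_LL R H) \<rparr>"

definition YD_LR ::
    "('k, 'r) ring_scheme \<Rightarrow> ('k, 'u, 'z) weak_hopf_scheme
      \<Rightarrow> (('k, 'u) yd_module, ('k, 'u) yd_arrow) braided_cat" where
  "YD_LR R H =
    \<lparr> Obj = Collect (yd_LR R H),
      Arr = yd_arrows (yd_LR R H) (left_linear R H) (right_colinear R H),
      Dom = fst, Cod = snd \<circ> snd, Id = yd_id, Comp = yd_comp,
      TensO = tensor_LR R H, TensA = tensor_arrow R (tensor_LR R H),
      Unit = unit_LR R H,
      Assoc = assoc_arrow R (tensor_LR R H),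
      LUnit = left_lunit (tensor_LR R H) (unit_LR R H),
      RUnit = left_runit H (tensor_LR R H) (unit_LR R H),
      Braid = braid_LR R (tensor_LR R H) \<rparr>"

definition YD_RR ::
    "('k, 'r) ring_scheme \<Rightarrow> ('k, 'u, 'z) weak_hopf_scheme
      \<Rightarrow> (('k, 'u) yd_module, ('k, 'u) yd_arrow) braided_cat" where
  "YD_RR R H =
    \<lparr> Obj = Collect (yd_RR R H),
      Arr = yd_arrows (yd_RR R H) (right_linear R H) (right_colinear R H),
      Dom = fst, Cod = snd \<circ> snd, Id = yd_id, Comp = yd_comp,
      TensO = tensor_RR R H, TensA = tensor_arrow R (tensor_RR R H),
      Unit = unit_RR R H,
      Assoc = assoc_arrow R (tensor_RR R H),
      LUnit = right_lunit H (tensor_RR R H) (unit_RR R H),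
      RUnit = right_runit (tensor_RR R H) (unit_RR R H),
      Braid = braid_RR R (tensor_RR R H) \<rparr>"

definition YD_RL ::
    "('k, 'r) ring_scheme \<Rightarrow> ('k, 'u, 'z) weak_hopf_scheme
      \<Rightarrow> (('k, 'u) yd_module, ('k, 'u) yd_arrow) braided_cat" where
  "YD_RL R H =
    \<lparr> Obj = Collect (yd_RL R H),
      Arr = yd_arrows (yd_RL R H) (right_linear R H) (left_colinear R H),
      Dom = fst, Cod = snd \<circ> snd, Id = yd_id, Comp = yd_comp,
      TensO = tensor_RL R H, TensA = tensor_arrow R (tensor_RL R H),
      Unit = unit_RL R H,
      Assoc = assoc_arrow R (tensor_RL R H),
      LUnit = right_lunit H (tensor_RL R H) (unit_RL R H),
      RUnit = right_runit (tensor_RL R H) (unit_RL R H),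
      Braid = braid_RL R (tensor_RL R H) \<rparr>"

end

theory Submission
 imports Defs
begin

text \<open>In Sweedler notation, the passage from left-left to left-right modules keeps the action and turns
  \<open>m\<^sub>[\<^sub>-\<^sub>1\<^sub>] \<otimes> m\<^sub>[\<^sub>0\<^sub>]\<close> into \<open>m\<^sub>[\<^sub>0\<^sub>] \<otimes> S\<^sup>-\<^sup>1(m\<^sub>[\<^sub>-\<^sub>1\<^sub>])\<close>; from left-right to right-right modules the coaction
  is kept, \<open>h\<close> acts on the right as \<open>S(h)\<close>, and the tensor factors are flipped; from right-right to
  right-left modules the coaction is again composed with \<open>S\<^sup>-\<^sup>1\<close>. The braided monoidal axioms are verified
  directly for left-left modules only and are transported along these isomorphisms of categories.\<close>

section \<open>Tensor products and Sweedler sums\<close>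

text \<open>Three properties of the antipode explain the shape of the statement. With the coaction
  m_[0] \<otimes> S^-1(m_[-1]) the left-right braiding of (N, M) is the inverse of the left-left
  braiding of (M, N); this produces \<open>in\<close>. Since \<Delta>(S(h)) = S(h2) \<otimes> S(h1),
  the diagonal action of S(h) matches a right diagonal action of h only after a flip; this produces
  the bar. Since S exchanges H_s and H_t, the unit objects correspond. The outer two isomorphisms
  preserve tensor products and units on the nose, the middle one only up to the flip and S. The
  middle one is obtained by inverting the first and composing with a functor from left-left to
  reversed right-right modules. The recurring obstacle is that M \<otimes>_t N is a proper submodule
  of M \<otimes> N, and tensoring it again yields another subset of the universe. Identities are
  therefore checked after inclusion into the full tensor product; the inclusions stay injective
  under tensoring because each such submodule is the image of an idempotent linear map.\<close>

abbreviation in_carrier (infix \<open>.:\<close> 50) where "x .: M \<equiv> x \<in> carrier M"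
abbreviation smult_in (\<open>(_ *[_] _)\<close> [70, 0, 71] 70) where "r *[M] x \<equiv> r \<odot>\<^bsub>M\<^esub> x"
abbreviation add_in (\<open>(_ +[_] _)\<close> [65, 0, 66] 65) where "x +[M] y \<equiv> x \<oplus>\<^bsub>M\<^esub> y"

text \<open>An infinite type is equipotent to its square, so a pairing \<open>g\<close> exists and a
  list of pairs can be folded into one element. The fold is injective only among lists of equal
  length, hence the length is paired in separately through an injection \<open>i\<close> of the
  naturals.\<close>

lemma inj_encode:
 assumes "infinite (UNIV :: 'u set)"
 shows "inj (encode :: ('u \<times> 'u) list => 'u)"
proof -
 have "\<exists>g. bij_betw g ((UNIV :: 'u set) \<times> (UNIV :: 'u set)) (UNIV :: 'u set)"
  using card_of_Times_same_infinite[OF assms] by (simp only: card_of_ordIso)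
 then obtain g :: "'u \<times> 'u => 'u" where g: "inj g"
  unfolding UNIV_Times_UNIV bij_betw_def by blast
 have "\<exists>i :: nat => 'u. inj i \<and> range i \<subseteq> UNIV"
  using assms by (simp only: infinite_iff_countable_subset)
 then obtain i :: "nat => 'u" where i: "inj i" by (elim exE conjE)
 define k where "k = (%xs :: ('u \<times> 'u) list. foldr (%p s. g (g p, s)) xs undefined)"
 have k: "length xs = length ys ==> k xs = k ys ==> xs = ys" for xs ys
 proof (induction xs ys rule: list_induct2)
  case (Cons x xs y ys)
  then show ?case by (cases x, cases y) (simp add: k_def inj_eq[OF g])
 qed simp
 have "inj (%xs. g (i (length xs), k xs))"
  by (rule injI) (simp add: inj_eq[OF g] inj_eq[OF i] k)
 then show ?thesis unfolding encode_def by (rule someI[of inj])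
qed

section \<open>Linear and multilinear maps between modules on the fixed carrier type\<close>

locale tensor_universe = cring R for R :: "('k, 'r) ring_scheme" (structure) +
 fixes universe :: "'u itself"
 assumes infinite_universe: "infinite (UNIV :: 'u set)"
begin

abbreviation tensor_mod (infixr \<open>**\<close> 73) where "M ** N \<equiv> tensor R M N"
abbreviation pt where "pt M N \<equiv> pure_tensor R M N"
abbreviation lin where "lin M N \<equiv> lin_map R M N"
text \<open>Linearity over k in each variable already contains balancedness, since f(rm, n) = r f(m,
  n) = f(m, rn).\<close>

abbreviation bilin where "bilin M N P f \<equiv>
 (\<forall>a\<in>carrier M. (%b. f a b) \<in> lin N P) \<and> (\<forall>b\<in>carrier N. (%a. f a b) \<in> lin M P)"
abbreviation trilin where "trilin M N Q P f \<equiv>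
 (\<forall>a\<in>carrier M. \<forall>b\<in>carrier N. (%c. f a b c) \<in> lin Q P) \<and>
 (\<forall>a\<in>carrier M. \<forall>c\<in>carrier Q. (%b. f a b c) \<in> lin N P) \<and>
 (\<forall>b\<in>carrier N. \<forall>c\<in>carrier Q. (%a. f a b c) \<in> lin M P)"

lemma decode_encode [simp]: "decode (encode xs :: 'u) = xs"
 unfolding decode_def using inj_encode[OF infinite_universe] by (rule inv_into_f_f) simp

lemma lin_closed: "f \<in> lin M N ==> x .: M ==> f x .: N"
 by (auto simp: lin_map_def hom_def)

lemma lin_add:
 "f \<in> lin M N ==> x .: M ==> y .: M ==> f (x +[M] y) = f x +[N] f y"
 by (auto simp: lin_map_def hom_def)

lemma lin_smult:
 "f \<in> lin M N ==> r .: R ==> x .: M ==> f (r *[M] x) = r *[N] f x"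
 by (auto simp: lin_map_def)

lemma linI:
 assumes "!!x. x .: M ==> f x .: N"
  and "!!x y. x .: M ==> y .: M ==> f (x +[M] y) = f x +[N] f y"
  and "!!r x. r .: R ==> x .: M ==> f (r *[M] x) = r *[N] f x"
 shows "f \<in> lin M N"
 using assms by (auto simp: lin_map_def hom_def)

lemma module_zero: "module R M ==> x .: M ==> \<zero> *[M] x = \<zero>\<^bsub>M\<^esub>"
 by (rule module.smult_l_null)

lemma module_zero_closed [simp]: "module R M ==> \<zero>\<^bsub>M\<^esub> .: M"
 by (meson abelian_group.axioms(1) abelian_monoid.zero_closed module.axioms(2))

lemma module_add_closed [simp]:
 "module R M ==> x .: M ==> y .: M ==> x +[M] y .: M"
 by (meson abelian_group.axioms(1) abelian_monoid.a_closed module.axioms(2))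

lemma module_smult_closed [simp]:
 "module R M ==> r .: R ==> x .: M ==> r *[M] x .: M"
 by (rule module.smult_closed)

lemma lin_zero:
 assumes "module R M" "module R N" "f \<in> lin M N" shows "f \<zero>\<^bsub>M\<^esub> = \<zero>\<^bsub>N\<^esub>"
 using assms lin_smult[OF assms(3), of \<zero> "\<zero>\<^bsub>M\<^esub>"] by (simp add: module_zero lin_closed)

subsection \<open>Formal sums\<close>

abbreviation fsums where "fsums M N \<equiv> lists (carrier M \<times> carrier N)"

lemma tensor_eq_fsums:
 assumes "module R M" "module R N"
 shows "tensor_eq R M N xs ys ==> xs \<in> fsums M N \<and> ys \<in> fsums M N"
 by (induction rule: tensor_eq.induct) (use assms in auto)

text \<open>The generating rule \<open>cong\<close> only allows a common prefix; a change in the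
  left part is reached by rotating the list with \<open>comm\<close>, changing the tail, and
  rotating back.\<close>

lemma tensor_eq_append:
 assumes mod: "module R M" "module R N"
  and xs: "tensor_eq R M N xs xs'" and ys: "tensor_eq R M N ys ys'"
 shows "tensor_eq R M N (xs @ ys) (xs' @ ys')"
proof -
 note [simp] = tensor_eq_fsums[OF mod xs] tensor_eq_fsums[OF mod ys]
 have "tensor_eq R M N (xs @ ys) (xs @ ys')" by (rule tensor_eq.cong[OF ys]) simp
 also have "tensor_eq R M N (xs @ ys') (ys' @ xs)" by (rule tensor_eq.comm) simp_all
 also (tensor_eq.trans) have "tensor_eq R M N (ys' @ xs) (ys' @ xs')"
  by (rule tensor_eq.cong[OF xs]) simp
 also (tensor_eq.trans) have "tensor_eq R M N (ys' @ xs') (xs' @ ys')"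
  by (rule tensor_eq.comm) simp_all
 finally (tensor_eq.trans) show ?thesis .
qed

text \<open>The sum formed by \<open>sweedler\<close>, but on an explicit list instead of a coded
  element, so that inductions over formal sums can be carried out before passing to classes.\<close>

definition msum :: "('k, 'p, 'q) module_scheme => ('u => 'u => 'p) => ('u \<times> 'u) list => 'p" where
 "msum P f xs = foldr (%(a, b) s. f a b +[P] s) xs \<zero>\<^bsub>P\<^esub>"

lemma msum_simps [simp]: "msum P f [] = \<zero>\<^bsub>P\<^esub>" "msum P f ((a, b) # xs) = f a b +[P] msum P f xs"
 by (simp_all add: msum_def)

lemma module_add_facts:
 assumes "module R P"
 shows "!!x y z. x .: P ==> y .: P ==> z .: P
   ==> (x +[P] y) +[P] z = x +[P] (y +[P] z)"
  "!!x y. x .: P ==> y .: P ==> x +[P] y = y +[P] x"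
  "!!x. x .: P ==> x +[P] \<zero>\<^bsub>P\<^esub> = x" "!!x. x .: P ==> \<zero>\<^bsub>P\<^esub> +[P] x = x"
proof -
 interpret abelian_group P by (rule module.axioms(2)[OF assms(1)])
 show "!!x y z. x .: P ==> y .: P ==> z .: P
   ==> (x +[P] y) +[P] z = x +[P] (y +[P] z)"
  "!!x y. x .: P ==> y .: P ==> x +[P] y = y +[P] x"
  "!!x. x .: P ==> x +[P] \<zero>\<^bsub>P\<^esub> = x" "!!x. x .: P ==> \<zero>\<^bsub>P\<^esub> +[P] x = x"
  by (simp_all add: a_ac)
qed

lemma msum_closed:
 assumes "module R P" "\<forall>a\<in>A. \<forall>b\<in>B. f a b .: P" "xs \<in> lists (A \<times> B)"
 shows "msum P f xs .: P"
 using assms(3)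
proof (induction xs)
 case (Cons x xs)
 then show ?case using assms(1,2) by (cases x) simp
qed (simp add: assms(1))

lemma msum_append:
 assumes P: "module R P" and f: "\<forall>a\<in>A. \<forall>b\<in>B. f a b .: P"
  and "xs \<in> lists (A \<times> B)" and ys: "ys \<in> lists (A \<times> B)"
 shows "msum P f (xs @ ys) = msum P f xs +[P] msum P f ys"
 using assms(3)
proof (induction xs)
 case Nil
 then show ?case using msum_closed[OF P f ys] by (simp add: module_add_facts P)
next
 case (Cons x xs)
 obtain a b where x: "x = (a, b)" "a \<in> A" "b \<in> B" using Cons by auto
 have "msum P f xs .: P" "msum P f ys .: P"
  using msum_closed[OF P f] Cons ys by auto
 then show ?case using Cons x f by (simp add: module_add_facts(1) P)
qed

text \<open>This is the universal property at the level of formal sums: each generating relation of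
  the congruence is respected by a bilinear map into a module, so evaluation factors through the
  quotient.\<close>

lemma msum_tensor_eq:
 assumes mod: "module R M" "module R N" "module R P" and f: "bilin M N P f"
  and eq: "tensor_eq R M N xs ys"
 shows "msum P f xs = msum P f ys"
proof -
 have r: "!!a. a .: M ==> (%b. f a b) \<in> lin N P" and l: "!!b. b .: N ==> (%a. f a b) \<in> lin M P"
  using f by simp_all
 have c': "!!a b. a .: M ==> b .: N ==> f a b .: P"
  using lin_closed[OF r] by simp
 then have c: "\<forall>a\<in>carrier M. \<forall>b\<in>carrier N. f a b .: P" by simp
 note app = msum_append[OF mod(3) c] and cl = msum_closed[OF mod(3) c]
 show ?thesis using eq
 proof (induction rule: tensor_eq.induct)
  case (cong xs ys zs)
  note t = tensor_eq_fsums[OF mod(1,2) cong.hyps(1)]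
  show ?case using t cong.hyps(2) cong.IH by (simp only: app)
 next
  case (comm xs ys)
  then show ?case by (simp only: app module_add_facts(2)[OF mod(3) cl cl])
 next
  case (zero n)
  then show ?case using lin_zero[OF mod(1,3) l[OF zero]]
   by (simp add: module_add_facts(3)[OF mod(3)] mod)
 next
  case (add_left m m' n)
  then show ?case using lin_add[OF l[of n], of m m']
   by (simp add: module_add_facts(1,3)[OF mod(3)] mod c')
 next
  case (add_right m n n')
  then show ?case using lin_add[OF r[of m], of n n']
   by (simp add: module_add_facts(1,3)[OF mod(3)] mod c')
 next
  case (balanced s m n)
  then have "f (s *[M] m) n = f m (s *[N] n)"
   using lin_smult[OF r[of m], of s n] lin_smult[OF l[of n], of s m] by simp
  then show ?case by simp
 qed simp_all
qed

definition smult_fsum :: "('k, 'u, 'm) module_scheme => 'k => ('u \<times> 'u) list => ('u \<times> 'u) list" where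
 "smult_fsum M r = map (%(m, n). (r *[M] m, n))"

lemma smult_fsum_simps [simp]:
 "smult_fsum M r [] = []" "smult_fsum M r ((m, n) # xs) = (r *[M] m, n) # smult_fsum M r xs"
 "smult_fsum M r (xs @ ys) = smult_fsum M r xs @ smult_fsum M r ys"
 by (simp_all add: smult_fsum_def)

lemma smult_fsum_closed [simp]:
 "module R M ==> r .: R ==> xs \<in> fsums M N ==> smult_fsum M r xs \<in> fsums M N"
 by (induction xs) (auto simp: smult_fsum_def)

lemma module_smult_facts:
 assumes "module R M"
 shows "!!r x y. r .: R ==> x .: M ==> y .: M
   ==> r *[M] (x +[M] y) = r *[M] x +[M] r *[M] y"
  "!!r s x. r .: R ==> s .: R ==> x .: M
   ==> (r \<oplus> s) *[M] x = r *[M] x +[M] s *[M] x"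
  "!!r s x. r .: R ==> s .: R ==> x .: M
   ==> (r \<otimes> s) *[M] x = r *[M] (s *[M] x)"
  "!!x. x .: M ==> \<one> *[M] x = x"
  "!!r. r .: R ==> r *[M] \<zero>\<^bsub>M\<^esub> = \<zero>\<^bsub>M\<^esub>"
 using assms by (simp_all add: module.smult_r_distr module.smult_l_distr module.smult_assoc1
  module.smult_one module.smult_r_null)

text \<open>Scaling the left entries maps each generating relation to one of the same kind; in the
  balanced case this rests on the commutativity of the ground ring.\<close>

lemma tensor_eq_smult:
 assumes mod: "module R M" "module R N" and r: "r .: R"
 shows "tensor_eq R M N xs ys ==> tensor_eq R M N (smult_fsum M r xs) (smult_fsum M r ys)"
proof (induction rule: tensor_eq.induct)
 case (balanced s m n)
 have "r *[M] (s *[M] m) = s *[M] (r *[M] m)"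
  using balanced r by (simp add: module_smult_facts(3)[OF mod(1), symmetric] m_comm)
 then show ?case using balanced tensor_eq.balanced[of s R "r *[M] m" M n N] mod r by simp
next
 case (trans xs ys zs)
 show ?case by (rule tensor_eq.trans[OF trans.IH])
next
 case (add_left m m' n)
 then show ?case using tensor_eq.add_left[of "r *[M] m" M "r *[M] m'" n N R]
  by (simp add: mod r module_smult_facts(1))
next
 case (add_right m n n')
 then show ?case using tensor_eq.add_right[of "r *[M] m" M n N n' R] by (simp add: mod r)
next
 case (zero n)
 then show ?case using tensor_eq.zero[of n N R M] module.smult_r_null[OF mod(1) r] by simp
next
 case (sym xs ys)
 then show ?case by (intro tensor_eq.sym[OF sym.IH])
next
 case (cong xs ys zs)
 then show ?case by (simp add: tensor_eq.cong mod r)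
next
 case (comm xs ys)
 then show ?case using tensor_eq.comm[of "smult_fsum M r xs" M N "smult_fsum M r ys" R]
  by (simp add: mod r)
next
 case (refl xs)
 then show ?case by (simp add: tensor_eq.refl mod r)
qed

section \<open>The tensor product as a module\<close>

abbreviation tcl where "tcl M N \<equiv> tensor_class R M N"

text \<open>Equivalent lists have the same set of equivalent lists, so the choice operator selects
  the same representative for both.\<close>

lemma tensor_class_eq:
 assumes "tensor_eq R M N xs ys" shows "(tcl M N xs :: 'u) = tcl M N ys"
proof -
 have "tensor_eq R M N xs = tensor_eq R M N ys"
  by (rule ext) (metis assms tensor_eq.sym tensor_eq.trans)
 then show ?thesis by (simp add: tensor_class_def)
qed

lemma decode_class:
 assumes "xs \<in> fsums M N" shows "tensor_eq R M N xs (decode (tcl M N xs :: 'u))"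
 unfolding tensor_class_def decode_encode
 by (rule someI[of "tensor_eq R M N xs" xs]) (rule tensor_eq.refl[OF assms])

lemma tensor_simps:
 "carrier (M ** N) = tcl M N ` fsums M N" "\<zero>\<^bsub>M ** N\<^esub> = tcl M N []"
 "(x :: 'u) +[M ** N] y = tcl M N (decode x @ decode y)"
 "r *[M ** N] x = tcl M N (smult_fsum M r (decode x))"
 by (simp_all add: tensor_def smult_fsum_def)

lemma decode_fsums:
 assumes "module R M" "module R N" "x .: (M ** N)"
 shows "decode (x :: 'u) \<in> fsums M N" "tcl M N (decode x) = x"
proof -
 obtain xs where xs: "xs \<in> fsums M N" "x = tcl M N xs"
  using assms(3) by (auto simp: tensor_simps)
 note * = decode_class[OF xs(1)]
 show "decode x \<in> fsums M N" using tensor_eq_fsums[OF assms(1,2) *] xs by simp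
 show "tcl M N (decode x) = x" using tensor_class_eq[OF *] xs by simp
qed

lemma class_add:
 assumes "module R M" "module R N" "xs \<in> fsums M N" "ys \<in> fsums M N"
 shows "(tcl M N xs :: 'u) +[M ** N] tcl M N ys = tcl M N (xs @ ys)"
 unfolding tensor_simps
 by (rule tensor_class_eq, rule tensor_eq.sym, rule tensor_eq_append)
  (use assms decode_class in auto)

lemma class_smult:
 assumes "module R M" "module R N" "r .: R" "xs \<in> fsums M N"
 shows "r *[M ** N] (tcl M N xs :: 'u) = tcl M N (smult_fsum M r xs)"
 unfolding tensor_simps
 by (rule tensor_class_eq, rule tensor_eq.sym, rule tensor_eq_smult)
  (use assms decode_class in auto)

text \<open>The formal sums carry no subtraction, so an additive inverse is exhibited by scaling all
  left entries by -1; the pairs (-m, n) and (m, n) are brought together by commutativity and merge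
  into (0, n).\<close>

lemma tensor_eq_cancel:
 assumes mod: "module R M" "module R N"
 shows "xs \<in> fsums M N ==> tensor_eq R M N (smult_fsum M (\<ominus> \<one>) xs @ xs) []"
proof (induction xs)
 case Nil
 then show ?case using tensor_eq.refl[of "[]"] by simp
next
 case (Cons x xs)
 obtain m n where x: "x = (m, n)" "m .: M" "n .: N" using Cons by auto
 let ?ys = "smult_fsum M (\<ominus> \<one>) xs" and ?m = "\<ominus> \<one> *[M] m"
 have ys: "?ys \<in> fsums M N" using Cons mod by simp
 have m: "?m .: M" using x mod by simp
 have z: "?m +[M] m = \<zero>\<^bsub>M\<^esub>"
  using x mod module_smult_facts(2)[OF mod(1), of "\<ominus> \<one>" \<one> m]
  by (simp add: module_smult_facts(4) module_zero l_neg)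
 have "tensor_eq R M N ((?ys @ [(m, n)]) @ xs) (([(m, n)] @ ?ys) @ xs)"
  using x ys Cons mod by (intro tensor_eq_append tensor_eq.comm tensor_eq.refl) auto
 then have "tensor_eq R M N ((?m, n) # ?ys @ (m, n) # xs) ([(?m, n), (m, n)] @ ?ys @ xs)"
  using x m tensor_eq.cong[of R M N _ _ "[(?m, n)]"] by force
 also have "tensor_eq R M N ([(?m, n), (m, n)] @ ?ys @ xs) ([(?m +[M] m, n)] @ [])"
  using x m Cons mod by (intro tensor_eq_append tensor_eq.sym[OF tensor_eq.add_left]) auto
 also (tensor_eq.trans) have "tensor_eq R M N ... []"
  using tensor_eq.zero[OF x(3), of R M] z by simp
 finally (tensor_eq.trans) show ?case by (simp add: x)
qed

lemma tensor_module [simp]: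
 assumes mod: "module R M" "module R N"
 shows "module R (M ** N :: ('k, 'u) module)"
proof -
 let ?T = "M ** N :: ('k, 'u) module"
 have ex: "\<exists>xs. xs \<in> fsums M N \<and> x = tcl M N xs" if "x .: ?T" for x
  using that by (auto simp: tensor_simps)
 have cl: "tcl M N xs .: ?T" if "xs \<in> fsums M N" for xs
  using that by (auto simp: tensor_simps)
 note * = class_add[OF mod] class_smult[OF mod] tensor_simps(2)
 have sm: "(\<ominus> \<one>) .: R" by simp
 show ?thesis
 proof (intro moduleI is_cring abelian_groupI)
  fix x y z assume "x .: ?T" "y .: ?T" "z .: ?T"
  then obtain xs ys zs where l: "xs \<in> fsums M N" "ys \<in> fsums M N" "zs \<in> fsums M N"
   "x = tcl M N xs" "y = tcl M N ys" "z = tcl M N zs" using ex by meson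
  then show "x +[?T] y +[?T] z = x +[?T] (y +[?T] z)" by (simp add: *)
 next
  fix x y assume "x .: ?T" "y .: ?T"
  then obtain xs ys where l: "xs \<in> fsums M N" "ys \<in> fsums M N"
   "x = tcl M N xs" "y = tcl M N ys" using ex by meson
  then show "x +[?T] y .: ?T" using cl by (simp add: *)
  show "x +[?T] y = y +[?T] x"
   using l by (simp add: * tensor_class_eq[OF tensor_eq.comm])
  fix r assume "r .: R"
  then show "r *[?T] (x +[?T] y) = r *[?T] x +[?T] r *[?T] y"
   using l mod by (simp add: *)
 next
  fix x assume "x .: ?T"
  then obtain xs where l: "xs \<in> fsums M N" "x = tcl M N xs" using ex by meson
  show "\<zero>\<^bsub>?T\<^esub> +[?T] x = x" using l by (simp add: *)
  show "\<exists>y\<in>carrier ?T. y +[?T] x = \<zero>\<^bsub>?T\<^esub>"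
   using l mod sm by (intro bexI[of _ "tcl M N (smult_fsum M (\<ominus> \<one>) xs)"])
    (simp_all add: * cl tensor_class_eq[OF tensor_eq_cancel[OF mod]])
  show "\<one> *[?T] x = x"
  proof -
   have "smult_fsum M \<one> xs = xs" using l(1)
    by (induction xs) (auto simp: module_smult_facts(4)[OF mod(1)])
   then show ?thesis using l by (simp add: *)
  qed
  fix r assume r: "r .: R"
  show "r *[?T] x .: ?T" using l r mod by (simp add: * cl)
  fix s assume s: "s .: R"
  have "smult_fsum M (r \<otimes> s) xs = smult_fsum M r (smult_fsum M s xs)" using l(1) r s
   by (induction xs) (auto simp: module_smult_facts(3)[OF mod(1)])
  then show "(r \<otimes> s) *[?T] x = r *[?T] (s *[?T] x)" using l r s mod by (simp add: *)
  \<comment> \<open>Splitting r + s entry by entry interleaves the pairs (rm, n) and (sm, n), while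
    the right-hand side lists all r-multiples before all s-multiples; the induction sorts them one
    entry at a time.\<close>
  have "tensor_eq R M N (smult_fsum M (r \<oplus> s) xs) (smult_fsum M r xs @ smult_fsum M s xs)"
   using l(1)
  proof (induction xs)
   case Nil
   then show ?case using tensor_eq.refl[of "[]"] by simp
  next
   case (Cons a xs)
   obtain m n where a: "a = (m, n)" "m .: M" "n .: N" using Cons by auto
   let ?r = "smult_fsum M r xs" and ?s = "smult_fsum M s xs"
   have c: "?r \<in> fsums M N" "?s \<in> fsums M N" using Cons r s mod by auto
   have 1: "tensor_eq R M N ([((r \<oplus> s) *[M] m, n)] @ smult_fsum M (r \<oplus> s) xs)
     ([(r *[M] m, n), (s *[M] m, n)] @ ?r @ ?s)"
    using Cons a r s mod
    by (intro tensor_eq_append mod)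
     (auto simp: module_smult_facts(2)[OF mod(1)] intro: tensor_eq.add_left)
   have 2: "tensor_eq R M N ([(r *[M] m, n)] @ ([(s *[M] m, n)] @ ?r) @ ?s)
     ([(r *[M] m, n)] @ (?r @ [(s *[M] m, n)]) @ ?s)"
    using a r s c mod
    by (intro tensor_eq_append mod tensor_eq.comm tensor_eq.refl) auto
   show ?case using tensor_eq.trans[OF 1] 2 by (simp add: a)
  qed
  then have "tcl M N (smult_fsum M (r \<oplus> s) xs) = tcl M N (smult_fsum M r xs @ smult_fsum M s xs)"
   by (rule tensor_class_eq)
  then show "(r \<oplus> s) *[?T] x = r *[?T] x +[?T] s *[?T] x"
   using l r s mod by (simp add: *)
 next
  show "\<zero>\<^bsub>?T\<^esub> .: ?T" using cl by (simp add: *)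
 qed
qed

end

context tensor_universe
begin

subsection \<open>Sweedler sums\<close>

text \<open>Mentioning the two factors, and being zero outside the tensor product, makes the congruence
 rule below unconditional, so that the simplifier rewrites under Sweedler sums.\<close>

definition Sw :: "('k, 'u, 'a) module_scheme => ('k, 'u, 'b) module_scheme => ('k, 'p, 'q) module_scheme
  => 'u => ('u => 'u => 'p) => 'p" where
 "Sw M N P x f = (if module R M \<and> module R N \<and> x .: (M ** N :: ('k, 'u) module)
  then sweedler P x f else \<zero>\<^bsub>P\<^esub>)"

lemma sweedler_Sw:
 "module R M ==> module R N ==> x .: (M ** N) ==> sweedler P (x :: 'u) f = Sw M N P x f"
 by (simp add: Sw_def)

lemma Sw_msum:
 "module R M ==> module R N ==> x .: (M ** N) ==> Sw M N P (x :: 'u) f = msum P f (decode x)"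
 by (simp add: Sw_def sweedler_def msum_def)

lemma msum_cong:
 "(!!a b. a \<in> A ==> b \<in> B ==> f a b = g a b) ==> xs \<in> lists (A \<times> B) ==> msum P f xs = msum P g xs"
 by (induction xs) auto

lemma Sw_cong [cong]:
 assumes "x = y" and eq: "!!a b. a .: M ==> b .: N ==> f a b = g a b"
 shows "Sw M N P x f = Sw M N P (y :: 'u) g"
proof (cases "module R M \<and> module R N \<and> y .: (M ** N)")
 case True
 then have "decode y \<in> fsums M N" by (intro decode_fsums(1)) simp_all
 then have "msum P f (decode y) = msum P g (decode y)"
  by (rule msum_cong[rotated]) (rule eq)
 then show ?thesis using True by (simp only: Sw_msum assms(1))
next
 case False
 then show ?thesis unfolding Sw_def assms(1) by (simp only: if_False)
qed

lemma Sw_eqI: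
 "(!!a b. a .: M ==> b .: N ==> f a b = g a b) ==> Sw M N P x f = Sw M N P (x :: 'u) g"
 by (rule Sw_cong[OF HOL.refl])

lemma Sw_closed [simp]:
 assumes "module R M" "module R N" "module R P" "\<forall>a\<in>carrier M. \<forall>b\<in>carrier N. f a b .: P"
 shows "Sw M N P (x :: 'u) f .: P"
proof (cases "x .: (M ** N)")
 case True
 then show ?thesis using msum_closed[OF assms(3,4) decode_fsums(1)[OF assms(1,2) True]]
  by (simp only: Sw_msum assms)
qed (simp add: Sw_def assms)

lemma msum_lin:
 assumes "module R P" "module R Q" "g \<in> lin P Q" "\<forall>a\<in>A. \<forall>b\<in>B. f a b .: P"
  "xs \<in> lists (A \<times> B)"
 shows "g (msum P f xs) = msum Q (%a b. g (f a b)) xs"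
 using assms(5)
proof (induction xs)
 case (Cons x xs)
 then show ?case using assms msum_closed[OF assms(1,4)] by (cases x) (simp add: lin_add)
qed (simp add: lin_zero assms)

lemma Sw_lin:
 assumes "module R M" "module R N" "module R P" "module R Q" "g \<in> lin P Q"
  "\<forall>a\<in>carrier M. \<forall>b\<in>carrier N. f a b .: P"
 shows "g (Sw M N P (x :: 'u) f) = Sw M N Q x (%a b. g (f a b))"
proof (cases "x .: (M ** N)")
 case True
 then show ?thesis using msum_lin[OF assms(3-6) decode_fsums(1)[OF assms(1,2) True]]
  by (simp only: Sw_msum assms)
qed (simp add: Sw_def lin_zero assms)

lemma msum_add:
 assumes P: "module R P" and f: "\<forall>a\<in>A. \<forall>b\<in>B. f a b .: P" and g: "\<forall>a\<in>A. \<forall>b\<in>B. g a b .: P"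
  and "xs \<in> lists (A \<times> B)"
 shows "msum P (%a b. f a b +[P] g a b) xs = msum P f xs +[P] msum P g xs"
 using assms(4)
proof (induction xs)
 case (Cons x xs)
 interpret abelian_group P by (rule module.axioms(2)[OF P])
 show ?case using Cons f g msum_closed[OF P f] msum_closed[OF P g] by (cases x) (simp add: a_ac)
qed (simp add: P module_add_facts)

lemma Sw_add:
 assumes "module R M" "module R N" "module R P"
  "\<forall>a\<in>carrier M. \<forall>b\<in>carrier N. f a b .: P" "\<forall>a\<in>carrier M. \<forall>b\<in>carrier N. g a b .: P"
 shows "Sw M N P (x :: 'u) (%a b. f a b +[P] g a b) = Sw M N P x f +[P] Sw M N P x g"
proof (cases "x .: (M ** N)")
 case True
 then show ?thesis using msum_add[OF assms(3-5) decode_fsums(1)[OF assms(1,2) True]]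
  by (simp only: Sw_msum assms)
qed (simp add: Sw_def assms module_add_facts)

lemma lin_smult_const [simp]:
 assumes "module R P" "r .: R" "f \<in> lin A P"
 shows "(%x. r *[P] f x) \<in> lin A P"
proof (rule linI)
 fix s x assume "s .: R" "x .: A"
 then show "r *[P] f (s *[A] x) = s *[P] (r *[P] f x)"
  using assms by (simp add: lin_smult lin_closed module_smult_facts(3)[symmetric] m_comm)
qed (use assms in \<open>simp_all add: lin_closed lin_add module_smult_facts(1)\<close>)

lemma lin_id [simp]: "(%x. x) \<in> lin M M"
 by (rule linI) simp_all

lemma Sw_smult:
 assumes "module R M" "module R N" "module R P" "r .: R"
  "\<forall>a\<in>carrier M. \<forall>b\<in>carrier N. f a b .: P"
 shows "Sw M N P (x :: 'u) (%a b. r *[P] f a b) = r *[P] Sw M N P x f"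
 using Sw_lin[of M N P P "%y. r *[P] y" f x] assms by simp

lemma Sw_zero: "module R A ==> module R B ==> module R P ==> Sw A B P (y :: 'u) (%c d. \<zero>\<^bsub>P\<^esub>) = \<zero>\<^bsub>P\<^esub>"
 using Sw_smult[of A B P \<zero> "%_ _. \<zero>\<^bsub>P\<^esub>" y] by (simp add: module_zero)

text \<open>Fubini for finite sums. It would loop as a rewrite rule, so the Sweedler computations
  below invoke it explicitly wherever two sums change places, leaving only closure of the summands
  to the simplifier.\<close>

lemma Sw_swap:
 assumes "module R M" "module R N" "module R A" "module R B" "module R P"
  and f: "\<forall>a\<in>carrier M. \<forall>b\<in>carrier N. \<forall>c\<in>carrier A. \<forall>d\<in>carrier B. f a b c d .: P"
 shows "Sw M N P (x :: 'u) (%a b. Sw A B P (y :: 'u) (%c d. f a b c d))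
  = Sw A B P y (%c d. Sw M N P x (%a b. f a b c d))"
proof (cases "x .: (M ** N)")
 case True
 have eq: "msum P (%a b. Sw A B P y (%c d. f a b c d)) xs = Sw A B P y (%c d. msum P (%a b. f a b c d) xs)"
  if "xs \<in> fsums M N" for xs
  using that
 proof (induction xs)
  case Nil
  show ?case using assms by (simp add: Sw_zero)
 next
  case (Cons z xs)
  obtain a b where z: "z = (a, b)" "a .: M" "b .: N" using Cons by auto
  have "\<forall>c\<in>carrier A. \<forall>d\<in>carrier B. msum P (%a b. f a b c d) xs .: P"
   using msum_closed[of P "carrier M" "carrier N" _ xs] f Cons assms by simp
  then show ?case using Cons z assms by (simp add: Sw_add)
 qed
 have "Sw M N P x (%a b. Sw A B P y (%c d. f a b c d))
   = Sw A B P y (%c d. msum P (%a b. f a b c d) (decode x))"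
  using eq[OF decode_fsums(1)[OF assms(1,2) True]] by (simp only: Sw_msum True assms)
 then show ?thesis by (simp only: Sw_msum True assms)
next
 case False
 have "Sw A B P y (%c d. \<zero>\<^bsub>P\<^esub>) = \<zero>\<^bsub>P\<^esub>" using assms by (simp add: Sw_zero)
 then show ?thesis using False by (simp add: Sw_def)
qed

lemma lin_Sw_fun [simp]:
 assumes "module R M" "module R N" "module R P"
  and f: "\<forall>a\<in>carrier M. \<forall>b\<in>carrier N. (%x. f x a b) \<in> lin A P"
 shows "(%x. Sw M N P (u :: 'u) (f x)) \<in> lin A P"
proof (rule linI)
 have c: "a .: M ==> b .: N ==> x .: A ==> f x a b .: P" for a b x
  using f lin_closed[of "%x. f x a b" A P x] by simp
 have l: "a .: M ==> b .: N ==> (%x. f x a b) \<in> lin A P" for a b using f by simp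
 fix x assume x: "x .: A"
 then show "Sw M N P u (f x) .: P" using assms(1-3) c by simp
 fix y assume y: "y .: A"
 have "Sw M N P u (f (x +[A] y)) = Sw M N P u (%a b. f x a b +[P] f y a b)"
  using assms(1,2) lin_add[OF l x y] by (intro Sw_cong) simp_all
 also have "... = Sw M N P u (f x) +[P] Sw M N P u (f y)"
  using assms(1-3) c x y by (intro Sw_add) auto
 finally show "Sw M N P u (f (x +[A] y)) = Sw M N P u (f x) +[P] Sw M N P u (f y)" .
next
 have c: "a .: M ==> b .: N ==> x .: A ==> f x a b .: P" for a b x
  using f lin_closed[of "%x. f x a b" A P x] by simp
 have l: "a .: M ==> b .: N ==> (%x. f x a b) \<in> lin A P" for a b using f by simp
 fix r x assume x: "r .: R" "x .: A"
 have "Sw M N P u (f (r *[A] x)) = Sw M N P u (%a b. r *[P] f x a b)"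
  using assms(1,2) lin_smult[OF l x] by (intro Sw_cong) simp_all
 also have "... = r *[P] Sw M N P u (f x)" using assms(1-3) c x by (intro Sw_smult) auto
 finally show "Sw M N P u (f (r *[A] x)) = r *[P] Sw M N P u (f x)" .
qed

lemma bilinD:
 assumes "bilin M N P f"
 shows "!!a. a .: M ==> (%b. f a b) \<in> lin N P" "!!b. b .: N ==> (%a. f a b) \<in> lin M P"
  "!!a b. a .: M ==> b .: N ==> f a b .: P"
  "\<forall>a\<in>carrier M. \<forall>b\<in>carrier N. f a b .: P"
proof -
 show r: "!!a. a .: M ==> (%b. f a b) \<in> lin N P" and "!!b. b .: N ==> (%a. f a b) \<in> lin M P"
  using assms by simp_all
 show "!!a b. a .: M ==> b .: N ==> f a b .: P" using lin_closed[OF r] by simp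
 then show "\<forall>a\<in>carrier M. \<forall>b\<in>carrier N. f a b .: P" by simp
qed

text \<open>The universal property of the tensor product: a bilinear map induces a linear map on
  coded classes.\<close>

lemma lin_Sw:
 assumes mod: "module R M" "module R N" "module R P" and f: "bilin M N P f"
 shows "(%x :: 'u. Sw M N P x f) \<in> lin (M ** N) P"
proof (rule linI)
 note c = bilinD(4)[OF f]
 fix x :: 'u assume x: "x .: (M ** N)"
 note xs = decode_fsums[OF mod(1,2) x]
 show "Sw M N P x f .: P" using mod c by simp
 \<comment> \<open>A class may be evaluated on any of its lists, because evaluation is invariant
   under \<open>tensor_eq\<close>; sums and scalar multiples can thus be computed on concatenated
   and scaled lists.\<close>
 have cl: "Sw M N P (tcl M N zs :: 'u) f = msum P f zs" if zs: "zs \<in> fsums M N" for zs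
 proof -
  have "tcl M N zs .: (M ** N :: ('k, 'u) module)" using zs by (simp only: tensor_simps imageI)
  then have "Sw M N P (tcl M N zs :: 'u) f = msum P f (decode (tcl M N zs :: 'u))" by (rule Sw_msum[OF mod(1,2)])
  also have "... = msum P f zs" by (rule msum_tensor_eq[OF mod f decode_class[OF zs], symmetric])
  finally show ?thesis .
 qed
 {
  fix y :: 'u assume y: "y .: (M ** N)"
  note ys = decode_fsums[OF mod(1,2) y]
  have "Sw M N P (x +[M ** N] y) f = msum P f (decode x @ decode y)"
   unfolding tensor_simps(3) by (rule cl) (use xs ys in simp)
  also have "... = Sw M N P x f +[P] Sw M N P y f"
   by (simp only: msum_append[OF mod(3) c xs(1) ys(1)] Sw_msum mod(1,2) x y)
  finally show "Sw M N P (x +[M ** N] y) f = Sw M N P x f +[P] Sw M N P y f" .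
 }
 fix r assume r: "r .: R"
 have eq: "msum P f (smult_fsum M r zs) = msum P (%a b. r *[P] f a b) zs" if "zs \<in> fsums M N" for zs
  using that
 proof (induction zs)
  case (Cons z zs)
  then show ?case using lin_smult[OF bilinD(2)[OF f] r] by (cases z) simp
 qed simp
 have "Sw M N P (r *[M ** N] x) f = msum P f (smult_fsum M r (decode x))"
  unfolding tensor_simps(4) by (rule cl) (use mod r xs in simp)
 also have "... = Sw M N P x (%a b. r *[P] f a b)" by (simp only: eq xs(1) Sw_msum mod(1,2) x)
 also have "... = r *[P] Sw M N P x f" by (rule Sw_smult[OF mod r c])
 finally show "Sw M N P (r *[M ** N] x) f = r *[P] Sw M N P x f" .
qed

lemma lin_compose: "f \<in> lin N P ==> g \<in> lin M N ==> (%x. f (g x)) \<in> lin M P"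
 by (rule linI) (simp_all add: lin_closed lin_add lin_smult)

lemma lin_Sw_arg [simp]:
 assumes "module R M" "module R N" "module R P" "bilin M N P f" "g \<in> lin A (M ** N)"
 shows "(%x. Sw M N P (g x :: 'u) f) \<in> lin A P"
 by (rule lin_compose[OF lin_Sw[OF assms(1-4)] assms(5)])

lemma pt_closed [simp]: "a .: M ==> b .: N ==> (pt M N a b :: 'u) .: (M ** N)"
 by (simp add: pure_tensor_def tensor_simps)

lemma Sw_pt [simp]:
 assumes mod: "module R M" "module R N" "module R P" and f: "bilin M N P f"
  and ab: "a .: M" "b .: N"
 shows "Sw M N P (pt M N a b :: 'u) f = f a b"
proof -
 have "Sw M N P (pt M N a b :: 'u) f = msum P f (decode (pt M N a b :: 'u))"
  by (rule Sw_msum[OF mod(1,2)]) (simp add: ab)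
 also have "... = msum P f [(a, b)]"
  unfolding pure_tensor_def using ab
  by (intro msum_tensor_eq[OF mod f tensor_eq.sym] decode_class) simp
 also have "... = f a b" by (simp add: module_add_facts mod bilinD(3)[OF f] ab)
 finally show ?thesis .
qed

lemma pt_lin:
 assumes "module R M" "module R N"
 shows "b .: N ==> (%a. pt M N a b :: 'u) \<in> lin M (M ** N)"
  "a .: M ==> (%b. pt M N a b :: 'u) \<in> lin N (M ** N)"
proof -
 have ad: "(pt M N a b :: 'u) +[M ** N] pt M N c d = tcl M N [(a, b), (c, d)]"
  if "a .: M" "b .: N" "c .: M" "d .: N" for a b c d
  unfolding pure_tensor_def using that by (subst class_add[OF assms]) simp_all
 have sm: "r *[M ** N] (pt M N a b :: 'u) = tcl M N [(r *[M] a, b)]"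
  if "a .: M" "b .: N" "r .: R" for a b r
  unfolding pure_tensor_def using that by (subst class_smult[OF assms]) simp_all
 show "b .: N ==> (%a. pt M N a b :: 'u) \<in> lin M (M ** N)"
  by (rule linI) (simp_all add: ad sm, simp_all add: pure_tensor_def tensor_class_eq[OF tensor_eq.add_left])
 show "a .: M ==> (%b. pt M N a b :: 'u) \<in> lin N (M ** N)"
  by (rule linI) (simp_all add: ad sm, simp_all add: pure_tensor_def tensor_class_eq[OF tensor_eq.add_right]
    tensor_class_eq[OF tensor_eq.balanced])
qed

lemma lin_pt [simp]:
 assumes "module R M" "module R N"
 shows "f \<in> lin A M ==> b .: N ==> (%x. pt M N (f x) b :: 'u) \<in> lin A (M ** N)"
  "a .: M ==> g \<in> lin A N ==> (%x. pt M N a (g x) :: 'u) \<in> lin A (M ** N)"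
 using lin_compose[OF pt_lin(1)[OF assms]] lin_compose[OF pt_lin(2)[OF assms]] by blast+

lemma pt_smult [simp]:
 assumes "module R M" "module R N" "r .: R" "a .: M" "b .: N"
 shows "pt M N (r *[M] a) b = r *[M ** N] (pt M N a b :: 'u)"
  "pt M N a (r *[N] b) = r *[M ** N] (pt M N a b :: 'u)"
 using lin_smult[OF pt_lin(1)[of M N b]] lin_smult[OF pt_lin(2)[of M N a]] assms by auto

lemma Sw_id [simp]:
 assumes mod: "module R M" "module R N" and x: "(x :: 'u) .: (M ** N)"
 shows "Sw M N (M ** N) x (pt M N) = x"
proof -
 have "msum (M ** N) (pt M N) zs = (tcl M N zs :: 'u)" if "zs \<in> fsums M N" for zs
  using that
 proof (induction zs)
  case (Cons z zs)
  then show ?case using class_add[OF mod, of "[z]" zs] by (cases z) (simp add: pure_tensor_def)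
 qed (simp add: tensor_simps)
 then show ?thesis using decode_fsums[OF mod x] by (simp only: Sw_msum mod(1,2) x)
qed

text \<open>A linear map out of M \<otimes> N commutes with Sweedler sums. As a rewrite rule,
  together with \<open>Sw_pt\<close>, it flattens every composite of maps given on elementary
  tensors into one nested sum, which is the normal form used below.\<close>

lemma Sw_Sw [simp]:
 assumes "module R M" "module R N" "module R A" "module R B" "module R P" "bilin M N P f"
  "\<forall>a\<in>carrier A. \<forall>b\<in>carrier B. G a b .: (M ** N)"
 shows "Sw M N P (Sw A B (M ** N) (x :: 'u) G) f = Sw A B P x (%a b. Sw M N P (G a b :: 'u) f)"
 by (rule Sw_lin[OF assms(3,4) tensor_module[OF assms(1,2)] assms(5) lin_Sw[OF assms(1,2,5,6)] assms(7)])

lemma pt_Sw [simp]: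
 assumes "module R M" "module R N" "module R A" "module R B"
 shows "\<forall>a\<in>carrier A. \<forall>b\<in>carrier B. G a b .: M ==> n .: N
   ==> pt M N (Sw A B M (x :: 'u) G) n = Sw A B (M ** N) x (%a b. pt M N (G a b) n :: 'u)"
  "\<forall>a\<in>carrier A. \<forall>b\<in>carrier B. G' a b .: N ==> m .: M
   ==> pt M N m (Sw A B N (x :: 'u) G') = Sw A B (M ** N) x (%a b. pt M N m (G' a b) :: 'u)"
 using assms by (auto intro!: Sw_lin[OF _ _ _ _ pt_lin(1)] Sw_lin[OF _ _ _ _ pt_lin(2)])

lemma Sw_smult_arg [simp]:
 assumes "module R M" "module R N" "module R P" "bilin M N P f" "r .: R" "x .: (M ** N)"
 shows "Sw M N P (r *[M ** N] (x :: 'u)) f = r *[P] Sw M N P x f"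
 using lin_smult[OF lin_Sw[OF assms(1-4)] assms(5,6)] .

subsection \<open>Retracts and corestriction\<close>

text \<open>A submodule with a chosen linear projection, hence a direct summand. The projections
  that occur are the identity, the action of 1 on a non-unital module, \<open>et\<close>,
  \<open>es\<close>, and a flipped form of \<Delta>(1).\<close>

definition retract :: "('u => 'u) => ('k, 'u, 'a) module_scheme => ('k, 'u, 'b) module_scheme => bool" where
 "retract p A' A \<longleftrightarrow> module R A' \<and> module R A \<and> (%x. x) \<in> lin A' A \<and> p \<in> lin A A'
  \<and> (\<forall>a\<in>carrier A'. p a = a)"

lemma retractD:
 assumes "retract p A' A"
 shows "module R A'" "module R A" "(%x. x) \<in> lin A' A" "p \<in> lin A A'" "!!a. a .: A' ==> p a = a"
  "!!a. a .: A' ==> a .: A" "!!a. a .: A ==> p a .: A'"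
 using assms lin_closed[of "%x. x" A' A] lin_closed[of p A A'] by (auto simp: retract_def)

lemma retract_id: "module R A ==> retract (%x. x) A A"
 by (simp add: retract_def)

lemma lin_retract:
 assumes "retract p A' A" "f \<in> lin A P" shows "f \<in> lin A' P"
 using lin_compose[OF assms(2) retractD(3)[OF assms(1)]] by simp

lemma bilin_retract:
 assumes "retract p A' A" "retract q B' B" "bilin A B P f"
 shows "bilin A' B' P f"
proof (intro conjI ballI)
 fix a assume "a .: A'"
 then show "(%b. f a b) \<in> lin B' P"
  by (intro lin_retract[OF assms(2)] bilinD(1)[OF assms(3)] retractD(6)[OF assms(1)])
next
 fix b assume "b .: B'"
 then show "(%a. f a b) \<in> lin A' P"
  by (intro lin_retract[OF assms(1)] bilinD(2)[OF assms(3)] retractD(6)[OF assms(2)])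
qed

abbreviation inc where "inc A' B' A B x \<equiv> Sw A' B' (A ** B) x (pt A B)"

lemma Sw_inc:
 assumes r: "retract p A' A" "retract q B' B" and P: "module R P" and f: "bilin A B P f"
 shows "Sw A B P (inc A' B' A B x) f = Sw A' B' P (x :: 'u) f"
 using retractD[OF r(1)] retractD[OF r(2)] P f by simp

text \<open>The tensor product p \<otimes> q of the projections is a left inverse of the canonical
  map between the tensor products; for arbitrary submodules that map could fail to be
  injective.\<close>

lemma inc_inject:
 assumes r: "retract p A' A" "retract q B' B" and x: "(x :: 'u) .: (A' ** B')"
 shows "x = Sw A B (A' ** B') (inc A' B' A B x) (%a b. pt A' B' (p a) (q b))"
 using retractD[OF r(1)] retractD[OF r(2)] x by (simp add: Sw_inc[OF r])

lemma inc_inj: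
 assumes r: "retract p A' A" "retract q B' B" and "(x :: 'u) .: (A' ** B')" "y .: (A' ** B')"
  "inc A' B' A B x = inc A' B' A B y"
 shows "x = y"
 using inc_inject[OF r assms(3)] inc_inject[OF r assms(4)] assms(5) by simp

text \<open>Injectivity makes the definite description in \<open>corestrict\<close> unique. A
  corestriction is therefore identified by naming a candidate preimage and comparing its image in
  the ambient tensor product.\<close>

lemma corestrict_inc:
 assumes r: "retract p A' A" "retract q B' B" and x: "(x :: 'u) .: (A' ** B')"
 shows "corestrict R A' B' A B (inc A' B' A B x) = x"
 unfolding corestrict_def
 using x inc_inj[OF r _ x] sweedler_Sw[OF retractD(1)[OF r(1)] retractD(1)[OF r(2)]]
 by (intro the_equality) auto

text \<open>\<open>y \<in> A \<otimes> B\<close> comes from \<open>A' \<otimes> B'\<close> iff it is fixed by the projection \<open>p \<otimes> q\<close>.\<close>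

lemma corestrict_retract:
 assumes r: "retract p A' A" "retract q B' B" and y: "(y :: 'u) .: (A ** B)"
  and fx: "Sw A B (A ** B) y (%a b. pt A B (p a) (q b)) = y"
 shows "corestrict R A' B' A B y = Sw A B (A' ** B') y (%a b. pt A' B' (p a) (q b))"
  "corestrict R A' B' A B y .: (A' ** B')"
  "inc A' B' A B (corestrict R A' B' A B y) = y"
proof -
 note [simp] = retractD[OF r(1)] retractD[OF r(2)]
 let ?x = "Sw A B (A' ** B') y (%a b. pt A' B' (p a) (q b))"
 have b: "bilin A' B' (A ** B) (pt A B)" by (rule bilin_retract[OF r]) simp
 have x: "?x .: (A' ** B')" by simp
 have i: "inc A' B' A B ?x = y" using fx b by simp
 then have e: "corestrict R A' B' A B y = ?x" using corestrict_inc[OF r x] by simp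
 then show "corestrict R A' B' A B y = ?x" "corestrict R A' B' A B y .: (A' ** B')"
  "inc A' B' A B (corestrict R A' B' A B y) = y" using x i by simp_all
qed

lemma Sw_corestrict:
 assumes r: "retract p A' A" "retract q B' B" and y: "(y :: 'u) .: (A ** B)"
  and fx: "Sw A B (A ** B) y (%a b. pt A B (p a) (q b)) = y"
  and P: "module R P" and f: "bilin A B P f"
 shows "Sw A' B' P (corestrict R A' B' A B y) f = Sw A B P y f"
 using Sw_inc[OF r P f, of "corestrict R A' B' A B y"] corestrict_retract(3)[OF r y fx] by simp

subsection \<open>Dependence on the module structure only\<close>

text \<open>Tensor products depend only on the underlying module. Records that differ in action or
  coaction, or that lack these fields, therefore have literally equal tensor products; the
  strictness of two of the functors depends on this.\<close>

definition mod_eq where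
 "mod_eq M M' \<longleftrightarrow> carrier M = carrier M' \<and> add M = add M' \<and> zero M = zero M' \<and> smult M = smult M'"

lemma tensor_eq_mod_eq:
 assumes "mod_eq M M'" "mod_eq N N'" shows "tensor_eq R M N xs ys ==> tensor_eq R M' N' xs ys"
proof (induction rule: tensor_eq.induct)
 case (trans xs ys zs)
 show ?case by (rule tensor_eq.trans[OF trans.IH])
next
 case (sym xs ys)
 show ?case by (rule tensor_eq.sym[OF sym.IH])
qed (use assms in \<open>auto simp: mod_eq_def intro: tensor_eq.refl tensor_eq.cong tensor_eq.comm
  intro!: tensor_eq.zero[of _ N' R M', simplified] tensor_eq.add_left[of _ M' _ _ N' R]
   tensor_eq.add_right[of _ M' _ N' _ R] tensor_eq.balanced[of _ R _ M' _ N']\<close>)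

lemma mod_eq_sym: "mod_eq M M' ==> mod_eq M' M"
 by (simp add: mod_eq_def)

lemma mod_eq_tensor:
 assumes "mod_eq M M'" "mod_eq N N'"
 shows "(M ** N :: ('k, 'u) module) = M' ** N'" "(pt M N :: 'u => 'u => 'u) = pt M' N'"
proof -
 have "tensor_eq R M N = tensor_eq R M' N'"
  using tensor_eq_mod_eq[OF assms] tensor_eq_mod_eq[OF mod_eq_sym[OF assms(1)] mod_eq_sym[OF assms(2)]]
  by (intro ext iffI) assumption+
 then have "tensor_class R M N = (tensor_class R M' N' :: _ => 'u)"
  by (intro ext) (simp add: tensor_class_def)
 then show "(M ** N :: ('k, 'u) module) = M' ** N'" "(pt M N :: 'u => 'u => 'u) = pt M' N'"
  using assms by (auto simp: tensor_def pure_tensor_def mod_eq_def fun_eq_iff)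
qed

lemma mod_eq_imp_module:
 assumes "mod_eq M M'" "module R M" shows "module R M'"
proof -
 interpret M: module R M by (rule assms(2))
 have eq: "carrier M = carrier M'" "add M = add M'" "zero M = zero M'" "smult M = smult M'"
  using assms(1) by (simp_all add: mod_eq_def)
 note f = abelian_groupE[OF M.abelian_group_axioms, unfolded eq] M.smult_closed[unfolded eq]
  M.smult_l_distr[unfolded eq] M.smult_r_distr[unfolded eq] M.smult_assoc1[unfolded eq]
  M.smult_one[unfolded eq]
 show ?thesis by (intro moduleI abelian_groupI is_cring; (rule f; assumption))
qed

lemma mod_eq_module: "mod_eq M M' ==> module R M = module R M'"
 by (rule iffI) (erule (1) mod_eq_imp_module, erule mod_eq_imp_module[OF mod_eq_sym])

lemma mod_eq_Sw:
 assumes "mod_eq M M'" "mod_eq N N'" "mod_eq P P'" shows "Sw M N P (x :: 'u) f = Sw M' N' P' x f"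
 using assms(3) by (simp add: Sw_def mod_eq_tensor[OF assms(1,2)] mod_eq_module[OF assms(1)]
  mod_eq_module[OF assms(2)] sweedler_def mod_eq_def)

lemma mod_eq_lin: "mod_eq M M' ==> mod_eq N N' ==> lin M N = lin M' N'"
 by (simp add: mod_eq_def lin_map_def hom_def)

end

section \<open>Weak Hopf algebras\<close>

context tensor_universe
begin

text \<open>A template: instantiated with a given bilinear map and added to the simplifier, these
  rules pull scalars and sums out of either argument and discharge the linearity side conditions of
  the Sweedler rules.\<close>

lemma bilin_simps:
 assumes f: "bilin M N P f" and mod: "module R M" "module R N" "module R P"
 shows "!!a b. a .: M ==> b .: N ==> f a b .: P"
  "!!g A b. g \<in> lin A M ==> b .: N ==> (%x. f (g x) b) \<in> lin A P"
  "!!g A a. g \<in> lin A N ==> a .: M ==> (%x. f a (g x)) \<in> lin A P"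
  "!!r a b. r .: R ==> a .: M ==> b .: N ==> f (r *[M] a) b = r *[P] f a b"
  "!!r a b. r .: R ==> a .: M ==> b .: N ==> f a (r *[N] b) = r *[P] f a b"
  "!!A B (x :: 'u) G b. module R A ==> module R B ==> \<forall>c\<in>carrier A. \<forall>d\<in>carrier B. G c d .: M
   ==> b .: N ==> f (Sw A B M x G) b = Sw A B P x (%c d. f (G c d) b)"
  "!!A B (x :: 'u) G a. module R A ==> module R B ==> \<forall>c\<in>carrier A. \<forall>d\<in>carrier B. G c d .: N
   ==> a .: M ==> f a (Sw A B N x G) = Sw A B P x (%c d. f a (G c d))"
 using bilinD(3)[OF f] lin_compose[OF bilinD(2)[OF f]] lin_compose[OF bilinD(1)[OF f]]
  lin_smult[OF bilinD(2)[OF f]] lin_smult[OF bilinD(1)[OF f]]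
  Sw_lin[OF _ _ mod(1,3) bilinD(2)[OF f]] Sw_lin[OF _ _ mod(2,3) bilinD(1)[OF f]]
 by simp_all

lemma lin_simps:
 assumes f: "f \<in> lin M P" and mod: "module R M" "module R P"
 shows "!!a. a .: M ==> f a .: P"
  "!!g A. g \<in> lin A M ==> (%x. f (g x)) \<in> lin A P"
  "!!r a. r .: R ==> a .: M ==> f (r *[M] a) = r *[P] f a"
  "!!A B (x :: 'u) G. module R A ==> module R B ==> \<forall>c\<in>carrier A. \<forall>d\<in>carrier B. G c d .: M
   ==> f (Sw A B M x G) = Sw A B P x (%c d. f (G c d))"
 using lin_closed[OF f] lin_compose[OF f] lin_smult[OF f] Sw_lin[OF _ _ mod f] by simp_all

lemma trilin_simps:
 assumes f: "trilin M N Q P f" and mod: "module R M" "module R N" "module R Q" "module R P"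
 shows "!!a b c. a .: M ==> b .: N ==> c .: Q ==> f a b c .: P"
  "!!g A b c. g \<in> lin A M ==> b .: N ==> c .: Q ==> (%x. f (g x) b c) \<in> lin A P"
  "!!g A a c. g \<in> lin A N ==> a .: M ==> c .: Q ==> (%x. f a (g x) c) \<in> lin A P"
  "!!g A a b. g \<in> lin A Q ==> a .: M ==> b .: N ==> (%x. f a b (g x)) \<in> lin A P"
proof -
 have l: "!!a b. a .: M ==> b .: N ==> (%c. f a b c) \<in> lin Q P"
  "!!a c. a .: M ==> c .: Q ==> (%b. f a b c) \<in> lin N P"
  "!!b c. b .: N ==> c .: Q ==> (%a. f a b c) \<in> lin M P" using f by simp_all
 show "!!a b c. a .: M ==> b .: N ==> c .: Q ==> f a b c .: P"
  using lin_closed[OF l(1)] by simp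
 show "!!g A b c. g \<in> lin A M ==> b .: N ==> c .: Q ==> (%x. f (g x) b c) \<in> lin A P"
  by (rule lin_compose[OF l(3)])
 show "!!g A a c. g \<in> lin A N ==> a .: M ==> c .: Q ==> (%x. f a (g x) c) \<in> lin A P"
  by (rule lin_compose[OF l(2)])
 show "!!g A a b. g \<in> lin A Q ==> a .: M ==> b .: N ==> (%x. f a b (g x)) \<in> lin A P"
  by (rule lin_compose[OF l(1)])
qed

end

locale weak_hopf_bij = weak_hopf_algebra R H + tensor_universe R "TYPE('u)"
 for R :: "('k, 'r) ring_scheme" (structure) and H :: "('k, 'u, 'z) weak_hopf_scheme" +
 assumes antipode_bij: "bij_betw (antipode H) (carrier H) (carrier H)"
begin

abbreviation hm (infixr \<open>.*\<close> 75) where "a .* b \<equiv> a \<otimes>\<^bsub>H\<^esub> b"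
abbreviation uH where "uH \<equiv> \<one>\<^bsub>H\<^esub>"
abbreviation eH where "eH \<equiv> counit H"
abbreviation D where "D P h f \<equiv> Sw H H P (comult H h) f"
abbreviation S where "S \<equiv> antipode H"
abbreviation et where "et \<equiv> eps_t H"
abbreviation es where "es \<equiv> eps_s H"
abbreviation esb where "esb \<equiv> eps_s_bar H"
abbreviation etb where "etb \<equiv> eps_t_bar H"

lemma H_ring: "ring H" by (rule ring_axioms)

lemma H_module [simp]: "module R H" by (rule module_axioms)

lemma H_monoid: "monoid H" using H_ring by (rule ring.is_monoid)

lemma hone_closed: "uH .: H"
 by (rule monoid.one_closed[OF H_monoid])

lemma hm_assoc [simp]:
 "a .: H ==> b .: H ==> c .: H ==> (a .* b) .* c = a .* (b .* c)"
 by (rule monoid.m_assoc[OF H_monoid])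

lemma hm_smult [simp]:
 "r .: R ==> a .: H ==> b .: H ==> (r *[H] a) .* b = r *[H] (a .* b)"
 "r .: R ==> a .: H ==> b .: H ==> a .* (r *[H] b) = r *[H] (a .* b)"
 by (simp_all add: smult_mult_left smult_mult_right)

lemma hm_bilin: "bilin H H H (%a b. a .* b)"
 by (intro conjI ballI linI) (simp_all add: ring.ring_simprules[OF H_ring])

lemmas lin_hm [simp] = bilin_simps(2,3,6,7)[OF hm_bilin H_module H_module H_module]

lemma comult_lin: "comult H \<in> lin H (H ** H)" by (rule comult_linear)

lemmas comult_simps [simp] = lin_simps(1-3)[OF comult_lin H_module tensor_module[OF H_module H_module]]

lemma antipode_lin: "S \<in> lin H H" by (rule antipode_linear)

lemmas antipode_simps [simp] = lin_simps[OF antipode_lin H_module H_module]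

lemma counit_closed [simp]: "h .: H ==> eH h .: R"
 using counit_additive by (auto simp: hom_def)

lemma counit_smult_eq [simp]: "r .: R ==> h .: H ==> eH (r *[H] h) = r \<otimes> eH h"
 by (rule counit_smult)

text \<open>The counit takes values in the ring, which is not one of the modules here; scalars
  therefore always appear applied to a module element, and the pairing eH h *[P] p takes the place
  of the linear form.\<close>

lemma counit_bilin: "module R P ==> bilin H P P (%h p. eH h *[P] p)"
 using counit_additive
 by (intro conjI ballI linI)
  (auto simp: hom_def module_smult_facts m_assoc m_comm simp flip: module_smult_facts(3))

lemma counit_lin [simp]:
 assumes "module R P"
 shows "g \<in> lin A H ==> p .: P ==> (%x. eH (g x) *[P] p) \<in> lin A P"
  "module R A ==> module R B ==> \<forall>c\<in>carrier A. \<forall>d\<in>carrier B. G c d .: H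
   ==> p .: P ==> eH (Sw A B H (x :: 'u) G) *[P] p = Sw A B P x (%c d. eH (G c d) *[P] p)"
 using bilin_simps(2,6)[OF counit_bilin[OF assms] H_module assms assms] by simp_all

lemma smult_smult [simp]:
 "module R P ==> r .: R ==> s .: R ==> p .: P
  ==> (r \<otimes> s) *[P] p = r *[P] (s *[P] p)"
 by (rule module_smult_facts(3))

lemma smult_left_commute:
 "module R P ==> r .: R ==> s .: R ==> p .: P
  ==> r *[P] (s *[P] p) = s *[P] (r *[P] p)"
 using module_smult_facts(3)[of P r s p] module_smult_facts(3)[of P s r p] by (simp add: m_comm)

lemma smult_Sw [simp]:
 "module R A ==> module R B ==> module R P ==> r .: R
  ==> \<forall>a\<in>carrier A. \<forall>b\<in>carrier B. f a b .: P
  ==> r *[P] Sw A B P (x :: 'u) f = Sw A B P x (%a b. r *[P] f a b)"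
 by (rule Sw_smult[symmetric])

subsection \<open>The axioms in Sweedler notation\<close>

lemma comult_sweedler: "h .: H ==> sweedler P (comult H h) f = D P h f"
 by (rule sweedler_Sw) simp_all

text \<open>The axiom is an equation in H \<otimes> (H \<otimes> H); applying an arbitrary trilinear
  map to it gives a form that can be used inside any larger Sweedler sum. The other axioms are
  recast in the same way.\<close>

lemma coassoc:
 assumes h: "h .: H" and P: "module R P" and f: "trilin H H H P f"
 shows "D P h (%a b. D P a (%c d. f c d b)) = D P h (%a b. D P b (%c d. f a c d))"
 using arg_cong[OF coassociative[OF h], of "%x. Sw H (H ** H) P x (%a u. Sw H H P u (%b c. f a b c))"]
  h P f trilin_simps[OF f] by (simp add: comult_sweedler)

lemma comult_one:
 assumes P: "module R P" and f: "trilin H H H P f"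
 shows "D P uH (%a b. D P a (%c d. f c d b)) = D P uH (%a b. D P uH (%a' b'. f a (b .* a') b'))"
  "D P uH (%a b. D P a (%c d. f c d b)) = D P uH (%a b. D P uH (%a' b'. f a (a' .* b) b'))"
 using arg_cong[OF comult_one_1, of "%x. Sw H (H ** H) P x (%a u. Sw H H P u (%b c. f a b c))"]
  arg_cong[OF comult_one_2, of "%x. Sw H (H ** H) P x (%a u. Sw H H P u (%b c. f a b c))"]
  P f trilin_simps[OF f] by (simp_all add: comult_sweedler)

lemma D_counit:
 assumes h: "h .: H" and P: "module R P" and f: "f \<in> lin H P"
 shows "D P h (%a b. eH a *[P] f b) = f h" "D P h (%a b. eH b *[P] f a) = f h"
 using arg_cong[OF counit_left[OF h], of f] arg_cong[OF counit_right[OF h], of f]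
  h P f by (simp_all add: comult_sweedler lin_simps[OF f])

lemma D_mult:
 assumes "g .: H" "h .: H" and P: "module R P" and f: "bilin H H P f"
 shows "D P (g .* h) f = D P g (%a b. D P h (%c d. f (a .* c) (b .* d)))"
 using assms bilin_simps[OF f] by (simp add: comult_mult comult_sweedler)

text \<open>Multiplicativity of \<Delta> at 1h and h1. In a weak bialgebra \<Delta>(1) is merely an
  idempotent, so inserting and removing it next to \<Delta>(h) is a genuine step, used constantly
  below.\<close>

lemma D_one:
 assumes "h .: H" and P: "module R P" and f: "bilin H H P f"
 shows "D P uH (%u v. D P h (%a b. f (u .* a) (v .* b))) = D P h f"
  "D P h (%a b. D P uH (%u v. f (a .* u) (b .* v))) = D P h f"
 using D_mult[OF hone_closed assms] D_mult[OF assms(1) hone_closed assms(2,3)] assms by simp_all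

text \<open>The axioms are sums in the ring, whereas \<open>Sw\<close> needs a module as target;
  letting both sides act on an element \<open>p\<close> transfers them, by an induction over the
  decoded list.\<close>

lemma counit_mult:
 assumes "g .: H" "h .: H" "l .: H" and P: "module R P" "p .: P"
 shows "D P g (%a b. eH (h .* a) *[P] (eH (b .* l) *[P] p)) = eH (h .* g .* l) *[P] p"
  "D P g (%a b. eH (h .* b) *[P] (eH (a .* l) *[P] p)) = eH (h .* g .* l) *[P] p"
proof -
 have *: "foldr (%(a, b) s. \<phi> a b \<oplus> s) xs \<zero> *[P] p = msum P (%a b. \<phi> a b *[P] p) xs"
  if "xs \<in> fsums H H" and c: "\<forall>a\<in>carrier H. \<forall>b\<in>carrier H. \<phi> a b .: R" for \<phi> xs
  using that(1)
 proof (induction xs)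
  case (Cons x xs)
  have "foldr (%(a, b) s. \<phi> a b \<oplus> s) xs \<zero> .: R"
   using Cons.hyps(2) c by (induction xs) auto
  then show ?case using Cons c P by (cases x) (simp add: module_smult_facts(2))
 qed (simp add: module_zero P)
 have conv: "sweedler R (comult H g) \<phi> *[P] p = D P g (%a b. \<phi> a b *[P] p)"
  if "\<forall>a\<in>carrier H. \<forall>b\<in>carrier H. \<phi> a b .: R" for \<phi>
  unfolding sweedler_def
  by (subst *[OF decode_fsums(1) that]) (simp_all add: assms Sw_msum)
 have a: "(h .* g) .* l = h .* g .* l" using assms by simp
 show "D P g (%a b. eH (h .* a) *[P] (eH (b .* l) *[P] p)) = eH (h .* g .* l) *[P] p"
  using assms counit_mult_1[of h g l] unfolding a by (simp add: conv)
 show "D P g (%a b. eH (h .* b) *[P] (eH (a .* l) *[P] p)) = eH (h .* g .* l) *[P] p"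
  using assms counit_mult_2[of h g l] unfolding a by (simp add: conv)
qed

lemma eps_D:
 "h .: H ==> et h = D H uH (%a b. eH (a .* h) *[H] b)"
 "h .: H ==> es h = D H uH (%a b. eH (h .* b) *[H] a)"
 "h .: H ==> esb h = D H uH (%a b. eH (b .* h) *[H] a)"
 "h .: H ==> etb h = D H uH (%a b. eH (h .* a) *[H] b)"
 by (simp_all add: eps_t_def eps_s_def eps_s_bar_def eps_t_bar_def comult_sweedler)

lemma eps_lin: "et \<in> lin H H" "es \<in> lin H H" "esb \<in> lin H H" "etb \<in> lin H H"
proof -
 have *: "f \<in> lin H H" if "g \<in> lin H H" "!!h. h .: H ==> f h = g h" for f g
  by (rule linI) (use that in \<open>simp_all add: lin_closed lin_add lin_smult\<close>)
 show "et \<in> lin H H" by (rule *[OF _ eps_D(1)]) simp_all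
 show "es \<in> lin H H" by (rule *[OF _ eps_D(2)]) simp_all
 show "esb \<in> lin H H" by (rule *[OF _ eps_D(3)]) simp_all
 show "etb \<in> lin H H" by (rule *[OF _ eps_D(4)]) simp_all
qed

lemmas eps_simps [simp] = eps_lin lin_simps[OF eps_lin(1) H_module H_module]
 lin_simps[OF eps_lin(2) H_module H_module] lin_simps[OF eps_lin(3) H_module H_module]
 lin_simps[OF eps_lin(4) H_module H_module]

text \<open>In each case start from the right-hand side and insert the counit on the leg containing
  h. Multiplicativity of \<Delta> and the axiom for the threefold coproduct of 1 produce two copies
  of \<Delta>(1); one is absorbed into \<Delta>(h), and the other, paired with the counit, is the
  projection on the left.\<close>

lemma D_eps:
 assumes h: "h .: H" and P: "module R P" and f: "bilin H H P f"
 shows "D P h (%a b. f a (et b)) = D P uH (%u v. f (u .* h) v)"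
  "D P h (%a b. f (es a) b) = D P uH (%u v. f u (h .* v))"
  "D P h (%a b. f (esb a) b) = D P uH (%u v. f u (v .* h))"
  "D P h (%a b. f a (etb b)) = D P uH (%u v. f (h .* u) v)"
proof -
 note [simp] = h P bilin_simps[OF f H_module H_module P]
 note sw = Sw_swap[of H H H H P]
 have "D P uH (%u v. f (u .* h) v) = D P uH (%u v. D P (u .* h) (%c d. eH d *[P] f c v))"
  by (simp add: D_counit)
 also have "... = D P uH (%u v. D P u (%c d. D P h (%a b. eH (d .* b) *[P] f (c .* a) v)))"
  by (simp add: D_mult)
 also have "... = D P uH (%u v. D P uH (%u' v'. D P h (%a b. eH (u' .* v .* b) *[P] f (u .* a) v')))"
  by (simp add: comult_one(2))
 also have "... = D P uH (%u' v'. D P uH (%u v. D P h (%a b. eH (u' .* v .* b) *[P] f (u .* a) v')))"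
  by (rule sw) simp_all
 also have "... = D P uH (%u' v'. D P h (%a b. eH (u' .* b) *[P] f a v'))"
  by (simp add: D_one(1)[of h P "%a b. eH (_ .* b) *[P] f a _"])
 also have "... = D P h (%a b. D P uH (%u' v'. eH (u' .* b) *[P] f a v'))"
  by (rule sw) simp_all
 also have "... = D P h (%a b. f a (et b))" by (simp add: eps_D)
 finally show "D P h (%a b. f a (et b)) = D P uH (%u v. f (u .* h) v)" ..
 have "D P uH (%u v. f u (h .* v)) = D P uH (%u v. D P (h .* v) (%c d. eH c *[P] f u d))"
  by (simp add: D_counit)
 also have "... = D P uH (%u v. D P h (%a b. D P v (%c d. eH (a .* c) *[P] f u (b .* d))))"
  by (simp add: D_mult)
 also have "... = D P h (%a b. D P uH (%u v. D P v (%c d. eH (a .* c) *[P] f u (b .* d))))"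
  by (rule sw) simp_all
 also have "... = D P h (%a b. D P uH (%u v. D P uH (%u' v'. eH (a .* u' .* v) *[P] f u (b .* v'))))"
  by (simp add: coassoc[symmetric] comult_one(2))
 also have "... = D P uH (%u v. D P h (%a b. D P uH (%u' v'. eH (a .* u' .* v) *[P] f u (b .* v'))))"
  by (rule sw) simp_all
 also have "... = D P uH (%u v. D P h (%a b. eH (a .* v) *[P] f u b))"
 proof -
  have "D P h (%a b. D P uH (%u' v'. eH (a .* u' .* v) *[P] f u (b .* v'))) = D P h (%a b. eH (a .* v) *[P] f u b)"
   if "u .: H" "v .: H" for u v
   using D_one(2)[of h P "%a b. eH (a .* v) *[P] f u b"] that by simp
  then show ?thesis by simp
 qed
 also have "... = D P h (%a b. D P uH (%u v. eH (a .* v) *[P] f u b))"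
  by (rule sw) simp_all
 also have "... = D P h (%a b. f (es a) b)" by (simp add: eps_D)
 finally show "D P h (%a b. f (es a) b) = D P uH (%u v. f u (h .* v))" ..
 have "D P uH (%u v. f u (v .* h)) = D P uH (%u v. D P (v .* h) (%c d. eH c *[P] f u d))"
  by (simp add: D_counit)
 also have "... = D P uH (%u v. D P v (%c d. D P h (%a b. eH (c .* a) *[P] f u (d .* b))))"
  by (simp add: D_mult)
 also have "... = D P uH (%u v. D P uH (%u' v'. D P h (%a b. eH (v .* u' .* a) *[P] f u (v' .* b))))"
  by (simp add: coassoc[symmetric] comult_one(1))
 also have "... = D P uH (%u v. D P h (%a b. eH (v .* a) *[P] f u b))"
  by (simp add: D_one(1)[of h P "%a b. eH (_ .* a) *[P] f _ b"])
 also have "... = D P h (%a b. D P uH (%u v. eH (v .* a) *[P] f u b))"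
  by (rule sw) simp_all
 also have "... = D P h (%a b. f (esb a) b)" by (simp add: eps_D)
 finally show "D P h (%a b. f (esb a) b) = D P uH (%u v. f u (v .* h))" ..
 have "D P uH (%u v. f (h .* u) v) = D P uH (%u v. D P (h .* u) (%c d. eH d *[P] f c v))"
  by (simp add: D_counit)
 also have "... = D P uH (%u v. D P h (%a b. D P u (%c d. eH (b .* d) *[P] f (a .* c) v)))"
  by (simp add: D_mult)
 also have "... = D P h (%a b. D P uH (%u v. D P u (%c d. eH (b .* d) *[P] f (a .* c) v)))"
  by (rule sw) simp_all
 also have "... = D P h (%a b. D P uH (%u v. D P uH (%u' v'. eH (b .* v .* u') *[P] f (a .* u) v')))"
  by (simp add: comult_one(1))
 also have "... = D P h (%a b. D P uH (%u' v'. D P uH (%u v. eH (b .* v .* u') *[P] f (a .* u) v')))"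
  by (rule Sw_eqI, rule sw) simp_all
 also have "... = D P uH (%u' v'. D P h (%a b. D P uH (%u v. eH (b .* v .* u') *[P] f (a .* u) v')))"
  by (rule sw) simp_all
 also have "... = D P uH (%u' v'. D P h (%a b. eH (b .* u') *[P] f a v'))"
 proof -
  have "D P h (%a b. D P uH (%u v. eH (b .* v .* u') *[P] f (a .* u) v')) = D P h (%a b. eH (b .* u') *[P] f a v')"
   if "u' .: H" "v' .: H" for u' v'
   using D_one(2)[of h P "%a b. eH (b .* u') *[P] f a v'"] that by simp
  then show ?thesis by simp
 qed
 also have "... = D P h (%a b. D P uH (%u' v'. eH (b .* u') *[P] f a v'))"
  by (rule sw) simp_all
 also have "... = D P h (%a b. f a (etb b))" by (simp add: eps_D)
 finally show "D P h (%a b. f a (etb b)) = D P uH (%u v. f (h .* u) v)" ..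
qed

text \<open>The case h = 1: each leg of \<Delta>(1) may be replaced by its projection. In particular
  \<Delta>(1) has its first leg in H_s and its second in H_t, which licenses all later replacements
  of u by \<open>es u\<close> and of v by \<open>et v\<close>.\<close>

lemma D_one_eps:
 assumes P: "module R P" and f: "bilin H H P f"
 shows "D P uH (%u v. f u (et v)) = D P uH f" "D P uH (%u v. f (es u) v) = D P uH f"
  "D P uH (%u v. f (esb u) v) = D P uH f" "D P uH (%u v. f u (etb v)) = D P uH f"
 using D_eps[OF hone_closed assms] by simp_all

lemma counit_eps:
 assumes "g .: H" "h .: H" "module R P" "p .: P"
 shows "eH (h .* et g) *[P] p = eH (h .* g) *[P] p" "eH (h .* esb g) *[P] p = eH (h .* g) *[P] p"
  "eH (es h .* g) *[P] p = eH (h .* g) *[P] p" "eH (etb h .* g) *[P] p = eH (h .* g) *[P] p"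
 using counit_mult[OF hone_closed assms(2,1,3,4)] assms
 by (simp_all add: eps_D smult_left_commute[of P "eH (_ .* g)" "eH (h .* _)"])

lemma eps_absorb [simp]:
 assumes "g .: H" "h .: H"
 shows "et (h .* et g) = et (h .* g)" "et (h .* esb g) = et (h .* g)"
  "esb (h .* et g) = esb (h .* g)" "esb (h .* esb g) = esb (h .* g)"
  "es (es h .* g) = es (h .* g)" "es (etb h .* g) = es (h .* g)"
  "etb (es h .* g) = etb (h .* g)" "etb (etb h .* g) = etb (h .* g)"
proof -
 note c = counit_eps[OF assms(1) _ H_module] and c' = counit_eps[OF _ assms(2) H_module]
 have a: "(x .* h) .* y = x .* h .* y" if "x .: H" "y .: H" for x y using that assms by simp
 have b: "eH (x .* h .* et g) *[H] p = eH (x .* h .* g) *[H] p" "eH (x .* h .* esb g) *[H] p = eH (x .* h .* g) *[H] p"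
  if "x .: H" "p .: H" for x p
  using c(1,2)[of "x .* h" p] that assms by simp_all
 show "et (h .* et g) = et (h .* g)" "et (h .* esb g) = et (h .* g)"
  "esb (h .* et g) = esb (h .* g)" "esb (h .* esb g) = esb (h .* g)"
  using assms by (simp_all add: eps_D[of "h .* _"] b)
 show "es (es h .* g) = es (h .* g)" "es (etb h .* g) = es (h .* g)"
  "etb (es h .* g) = etb (h .* g)" "etb (etb h .* g) = etb (h .* g)"
  using assms c'(3,4)[of "g .* _"] by (simp_all add: eps_D[of "_ .* g"])
qed

lemma eps_eps [simp]:
 assumes g: "g .: H"
 shows "et (et g) = et g" "et (esb g) = et g" "esb (et g) = esb g" "esb (esb g) = esb g"
  "es (es g) = es g" "es (etb g) = es g" "etb (es g) = etb g" "etb (etb g) = etb g"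
 using eps_absorb(1-4)[OF g hone_closed] eps_absorb(5-8)[OF hone_closed g] g
 by (simp_all del: eps_absorb)

lemma eps_in:
 assumes "h .: H" shows "es (esb h) = esb h" "et (etb h) = etb h"
proof -
 have "es (esb h) = D H uH (%a b. eH (b .* h) *[H] es a)" using assms by (simp add: eps_D(3))
 also have "... = esb h" using assms D_one_eps(2)[of H "%a b. eH (b .* h) *[H] a"] by (simp add: eps_D(3))
 finally show "es (esb h) = esb h" .
 have "et (etb h) = D H uH (%a b. eH (h .* a) *[H] et b)" using assms by (simp add: eps_D(4))
 also have "... = etb h" using assms D_one_eps(1)[of H "%a b. eH (h .* a) *[H] b"] by (simp add: eps_D(4))
 finally show "et (etb h) = etb h" .
qed

text \<open>The two axioms for \<Delta>(1) differ only in the order of the product in the middle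
  leg. Pairing the outer legs with the counit turns that middle leg into the two products compared
  here.\<close>

lemma eps_commute:
 assumes "g .: H" "h .: H" shows "et g .* es h = es h .* et g"
proof -
 let ?F = "%a b c. eH (h .* c) *[H] (eH (a .* g) *[H] b)"
 have "et g .* es h = D H uH (%u' v'. D H uH (%u v. ?F u (v .* u') v'))"
  using assms by (simp add: eps_D)
 also have "... = D H uH (%u v. D H uH (%u' v'. ?F u (v .* u') v'))"
  using assms by (intro Sw_swap) simp_all
 also have "... = D H uH (%u v. D H uH (%u' v'. ?F u (u' .* v) v'))"
  using assms comult_one[of H ?F] by simp
 also have "... = es h .* et g"
  using assms by (simp add: eps_D smult_left_commute[of H "eH (h .* _)" "eH (_ .* g)"])
 finally show ?thesis .
qed

section \<open>The target and source parts of H\<close>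

abbreviation Ht where "Ht \<equiv> target H"
abbreviation Hs where "Hs \<equiv> source H"

lemma Ht_iff: "z \<in> Ht \<longleftrightarrow> z .: H \<and> et z = z"
 unfolding target_def by (rule iffI, erule imageE, simp, erule conjE, rule image_eqI[of _ _ z], simp_all)

lemma Hs_iff: "y \<in> Hs \<longleftrightarrow> y .: H \<and> es y = y"
 unfolding source_def by (rule iffI, erule imageE, simp, erule conjE, rule image_eqI[of _ _ y], simp_all)

lemma Ht_D [simp]: "z \<in> Ht ==> z .: H" "z \<in> Ht ==> et z = z" by (simp_all add: Ht_iff)
lemma Hs_D [simp]: "y \<in> Hs ==> y .: H" "y \<in> Hs ==> es y = y" by (simp_all add: Hs_iff)

lemma eps_range [simp]: "h .: H ==> et h \<in> Ht" "h .: H ==> etb h \<in> Ht"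
  "h .: H ==> es h \<in> Hs" "h .: H ==> esb h \<in> Hs"
 by (simp_all add: Ht_iff Hs_iff eps_in del: Ht_D Hs_D)

lemma Ht_Hs_commute: "z \<in> Ht ==> y \<in> Hs ==> z .* y = y .* z"
 using eps_commute[of z y] by simp

text \<open>Write z = \<open>et z\<close> as a combination of second legs of \<Delta>(1) and apply
  \<Delta> to that leg. The two forms of the threefold coproduct of 1 then give z1_1 \<otimes> 1_2
  and 1_1 z \<otimes> 1_2 respectively.\<close>

lemma D_Ht:
 assumes z: "z \<in> Ht" and P: "module R P" and f: "bilin H H P f"
 shows "D P z f = D P uH (%u v. f (z .* u) v)" "D P z f = D P uH (%u v. f (u .* z) v)"
proof -
 note [simp] = P bilin_simps[OF f H_module H_module P]
 have zH [simp]: "z .: H" using z by simp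
 have "D P z f = D P (et z) f" using z by simp
 also have "... = D P uH (%a b. D P b (%c d. eH (a .* z) *[P] f c d))"
  using Sw_lin[of H H H P "%x. D P x f"] f by (simp add: eps_D(1))
 finally have 1: "D P z f = ..." .
 have zz: "z = D H uH (%a b. eH (a .* z) *[H] b)" using z by (simp flip: eps_D(1))
 show "D P z f = D P uH (%u v. f (z .* u) v)"
 proof -
  have "D P z f = D P uH (%u v. D P uH (%u' v'. eH (u .* z) *[P] f (v .* u') v'))"
   unfolding 1 by (simp add: coassoc[symmetric] comult_one(1))
  also have "... = D P uH (%u' v'. D P uH (%u v. eH (u .* z) *[P] f (v .* u') v'))"
   by (rule Sw_swap) simp_all
  also have "... = D P uH (%u' v'. f (et z .* u') v')" by (simp add: eps_D(1))
  finally show ?thesis using z by simp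
 qed
 show "D P z f = D P uH (%u v. f (u .* z) v)"
 proof -
  have "D P z f = D P uH (%u v. D P uH (%u' v'. eH (u .* z) *[P] f (u' .* v) v'))"
   unfolding 1 by (simp add: coassoc[symmetric] comult_one(2))
  also have "... = D P uH (%u' v'. D P uH (%u v. eH (u .* z) *[P] f (u' .* v) v'))"
   by (rule Sw_swap) simp_all
  also have "... = D P uH (%u' v'. f (u' .* et z) v')" by (simp add: eps_D(1))
  finally show ?thesis using z by simp
 qed
qed

lemma D_Hs:
 assumes y: "y \<in> Hs" and P: "module R P" and f: "bilin H H P f"
 shows "D P y f = D P uH (%u v. f u (v .* y))" "D P y f = D P uH (%u v. f u (y .* v))"
proof -
 note [simp] = P bilin_simps[OF f H_module H_module P]
 have yH [simp]: "y .: H" using y by simp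
 have "D P y f = D P (es y) f" using y by simp
 also have "... = D P uH (%a b. D P a (%c d. eH (y .* b) *[P] f c d))"
  using Sw_lin[of H H H P "%x. D P x f"] f by (simp add: eps_D(2))
 finally have 1: "D P y f = ..." .
 show "D P y f = D P uH (%u v. f u (v .* y))"
 proof -
  have "D P y f = D P uH (%u v. D P uH (%u' v'. eH (y .* v') *[P] f u (v .* u')))"
   unfolding 1 by (simp add: comult_one(1)[of P "%c d b. eH (y .* b) *[P] f c d"])
  also have "... = D P uH (%u v. f u (v .* es y))" by (simp add: eps_D(2))
  finally show ?thesis using y by simp
 qed
 show "D P y f = D P uH (%u v. f u (y .* v))"
 proof -
  have "D P y f = D P uH (%u v. D P uH (%u' v'. eH (y .* v') *[P] f u (u' .* v)))"
   unfolding 1 by (simp add: comult_one(2)[of P "%c d b. eH (y .* b) *[P] f c d"])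
  also have "... = D P uH (%u v. f u (es y .* v))" by (simp add: eps_D(2))
  finally show ?thesis using y by simp
 qed
qed

lemma eps_hone [simp]: "et uH = uH" "es uH = uH" "uH \<in> Ht" "uH \<in> Hs"
proof -
 show "et uH = uH" "es uH = uH"
  using D_counit[of uH H "%x. x"] eps_D(1,2)[of uH] by simp_all
 then show "uH \<in> Ht" "uH \<in> Hs" by (simp_all add: Ht_iff Hs_iff del: Ht_D Hs_D)
qed

text \<open>The counit axiom and the two formulas for \<Delta> on H_t express zz' as \<epsilon>(z
  1_1 z') 1_2. The leg 1_1 lies in H_s and commutes past z, which leaves the value of
  \<open>et\<close> at zz'.\<close>

lemma Ht_mult [simp]:
 assumes z: "z \<in> Ht" "z' \<in> Ht" shows "z .* z' \<in> Ht"
proof -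
 have [simp]: "z .: H" "z' .: H" using z by simp_all
 have "z .* z' = D H (z .* z') (%a b. eH a *[H] b)" by (simp add: D_counit(1)[of _ H "%x. x"])
 also have "... = D H z (%a b. D H z' (%c d. eH (a .* c) *[H] (b .* d)))"
  by (simp add: D_mult)
 also have "... = D H uH (%u v. D H uH (%u' v'. eH (z .* u .* u' .* z') *[H] (v .* v')))"
  by (simp add: D_Ht(1)[OF z(1)] D_Ht(2)[OF z(2)])
 also have "... = D H uH (%u v. eH (z .* u .* z') *[H] v)"
  using D_one(1)[of uH H "%a b. eH (z .* a .* z') *[H] b"] by simp
 also have "... = D H uH (%u v. eH (z .* es u .* z') *[H] v)"
  using D_one_eps(2)[of H "%a b. eH (z .* a .* z') *[H] b"] by simp
 also have "... = D H uH (%u v. eH (es u .* z .* z') *[H] v)"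
 proof -
  have "z .* es u .* z' = es u .* z .* z'" if "u .: H" for u
   using Ht_Hs_commute[OF z(1), of "es u"] that by (simp flip: hm_assoc)
  then show ?thesis by simp
 qed
 also have "... = et (z .* z')"
  using D_one_eps(2)[of H "%a b. eH (a .* z .* z') *[H] b"] by (simp add: eps_D(1))
 finally show ?thesis by (simp add: Ht_iff del: Ht_D)
qed

end

context weak_hopf_bij
begin

subsection \<open>The antipode\<close>

lemma D_antipode:
 assumes h: "h .: H" and P: "module R P" and f: "f \<in> lin H P"
 shows "D P h (%a b. f (S a .* b)) = f (es h)" "D P h (%a b. f (a .* S b)) = f (et h)"
 using arg_cong[OF antipode_left[OF h], of f] arg_cong[OF antipode_right[OF h], of f]
  h P f by (simp_all add: comult_sweedler lin_simps[OF f])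

lemma D_antipode_eps:
 assumes h: "h .: H" and P: "module R P" and f: "f \<in> lin H P"
 shows "D P h (%a b. f (es a .* S b)) = f (S h)" "D P h (%a b. f (S a .* et b)) = f (S h)"
proof -
 note [simp] = h P f lin_simps[OF f]
 have m: "f (S h) = D P h (%a b. D P b (%c d. f (S a .* c .* S d)))"
  using arg_cong[OF antipode_middle[OF h], of f] by (simp add: comult_sweedler)
 show "D P h (%a b. f (S a .* et b)) = f (S h)"
  unfolding m by (simp add: D_antipode(2)[of _ P "%x. f (S _ .* x)", symmetric])
 have "f (S h) = D P h (%a b. D P a (%c d. f (S c .* d .* S b)))"
  unfolding m by (simp add: coassoc)
 also have "... = D P h (%a b. f (es a .* S b))"
 proof -
  have "D P a (%c d. f (S c .* d .* w)) = f (es a .* w)" if "a .: H" "w .: H" for a w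
   using D_antipode(1)[of a P "%x. f (x .* w)"] that by simp
  then show ?thesis by simp
 qed
 finally show "D P h (%a b. f (es a .* S b)) = f (S h)" ..
qed

text \<open>In S(y) = \<open>es\<close>(y1) S(y2) the tensor \<open>es\<close>(y1) \<otimes> y2
  equals 1_1 \<otimes> y1_2, which for y in H_s is \<Delta>(y) again; what remains is y1 S(y2). The
  companion statement for H_t is symmetric.\<close>

lemma antipode_Hs: assumes y: "y \<in> Hs" shows "S y = et y"
proof -
 have [simp]: "y .: H" using y by simp
 have "S y = D H y (%a b. es a .* S b)" using D_antipode_eps(1)[of y H "%x. x"] by simp
 also have "... = D H uH (%u v. u .* S (y .* v))" by (rule D_eps(2)) simp_all
 also have "... = D H y (%a b. a .* S b)" by (simp add: D_Hs(2)[OF y])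
 also have "... = et y" using D_antipode(2)[of y H "%x. x"] by simp
 finally show ?thesis .
qed

lemma antipode_Ht: assumes z: "z \<in> Ht" shows "S z = es z"
proof -
 have [simp]: "z .: H" using z by simp
 have "S z = D H z (%a b. S a .* et b)" using D_antipode_eps(2)[of z H "%x. x"] by simp
 also have "... = D H uH (%u v. S (u .* z) .* v)" by (rule D_eps(1)) simp_all
 also have "... = D H z (%a b. S a .* b)" by (simp add: D_Ht(2)[OF z])
 also have "... = es z" using D_antipode(1)[of z H "%x. x"] by simp
 finally show ?thesis .
qed

lemma antipode_eps_bar [simp]:
 "h .: H ==> S (esb h) = et h" "h .: H ==> S (etb h) = es h" "S uH = uH"
 by (simp_all add: antipode_Hs antipode_Ht)

lemma antipode_range [simp]: "y \<in> Hs ==> S y \<in> Ht" "z \<in> Ht ==> S z \<in> Hs"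
 by (simp_all add: antipode_Hs antipode_Ht)

text \<open>First k is replaced by \<open>et k\<close>, which the outer projection does not notice;
  then \<Delta> of an element of H_t is 1_1 z \<otimes> 1_2, and the stray \<Delta>(1) is absorbed
  into \<Delta>(h).\<close>

lemma eps_mult_conj:
 assumes h: "h .: H" and k: "k .: H"
 shows "et (h .* k) = D H h (%a b. a .* et k .* S b)" "es (h .* k) = D H k (%a b. S a .* es h .* b)"
proof -
 note [simp] = h k
 have "et (h .* k) = D H (h .* et k) (%a b. a .* S b)" using D_antipode(2)[of "h .* et k" H "%x. x"] by simp
 also have "... = D H h (%a b. D H uH (%c d. a .* c .* et k .* S (b .* d)))"
  by (simp add: D_mult D_Ht(2)[of "et k"])
 also have "... = D H h (%a b. a .* et k .* S b)"
  using D_one(2)[of h H "%a b. a .* et k .* S b"] by simp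
 finally show "et (h .* k) = D H h (%a b. a .* et k .* S b)" .
 have "es (h .* k) = D H (es h .* k) (%a b. S a .* b)" using D_antipode(1)[of "es h .* k" H "%x. x"] by simp
 also have "... = D H uH (%c d. D H k (%a b. S (c .* a) .* es h .* d .* b))"
  by (simp add: D_mult D_Hs(2)[of "es h"])
 also have "... = D H k (%a b. S a .* es h .* b)"
  using D_one(1)[of k H "%a b. S a .* es h .* b"] by simp
 finally show "es (h .* k) = D H k (%a b. S a .* es h .* b)" .
qed

text \<open>Convolution uniqueness of inverses, with projections instead of units. S(hk) is extended
  by \<open>et\<close> of the second leg of hk, which unfolds to b1 d1 S(d2) S(b2); regrouping turns
  the front part into \<open>es\<close> of a product, which unfolds by conjugation, and the
  remaining factors collapse separately to S(k) and S(h).\<close>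

lemma antipode_mult [simp]:
 assumes h: "h .: H" and k: "k .: H" shows "S (h .* k) = S k .* S h"
proof -
 note [simp] = h k
 have "S (h .* k) = D H (h .* k) (%a b. S a .* et b)"
  using D_antipode_eps(2)[of "h .* k" H "%x. x"] by simp
 also have "... = D H h (%a b. D H k (%c d. S (a .* c) .* et (b .* d)))" by (simp add: D_mult)
 also have "... = D H h (%a b. D H k (%c d. D H b (%x y. S (a .* c) .* x .* et d .* S y)))"
  by (simp add: eps_mult_conj)
 also have "... = D H k (%c d. D H h (%a b. D H b (%x y. S (a .* c) .* x .* et d .* S y)))"
  by (rule Sw_swap) simp_all
 also have "... = D H k (%c d. D H h (%a b. D H a (%a' x. S (a' .* c) .* x .* et d .* S b)))"
  by (simp add: coassoc)
 also have "... = D H k (%c d. D H h (%a b. D H a (%a' x. D H d (%u v. S (a' .* c) .* x .* u .* S v .* S b))))"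
 proof -
  have "et d .* w = D H d (%u v. u .* S v .* w)" if "d .: H" "w .: H" for d w
   using D_antipode(2)[of d H "%x. x .* w"] that by simp
  then show ?thesis by simp
 qed
 also have "... = D H k (%c d. D H d (%u v. D H h (%a b. D H a (%a' x. S (a' .* c) .* x .* u .* S v .* S b))))"
  (is "D H k ?l = D H k ?r")
 proof (rule Sw_eqI)
  fix c d assume [simp]: "c .: H" "d .: H"
  show "?l c d = ?r c d"
  proof -
   have "?l c d = D H h (%a b. D H d (%u v. D H a (%a' x. S (a' .* c) .* x .* u .* S v .* S b)))"
    by (rule Sw_eqI, rule Sw_swap) simp_all
   also have "... = ?r c d" by (rule Sw_swap) simp_all
   finally show ?thesis .
  qed
 qed
 also have "... = D H k (%c d. D H c (%c' u. D H h (%a b. D H a (%a' x. S (a' .* c') .* x .* u .* S d .* S b))))"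
  by (rule coassoc[symmetric]) simp_all
 also have "... = D H k (%c d. D H h (%a b. es (a .* c) .* S d .* S b))" (is "D H k ?l = D H k ?r")
 proof (rule Sw_eqI)
  fix c d assume [simp]: "c .: H" "d .: H"
  show "?l c d = ?r c d"
  proof -
   have "?l c d = D H h (%a b. D H c (%c' u. D H a (%a' x. S (a' .* c') .* x .* u .* S d .* S b)))"
    by (rule Sw_swap) simp_all
   also have "... = D H h (%a b. D H a (%a' x. D H c (%c' u. S (a' .* c') .* x .* u .* S d .* S b)))"
    by (rule Sw_eqI, rule Sw_swap) simp_all
   also have "... = D H h (%a b. D H (a .* c) (%a' x. S a' .* x .* S d .* S b))"
    by (simp add: D_mult)
   also have "... = ?r c d"
   proof -
    have "D H g (%a' x. S a' .* x .* w) = es g .* w" if "g .: H" "w .: H" for g w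
     using D_antipode(1)[of g H "%x. x .* w"] that by simp
    then show ?thesis by simp
   qed
   finally show ?thesis .
  qed
 qed
 also have "... = D H k (%c d. D H h (%a b. D H c (%u v. S u .* es a .* v .* S d .* S b)))"
  by (simp add: eps_mult_conj)
 also have "... = D H h (%a b. D H k (%c d. D H c (%u v. S u .* es a .* v .* S d .* S b)))"
  by (rule Sw_swap) simp_all
 also have "... = D H h (%a b. D H k (%u w. D H w (%v d. S u .* es a .* v .* S d .* S b)))"
  by (simp add: coassoc)
 also have "... = D H h (%a b. D H k (%u w. S u .* es a .* et w .* S b))"
 proof -
  have "D H w (%v d. S u .* es a .* v .* S d .* S b) = S u .* es a .* et w .* S b"
   if "u .: H" "a .: H" "w .: H" "b .: H" for u a w b
   using D_antipode(2)[of w H "%x. S u .* es a .* x .* S b"] that by simp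
  then show ?thesis by simp
 qed
 \<comment> \<open>The commutation of H_t and H_s separates the legs of k from those of h.\<close>
 also have "... = D H h (%a b. D H k (%u w. S u .* et w .* es a .* S b))"
 proof -
  have "es a .* et w .* S b = et w .* es a .* S b" if "a .: H" "w .: H" "b .: H" for a w b
   using eps_commute[of w a] that by (simp flip: hm_assoc)
  then show ?thesis by simp
 qed
 also have "... = D H h (%a b. S k .* es a .* S b)"
 proof -
  have "D H k (%u w. S u .* et w .* x) = S k .* x" if "x .: H" for x
   using D_antipode_eps(2)[of k H "%y. y .* x"] that by simp
  then show ?thesis by simp
 qed
 also have "... = S k .* S h"
  using D_antipode_eps(1)[of h H "%y. S k .* y"] by simp
 finally show ?thesis .
qed

text \<open>Replacing the legs by \<open>etb\<close> and \<open>esb\<close>, on which S gives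
  \<open>es\<close> and \<open>et\<close>, expands the left side into three copies of \<Delta>(1).
  The counit axiom contracts the copy in the middle, and what is left is 1_1 \<otimes>
  \<open>et\<close>(1_2) = \<Delta>(1).\<close>

lemma D_one_antipode:
 assumes P: "module R P" and f: "bilin H H P f"
 shows "D P uH (%u v. f (S v) (S u)) = D P uH f"
proof -
 note [simp] = P bilin_simps[OF f H_module H_module P]
 have "D P uH (%u v. f (S v) (S u)) = D P uH (%u v. f (S (etb v)) (S u))"
  using D_one_eps(4)[OF P, of "%u v. f (S v) (S u)"] by simp
 also have "... = D P uH (%u v. f (S (etb v)) (S (esb u)))"
  using D_one_eps(3)[OF P, of "%u v. f (S (etb v)) (S u)"] by simp
 also have "... = D P uH (%u v. D P uH (%x y. D P uH (%a b. eH (a .* u) *[P] (eH (v .* y) *[P] f x b))))"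
 proof -
  have "f (S (etb v)) (S (esb u)) = D P uH (%x y. D P uH (%a b. eH (a .* u) *[P] (eH (v .* y) *[P] f x b)))"
   if [simp]: "u .: H" "v .: H" for u v
  proof -
   have "f (S (etb v)) (S (esb u)) = D P uH (%x y. eH (v .* y) *[P] f x (et u))"
    by (simp add: eps_D(2)[of v])
   then show ?thesis
    by (simp add: eps_D(1)[of u] smult_left_commute[of P "eH (v .* _)" "eH (_ .* u)"])
  qed
  then show ?thesis by simp
 qed
 also have "... = D P uH (%x y. D P uH (%u v. D P uH (%a b. eH (a .* u) *[P] (eH (v .* y) *[P] f x b))))"
  by (rule Sw_swap) simp_all
 also have "... = D P uH (%x y. D P uH (%a b. D P uH (%u v. eH (a .* u) *[P] (eH (v .* y) *[P] f x b))))"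
  by (rule Sw_eqI, rule Sw_swap) simp_all
 also have "... = D P uH (%x y. f x (et y))" by (simp add: counit_mult eps_D)
 also have "... = D P uH f" by (rule D_one_eps(1)[OF P f])
 finally show ?thesis .
qed

text \<open>\<open>\<Delta>(\<epsilon>\<^sub>s(h))\<close> is the convolution of \<open>h \<mapsto> S(h\<^sub>2) \<otimes> S(h\<^sub>1)\<close> and \<open>\<Delta>\<close>.\<close>

lemma D_eps_s_convolution:
 assumes h: "h .: H" and P: "module R P" and g: "bilin H H P g"
 shows "D P h (%p q. D P p (%p1 p2. D P q (%q1 q2. g (S p2 .* q1) (S p1 .* q2)))) = D P (es h) g"
proof -
 note [simp] = h P bilin_simps[OF g H_module H_module P]
 have "D P h (%p q. D P p (%p1 p2. D P q (%q1 q2. g (S p2 .* q1) (S p1 .* q2))))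
   = D P h (%a r. D P r (%s t. D P s (%s1 s2. g (S s1 .* s2) (S a .* t))))"
  by (simp add: coassoc)
 also have "... = D P h (%a r. D P r (%s t. g (es s) (S a .* t)))"
  by (simp add: D_antipode(1)[of _ P "%x. g x (S _ .* _)"])
 also have "... = D P h (%a r. D P uH (%u v. g u (S a .* r .* v)))"
 proof -
  have "D P r (%s t. g (es s) (S a .* t)) = D P uH (%u v. g u (S a .* r .* v))"
   if "a .: H" "r .: H" for a r
   using D_eps(2)[of r P "%s t. g s (S a .* t)"] that by simp
  then show ?thesis by simp
 qed
 also have "... = D P uH (%u v. D P h (%a r. g u (S a .* r .* v)))"
  by (rule Sw_swap) simp_all
 also have "... = D P uH (%u v. g u (es h .* v))"
 proof -
  have "D P h (%a r. g u (S a .* r .* v)) = g u (es h .* v)" if "u .: H" "v .: H" for u v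
   using D_antipode(1)[of h P "%x. g u (x .* v)"] that by simp
  then show ?thesis by simp
 qed
 also have "... = D P (es h) g" using D_Hs(2)[of "es h" P g] g by simp
 finally show ?thesis .
qed

text \<open>Both \<Delta>(S(h)) and S(h2) \<otimes> S(h1) behave as convolution inverses of
  \<Delta>. In \<Delta>(\<open>es\<close>(h1)) \<Delta>(S(h2)) the first factor is replaced by the
  convolution above, after which \<Delta> and \<Delta> composed with S contract to \<Delta> of an
  element of H_t.\<close>

lemma D_antipode_arg:
 assumes h: "h .: H" and P: "module R P" and f: "bilin H H P f"
 shows "D P (S h) f = D P h (%a b. f (S b) (S a))"
proof -
 note [simp] = h P bilin_simps[OF f H_module H_module P]
 have fD: "(%x. D P x f) \<in> lin H P" using f by simp
 have "D P (S h) f = D P h (%a b. D P (es a .* S b) f)"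
  using D_antipode_eps(1)[OF h P fD] by simp
 also have "... = D P h (%a b. D P (es a) (%x y. D P (S b) (%c d. f (x .* c) (y .* d))))"
  by (simp add: D_mult)
 also have "... = D P h (%a b. D P a (%p q. D P p (%p1 p2. D P q (%q1 q2.
   D P (S b) (%c d. f (S p2 .* q1 .* c) (S p1 .* q2 .* d))))))"
  by (simp add: D_eps_s_convolution[symmetric])
 also have "... = D P h (%p b'. D P b' (%q b. D P p (%p1 p2. D P q (%q1 q2.
   D P (S b) (%c d. f (S p2 .* q1 .* c) (S p1 .* q2 .* d))))))"
  by (rule coassoc) simp_all
 also have "... = D P h (%p b'. D P p (%p1 p2. D P b' (%q b. D P q (%q1 q2.
   D P (S b) (%c d. f (S p2 .* q1 .* c) (S p1 .* q2 .* d))))))"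
  by (rule Sw_eqI, rule Sw_swap) simp_all
 also have "... = D P h (%p b'. D P p (%p1 p2. D P (et b') (%x y. f (S p2 .* x) (S p1 .* y))))"
 proof -
  have "D P b' (%q b. D P q (%q1 q2. D P (S b) (%c d. f (S p2 .* q1 .* c) (S p1 .* q2 .* d))))
    = D P (et b') (%x y. f (S p2 .* x) (S p1 .* y))"
   if [simp]: "b' .: H" "p1 .: H" "p2 .: H" for b' p1 p2
   using D_antipode(2)[of b' P "%z. D P z (%x y. f (S p2 .* x) (S p1 .* y))"] by (simp add: D_mult)
  then show ?thesis by simp
 qed
 also have "... = D P h (%p b'. D P p (%p1 p2. D P uH (%u v. f (S p2 .* et b' .* u) (S p1 .* v))))"
  by (simp add: D_Ht(1)[of "et _"])
 also have "... = D P h (%p1 r. D P r (%p2 b'. D P uH (%u v. f (S p2 .* et b' .* u) (S p1 .* v))))"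
  by (rule coassoc) simp_all
 also have "... = D P h (%p1 r. D P uH (%u v. f (S r .* u) (S p1 .* v)))"
 proof -
  have "D P r (%p2 b'. D P uH (%u v. f (S p2 .* et b' .* u) (S p1 .* v)))
    = D P uH (%u v. f (S r .* u) (S p1 .* v))" if [simp]: "r .: H" "p1 .: H" for r p1
   using D_antipode_eps(2)[of r P "%z. D P uH (%u v. f (z .* u) (S p1 .* v))"] by simp
  then show ?thesis by simp
 qed
 also have "... = D P uH (%u v. D P h (%p1 r. f (S r .* u) (S p1 .* v)))"
  by (rule Sw_swap) simp_all
 \<comment> \<open>The leftover \<Delta>(1) stands to the right of S(r) \<otimes> S(p1). Written as
   S(1_2) \<otimes> S(1_1), it moves inside the antipode to the left of \<Delta>(h), where it is
   absorbed.\<close>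
 also have "... = D P uH (%u v. D P h (%p1 r. f (S (v .* r)) (S (u .* p1))))"
  using D_one_antipode[OF P, of "%u v. D P h (%p1 r. f (S r .* u) (S p1 .* v))"] by simp
 also have "... = D P h (%a b. f (S b) (S a))"
  using D_one(1)[of h P "%a b. f (S b) (S a)"] by simp
 finally show ?thesis .
qed

text \<open>In \<epsilon>(S(h)) = \<epsilon>(\<open>es\<close>(h1) S(h2)) the projection may be
  dropped under the counit, which leaves \<epsilon>(\<open>et h\<close>) = \<epsilon>(h).\<close>

lemma counit_antipode [simp]:
 assumes h: "h .: H" and P: "module R P" "p .: P"
 shows "eH (S h) *[P] p = eH h *[P] p"
proof -
 note [simp] = h P
 have "eH (S h) *[P] p = D P h (%a b. eH (es a .* S b) *[P] p)"
  using D_antipode_eps(1)[of h P "%x. eH x *[P] p"] by simp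
 also have "... = D P h (%a b. eH (a .* S b) *[P] p)" by (simp add: counit_eps)
 also have "... = eH (et h) *[P] p"
  using D_antipode(2)[of h P "%x. eH x *[P] p"] by simp
 also have "... = eH h *[P] p" using counit_eps(1)[of h uH P p] by simp
 finally show ?thesis .
qed

subsection \<open>The inverse of the antipode\<close>

abbreviation T where "T \<equiv> antipode_inv H"

lemma antipode_inv_simps [simp]:
 "h .: H ==> T h .: H" "h .: H ==> S (T h) = h" "h .: H ==> T (S h) = h"
proof -
 have im: "S ` carrier H = carrier H" and inj: "inj_on S (carrier H)"
  using antipode_bij by (auto simp: bij_betw_def)
 show "h .: H ==> T h .: H" "h .: H ==> S (T h) = h"
  using inv_into_into[of h S "carrier H"] f_inv_into_f[of h S "carrier H"] im
  by (simp_all add: antipode_inv_def)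
 show "h .: H ==> T (S h) = h"
  using inv_into_f_f[OF inj] by (simp add: antipode_inv_def)
qed

lemma antipode_inj: "a .: H ==> b .: H ==> S a = S b ==> a = b"
 by (metis antipode_inv_simps(3))

lemma antipode_inv_lin: "T \<in> lin H H"
proof (rule linI)
 fix x y assume "x .: H" "y .: H"
 then show "T (x +[H] y) = T x +[H] T y"
  by - (rule antipode_inj, simp_all add: lin_add[OF antipode_lin])
next
 fix r x assume "r .: R" "x .: H"
 then show "T (r *[H] x) = r *[H] T x" by - (rule antipode_inj, simp_all)
qed simp

lemmas antipode_inv_lins [simp] = lin_simps(2-4)[OF antipode_inv_lin H_module H_module]

lemma antipode_inv_mult [simp]:
 "h .: H ==> k .: H ==> T (h .* k) = T k .* T h" "T uH = uH"
 by (rule antipode_inj; simp)+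

lemma antipode_inv_eps [simp]:
 "h .: H ==> T (et h) = esb h" "h .: H ==> T (es h) = etb h"
 by (rule antipode_inj; simp)+

lemma D_antipode_inv_arg:
 assumes h: "h .: H" and P: "module R P" and f: "bilin H H P f"
 shows "D P (T h) f = D P h (%a b. f (T b) (T a))"
proof -
 note [simp] = h P bilin_simps[OF f H_module H_module P]
 show ?thesis using D_antipode_arg[of "T h" P "%a b. f (T b) (T a)"] by simp
qed

lemma counit_antipode_inv [simp]:
 "h .: H ==> module R P ==> p .: P ==> eH (T h) *[P] p = eH h *[P] p"
 using counit_antipode[of "T h" P p] by simp

text \<open>Applying T = S^-1 to the antipode axioms reverses the products and turns
  \<open>et\<close>, \<open>es\<close> into \<open>esb\<close>, \<open>etb\<close>. These are the
  contractions that make the inverse of the braiding work.\<close>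

lemma D_antipode_inv:
 assumes h: "h .: H" and P: "module R P" and f: "f \<in> lin H P"
 shows "D P h (%a b. f (b .* T a)) = f (esb h)" "D P h (%a b. f (T b .* a)) = f (etb h)"
proof -
 note [simp] = h P f lin_simps[OF f H_module P]
 show "D P h (%a b. f (b .* T a)) = f (esb h)"
  using D_antipode(2)[of h P "%x. f (T x)"] by simp
 show "D P h (%a b. f (T b .* a)) = f (etb h)"
  using D_antipode(1)[of h P "%x. f (T x)"] by simp
qed

text \<open>Both sides equal S(h2) S(S(h1)), the left by anti-multiplicativity and the right by
  anti-comultiplicativity. It gives the compatibility of S with the actions on the unit
  objects.\<close>

lemma antipode_eps_s:
 assumes h: "h .: H" shows "S (es h) = et (S h)"
 using D_antipode(1)[of h H S] D_antipode(2)[of "S h" H "%x. x"] D_antipode_arg[of h H "%a b. a .* S b"] h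
 by simp

end

context tensor_universe
begin

text \<open>\<open>X\<close> is described by its fields rather than as a specific record, so that
  the lemma covers plain submodules as well as objects that carry an action and a coaction on the
  same submodule.\<close>

lemma submodule_retract:
 assumes V: "module R V" and p: "p \<in> lin V V" and pp: "!!v. v .: V ==> p (p v) = p v"
  and X: "carrier X = p ` carrier V" "zero X = zero V"
   "add X = restrict2 (p ` carrier V) (p ` carrier V) (add V)"
   "smult X = restrict2 (carrier R) (p ` carrier V) (smult V)"
 shows "retract p X V"
proof -
 let ?A = "p ` carrier V"
 have iff: "v \<in> ?A \<longleftrightarrow> v .: V \<and> p v = v" for v
  by (rule iffI, erule imageE, simp add: pp lin_closed[OF p], erule conjE, rule image_eqI[of _ _ v]) simp_all
 have ops: "x +[X] y = x +[V] y" "x +[V] y \<in> ?A" if "x \<in> ?A" "y \<in> ?A" for x y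
  using that V lin_add[OF p] by (simp_all add: X restrict2_def iff)
 have sm: "r *[X] x = r *[V] x" "r *[V] x \<in> ?A" if "r .: R" "x \<in> ?A" for r x
  using that V lin_smult[OF p] by (simp_all add: X restrict2_def iff)
 have z: "\<zero>\<^bsub>V\<^esub> \<in> ?A" using lin_zero[OF V V p] V by (simp add: iff)
 have c: "x \<in> ?A ==> x .: V" for x by (simp add: iff)
 note add = module_add_facts[OF V] and smu = module_smult_facts[OF V]
 have mX: "module R X"
 proof (intro moduleI abelian_groupI is_cring; (unfold X(1,2))?)
  fix x assume x: "x \<in> ?A"
  have "(\<ominus> \<one> *[V] x) +[V] x = (\<ominus> \<one> \<oplus> \<one>) *[V] x" using x by (simp add: smu(2,4) c)
  also have "... = \<zero>\<^bsub>V\<^esub>" using c[OF x] by (simp only: l_neg one_closed module_zero[OF V])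
  finally show "\<exists>y\<in>?A. y +[X] x = \<zero>\<^bsub>V\<^esub>"
   using x by (intro bexI[of _ "\<ominus> \<one> *[V] x"]) (simp_all add: ops sm)
 next
  fix x y assume "x \<in> ?A" "y \<in> ?A"
  then show "x +[X] y = y +[X] x" by (simp add: ops c add(2))
 qed (simp_all add: ops sm z c add(1,3,4) smu)
 have "p \<in> lin V X"
  by (rule linI) (simp_all add: X(1) ops sm lin_add[OF p] lin_smult[OF p])
 moreover have "(%x. x) \<in> lin X V" by (rule linI) (simp_all add: X(1) ops sm c)
 ultimately show ?thesis using mX V by (simp add: retract_def X(1) iff)
qed

end

section \<open>Moving elements of H_s and H_t through \<Delta>(1)\<close>

context weak_hopf_bij
begin

text \<open>Applied to M \<otimes>_t N, this moves an element y of H_s from the left factor to the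
  right one as \<open>et y\<close>, which is S(y). It is the balancing that makes \<Delta>(1)(M
  \<otimes> N) a tensor product over the base, and it drives the right unit and triangle
  arguments.\<close>

lemma D_one_Hs:
 assumes y: "y \<in> Hs" and P: "module R P" and f: "bilin H H P f"
 shows "D P uH (%u v. f (u .* y) v) = D P uH (%u v. f u (v .* et y))"
proof -
 note [simp] = P bilin_simps[OF f H_module H_module P]
 have [simp]: "y .: H" using y by simp
 have "D P uH (%u v. f (u .* y) v) = D P y (%a b. f a (et b))" by (simp add: D_eps(1))
 also have "... = D P uH (%u v. f u (et (v .* y)))" by (simp add: D_Hs(1)[OF y])
 also have "... = D P uH (%u v. f u (et (et v .* y)))"
  using D_one_eps(1)[OF P, of "%u v. f u (et (v .* y))"] by simp
 also have "... = D P uH (%u v. f u (et v .* et y))"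
 proof -
  have "et (et v .* y) = et v .* et y" if "v .: H" for v
   using eps_absorb(1)[of y "et v"] Ht_mult[of "et v" "et y"] that by (simp del: eps_absorb)
  then show ?thesis by simp
 qed
 also have "... = D P uH (%u v. f u (v .* et y))"
  using D_one_eps(1)[OF P, of "%u v. f u (v .* et y)"] by simp
 finally show ?thesis .
qed

text \<open>Both sides come from \<Delta>(z), read once through \<open>esb\<close> and once through
  the H_t formula. It is the counterpart of the preceding rule for the left unit constraint.\<close>

lemma D_one_Ht:
 assumes z: "z \<in> Ht" and P: "module R P" and f: "bilin H H P f"
 shows "D P uH (%u v. f (et u) (v .* z)) = D P uH (%u v. f (et (u .* z)) v)"
proof -
 note [simp] = P bilin_simps[OF f H_module H_module P]
 have [simp]: "z .: H" using z by simp
 have "D P uH (%u v. f (et u) (v .* z)) = D P z (%a b. f (et (esb a)) b)"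
  by (rule D_eps(3)[symmetric]) simp_all
 also have "... = D P z (%a b. f (et a) b)" by simp
 also have "... = D P uH (%u v. f (et (u .* z)) v)" by (rule D_Ht(2)[OF z]) simp_all
 finally show ?thesis .
qed

lemma D_eps_mult:
 assumes h: "h .: H" and P: "module R P" and k: "k \<in> lin H P"
 shows "D P h (%a b. k (et a .* b)) = k h" "D P h (%a b. k (esb b .* a)) = k h"
proof -
 note [simp] = h P k lin_simps[OF k H_module P]
 have "D P h (%a b. k (et a .* b)) = D P h (%a b. D P uH (%u v. eH (u .* a) *[P] k (v .* b)))"
  by (simp add: eps_D(1))
 also have "... = D P uH (%u v. D P h (%a b. eH (u .* a) *[P] k (v .* b)))" by (rule Sw_swap) simp_all
 also have "... = k h"
  using D_one(1)[of h P "%a b. eH a *[P] k b"] D_counit(1)[OF h P k] by simp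
 finally show "D P h (%a b. k (et a .* b)) = k h" .
 have "D P h (%a b. k (esb b .* a)) = D P h (%a b. D P uH (%u v. eH (v .* b) *[P] k (u .* a)))"
  by (simp add: eps_D(3))
 also have "... = D P uH (%u v. D P h (%a b. eH (v .* b) *[P] k (u .* a)))" by (rule Sw_swap) simp_all
 also have "... = k h"
  using D_one(1)[of h P "%a b. eH b *[P] k a"] D_counit(2)[OF h P k] by simp
 finally show "D P h (%a b. k (esb b .* a)) = k h" .
qed

text \<open>For k the identity this reads \<open>et\<close>(h1 z) h2 = hz, which is exactly the
  H-linearity of the left unit constraint; it is also the key to the Yetter-Drinfeld condition on
  the unit object.\<close>

lemma D_eps_t_mult:
 assumes h: "h .: H" and z: "z \<in> Ht" and P: "module R P" and k: "k \<in> lin H P"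
 shows "D P h (%a b. k (et (a .* z) .* b)) = k (h .* z)"
proof -
 note [simp] = h P k lin_simps[OF k H_module P]
 have [simp]: "z .: H" using z by simp
 have "k (h .* z) = D P (h .* z) (%a b. k (et a .* b))" by (rule D_eps_mult(1)[symmetric]) simp_all
 also have "... = D P h (%a b. D P uH (%u v. k (et (a .* u .* z) .* b .* v)))"
  by (simp add: D_mult D_Ht(2)[OF z])
 also have "... = D P h (%a b. k (et (a .* z) .* b))"
  using D_one(2)[of h P "%a b. k (et (a .* z) .* b)"] by simp
 finally show ?thesis ..
qed

section \<open>Modules over a weak Hopf algebra\<close>

lemma lin_eqI:
 assumes "g \<in> lin B P" "!!b. b .: B ==> f b = g b" "module R B"
 shows "f \<in> lin B P"
 by (rule linI) (use assms in \<open>simp_all add: lin_closed lin_add lin_smult\<close>)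

subsection \<open>Not necessarily unital actions and their unital parts\<close>

text \<open>Unitality is left out on purpose. The diagonal action on the full tensor product and the
  action \<open>et\<close>(hz) on all of H are associative, but 1 acts as a projection; M
  \<otimes>_t N and H_t are the images of these projections.\<close>

definition lact :: "('k, 'u, 'a) module_scheme => ('u => 'u => 'u) => bool" where
 "lact V \<alpha> \<longleftrightarrow> module R V \<and> bilin H V V \<alpha> \<and>
  (\<forall>g\<in>carrier H. \<forall>h\<in>carrier H. \<forall>v\<in>carrier V. \<alpha> g (\<alpha> h v) = \<alpha> (g .* h) v)"

lemma lactD:
 assumes "lact V \<alpha>"
 shows "module R V" "bilin H V V \<alpha>"
  "!!g h v. g .: H ==> h .: H ==> v .: V ==> \<alpha> g (\<alpha> h v) = \<alpha> (g .* h) v"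
 using assms by (simp_all add: lact_def)

lemma lact_simps:
 assumes "lact V \<alpha>"
 shows "module R V"
  "!!g h v. g .: H ==> h .: H ==> v .: V ==> \<alpha> g (\<alpha> h v) = \<alpha> (g .* h) v"
  "!!h v. h .: H ==> v .: V ==> \<alpha> h v .: V"
  "!!g A b. g \<in> lin A H ==> b .: V ==> (%x. \<alpha> (g x) b) \<in> lin A V"
  "!!g A a. g \<in> lin A V ==> a .: H ==> (%x. \<alpha> a (g x)) \<in> lin A V"
  "!!A B (x :: 'u) G b. module R A ==> module R B ==> \<forall>c\<in>carrier A. \<forall>d\<in>carrier B. G c d .: H
   ==> b .: V ==> \<alpha> (Sw A B H x G) b = Sw A B V x (%c d. \<alpha> (G c d) b)"
  "!!A B (x :: 'u) G a. module R A ==> module R B ==> \<forall>c\<in>carrier A. \<forall>d\<in>carrier B. G c d .: V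
   ==> a .: H ==> \<alpha> a (Sw A B V x G) = Sw A B V x (%c d. \<alpha> a (G c d))"
  "!!r a b. r .: R ==> a .: H ==> b .: V ==> \<alpha> a (r *[V] b) = r *[V] \<alpha> a b"
 using lactD[OF assms] bilin_simps[OF lactD(2)[OF assms] H_module lactD(1)[OF assms] lactD(1)[OF assms]]
 by (simp_all only:)

lemma lact_H: "lact H (mult H)"
 using hm_bilin by (simp add: lact_def)

lemma left_module_lact: "left_module R H M ==> lact M (act M)"
 by (simp add: lact_def left_module_def)

lemma lact_eps_t: "lact H (%h z. et (h .* z))"
 by (simp add: lact_def)

lemma left_diag_eq:
 assumes "module R A" "module R B" "u .: (H ** H)" "x .: (A ** B)"
 shows "left_diag R A \<alpha> B \<beta> u x = Sw H H (A ** B) u (%g h. Sw A B (A ** B) x (%a b. pt A B (\<alpha> g a) (\<beta> h b)))"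
 unfolding left_diag_def sweedler_Sw[OF assms(1,2,4)] sweedler_Sw[OF H_module H_module assms(3)] ..

abbreviation ldiag where "ldiag A \<alpha> B \<beta> h x \<equiv> left_diag R A \<alpha> B \<beta> (comult H h) x"

lemma ldiag_eq:
 assumes "module R A" "module R B" "h .: H" "x .: (A ** B)"
 shows "ldiag A \<alpha> B \<beta> h x = D (A ** B) h (%g h. Sw A B (A ** B) x (%a b. pt A B (\<alpha> g a) (\<beta> h b)))"
 using left_diag_eq[OF assms(1,2) _ assms(4)] assms(3) by simp

lemma Sw_ldiag:
 assumes A: "lact A \<alpha>" and B: "lact B \<beta>" and P: "module R P" and f: "bilin A B P f"
  and "h .: H" "x .: (A ** B)"
 shows "Sw A B P (ldiag A \<alpha> B \<beta> h x) f = D P h (%c d. Sw A B P x (%a b. f (\<alpha> c a) (\<beta> d b)))"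
 using assms lact_simps[OF A] lact_simps[OF B] bilin_simps[OF f]
 by (simp add: ldiag_eq lact_simps[OF A] lact_simps[OF B])

lemma ldiag_closed:
 assumes "lact A \<alpha>" "lact B \<beta>" "h .: H" "x .: (A ** B)"
 shows "ldiag A \<alpha> B \<beta> h x .: (A ** B)"
 using assms(3,4) by (simp add: ldiag_eq lact_simps[OF assms(1)] lact_simps[OF assms(2)])

lemma lact_ldiag:
 assumes A: "lact A \<alpha>" and B: "lact B \<beta>" shows "lact (A ** B) (ldiag A \<alpha> B \<beta>)"
proof -
 note [simp] = lact_simps[OF A] lact_simps[OF B]
 let ?d = "%h x. D (A ** B) h (%g h. Sw A B (A ** B) x (%a b. pt A B (\<alpha> g a) (\<beta> h b)))"
 have b: "bilin H (A ** B) (A ** B) (ldiag A \<alpha> B \<beta>)"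
 proof (intro conjI ballI)
  fix h assume [simp]: "h .: H"
  show "(%x. ldiag A \<alpha> B \<beta> h x) \<in> lin (A ** B) (A ** B)"
   by (rule lin_eqI[of "%x. ?d h x"]) (simp_all add: ldiag_eq)
 next
  fix x :: 'u assume [simp]: "x .: (A ** B)"
  show "(%h. ldiag A \<alpha> B \<beta> h x) \<in> lin H (A ** B)"
   by (rule lin_eqI[of "%h. ?d h x"]) (simp_all add: ldiag_eq del: comult_simps(3))
 qed
 have "ldiag A \<alpha> B \<beta> g (ldiag A \<alpha> B \<beta> h x) = ldiag A \<alpha> B \<beta> (g .* h) x"
  if [simp]: "g .: H" "h .: H" "x .: (A ** B)" for g h x
  by (simp add: ldiag_eq D_mult)
 then show ?thesis using b by (simp add: lact_def)
qed

lemma tensor_t_eq: "tensor_t R H A \<alpha> B \<beta> = ldiag A \<alpha> B \<beta> uH ` carrier (A ** B)"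
 by (simp add: tensor_t_def)

lemma lact_image_iff:
 assumes "lact V \<alpha>" shows "v \<in> \<alpha> uH ` carrier V \<longleftrightarrow> v .: V \<and> \<alpha> uH v = v"
 by (rule iffI, erule imageE, simp add: lact_simps[OF assms], erule conjE, rule image_eqI[of _ _ v])
  (simp_all add: lact_simps[OF assms])

lemma tensor_t_iff:
 assumes "lact A \<alpha>" "lact B \<beta>"
 shows "x \<in> tensor_t R H A \<alpha> B \<beta> \<longleftrightarrow> x .: (A ** B) \<and> ldiag A \<alpha> B \<beta> uH x = x"
 unfolding tensor_t_eq by (rule lact_image_iff[OF lact_ldiag[OF assms]])

lemma left_object_simps [simp]:
 "carrier (left_object R H V A \<alpha> \<rho>) = A" "zero (left_object R H V A \<alpha> \<rho>) = zero V"
 "add (left_object R H V A \<alpha> \<rho>) = restrict2 A A (add V)"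
 "smult (left_object R H V A \<alpha> \<rho>) = restrict2 (carrier R) A (smult V)"
 "mult (left_object R H V A \<alpha> \<rho>) = (%_ _. undefined)" "one (left_object R H V A \<alpha> \<rho>) = undefined"
 "act (left_object R H V A \<alpha> \<rho>) = restrict2 (carrier H) A \<alpha>"
 "coact (left_object R H V A \<alpha> \<rho>) = restrict \<rho> A"
 by (simp_all add: left_object_def module.extend_def submod_def)

lemma submod_simps [simp]:
 "carrier (submod R V A) = A" "zero (submod R V A) = zero V" "add (submod R V A) = restrict2 A A (add V)"
 "smult (submod R V A) = restrict2 (carrier R) A (smult V)"
 by (simp_all add: submod_def)

lemma mod_eq_left_object: "mod_eq (left_object R H V A \<alpha> \<rho>) (submod R V A)"
 by (simp add: mod_eq_def)

lemma restrict2_simps [simp]: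
 "x \<in> A ==> y \<in> B ==> restrict2 A B f x y = f x y" "restrict2 A B (restrict2 A B f) = restrict2 A B f"
 by (simp_all add: restrict2_def fun_eq_iff)

lemma lact_submod_retract:
 assumes "lact V \<alpha>" shows "retract (\<alpha> uH) (submod R V (\<alpha> uH ` carrier V)) V"
  "retract (\<alpha> uH) (left_object R H V (\<alpha> uH ` carrier V) \<alpha> \<rho>) V"
 using lact_simps[OF assms] lact_simps(5)[OF assms, of "%x. x" V uH]
 by (intro submodule_retract; simp)+

lemma left_module_left_object:
 assumes V: "lact V \<alpha>" and A: "A = \<alpha> uH ` carrier V"
 shows "left_module R H (left_object R H V A \<alpha> \<rho>)"
proof -
 let ?X = "left_object R H V A \<alpha> \<rho>"
 note [simp] = lact_simps[OF V]
 have iff: "v \<in> A \<longleftrightarrow> v .: V \<and> \<alpha> uH v = v" for v unfolding A by (rule lact_image_iff[OF V])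
 have r: "retract (\<alpha> uH) ?X V" unfolding A by (rule lact_submod_retract(2)[OF V])
 have lX: "f \<in> lin B ?X" if f: "f \<in> lin B V" and i: "!!b. b .: B ==> f b \<in> A" for f and B :: "('k, 'u, 'c) module_scheme"
  by (rule linI) (use i lin_add[OF f] lin_smult[OF f] in simp_all)
 have inA: "h .: H ==> v \<in> A ==> \<alpha> h v \<in> A" for h v by (simp add: iff)
 show ?thesis
  unfolding left_module_def extensional_module_def
 proof (intro conjI ballI)
  show "module R ?X" using r by (rule retractD)
  fix h assume h: "h .: H"
  have "\<alpha> h \<in> lin ?X V" using h by (intro lin_retract[OF r]) simp
  then show "act ?X h \<in> lin ?X ?X"
   using inA h retractD(1)[OF r] by (intro lin_eqI[OF lX, of "\<alpha> h"]) simp_all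
 next
  fix m assume m: "m .: ?X"
  then have "(%h. \<alpha> h m) \<in> lin H V" using iff by simp
  then show "(%h. act ?X h m) \<in> lin H ?X"
   using inA m by (intro lin_eqI[OF lX, of "%h. \<alpha> h m"]) simp_all
 qed (use inA in \<open>simp_all add: iff\<close>)
qed

subsection \<open>Comodules\<close>

abbreviation LC where "LC M P m f \<equiv> Sw H M P (coact M m) f"
abbreviation RC where "RC M P m f \<equiv> Sw M H P (coact M m) f"

lemma left_module_simps:
 assumes "left_module R H M"
 shows "module R M" "!!m. m .: M ==> act M uH m = m"
 using assms by (simp_all add: left_module_def)

lemmas left_act_simps = left_module_simps lact_simps(2-8)[OF left_module_lact]

lemma left_comodule_lin: "left_comodule R H M ==> coact M \<in> lin M (H ** M)"
 by (simp add: left_comodule_def)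

lemma left_coact_simps:
 assumes "left_comodule R H M" "module R M"
 shows "coact M \<in> lin M (H ** M)" "!!a. a .: M ==> coact M a .: (H ** M)"
  "!!g A. g \<in> lin A M ==> (%x. coact M (g x)) \<in> lin A (H ** M)"
  "!!r a. r .: R ==> a .: M ==> coact M (r *[M] a) = r *[H ** M] coact M a"
 using left_comodule_lin[OF assms(1)]
  lin_simps(1-3)[OF left_comodule_lin[OF assms(1)] assms(2) tensor_module[OF H_module assms(2)]]
 by (simp_all only:)

lemma LC_coassoc:
 assumes M: "left_comodule R H M" "module R M" and m: "m .: M"
  and P: "module R P" and f: "trilin H H M P f"
 shows "LC M P m (%a x. D P a (%b c. f b c x)) = LC M P m (%a x. LC M P x (%b y. f a b y))"
proof -
 note [simp] = M(2) left_coact_simps[OF M] m P trilin_simps[OF f H_module H_module M(2) P]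
 have co: "sweedler (H ** (H ** M)) (coact M m) (%a x.
     sweedler (H ** (H ** M)) (comult H a) (%b c. pt H (H ** M) b (pt H M c x)))
    = sweedler (H ** (H ** M)) (coact M m) (%a x. pt H (H ** M) a (coact M x))"
  using M(1) m by (simp add: left_comodule_def)
 have conv: "sweedler Q (coact M m) g = LC M Q m g" for Q :: "('k, 'u) module" and g
  by (rule sweedler_Sw) simp_all
 show ?thesis
  using arg_cong[OF co, of "%x. Sw H (H ** M) P x (%a u. Sw H M P u (%b c. f a b c))"]
  by (simp add: comult_sweedler conv)
qed

lemma LC_counit:
 assumes M: "left_comodule R H M" "module R M" and m: "m .: M"
  and P: "module R P" and f: "f \<in> lin M P"
 shows "LC M P m (%a x. eH a *[P] f x) = f m"
proof -
 note [simp] = M(2) left_coact_simps[OF M] m P lin_simps[OF f M(2) P]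
 have "sweedler M (coact M m) (%a x. eH a *[M] x) = m"
  using M(1) m by (simp add: left_comodule_def)
 then have "LC M M m (%a x. eH a *[M] x) = m" by (subst sweedler_Sw[symmetric]) simp_all
 from arg_cong[OF this, of f] show ?thesis by simp
qed

subsection \<open>Left-left Yetter-Drinfeld modules\<close>

lemma yd_LL_D: "yd_LL R H M ==> left_module R H M" "yd_LL R H M ==> left_comodule R H M"
 by (simp_all add: yd_LL_def)

lemma yd_LL_module: "yd_LL R H M ==> module R M"
 using left_module_simps(1)[OF yd_LL_D(1)] .

lemma yd_LL_lact: "yd_LL R H M ==> lact M (act M)"
 by (rule left_module_lact[OF yd_LL_D(1)])

lemma yd_LL_coact:
 assumes "yd_LL R H M"
 shows "coact M \<in> lin M (H ** M)" "!!a. a .: M ==> coact M a .: (H ** M)"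
  "!!g A. g \<in> lin A M ==> (%x. coact M (g x)) \<in> lin A (H ** M)"
  "!!r a. r .: R ==> a .: M ==> coact M (r *[M] a) = r *[H ** M] coact M a"
 using left_coact_simps[OF yd_LL_D(2)[OF assms] yd_LL_module[OF assms]] by (simp_all only:)

lemmas yd_LL_simps = left_act_simps[OF yd_LL_D(1)] yd_LL_coact

text \<open>The range condition on the coaction, expressed as invariance of \<lambda>(m) under
  \<Delta>(1).\<close>

lemma LL_unit:
 assumes M: "yd_LL R H M" and m: "m .: M" and P: "module R P" and f: "bilin H M P f"
 shows "D P uH (%u v. LC M P m (%a x. f (u .* a) (act M v x))) = LC M P m f"
proof -
 note [simp] = yd_LL_simps[OF M] m P bilin_simps[OF f H_module yd_LL_module[OF M] P]
 have "coact M m \<in> tensor_t R H H (mult H) M (act M)" using M m by (simp add: yd_LL_def)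
 then have "ldiag H (mult H) M (act M) uH (coact M m) = coact M m"
  using tensor_t_iff[OF lact_H yd_LL_lact[OF M]] by simp
 from arg_cong[OF this, of "%x. Sw H M P x f"] show ?thesis
  using Sw_ldiag[OF lact_H yd_LL_lact[OF M] P f] by simp
qed

lemma LL_yd:
 assumes M: "yd_LL R H M" and m: "m .: M" and h: "h .: H" and P: "module R P" and f: "bilin H M P f"
 shows "D P h (%u v. LC M P m (%a x. f (u .* a) (act M v x)))
  = D P h (%u v. LC M P (act M u m) (%a x. f (a .* v) x))"
proof -
 note [simp] = yd_LL_simps[OF M] m h P bilin_simps[OF f H_module yd_LL_module[OF M] P]
 have yd: "sweedler (H ** M) (comult H h) (%h\<^sub>1 h\<^sub>2. sweedler (H ** M) (coact M m) (%a m\<^sub>0.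
     pt H M (h\<^sub>1 .* a) (act M h\<^sub>2 m\<^sub>0)))
   = sweedler (H ** M) (comult H h) (%h\<^sub>1 h\<^sub>2. sweedler (H ** M) (coact M (act M h\<^sub>1 m)) (%a m\<^sub>0.
     pt H M (a .* h\<^sub>2) m\<^sub>0))"
  using M m h by (simp only: yd_LL_def)
 have conv: "sweedler Q (coact M m) g = LC M Q m g" if "m .: M" for Q :: "('k, 'u) module" and g m
  by (rule sweedler_Sw) (simp_all add: that)
 from arg_cong[OF yd, of "%x. Sw H M P x f"] show ?thesis using f
  by (simp add: comult_sweedler conv)
qed

lemma LL_unit':
 assumes M: "yd_LL R H M" and m: "m .: M" and P: "module R P" and f: "bilin H M P f"
 shows "D P uH (%u v. LC M P (act M u m) (%a x. f (a .* v) x)) = LC M P m f"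
 using LL_yd[OF M m hone_closed P f] LL_unit[OF M m P f] by simp

text \<open>Insert \<Delta>(1), combine it with y into \<Delta>(y) = 1_1 \<otimes> y1_2, apply the
  compatibility condition at h = y, and split \<Delta>(y) off again as 1_1 \<otimes> 1_2 y. The
  coaction is thus balanced over H_s.\<close>

lemma LL_Hs:
 assumes M: "yd_LL R H M" and m: "m .: M" and y: "y \<in> Hs" and P: "module R P" and f: "bilin H M P f"
 shows "LC M P m (%a x. f (a .* y) x) = LC M P m (%a x. f a (act M y x))"
proof -
 note [simp] = yd_LL_simps[OF M] m P bilin_simps[OF f H_module yd_LL_module[OF M] P]
 have [simp]: "y .: H" using y by simp
 have "LC M P m (%a x. f a (act M y x)) = D P uH (%u v. LC M P m (%a x. f (u .* a) (act M (y .* v) x)))"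
  using LL_unit[OF M m P, of "%a x. f a (act M y x)"] by simp
 also have "... = D P y (%u v. LC M P m (%a x. f (u .* a) (act M v x)))" by (simp add: D_Hs(2)[OF y])
 also have "... = D P y (%u v. LC M P (act M u m) (%a x. f (a .* v) x))" by (rule LL_yd[OF M]) (simp_all add: f)
 also have "... = D P uH (%u v. LC M P (act M u m) (%a x. f (a .* v .* y) x))" by (simp add: D_Hs(1)[OF y])
 also have "... = LC M P m (%a x. f (a .* y) x)"
  using LL_unit'[OF M m P, of "%a x. f (a .* y) x"] by simp
 finally show ?thesis ..
qed

text \<open>The compatibility condition at h = z, with \<Delta>(z) read as 1_1 z \<otimes> 1_2
  before its use and as z1_1 \<otimes> 1_2 after it.\<close>

lemma LL_act_Ht:
 assumes M: "yd_LL R H M" and m: "m .: M" and z: "z \<in> Ht" and P: "module R P" and f: "bilin H M P f"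
 shows "LC M P (act M z m) f = LC M P m (%a x. f (z .* a) x)"
proof -
 note [simp] = yd_LL_simps[OF M] m P bilin_simps[OF f H_module yd_LL_module[OF M] P]
 have [simp]: "z .: H" using z by simp
 have "LC M P (act M z m) f = D P uH (%u v. LC M P (act M (u .* z) m) (%a x. f (a .* v) x))"
  using LL_unit'[OF M _ P f, of "act M z m"] by simp
 also have "... = D P z (%u v. LC M P (act M u m) (%a x. f (a .* v) x))" by (simp add: D_Ht(2)[OF z])
 also have "... = D P z (%u v. LC M P m (%a x. f (u .* a) (act M v x)))"
  by (rule LL_yd[OF M, symmetric]) (simp_all add: f)
 also have "... = D P uH (%u v. LC M P m (%a x. f (z .* u .* a) (act M v x)))" by (simp add: D_Ht(1)[OF z])
 also have "... = LC M P m (%a x. f (z .* a) x)"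
  using LL_unit[OF M m P, of "%a x. f (z .* a) x"] by simp
 finally show ?thesis .
qed

text \<open>In \<Delta>(1) an element y of H_s on the left leg becomes \<open>et y\<close> on the
  right leg, and in the compatibility condition for 1 the right leg multiplies the coaction from the
  right.\<close>

lemma LL_act_Hs:
 assumes M: "yd_LL R H M" and m: "m .: M" and y: "y \<in> Hs" and P: "module R P" and f: "bilin H M P f"
 shows "LC M P (act M y m) f = LC M P m (%a x. f (a .* et y) x)"
proof -
 note [simp] = yd_LL_simps[OF M] m P bilin_simps[OF f H_module yd_LL_module[OF M] P]
 have [simp]: "y .: H" using y by simp
 have "LC M P (act M y m) f = D P uH (%u v. LC M P (act M (u .* y) m) (%a x. f (a .* v) x))"
  using LL_unit'[OF M _ P f, of "act M y m"] by simp
 also have "... = D P uH (%u v. LC M P (act M u m) (%a x. f (a .* v .* et y) x))"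
  by (rule D_one_Hs[OF y]) simp_all
 also have "... = LC M P m (%a x. f (a .* et y) x)"
  using LL_unit'[OF M m P, of "%a x. f (a .* et y) x"] by simp
 finally show ?thesis .
qed

text \<open>Counitality applied to zm, whose coaction is z m_[-1] \<otimes> m_[0]. It recovers the
  action of H_t from the coaction and is what turns counit pairings into \<Delta>(1) in the braiding
  computations.\<close>

lemma LL_counit_Ht:
 assumes M: "yd_LL R H M" and m: "m .: M" and z: "z \<in> Ht" and P: "module R P" and f: "f \<in> lin M P"
 shows "LC M P m (%a x. eH (z .* a) *[P] f x) = f (act M z m)"
proof -
 note [simp] = yd_LL_simps[OF M] m P f lin_simps[OF f yd_LL_module[OF M] P]
 have [simp]: "z .: H" using z by simp
 have "f (act M z m) = LC M P (act M z m) (%a x. eH a *[P] f x)"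
  by (rule LC_counit[OF yd_LL_D(2)[OF M], symmetric]) simp_all
 also have "... = LC M P m (%a x. eH (z .* a) *[P] f x)"
  by (rule LL_act_Ht[OF M m z P]) simp
 finally show ?thesis ..
qed

end

context weak_hopf_bij
begin

lemma left_object_cong:
 "(!!v. v \<in> A ==> \<rho> v = \<rho>' v) ==> left_object R H V A \<alpha> \<rho> = left_object R H V A \<alpha> \<rho>'"
 by (simp add: left_object_def cong: restrict_cong)

text \<open>The conditions are imposed on the ambient module \<open>V\<close>, of which the object is the unital part.\<close>

lemma left_object_yd_LL:
 fixes lam :: "'u => 'u"
 assumes V: "lact V \<alpha>" and A: "A = \<alpha> uH ` carrier V" and lam: "lam \<in> lin V (H ** V)"
  and co: "!!v f (P :: ('k, 'u) module). v \<in> A ==> module R P ==> trilin H H V P f ==>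
   Sw H V P (lam v) (%a w. D P a (%b c. f b c w)) = Sw H V P (lam v) (%a w. Sw H V P (lam w) (%b x. f a b x))"
  and counit: "!!v. v \<in> A ==> Sw H V V (lam v) (%a w. eH a *[V] w) = v"
  and unit: "!!v f (P :: ('k, 'u) module). v \<in> A ==> module R P ==> bilin H V P f ==>
   D P uH (%u w. Sw H V P (lam v) (%a x. f (u .* a) (\<alpha> w x))) = Sw H V P (lam v) f"
  and yd: "!!v h f (P :: ('k, 'u) module). v \<in> A ==> h .: H ==> module R P ==> bilin H V P f ==>
   D P h (%u w. Sw H V P (lam v) (%a x. f (u .* a) (\<alpha> w x)))
    = D P h (%u w. Sw H V P (lam (\<alpha> u v)) (%a x. f (a .* w) x))"
  and X_def: "X = left_object R H V A \<alpha> (%v. corestrict R H (submod R V A) H V (lam v))"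
 shows "yd_LL R H X"
  "v \<in> A ==> module R (P :: ('k, 'p, 'q) module_scheme) ==> bilin H V P f ==>
   Sw H X P (coact X v) f = Sw H V P (lam v) f"
proof -
 note [simp] = lact_simps[OF V] lin_simps[OF lam lact_simps(1)[OF V] tensor_module[OF H_module lact_simps(1)[OF V]]]
 have iff: "v \<in> A \<longleftrightarrow> v .: V \<and> \<alpha> uH v = v" for v unfolding A by (rule lact_image_iff[OF V])
 have A0: "v \<in> A ==> v .: V" "v .: V ==> \<alpha> uH v \<in> A" "h .: H ==> v \<in> A ==> \<alpha> h v \<in> A"
  for v h by (simp_all add: iff)
 \<comment> \<open>Replacing f by f(-, 1 -) does not change the left side of \<open>unit\<close>,
   because 1 acts as the identity on every \<alpha> w x; hence it does not change the right side
   either.\<close>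
 have inv: "Sw H V P (lam v) (%a w. f a (\<alpha> uH w)) = Sw H V P (lam v) f"
  if v [simp]: "v \<in> A" and P: "module R P" and f: "bilin H V P f" for v and P :: "('k, 'u) module" and f
 proof -
  note [simp] = P bilin_simps[OF f H_module lact_simps(1)[OF V] P] A0(1)[OF v]
  show ?thesis using unit[of v P "%a w. f a (\<alpha> uH w)"] unit[of v P f] f by simp
 qed
 have lm: "left_module R H X" unfolding X_def by (rule left_module_left_object[OF V A])
 note [simp] = left_module_simps(1)[OF lm]
 have cX [simp]: "A = carrier X" and coX0: "v \<in> A ==> coact X v = corestrict R H (submod R V A) H V (lam v)"
  and sX: "smult X = restrict2 (carrier R) A (smult V)"
  and aX0: "h .: H ==> v \<in> A ==> act X h v = \<alpha> h v" for v h by (simp_all add: X_def)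
 have [simp]: "v .: X ==> v .: V" "v .: V ==> \<alpha> uH v .: X"
   "h .: H ==> v .: X ==> \<alpha> h v .: X"
   "h .: H ==> v .: X ==> act X h v = \<alpha> h v"
  and coX: "v \<in> A ==> coact X v = corestrict R H (submod R V A) H V (lam v)" for v h
  using A0 aX0 coX0 unfolding cX by blast+
 have idX: "v .: X ==> \<alpha> uH v = v" for v using iff unfolding cX by simp
 have r: "retract (\<alpha> uH) X V" and rs: "retract (\<alpha> uH) (submod R V A) V"
  unfolding X_def A by (rule lact_submod_retract[OF V])+
 have pX [simp]: "\<alpha> uH \<in> lin V X" "!!g B. g \<in> lin B V ==> (%x. \<alpha> uH (g x)) \<in> lin B X"
  using retractD(4)[OF r] lin_compose[OF retractD(4)[OF r]] by auto
 have eq: "mod_eq X (submod R V A)" unfolding X_def by (rule mod_eq_left_object)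
 have eqH: "mod_eq H H" by (simp add: mod_eq_def)
 have fx: "Sw H V (H ** V) (lam v) (%a w. pt H V a (\<alpha> uH w)) = lam v" if that: "v \<in> A" for v
  using A0(1)[OF that] inv[OF that, of "H ** V" "pt H V"] that by simp
 have C: "coact X v = Sw H V (H ** X) (lam v) (%a w. pt H X a (\<alpha> uH w))"
  and K: "module R P ==> bilin H V P f ==> Sw H X P (coact X v) f = Sw H V P (lam v) f"
  if v [simp]: "v \<in> A" for v f and P :: "('k, 'pp, 'qq) module_scheme"
 proof -
  have [simp]: "v .: X" using v by simp
  have l: "lam v .: (H ** V)" by simp
  show "coact X v = Sw H V (H ** X) (lam v) (%a w. pt H X a (\<alpha> uH w))"
   unfolding coX[OF v] mod_eq_tensor[OF eqH eq]
   using corestrict_retract(1)[OF retract_id[OF H_module] rs l] fx[OF v] by simp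
  show "module R P ==> bilin H V P f ==> Sw H X P (coact X v) f = Sw H V P (lam v) f"
   unfolding coX[OF v] mod_eq_Sw[OF eqH eq, of P P, unfolded mod_eq_def, simplified]
   by (rule Sw_corestrict[OF retract_id[OF H_module] rs l]) (use fx[OF v] in simp_all)
 qed
 show "v \<in> A ==> module R P ==> bilin H V P f ==> Sw H X P (coact X v) f = Sw H V P (lam v) f"
  using K[of v P f] by simp
 \<comment> \<open>A map that is bilinear only on the object \<open>X\<close> is extended to
   \<open>V\<close> by precomposing with the projection \<alpha> uH, so that the assumptions on
   \<open>V\<close> can be applied to it.\<close>
 have K0: "Sw H X P (coact X v) f = Sw H V P (lam v) (%a w. f a (\<alpha> uH w))"
  if v: "v .: X" and P: "module R P" and f: "bilin H X P f" for v f and P :: "('k, 'u) module"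
  using v P f bilin_simps[OF f H_module left_module_simps(1)[OF lm] P]
  by (simp add: C bilin_simps[OF f H_module left_module_simps(1)[OF lm] P])
 have lin: "coact X \<in> lin X (H ** X)"
  by (rule lin_eqI[OF lin_retract[OF r], of "%v. Sw H V (H ** X) (lam v) (%a w. pt H X a (\<alpha> uH w))"])
   (simp_all add: C lin_simps[OF lam])
 note [simp] = lin_simps(1-2)[OF lin left_module_simps(1)[OF lm] tensor_module[OF H_module left_module_simps(1)[OF lm]]]
 have conv: "sweedler Q (coact X m) g = LC X Q m g" if "m .: X" for Q :: "('k, 'pp, 'qq) module_scheme" and g m
  by (rule sweedler_Sw) (simp_all add: that)
 have com: "left_comodule R H X"
  unfolding left_comodule_def
 proof (intro conjI ballI lin)
  fix m assume m [simp]: "m .: X"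
  let ?Q = "H ** (H ** X)" and ?f = "%b c x. pt H (H ** X) b (pt H X c x)"
  have "sweedler ?Q (coact X m) (%a x. sweedler ?Q (comult H a) (%b c. ?f b c x))
    = LC X ?Q m (%a x. D ?Q a (%b c. ?f b c x))" by (simp add: conv comult_sweedler)
  also have "... = Sw H V ?Q (lam m) (%a w. D ?Q a (%b c. ?f b c (\<alpha> uH w)))"
   by (rule K0) simp_all
  also have "... = Sw H V ?Q (lam m) (%a w. Sw H V ?Q (lam w) (%b x. ?f a b (\<alpha> uH x)))"
   by (rule co) simp_all
  also have "... = Sw H V ?Q (lam m) (%a w. Sw H V ?Q (lam (\<alpha> uH w)) (%b x. ?f a b (\<alpha> uH x)))"
   by (rule inv[symmetric]) simp_all
  also have "... = Sw H V ?Q (lam m) (%a w. pt H (H ** X) a (coact X (\<alpha> uH w)))"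
   by (simp add: C)
  also have "... = LC X ?Q m (%a x. pt H (H ** X) a (coact X x))"
   by (rule K0[symmetric]) simp_all
  also have "... = sweedler ?Q (coact X m) (%a x. pt H (H ** X) a (coact X x))"
   by (simp add: conv)
  finally show "sweedler ?Q (coact X m) (%a x. sweedler ?Q (comult H a) (%b c. ?f b c x))
    = sweedler ?Q (coact X m) (%a x. pt H (H ** X) a (coact X x))" .
  have "eH a *[X] x \<in> A" if "a .: H" "x \<in> A" for a x
   using module_smult_closed[of X "eH a" x] that by simp
  then have "sweedler X (coact X m) (%a x. eH a *[X] x) = LC X V m (%a x. eH a *[X] x)"
   using Sw_lin[of H X X V "%x. x" "%a x. eH a *[X] x" "coact X m"] retractD(3)[OF r] by (simp add: conv)
  also have "... = LC X V m (%a x. eH a *[V] x)" by (rule Sw_eqI) (simp add: sX)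
  also have "... = m" using K[of m V "%a x. eH a *[V] x"] counit[of m] by simp
  finally show "sweedler X (coact X m) (%a x. eH a *[X] x) = m" .
 qed
 show "yd_LL R H X"
  unfolding yd_LL_def
 proof (intro conjI ballI lm com)
  fix m assume m [simp]: "m .: X"
  have "ldiag H (mult H) X (act X) uH (coact X m) = D (H ** X) uH (%u w. LC X (H ** X) m (%a x. pt H X (u .* a) (act X w x)))"
   by (rule ldiag_eq) simp_all
  also have "... = D (H ** X) uH (%u w. LC X (H ** X) m (%a x. pt H X (u .* a) (\<alpha> uH (\<alpha> w x))))"
   by simp
  also have "... = D (H ** X) uH (%u w. Sw H V (H ** X) (lam m) (%a x. pt H X (u .* a) (\<alpha> uH (\<alpha> w x))))"
   by (rule Sw_eqI, rule K) (simp_all del: lact_simps(2)[OF V])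
  also have "... = Sw H V (H ** X) (lam m) (%a x. pt H X a (\<alpha> uH x))"
   by (rule unit) simp_all
  finally have "ldiag H (mult H) X (act X) uH (coact X m) = coact X m" by (simp add: C)
  then show "coact X m \<in> tensor_t R H H (mult H) X (act X)"
   using tensor_t_iff[OF lact_H left_module_lact[OF lm]] by simp
  fix h assume h [simp]: "h .: H"
  have "sweedler (H ** X) (comult H h) (%u w. sweedler (H ** X) (coact X m) (%a x. pt H X (u .* a) (act X w x)))
    = D (H ** X) h (%u w. LC X (H ** X) m (%a x. pt H X (u .* a) (\<alpha> uH (\<alpha> w x))))"
   by (simp add: conv comult_sweedler)
  also have "... = D (H ** X) h (%u w. Sw H V (H ** X) (lam m) (%a x. pt H X (u .* a) (\<alpha> uH (\<alpha> w x))))"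
   by (rule Sw_eqI, rule K) (simp_all del: lact_simps(2)[OF V])
  also have "... = D (H ** X) h (%u w. Sw H V (H ** X) (lam (\<alpha> u m)) (%a x. pt H X (a .* w) (\<alpha> uH x)))"
   by (rule yd) simp_all
  also have "... = D (H ** X) h (%u w. LC X (H ** X) (\<alpha> u m) (%a x. pt H X (a .* w) (\<alpha> uH x)))"
   by (rule Sw_eqI, rule K[symmetric]) simp_all
  also have "... = sweedler (H ** X) (comult H h) (%u w. sweedler (H ** X) (coact X (act X u m)) (%a x. pt H X (a .* w) x))"
   by (simp add: conv comult_sweedler idX)
  finally show "sweedler (H ** X) (comult H h) (%u w. sweedler (H ** X) (coact X m) (%a x. pt H X (u .* a) (act X w x)))
    = sweedler (H ** X) (comult H h) (%u w. sweedler (H ** X) (coact X (act X u m)) (%a x. pt H X (a .* w) x))" .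
 qed
qed

end

context weak_hopf_bij
begin

subsection \<open>The unit object\<close>

text \<open>The projection on the second leg of \<Delta>(z) is harmless because h1 \<otimes>
  \<open>et\<close>(h2) = 1_1 h \<otimes> 1_2. For the compatibility condition, (hz)1 \<otimes>
  \<open>et\<close>((hz)2) becomes 1_1 hz \<otimes> 1_2, and hz is split as \<open>et\<close>(h1 z)
  h2.\<close>

lemma unit_LL_yd:
 shows "yd_LL R H (unit_LL R H)"
  "z \<in> Ht ==> module R (P :: ('k, 'p, 'q) module_scheme) ==> bilin H H P f ==>
   LC (unit_LL R H) P z f = D P z f"
proof -
 let ?\<alpha> = "%h z. et (h .* z)"
 have A: "Ht = ?\<alpha> uH ` carrier H" 
  unfolding target_def by (rule image_cong) simp_all
 have fx: "D P z (%a w. f a (et w)) = D P z f" if "z \<in> Ht" "module R P" "bilin H H P f" for z P f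
 proof -
  have "D P z (%a w. f a (et w)) = D P uH (%u v. f (u .* z) v)"
   by (rule D_eps(1)) (use that in simp_all)
  also have "... = D P z f" by (rule D_Ht(2)[OF that, symmetric])
  finally show ?thesis .
 qed
 have *: "D P uH (%u w. D P z (%a x. f (u .* a) (et (w .* x)))) = D P z f"
  if z: "z \<in> Ht" and P: "module R P" and f: "bilin H H P f" for z P f
 proof -
  note [simp] = bilin_simps[OF f H_module H_module P]
  show ?thesis using D_one(1)[of z P "%a x. f a (et x)"] z P fx[OF z P f] by simp
 qed
 have yd: "D P h (%u w. D P z (%a x. f (u .* a) (et (w .* x))))
   = D P h (%u w. D P (et (u .* z)) (%a x. f (a .* w) x))"
  if z: "z \<in> Ht" and h: "h .: H" and P: "module R P" and f: "bilin H H P f" for z h P f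
 proof -
  note [simp] = h P bilin_simps[OF f H_module H_module P]
  have [simp]: "z .: H" using z by simp
  have "D P h (%u w. D P z (%a x. f (u .* a) (et (w .* x)))) = D P (h .* z) (%a x. f a (et x))"
   by (simp add: D_mult)
  also have "... = D P uH (%u v. f (u .* h .* z) v)" by (rule D_eps(1)) simp_all
  also have "... = D P uH (%u v. D P h (%a b. f (u .* et (a .* z) .* b) v))"
   using D_eps_t_mult[of h z P "%x. f (_ .* x) _"] z by simp
  also have "... = D P h (%a b. D P uH (%u v. f (u .* et (a .* z) .* b) v))" by (rule Sw_swap) simp_all
  also have "... = D P h (%u w. D P (et (u .* z)) (%a x. f (a .* w) x))"
   by (simp add: D_Ht(2)[of "et (_ .* z)"])
  finally show ?thesis .
 qed
 have co: "D P v (%a w. D P a (%b c. f b c w)) = D P v (%a w. D P w (%b x. f a b x))"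
  if "v \<in> Ht" "module R P" "trilin H H H P f" for v f P
  using that by (intro coassoc) simp_all
 have ct: "D H v (%a w. eH a *[H] w) = v" if "v \<in> Ht" for v
  using that D_counit(1)[of v H "%x. x"] by simp
 note b = left_object_yd_LL[OF lact_eps_t A comult_lin, where X = "unit_LL R H"]
 show "yd_LL R H (unit_LL R H)"
  by (rule b(1); (rule co ct * yd unit_LL_def)?; assumption?)
 show "z \<in> Ht ==> module R P ==> bilin H H P f ==> LC (unit_LL R H) P z f = D P z f"
  by (rule b(2); (rule co ct * yd unit_LL_def)?; assumption?)
qed

lemma carrier_unit_LL: "carrier (unit_LL R H) = Ht"
 by (simp add: unit_LL_def)

lemma unit_LL_simps [simp]:
 "z .: (unit_LL R H) ==> z \<in> Ht" "h .: H ==> z \<in> Ht ==> act (unit_LL R H) h z = et (h .* z)"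
 "h .: H ==> et h .: (unit_LL R H)"
 by (simp_all add: unit_LL_def)

lemma retract_unit_LL: "retract et (unit_LL R H) H"
proof -
 have *: "et ` carrier H = Ht" unfolding target_def ..
 show ?thesis 
  by (rule submodule_retract[OF H_module eps_lin(1) eps_eps(1)]) (simp_all only: * unit_LL_def left_object_simps)
qed

subsection \<open>Tensor products\<close>

lemma ldiag_pt:
 assumes A: "lact A \<alpha>" and B: "lact B \<beta>" and "h .: H" "a .: A" "b .: B"
 shows "ldiag A \<alpha> B \<beta> h (pt A B a b) = D (A ** B) h (%c d. pt A B (\<alpha> c a) (\<beta> d b))"
 using assms by (simp add: ldiag_eq lact_simps[OF A] lact_simps[OF B])

text \<open>The coaction formula on all of M \<otimes> N. There it is coassociative and compatible
  with the diagonal action, but its counit returns \<Delta>(1)x; it becomes a comodule structure on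
  the part where \<Delta>(1) acts trivially.\<close>

definition lamLL :: "('k, 'u) yd_module => ('k, 'u) yd_module => 'u => 'u" where
 "lamLL M N x = Sw M N (H ** (M ** N)) x (%m n. LC M (H ** (M ** N)) m (%a m0.
  LC N (H ** (M ** N)) n (%b n0. pt H (M ** N) (a .* b) (pt M N m0 n0))))"

lemma Sw_lamLL:
 assumes M: "yd_LL R H M" and N: "yd_LL R H N" and P: "module R P"
  and f: "bilin H (M ** N) P f" and "x .: (M ** N)"
 shows "Sw H (M ** N) P (lamLL M N x) f
  = Sw M N P x (%m n. LC M P m (%a m0. LC N P n (%b n0. f (a .* b) (pt M N m0 n0))))"
proof -
 note [simp] = yd_LL_simps[OF M] yd_LL_simps[OF N] P
 show ?thesis using assms by (simp add: lamLL_def bilin_simps[OF f])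
qed

section \<open>Identities for the coaction on a tensor product, evaluated on m \<otimes> n\<close>

context
 fixes M N :: "('k, 'u) yd_module" and P :: "('k, 'p, 'q) module_scheme" and f :: "'u => 'u => 'p" and m n :: 'u
 assumes M: "yd_LL R H M" and N: "yd_LL R H N" and P: "module R P"
  and m: "m .: M" and n: "n .: N"
begin

text \<open>The second component already lies in M \<otimes>_t N. The range condition for N provides
  \<Delta>(1) with its first leg between the two coaction legs; as that leg lies in H_s,
  balancedness of the coaction of M moves it onto m_[0].\<close>

lemma LL2_inv:
 assumes f: "bilin H (M ** N) P f"
 shows "LC M P m (%a x. LC N P n (%b y. D P uH (%u v. f (a .* b) (pt M N (act M u x) (act N v y)))))
  = LC M P m (%a x. LC N P n (%b y. f (a .* b) (pt M N x y)))"
proof -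
 note [simp] = yd_LL_simps[OF M] yd_LL_simps[OF N] P m n
 note [simp] = bilin_simps[OF f H_module _ P]
 have "LC M P m (%a x. LC N P n (%b y. f (a .* b) (pt M N x y)))
   = LC M P m (%a x. D P uH (%u v. LC N P n (%b y. f (a .* u .* b) (pt M N x (act N v y)))))"
  using LL_unit[OF N n P, of "%b y. f (_ .* b) (pt M N _ y)"] by simp
 also have "... = D P uH (%u v. LC M P m (%a x. LC N P n (%b y. f (a .* u .* b) (pt M N x (act N v y)))))"
  by (rule Sw_swap) simp_all
 also have "... = D P uH (%u v. LC M P m (%a x. LC N P n (%b y. f (a .* es u .* b) (pt M N x (act N v y)))))"
  by (rule D_one_eps(2)[symmetric]) simp_all
 also have "... = D P uH (%u v. LC M P m (%a x. LC N P n (%b y. f (a .* b) (pt M N (act M (es u) x) (act N v y)))))"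
 proof (rule Sw_eqI)
  fix u v assume [simp]: "u .: H" "v .: H"
  show "LC M P m (%a x. LC N P n (%b y. f (a .* es u .* b) (pt M N x (act N v y))))
    = LC M P m (%a x. LC N P n (%b y. f (a .* b) (pt M N (act M (es u) x) (act N v y))))"
   using LL_Hs[OF M m _ P, of "es u" "%a x. LC N P n (%b y. f (a .* b) (pt M N x (act N v y)))"] by simp
 qed
 also have "... = D P uH (%u v. LC M P m (%a x. LC N P n (%b y. f (a .* b) (pt M N (act M u x) (act N v y)))))"
  by (rule D_one_eps(2)) simp_all
 also have "... = LC M P m (%a x. D P uH (%u v. LC N P n (%b y. f (a .* b) (pt M N (act M u x) (act N v y)))))"
  by (rule Sw_swap) simp_all
 also have "... = LC M P m (%a x. LC N P n (%b y. D P uH (%u v. f (a .* b) (pt M N (act M u x) (act N v y)))))"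
  by (rule Sw_eqI, rule Sw_swap) simp_all
 finally show ?thesis ..
qed

text \<open>The counit axiom splits \<epsilon>(ab) into \<epsilon>(a1_1) \<epsilon>(1_2 b). With 1_1
  taken in H_s and 1_2 in H_t, the first factor becomes an action on M and the second an action on
  N, which together are \<Delta>(1).\<close>

lemma LL2_counit:
 assumes f: "f' \<in> lin (M ** N) P"
 shows "LC M P m (%a x. LC N P n (%b y. eH (a .* b) *[P] f' (pt M N x y)))
  = D P uH (%u v. f' (pt M N (act M u m) (act N v n)))"
proof -
 note [simp] = yd_LL_simps[OF M] yd_LL_simps[OF N] P m n
 note [simp] = f lin_simps[OF f _ P]
 let ?F = "%a x b y u v. eH (a .* u) *[P] (eH (v .* b) *[P] f' (pt M N x y))"
 have "LC M P m (%a x. LC N P n (%b y. eH (a .* b) *[P] f' (pt M N x y)))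
   = LC M P m (%a x. LC N P n (%b y. D P uH (%u v. ?F a x b y u v)))"
  by (simp add: counit_mult(1))
 also have "... = LC M P m (%a x. D P uH (%u v. LC N P n (%b y. ?F a x b y u v)))"
  by (rule Sw_eqI, rule Sw_swap) simp_all
 also have "... = D P uH (%u v. LC M P m (%a x. LC N P n (%b y. ?F a x b y u v)))"
  by (rule Sw_swap) simp_all
 also have "... = D P uH (%u v. LC M P m (%a x. LC N P n (%b y. ?F a x b y (es u) v)))"
  by (rule D_one_eps(2)[symmetric]) simp_all
 also have "... = D P uH (%u v. LC M P m (%a x. LC N P n (%b y. ?F a x b y (es u) (et v))))"
  by (rule D_one_eps(1)[symmetric]) simp_all
 also have "... = D P uH (%u v. f' (pt M N (act M (es u) m) (act N (et v) n)))"
 proof (rule Sw_eqI)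
  fix u v assume [simp]: "u .: H" "v .: H"
  have "LC N P n (%b y. ?F a x b y (es u) (et v)) = eH (a .* es u) *[P] f' (pt M N x (act N (et v) n))"
   if [simp]: "a .: H" "x .: M" for a x
   using LL_counit_Ht[OF N n _ P, of "et v" "%y. eH (a .* es u) *[P] f' (pt M N x y)"]
   by (simp add: smult_left_commute[of P "eH (a .* es u)"])
  then have "LC M P m (%a x. LC N P n (%b y. ?F a x b y (es u) (et v)))
    = LC M P m (%a x. eH (a .* es u) *[P] f' (pt M N x (act N (et v) n)))" by simp
  also have "... = LC M P m (%a x. eH a *[P] f' (pt M N (act M (es u) x) (act N (et v) n)))"
   using LL_Hs[OF M m _ P, of "es u" "%a x. eH a *[P] f' (pt M N x (act N (et v) n))"] by simp
  also have "... = f' (pt M N (act M (es u) m) (act N (et v) n))"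
   using LC_counit[OF yd_LL_D(2)[OF M] _ m P, of "%x. f' (pt M N (act M (es u) x) (act N (et v) n))"] by simp
  finally show "LC M P m (%a x. LC N P n (%b y. ?F a x b y (es u) (et v)))
    = f' (pt M N (act M (es u) m) (act N (et v) n))" .
 qed
 also have "... = D P uH (%u v. f' (pt M N (act M u m) (act N (et v) n)))"
  by (rule D_one_eps(2)) simp_all
 also have "... = D P uH (%u v. f' (pt M N (act M u m) (act N v n)))"
  by (rule D_one_eps(1)) simp_all
 finally show ?thesis .
qed

text \<open>Starting from the right-hand side, the compatibility condition of N is used on the last
  two legs of the threefold coproduct of h and that of M on the first two, with coassociativity
  regrouping the legs in between.\<close>

lemma LL2_yd:
 assumes h: "h .: H" and f: "bilin H (M ** N) P f"
 shows "D P h (%u w. LC M P m (%a x. LC N P n (%b y. D P w (%p q. f (u .* a .* b) (pt M N (act M p x) (act N q y))))))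
  = D P h (%u w. D P u (%p q. LC M P (act M p m) (%a x. LC N P (act N q n) (%b y. f (a .* b .* w) (pt M N x y)))))"
  (is "?L = ?R")
proof -
 note [simp] = yd_LL_simps[OF M] yd_LL_simps[OF N] P m n h
 note [simp] = bilin_simps[OF f H_module _ P]
 have "?R = D P h (%p r. D P r (%q w. LC M P (act M p m) (%a x. LC N P (act N q n) (%b y. f (a .* b .* w) (pt M N x y)))))"
  by (rule coassoc) simp_all
 also have "... = D P h (%p r. LC M P (act M p m) (%a x. D P r (%q w. LC N P (act N q n) (%b y. f (a .* b .* w) (pt M N x y)))))"
  by (rule Sw_eqI, rule Sw_swap) simp_all
 also have "... = D P h (%p r. LC M P (act M p m) (%a x. D P r (%q w. LC N P n (%b y. f (a .* q .* b) (pt M N x (act N w y))))))"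
  using LL_yd[OF N n _ P, of _ "%b y. f (_ .* b) (pt M N _ y)"] by simp
 also have "... = D P h (%p r. D P r (%q w. LC M P (act M p m) (%a x. LC N P n (%b y. f (a .* q .* b) (pt M N x (act N w y))))))"
  by (rule Sw_eqI, rule Sw_swap) simp_all
 also have "... = D P h (%r w. D P r (%p q. LC M P (act M p m) (%a x. LC N P n (%b y. f (a .* q .* b) (pt M N x (act N w y))))))"
  by (rule coassoc[symmetric]) simp_all
 also have "... = D P h (%r w. D P r (%p q. LC M P m (%a x. LC N P n (%b y. f (p .* a .* b) (pt M N (act M q x) (act N w y))))))"
 proof (rule Sw_eqI)
  fix r w assume [simp]: "r .: H" "w .: H"
  show "D P r (%p q. LC M P (act M p m) (%a x. LC N P n (%b y. f (a .* q .* b) (pt M N x (act N w y)))))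
    = D P r (%p q. LC M P m (%a x. LC N P n (%b y. f (p .* a .* b) (pt M N (act M q x) (act N w y)))))"
   using LL_yd[OF M m _ P, of r "%a x. LC N P n (%b y. f (a .* b) (pt M N x (act N w y)))"] by simp
 qed
 also have "... = D P h (%u r. D P r (%p q. LC M P m (%a x. LC N P n (%b y. f (u .* a .* b) (pt M N (act M p x) (act N q y))))))"
  by (rule coassoc) simp_all
 also have "... = D P h (%u r. LC M P m (%a x. D P r (%p q. LC N P n (%b y. f (u .* a .* b) (pt M N (act M p x) (act N q y))))))"
  by (rule Sw_eqI, rule Sw_swap) simp_all
 also have "... = ?L" by (rule Sw_eqI, rule Sw_eqI, rule Sw_swap) simp_all
 finally show ?thesis ..
qed

text \<open>The threefold coproduct of 1 separates into two copies of \<Delta>(1). One is absorbed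
  by the range condition of M, the other acts on m_[0] \<otimes> n_[0] and is absorbed by
  \<open>LL2_inv\<close>.\<close>

lemma LL2_unit:
 assumes f: "bilin H (M ** N) P f"
 shows "D P uH (%u w. LC M P m (%a x. LC N P n (%b y. D P w (%p q. f (u .* a .* b) (pt M N (act M p x) (act N q y))))))
  = LC M P m (%a x. LC N P n (%b y. f (a .* b) (pt M N x y)))" (is "?L = _")
proof -
 note [simp] = yd_LL_simps[OF M] yd_LL_simps[OF N] P m n
 note [simp] = bilin_simps[OF f H_module _ P]
 let ?F = "%u p q. LC M P m (%a x. LC N P n (%b y. f (u .* a .* b) (pt M N (act M p x) (act N q y))))"
 have "?L = D P uH (%u w. LC M P m (%a x. D P w (%p q. LC N P n (%b y. f (u .* a .* b) (pt M N (act M p x) (act N q y))))))"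
  by (rule Sw_eqI, rule Sw_eqI, rule Sw_swap) simp_all
 also have "... = D P uH (%u w. D P w (%p q. ?F u p q))" by (rule Sw_eqI, rule Sw_swap) simp_all
 also have "... = D P uH (%w q. D P w (%u p. ?F u p q))" by (rule coassoc[symmetric]) simp_all
 also have "... = D P uH (%u v. D P uH (%u' v'. ?F u (u' .* v) v'))" by (rule comult_one(2)) simp_all
 also have "... = D P uH (%u v. LC M P m (%a x. LC N P n (%b y. D P uH (%u' v'. f (u .* a .* b) (pt M N (act M (u' .* v) x) (act N v' y))))))"
 proof (rule Sw_eqI)
  fix u v assume [simp]: "u .: H" "v .: H"
  have "D P uH (%u' v'. ?F u (u' .* v) v') = LC M P m (%a x. D P uH (%u' v'. LC N P n (%b y. f (u .* a .* b) (pt M N (act M (u' .* v) x) (act N v' y)))))"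
   by (rule Sw_swap) simp_all
  also have "... = LC M P m (%a x. LC N P n (%b y. D P uH (%u' v'. f (u .* a .* b) (pt M N (act M (u' .* v) x) (act N v' y)))))"
   by (rule Sw_eqI, rule Sw_swap) simp_all
  finally show "D P uH (%u' v'. ?F u (u' .* v) v') = ..." .
 qed
 also have "... = LC M P m (%a x. LC N P n (%b y. D P uH (%u v. f (a .* b) (pt M N (act M u x) (act N v y)))))"
  using LL_unit[OF M m P, of "%a x. LC N P n (%b y. D P uH (%u v. f (a .* b) (pt M N (act M u x) (act N v y))))"] by simp
 also have "... = LC M P m (%a x. LC N P n (%b y. f (a .* b) (pt M N x y)))" by (rule LL2_inv[OF f])
 finally show ?thesis .
qed

lemma LL2_coassoc:
 assumes f: "trilin H H (M ** N) P g"
 shows "LC M P m (%a x. LC N P n (%b y. D P a (%p q. D P b (%r s. g (p .* r) (q .* s) (pt M N x y)))))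
  = LC M P m (%a x. LC N P n (%b y. LC M P x (%c x'. LC N P y (%d y'. g (a .* b) (c .* d) (pt M N x' y')))))"
  (is "?L = ?R")
proof -
 note [simp] = yd_LL_simps[OF M] yd_LL_simps[OF N] P m n
 note [simp] = trilin_simps[OF f H_module H_module _ P]
 have "?L = LC M P m (%a x. D P a (%p q. LC N P n (%b y. D P b (%r s. g (p .* r) (q .* s) (pt M N x y)))))"
  by (rule Sw_eqI, rule Sw_swap) simp_all
 also have "... = LC M P m (%a x. LC M P x (%c x'. LC N P n (%b y. D P b (%r s. g (a .* r) (c .* s) (pt M N x' y)))))"
  by (rule LC_coassoc[OF yd_LL_D(2)[OF M]]) simp_all
 also have "... = LC M P m (%a x. LC M P x (%c x'. LC N P n (%b y. LC N P y (%d y'. g (a .* b) (c .* d) (pt M N x' y')))))"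
 proof (rule Sw_eqI, rule Sw_eqI)
  fix a x c x' assume [simp]: "a .: H" "x .: M" "c .: H" "x' .: M"
  show "LC N P n (%b y. D P b (%r s. g (a .* r) (c .* s) (pt M N x' y)))
   = LC N P n (%b y. LC N P y (%d y'. g (a .* b) (c .* d) (pt M N x' y')))"
   by (rule LC_coassoc[OF yd_LL_D(2)[OF N], of n P "%r s y. g (a .* r) (c .* s) (pt M N x' y)"]) simp_all
 qed
 also have "... = ?R" by (rule Sw_eqI, rule Sw_swap) simp_all
 finally show ?thesis .
qed

end

end

context weak_hopf_bij
begin

lemma lamLL_lin:
 assumes M: "yd_LL R H M" and N: "yd_LL R H N" shows "lamLL M N \<in> lin (M ** N) (H ** (M ** N))"
proof -
 note [simp] = yd_LL_simps[OF M] yd_LL_simps[OF N]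
 show ?thesis unfolding lamLL_def[abs_def] by simp
qed

lemma tensor_LL_eq:
 assumes M: "yd_LL R H M" and N: "yd_LL R H N"
 shows "tensor_LL R H M N = left_object R H (M ** N) (tensor_t R H M (act M) N (act N)) (ldiag M (act M) N (act N))
  (%x. corestrict R H (submod R (M ** N) (tensor_t R H M (act M) N (act N))) H (M ** N) (lamLL M N x))"
proof -
 note [simp] = yd_LL_simps[OF M] yd_LL_simps[OF N]
 let ?Q = "H ** (M ** N)"
 have conv: "m .: M ==> sweedler ?Q (coact M m) g = LC M ?Q m g"
  "n .: N ==> sweedler ?Q (coact N n) g = LC N ?Q n g" for m n g
  by (rule sweedler_Sw; simp)+
 show ?thesis unfolding tensor_LL_def left_tensor_def
 proof (rule left_object_cong)
  fix x assume "x \<in> tensor_t R H M (act M) N (act N)"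
  then have x: "x .: (M ** N)" using tensor_t_iff[OF yd_LL_lact[OF M] yd_LL_lact[OF N]] by simp
  have "sweedler ?Q x (%m n. sweedler ?Q (coact M m) (%a m0. sweedler ?Q (coact N n) (%b n0.
    pt H (M ** N) (a .* b) (pt M N m0 n0)))) = lamLL M N x"
   unfolding lamLL_def sweedler_Sw[OF yd_LL_module[OF M] yd_LL_module[OF N] x] by (simp add: conv)
  then show "corestrict R H (submod R (M ** N) (tensor_t R H M (act M) N (act N))) H (M ** N)
   (sweedler ?Q x (%m n. sweedler ?Q (coact M m) (%a m0. sweedler ?Q (coact N n) (%b n0.
    pt H (M ** N) (a .* b) (pt M N m0 n0))))) = corestrict R H (submod R (M ** N) (tensor_t R H M (act M) N (act N))) H (M ** N) (lamLL M N x)"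
   by (rule arg_cong)
 qed
qed

lemma tensor_LL_yd:
 assumes M: "yd_LL R H M" and N: "yd_LL R H N"
 shows "yd_LL R H (tensor_LL R H M N)"
  "x .: (tensor_LL R H M N) ==> module R (P :: ('k, 'p, 'q) module_scheme) ==> bilin H (M ** N) P f ==>
   LC (tensor_LL R H M N) P x f
    = Sw M N P x (%m n. LC M P m (%a m0. LC N P n (%b n0. f (a .* b) (pt M N m0 n0))))"
proof -
 note [simp] = yd_LL_simps[OF M] yd_LL_simps[OF N]
 let ?V = "M ** N" and ?\<alpha> = "ldiag M (act M) N (act N)" and ?A = "tensor_t R H M (act M) N (act N)"
 note lM = yd_LL_lact[OF M] and lN = yd_LL_lact[OF N]
 note lV = lact_ldiag[OF lM lN]
 note [simp] = lact_simps(3,4,5)[OF lV] ldiag_pt[OF lM lN]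
 have AV: "v \<in> ?A ==> v .: ?V" for v using tensor_t_iff[OF lM lN] by simp
 have co: "Sw H ?V P (lamLL M N v) (%a w. D P a (%b c. f b c w))
   = Sw H ?V P (lamLL M N v) (%a w. Sw H ?V P (lamLL M N w) (%b x. f a b x))"
  if v: "v \<in> ?A" and P [simp]: "module R P" and f: "trilin H H ?V P f" for v f and P :: "('k, 'u) module"
 proof -
  note [simp] = trilin_simps[OF f H_module H_module _ P] AV[OF v] Sw_lamLL[OF M N P]
  show ?thesis
   using LL2_coassoc[OF M N P _ _ f]
   by (simp add: D_mult lin_simps[OF lamLL_lin[OF M N]])
 qed
 have ct: "Sw H ?V ?V (lamLL M N v) (%a w. eH a *[?V] w) = v" if v: "v \<in> ?A" for v
 proof -
  note [simp] = AV[OF v] Sw_lamLL[OF M N]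
  have "?\<alpha> uH v = v" using v tensor_t_iff[OF lM lN] by simp
  moreover have "?\<alpha> uH v = Sw M N ?V v (%m n. D ?V uH (%u w. pt M N (act M u m) (act N w n)))"
   unfolding ldiag_eq[OF yd_LL_module[OF M] yd_LL_module[OF N] hone_closed AV[OF v]]
   by (rule Sw_swap) simp_all
  moreover have "Sw H ?V ?V (lamLL M N v) (%a w. eH a *[?V] w)
    = Sw M N ?V v (%m n. D ?V uH (%u w. pt M N (act M u m) (act N w n)))"
   using LL2_counit[OF M N, of ?V _ _ "%x. x"] by simp
  ultimately show ?thesis by simp
 qed
 have un: "D P uH (%u w. Sw H ?V P (lamLL M N v) (%a x. f (u .* a) (?\<alpha> w x))) = Sw H ?V P (lamLL M N v) f"
  if v: "v \<in> ?A" and P [simp]: "module R P" and f: "bilin H ?V P f" for v f and P :: "('k, 'u) module"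
 proof -
  note [simp] = bilin_simps[OF f H_module _ P] AV[OF v] Sw_lamLL[OF M N P]
  have "D P uH (%u w. Sw H ?V P (lamLL M N v) (%a x. f (u .* a) (?\<alpha> w x)))
   = D P uH (%u w. Sw M N P v (%m n. LC M P m (%a x. LC N P n (%b y. D P w (%p q. f (u .* a .* b) (pt M N (act M p x) (act N q y)))))))"
   by simp
  also have "... = Sw M N P v (%m n. D P uH (%u w. LC M P m (%a x. LC N P n (%b y. D P w (%p q. f (u .* a .* b) (pt M N (act M p x) (act N q y)))))))"
   by (rule Sw_swap) simp_all
  also have "... = Sw M N P v (%m n. LC M P m (%a m0. LC N P n (%b n0. f (a .* b) (pt M N m0 n0))))"
   by (rule Sw_eqI, rule LL2_unit[OF M N P _ _ f])
  also have "... = Sw H ?V P (lamLL M N v) f" using f by simp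
  finally show ?thesis .
 qed
 have yd: "D P h (%u w. Sw H ?V P (lamLL M N v) (%a x. f (u .* a) (?\<alpha> w x)))
   = D P h (%u w. Sw H ?V P (lamLL M N (?\<alpha> u v)) (%a x. f (a .* w) x))"
  if v: "v \<in> ?A" and h [simp]: "h .: H" and P [simp]: "module R P" and f: "bilin H ?V P f"
  for v h f and P :: "('k, 'u) module"
 proof -
  note [simp] = bilin_simps[OF f H_module _ P] AV[OF v] Sw_lamLL[OF M N P]
  have "D P h (%u w. Sw H ?V P (lamLL M N v) (%a x. f (u .* a) (?\<alpha> w x)))
   = D P h (%u w. Sw M N P v (%m n. LC M P m (%a x. LC N P n (%b y. D P w (%p q. f (u .* a .* b) (pt M N (act M p x) (act N q y)))))))"
   by simp
  also have "... = Sw M N P v (%m n. D P h (%u w. LC M P m (%a x. LC N P n (%b y. D P w (%p q. f (u .* a .* b) (pt M N (act M p x) (act N q y)))))))"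
   by (rule Sw_swap) simp_all
  also have "... = Sw M N P v (%m n. D P h (%u w. D P u (%p q. LC M P (act M p m) (%a x. LC N P (act N q n) (%b y. f (a .* b .* w) (pt M N x y))))))"
   by (rule Sw_eqI, rule LL2_yd[OF M N P _ _ h f])
  also have "... = D P h (%u w. Sw M N P v (%m n. D P u (%p q. LC M P (act M p m) (%a x. LC N P (act N q n) (%b y. f (a .* b .* w) (pt M N x y))))))"
   by (rule Sw_swap) simp_all
  also have "... = D P h (%u w. D P u (%p q. Sw M N P v (%m n. LC M P (act M p m) (%a x. LC N P (act N q n) (%b y. f (a .* b .* w) (pt M N x y))))))"
   by (rule Sw_eqI, rule Sw_swap) simp_all
  also have "... = D P h (%u w. Sw H ?V P (lamLL M N (?\<alpha> u v)) (%a x. f (a .* w) x))"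
   by (simp add: Sw_ldiag[OF lM lN])
  finally show ?thesis .
 qed
 note b = left_object_yd_LL[OF lV tensor_t_eq lamLL_lin[OF M N], where X = "tensor_LL R H M N"]
 show "yd_LL R H (tensor_LL R H M N)"
  by (rule b(1); (rule co ct un yd tensor_LL_eq[OF M N])?; assumption?)
 assume x: "x .: (tensor_LL R H M N)" and P: "module R P" and f: "bilin H ?V P f"
 have xA: "x \<in> ?A" using x unfolding tensor_LL_eq[OF M N] by simp
 have "LC (tensor_LL R H M N) P x f = Sw H ?V P (lamLL M N x) f"
  by (rule b(2)[OF _ _ _ _ _ xA P f]; (rule co ct un yd tensor_LL_eq[OF M N])?; assumption?)
 also have "... = Sw M N P x (%m n. LC M P m (%a m0. LC N P n (%b n0. f (a .* b) (pt M N m0 n0))))"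
  by (rule Sw_lamLL[OF M N P f AV[OF xA]])
 finally show "LC (tensor_LL R H M N) P x f = ..." .
qed

lemma tensor_LL_carrier_iff:
 assumes M: "yd_LL R H M" and N: "yd_LL R H N"
 shows "x .: (tensor_LL R H M N) \<longleftrightarrow> x .: (M ** N) \<and> ldiag M (act M) N (act N) uH x = x"
 unfolding tensor_LL_eq[OF M N] left_object_simps by (rule tensor_t_iff[OF yd_LL_lact[OF M] yd_LL_lact[OF N]])

lemma tensor_LL_retract:
 assumes M: "yd_LL R H M" and N: "yd_LL R H N"
 shows "retract (ldiag M (act M) N (act N) uH) (tensor_LL R H M N) (M ** N)"
 unfolding tensor_LL_eq[OF M N] tensor_t_eq
 by (rule lact_submod_retract(2)[OF lact_ldiag[OF yd_LL_lact[OF M] yd_LL_lact[OF N]]])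

lemma tensor_LL_act:
 assumes M: "yd_LL R H M" and N: "yd_LL R H N" and "h .: H" "x .: (tensor_LL R H M N)"
 shows "act (tensor_LL R H M N) h x = ldiag M (act M) N (act N) h x"
 using assms(3,4) unfolding tensor_LL_eq[OF M N] by simp

subsection \<open>Arrows\<close>

lemma lin_retract_corange:
 assumes r: "retract p Y W" and f: "f \<in> lin X W" and "!!x. x .: X ==> f x .: Y" and X: "module R X"
 shows "f \<in> lin X Y"
 by (rule lin_eqI[OF lin_compose[OF retractD(4)[OF r] f] _ X]) (simp add: retractD(5)[OF r] assms(3))

text \<open>Tensoring with A keeps a split monomorphism injective, its retraction being carried
  along; an arbitrary injective linear map need not survive over a general ring.\<close>

lemma split_inject:
 assumes mod: "module R A" "module R Y" "module R W" and j: "j \<in> lin Y W" and p: "p \<in> lin W Y"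
  and pj: "!!y. y .: Y ==> p (j y) = y" and z: "z .: (A ** Y)" "z' .: (A ** Y)"
  and eq: "Sw A Y (A ** W) z (%a y. pt A W a (j y)) = Sw A Y (A ** W) z' (%a y. pt A W a (j y))"
 shows "z = (z' :: 'u)"
proof -
 note [simp] = mod lin_simps[OF j mod(2,3)] lin_simps[OF p mod(3,2)] pj
 have *: "Sw A W (A ** Y) (Sw A Y (A ** W) y (%a y. pt A W a (j y))) (%a w. pt A Y a (p w)) = y"
  if "y .: (A ** Y)" for y using that j p by simp
 show ?thesis by (subst *[OF z(1), symmetric], subst *[OF z(2), symmetric], subst eq, rule HOL.refl)
qed

definition arrLL :: "('k, 'u) yd_module => ('u => 'u) => ('k, 'u) yd_module => bool" where
 "arrLL M f N \<longleftrightarrow> (M, f, N) \<in> Arr (YD_LL R H)"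

lemma arrLL_iff: "arrLL M f N \<longleftrightarrow> yd_LL R H M \<and> yd_LL R H N \<and> f \<in> extensional (carrier M) \<and>
  f \<in> lin M N \<and> (\<forall>h\<in>carrier H. \<forall>m\<in>carrier M. f (act M h m) = act N h (f m)) \<and>
  (\<forall>m\<in>carrier M. coact N (f m) = sweedler (H ** N) (coact M m) (%a x. pt H N a (f x)))"
 by (auto simp: arrLL_def YD_LL_def yd_arrows_def left_linear_def left_colinear_def)

lemma arrLLD:
 assumes f: "arrLL M f N"
 shows "yd_LL R H M" "yd_LL R H N" "f \<in> extensional (carrier M)" "f \<in> lin M N"
  "!!h m. h .: H ==> m .: M ==> f (act M h m) = act N h (f m)"
  "!!m P g. m .: M ==> module R P ==> bilin H N P g ==> LC N P (f m) g = LC M P m (%a x. g a (f x))"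
proof -
 show M: "yd_LL R H M" and N: "yd_LL R H N" and "f \<in> extensional (carrier M)" and l: "f \<in> lin M N"
  and "!!h m. h .: H ==> m .: M ==> f (act M h m) = act N h (f m)"
  using f by (simp_all add: arrLL_iff)
 fix m P g assume m [simp]: "m .: M" and P [simp]: "module R P" and g: "bilin H N P g"
 note [simp] = yd_LL_simps[OF M] yd_LL_simps[OF N] bilin_simps[OF g H_module _ P] lin_simps[OF l]
 have "coact N (f m) = sweedler (H ** N) (coact M m) (%a x. pt H N a (f x))"
  using f by (simp add: arrLL_iff)
 also have "... = LC M (H ** N) m (%a x. pt H N a (f x))" by (rule sweedler_Sw) simp_all
 finally show "LC N P (f m) g = LC M P m (%a x. g a (f x))" using g l by simp
qed

text \<open>Colinearity may be tested after a split monomorphism \<open>j\<close> from the codomain into an ambient module.\<close>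

lemma arrLLI:
 assumes M: "yd_LL R H M" and N: "yd_LL R H N" and l: "f \<in> lin M N"
  and a: "!!h m. h .: H ==> m .: M ==> f (act M h m) = act N h (f m)"
  and W: "module R (W :: ('k, 'u, 'w) module_scheme)" and j: "j \<in> lin N W" and p: "p \<in> lin W N"
  and pj: "!!y. y .: N ==> p (j y) = y"
  and c: "!!m. m .: M ==> LC N (H ** W) (f m) (%a y. pt H W a (j y)) = LC M (H ** W) m (%a x. pt H W a (j (f x)))"
 shows "arrLL M (restrict f (carrier M)) N"
proof -
 note [simp] = yd_LL_simps[OF M] yd_LL_simps[OF N] W lin_simps[OF l] lin_simps[OF j]
 have "coact N (f m) = sweedler (H ** N) (coact M m) (%a x. pt H N a (restrict f (carrier M) x))"
  if m [simp]: "m .: M" for m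
 proof -
  have "coact N (f m) = LC M (H ** N) m (%a x. pt H N a (f x))"
   by (rule split_inject[OF H_module yd_LL_module[OF N] W j p pj]) (use c j l in simp_all)
  also have "... = LC M (H ** N) m (%a x. pt H N a (restrict f (carrier M) x))" by simp
  also have "... = sweedler (H ** N) (coact M m) (%a x. pt H N a (restrict f (carrier M) x))"
   by (rule sweedler_Sw[symmetric]) simp_all
  finally show ?thesis .
 qed
 moreover have "restrict f (carrier M) \<in> lin M N" by (rule lin_eqI[OF l]) simp_all
 ultimately show ?thesis using M N a by (simp add: arrLL_iff)
qed

lemma arrLLI_id:
 assumes M: "yd_LL R H M" and N: "yd_LL R H N" and l: "f \<in> lin M N"
  and a: "!!h m. h .: H ==> m .: M ==> f (act M h m) = act N h (f m)"
  and c: "!!m. m .: M ==> LC N (H ** N) (f m) (pt H N) = LC M (H ** N) m (%a x. pt H N a (f x))"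
 shows "arrLL M (restrict f (carrier M)) N"
 by (rule arrLLI[OF M N l a yd_LL_module[OF N] lin_id lin_id HOL.refl]) (use c in simp_all)

text \<open>The criterion for maps into a tensor product, formulated entirely in the ambient A
  \<otimes> B and H \<otimes> (A \<otimes> B), so that no corestriction appears in the conditions to
  be checked.\<close>

lemma arrLLI_tensor:
 assumes M: "yd_LL R H M" and A: "yd_LL R H A" and B: "yd_LL R H B"
  and l: "f \<in> lin M (A ** B)" and cl: "!!m. m .: M ==> ldiag A (act A) B (act B) uH (f m) = f m"
  and a: "!!h m. h .: H ==> m .: M ==> f (act M h m) = ldiag A (act A) B (act B) h (f m)"
  and c: "!!m. m .: M ==> Sw A B (H ** (A ** B)) (f m) (%m n. LC A (H ** (A ** B)) m (%a m0.
    LC B (H ** (A ** B)) n (%b n0. pt H (A ** B) (a .* b) (pt A B m0 n0))))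
   = LC M (H ** (A ** B)) m (%a x. pt H (A ** B) a (f x))"
 shows "arrLL M (restrict f (carrier M)) (tensor_LL R H A B)"
proof -
 note r = tensor_LL_retract[OF A B]
 note [simp] = yd_LL_simps[OF A] yd_LL_simps[OF B]
 have cl': "m .: M ==> f m .: (tensor_LL R H A B)" for m
  using cl lin_closed[OF l] tensor_LL_carrier_iff[OF A B] by simp
 show ?thesis
 proof (rule arrLLI[OF M tensor_LL_yd(1)[OF A B] lin_retract_corange[OF r l cl' yd_LL_module[OF M]] _
    retractD(2,3,4,5)[OF r]])
  fix m assume m: "m .: M"
  show "LC (tensor_LL R H A B) (H ** A ** B) (f m) (%a y. pt H (A ** B) a y)
    = LC M (H ** A ** B) m (%a x. pt H (A ** B) a (f x))"
   unfolding c[OF m, symmetric] by (rule tensor_LL_yd(2)[OF A B cl'[OF m]]) simp_all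
 qed (simp_all add: tensor_LL_act[OF A B] cl' a)
qed

lemma tensor_LL_simps:
 assumes M: "yd_LL R H M" and N: "yd_LL R H N"
 shows "module R (tensor_LL R H M N)" "(%x. x) \<in> lin (tensor_LL R H M N) (M ** N)"
  "!!x. x .: (tensor_LL R H M N) ==> x .: (M ** N)"
 using retractD[OF tensor_LL_retract[OF M N]] by simp_all

lemma tensor_LL_Sw_act:
 assumes M: "yd_LL R H M" and N: "yd_LL R H N" and h: "h .: H" and x: "x .: (tensor_LL R H M N)"
  and P: "module R P" and f: "bilin M N P f"
 shows "Sw M N P (act (tensor_LL R H M N) h x) f = D P h (%u v. Sw M N P x (%m n. f (act M u m) (act N v n)))"
 unfolding tensor_LL_act[OF M N h x]
 by (rule Sw_ldiag[OF yd_LL_lact[OF M] yd_LL_lact[OF N] P f h tensor_LL_simps(3)[OF M N x]])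

lemma tensor_LL_Sw_unit:
 assumes M: "yd_LL R H M" and N: "yd_LL R H N" and x: "x .: (tensor_LL R H M N)"
  and P: "module R P" and f: "bilin M N P f"
 shows "D P uH (%u v. Sw M N P x (%m n. f (act M u m) (act N v n))) = Sw M N P x f"
  "Sw M N P x (%m n. D P uH (%u v. f (act M u m) (act N v n))) = Sw M N P x f"
proof -
 note [simp] = yd_LL_simps[OF M] yd_LL_simps[OF N] P bilin_simps[OF f _ _ P]
 show 1: "D P uH (%u v. Sw M N P x (%m n. f (act M u m) (act N v n))) = Sw M N P x f"
  using Sw_ldiag[OF yd_LL_lact[OF M] yd_LL_lact[OF N] P f hone_closed tensor_LL_simps(3)[OF M N x]]
   x tensor_LL_carrier_iff[OF M N] by simp
 have "Sw M N P x (%m n. D P uH (%u v. f (act M u m) (act N v n))) = D P uH (%u v. Sw M N P x (%m n. f (act M u m) (act N v n)))"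
  by (rule Sw_swap) simp_all
 then show "Sw M N P x (%m n. D P uH (%u v. f (act M u m) (act N v n))) = Sw M N P x f"
  using 1 by simp
qed

subsection \<open>The category of left-left Yetter-Drinfeld modules\<close>

abbreviation "LL \<equiv> YD_LL R H"
abbreviation TL where "TL \<equiv> tensor_LL R H"
abbreviation UL where "UL \<equiv> unit_LL R H"

lemma LL_sel [simp]:
 "Obj LL = Collect (yd_LL R H)" "Dom LL = fst" "Cod LL = snd \<circ> snd" "Id LL = yd_id" "Comp LL = yd_comp"
 "TensO LL = TL" "TensA LL = tensor_arrow R TL" "Unit LL = UL" "Assoc LL = assoc_arrow R TL"
 "LUnit LL = left_lunit TL UL" "RUnit LL = left_runit H TL UL" "Braid LL = braid_LL R TL"
 by (simp_all add: YD_LL_def)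

lemma Hom_LL: "\<phi> \<in> Hom LL M N \<longleftrightarrow> (\<exists>f. \<phi> = (M, f, N) \<and> arrLL M f N)"
 by (cases \<phi>) (auto simp: Hom_def arrLL_def)

lemma Hom_LL_I: "arrLL M f N ==> (M, f, N) \<in> Hom LL M N"
 by (simp add: Hom_LL)

lemma yd_comp_simp [simp]: "yd_comp (N, g, P) (M, f, N') = (M, compose (carrier M) g f, P)"
 by (simp add: yd_comp_def)

lemma compose_eqI: "(!!x. x \<in> A ==> g (f x) = g' (f' x)) ==> compose A g f = compose A g' f'"
 by (auto simp: compose_def)

lemma arrLL_eqI:
 "arrLL M f N ==> arrLL M g N ==> (!!x. x .: M ==> f x = g x) ==> f = g"
 by (meson arrLLD(3) extensionalityI)

lemma arrLL_closed: "arrLL M f N ==> x .: M ==> f x .: N"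
 using lin_closed[OF arrLLD(4)] .

lemma arrLL_id: assumes M: "yd_LL R H M" shows "arrLL M (\<lambda>x\<in>carrier M. x) M"
 by (rule arrLLI_id[OF M M]) simp_all

lemma arrLL_comp:
 assumes f: "arrLL M f N" and g: "arrLL N g P" shows "arrLL M (compose (carrier M) g f) P"
proof -
 note M = arrLLD(1)[OF f] and P = arrLLD(2)[OF g] and N = arrLLD(1)[OF g]
 note [simp] = yd_LL_simps[OF M] yd_LL_simps[OF N] yd_LL_simps[OF P] lin_simps[OF arrLLD(4)[OF f]] lin_simps[OF arrLLD(4)[OF g]]
 show ?thesis unfolding compose_def
 proof (rule arrLLI_id[OF M P lin_compose[OF arrLLD(4)[OF g] arrLLD(4)[OF f]]])
  fix m assume [simp]: "m .: M"
  show "LC P (H ** P) (g (f m)) (pt H P) = LC M (H ** P) m (%a x. pt H P a (g (f x)))"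
   using arrLLD(6)[OF g, of "f m" "H ** P" "pt H P"] arrLLD(4)[OF g] by (simp add: arrLLD(6)[OF f])
 qed (simp add: arrLLD(5)[OF f] arrLLD(5)[OF g])
qed

lemma category_LL: "category LL"
proof
 fix \<phi> assume "\<phi> \<in> Arr LL"
 then show "Dom LL \<phi> \<in> Obj LL" "Cod LL \<phi> \<in> Obj LL"
  using arrLLD(1,2)[unfolded arrLL_def] by (cases \<phi>, force)+
next
 fix M assume "M \<in> Obj LL"
 then show "Id LL M \<in> Hom LL M M" using arrLL_id by (simp add: Hom_LL yd_id_def)
next
 fix \<phi> \<psi> M N P assume "\<phi> \<in> Hom LL M N" "\<psi> \<in> Hom LL N P"
 then obtain f g where *: "\<phi> = (M, f, N)" "\<psi> = (N, g, P)" "arrLL M f N" "arrLL N g P"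
  by (auto simp: Hom_LL)
 show "Comp LL \<psi> \<phi> \<in> Hom LL M P" using arrLL_comp[OF *(3,4)] * by (simp add: Hom_LL)
 fix \<chi> Q assume "\<chi> \<in> Hom LL P Q"
 then obtain h where h: "\<chi> = (P, h, Q)" by (auto simp: Hom_LL)
 show "Comp LL \<chi> (Comp LL \<psi> \<phi>) = Comp LL (Comp LL \<chi> \<psi>) \<phi>"
  using arrLL_closed[OF *(3)] by (auto simp: * h compose_def restrict_def)
next
 fix \<phi> M N assume "\<phi> \<in> Hom LL M N"
 then obtain f where *: "\<phi> = (M, f, N)" "arrLL M f N" by (auto simp: Hom_LL)
 show "Comp LL \<phi> (Id LL M) = \<phi>" "Comp LL (Id LL N) \<phi> = \<phi>"
  using arrLLD(3)[OF *(2)] arrLL_closed[OF *(2)]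
  by (auto simp: * yd_id_def compose_def restrict_def extensional_def fun_eq_iff)
qed

text \<open>A bijective morphism is an isomorphism, as in any category of modules with additional
  linear structure; invertibility of each constraint below reduces to a set-theoretic
  inverse.\<close>

lemma LL_inverse:
 assumes f: "arrLL M f N" and g: "!!y. y .: N ==> g y .: M"
  and fg: "!!y. y .: N ==> f (g y) = y" and gf: "!!x. x .: M ==> g (f x) = x"
 shows "arrLL N (restrict g (carrier N)) M" "inverse_arrows LL (M, f, N) (N, restrict g (carrier N), M)"
  "(M, f, N) \<in> Iso LL M N"
proof -
 note M = arrLLD(1)[OF f] and N = arrLLD(2)[OF f] and l = arrLLD(4)[OF f]
 note [simp] = yd_LL_simps[OF M] yd_LL_simps[OF N] lin_simps[OF l] g fg
 have gl: "g \<in> lin N M"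
 proof (rule linI)
  fix x y assume [simp]: "x .: N" "y .: N"
  show "g (x +[N] y) = g x +[M] g y"
   using gf[of "g x +[M] g y"] lin_add[OF l, of "g x" "g y"] by simp
 next
  fix r x assume [simp]: "r .: R" "x .: N"
  show "g (r *[N] x) = r *[M] g x"
   using gf[of "r *[M] g x"] by simp
 qed simp
 note [simp] = lin_simps[OF gl]
 show a: "arrLL N (restrict g (carrier N)) M"
 \<comment> \<open>Colinearity of g is tested after composition with f itself, for which g is the
   retraction; the condition then becomes colinearity of f.\<close>
 proof (rule arrLLI[OF N M gl _ yd_LL_module[OF N] l gl gf])
  fix h n assume [simp]: "h .: H" "n .: N"
  show "g (act N h n) = act M h (g n)" using gf[of "act M h (g n)"] arrLLD(5)[OF f, of h "g n"] by simp
 next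
  fix n assume [simp]: "n .: N"
  show "LC M (H ** N) (g n) (%a y. pt H N a (f y)) = LC N (H ** N) n (%a x. pt H N a (f (g x)))"
   using arrLLD(6)[OF f, of "g n" "H ** N" "pt H N"] by simp
 qed
 show i: "inverse_arrows LL (M, f, N) (N, restrict g (carrier N), M)"
  using f a arrLL_closed[OF f] unfolding inverse_arrows_def
  by (auto simp: Hom_LL arrLL_def yd_id_def compose_def gf intro!: restrict_ext)
 then show "(M, f, N) \<in> Iso LL M N" using f by (auto simp: Iso_def Hom_LL)
qed

subsection \<open>Tensor products of arrows\<close>

lemma tensor_arrow_LL:
 assumes f: "arrLL M f M'" and g: "arrLL N g N'"
 shows "tensor_arrow R TL (M, f, M') (N, g, N') = (TL M N,
   restrict (%x. Sw M N (M' ** N') x (%m n. pt M' N' (f m) (g n))) (carrier (TL M N)), TL M' N')"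
  "arrLL (TL M N) (restrict (%x. Sw M N (M' ** N') x (%m n. pt M' N' (f m) (g n))) (carrier (TL M N))) (TL M' N')"
proof -
 note M = arrLLD(1)[OF f] and M' = arrLLD(2)[OF f] and N = arrLLD(1)[OF g] and N' = arrLLD(2)[OF g]
 note [simp] = yd_LL_simps[OF M] yd_LL_simps[OF N] yd_LL_simps[OF M'] yd_LL_simps[OF N']
  tensor_LL_simps[OF M N] tensor_LL_simps[OF M' N'] lin_simps[OF arrLLD(4)[OF f]] lin_simps[OF arrLLD(4)[OF g]]
  arrLLD(4,5)[OF f] arrLLD(4,5)[OF g]
 show "tensor_arrow R TL (M, f, M') (N, g, N') = (TL M N,
   restrict (%x. Sw M N (M' ** N') x (%m n. pt M' N' (f m) (g n))) (carrier (TL M N)), TL M' N')"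
  by (auto simp: tensor_arrow_def sweedler_Sw[of M N] intro!: restrict_ext)
 show "arrLL (TL M N) (restrict (%x. Sw M N (M' ** N') x (%m n. pt M' N' (f m) (g n))) (carrier (TL M N))) (TL M' N')"
 proof (rule arrLLI_tensor[OF tensor_LL_yd(1)[OF M N] M' N'])
  fix x assume x [simp]: "x .: (TL M N)"
  let ?Q = "H ** (M' ** N')"
  show "ldiag M' (act M') N' (act N') uH (Sw M N (M' ** N') x (%m n. pt M' N' (f m) (g n)))
    = Sw M N (M' ** N') x (%m n. pt M' N' (f m) (g n))"
   using tensor_LL_Sw_unit(1)[OF M N x, of "M' ** N'" "%m n. pt M' N' (f m) (g n)"] by (simp add: ldiag_eq)
  fix h assume [simp]: "h .: H"
  show "Sw M N (M' ** N') (act (TL M N) h x) (%m n. pt M' N' (f m) (g n))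
    = ldiag M' (act M') N' (act N') h (Sw M N (M' ** N') x (%m n. pt M' N' (f m) (g n)))"
   by (simp add: tensor_LL_Sw_act[OF M N] ldiag_eq)
 next
  fix x assume x [simp]: "x .: (TL M N)"
  let ?Q = "H ** (M' ** N')"
  show "Sw M' N' ?Q (Sw M N (M' ** N') x (%m n. pt M' N' (f m) (g n))) (%m n. LC M' ?Q m (%a m0. LC N' ?Q n (%b n0.
     pt H (M' ** N') (a .* b) (pt M' N' m0 n0))))
    = LC (TL M N) ?Q x (%a x. pt H (M' ** N') a (Sw M N (M' ** N') x (%m n. pt M' N' (f m) (g n))))"
   by (simp add: tensor_LL_yd(2)[OF M N] arrLLD(6)[OF f] arrLLD(6)[OF g])
 qed simp
qed

end

context weak_hopf_bij
begin

subsection \<open>Unit constraints\<close>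

text \<open>The mirror image of \<open>D_eps_t_mult\<close>, giving the H-linearity of the right
  unit constraint, where z acts through \<open>esb z\<close>.\<close>

lemma D_eps_sb_mult:
 assumes h: "h .: H" and z: "z .: H" and P: "module R P" and k: "k \<in> lin H P"
 shows "D P h (%a b. k (esb (b .* z) .* a)) = k (h .* esb z)"
proof -
 note [simp] = h z P k lin_simps[OF k H_module P]
 have "k (h .* esb z) = D P (h .* esb z) (%a b. k (esb b .* a))"
  by (rule D_eps_mult(2)[symmetric]) simp_all
 also have "... = D P h (%a b. D P uH (%u v. k (esb (b .* v .* esb z) .* a .* u)))"
  by (simp add: D_mult D_Hs(1)[of "esb z"] del: eps_absorb)
 also have "... = D P h (%a b. k (esb (b .* esb z) .* a))"
  using D_one(2)[of h P "%a b. k (esb (b .* esb z) .* a)"] by (simp del: eps_absorb)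
 also have "... = D P h (%a b. k (esb (b .* z) .* a))" by simp
 finally show ?thesis ..
qed

lemma unit_LL_lin [simp]: "(%x. x) \<in> lin UL H" "module R UL"
 using retractD[OF retract_unit_LL] by simp_all

lemma unit_LL_pt:
 "module R M ==> g \<in> lin A H ==> (%x. et (g x)) \<in> lin A UL"
 by (rule lin_compose[OF retractD(4)[OF retract_unit_LL]])

lemma Ht_unit_LL [simp]: "z \<in> Ht ==> z .: UL"
 by (simp add: carrier_unit_LL)

text \<open>Linearity is the identity \<open>et\<close>(h1 z) h2 = hz. For colinearity,
  \<lambda>(zm) = z m_[-1] \<otimes> m_[0], and the \<Delta>(1) contained in \<Delta>(z) = z1_1
  \<otimes> 1_2 is absorbed by the coaction of m.\<close>

lemma lunit_LL:
 assumes M: "yd_LL R H M"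
 shows "left_lunit TL UL M = (TL UL M, restrict (%x. Sw UL M M x (%z m. act M z m)) (carrier (TL UL M)), M)"
  "left_lunit TL UL M \<in> Iso LL (TL UL M) M"
proof -
 note U = unit_LL_yd(1)
 note [simp] = yd_LL_simps[OF M] yd_LL_simps[OF U] tensor_LL_simps[OF U M] unit_LL_pt[OF yd_LL_module[OF M]]
  lin_simps(4)[OF yd_LL_coact(1)[OF M] yd_LL_module[OF M] tensor_module[OF H_module yd_LL_module[OF M]]]
 let ?T = "TL UL M" and ?\<phi> = "%x. Sw UL M M x (%z m. act M z m)"
 show eq: "left_lunit TL UL M = (?T, restrict ?\<phi> (carrier ?T), M)"
  by (auto simp: left_lunit_def sweedler_Sw[of UL M] intro!: restrict_ext)
 have arr: "arrLL ?T (restrict ?\<phi> (carrier ?T)) M"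
 proof (rule arrLLI_id[OF tensor_LL_yd(1)[OF U M] M])
  fix h x assume h [simp]: "h .: H" and x [simp]: "x .: ?T"
  have "?\<phi> (act ?T h x) = D M h (%u v. Sw UL M M x (%z m. act M (et (u .* z) .* v) m))"
   by (simp add: tensor_LL_Sw_act[OF U M])
  also have "... = Sw UL M M x (%z m. D M h (%u v. act M (et (u .* z) .* v) m))"
   by (rule Sw_swap) simp_all
  also have "... = act M h (?\<phi> x)"
   by (simp add: D_eps_t_mult[of h _ M "%y. act M y _"])
  finally show "?\<phi> (act ?T h x) = act M h (?\<phi> x)" .
 next
  fix x assume x [simp]: "x .: ?T"
  let ?Q = "H ** M"
  have "LC M ?Q (?\<phi> x) (pt H M) = Sw UL M ?Q x (%z m. LC M ?Q (act M z m) (pt H M))"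
   by simp
  also have "... = Sw UL M ?Q x (%z m. LC M ?Q m (%a m0. pt H M (z .* a) m0))"
   using LL_act_Ht[OF M, of _ _ ?Q "pt H M"] by (intro Sw_eqI) simp
  also have "... = Sw UL M ?Q x (%z m. D ?Q z (%a z0. LC M ?Q m (%b m0. pt H M (a .* b) (act M z0 m0))))"
  proof (rule Sw_eqI)
   fix z m assume z: "z .: UL" and m [simp]: "m .: M"
   have zt: "z \<in> Ht" and [simp]: "z .: H" using z by simp_all
   have "D ?Q z (%a z0. LC M ?Q m (%b m0. pt H M (a .* b) (act M z0 m0)))
     = D ?Q uH (%u v. LC M ?Q m (%b m0. pt H M (z .* u .* b) (act M v m0)))"
    by (simp add: D_Ht(1)[OF zt])
   also have "... = LC M ?Q m (%b m0. pt H M (z .* b) m0)"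
    using LL_unit[OF M m, of ?Q "%b m0. pt H M (z .* b) m0"] by simp
   finally show "LC M ?Q m (%a m0. pt H M (z .* a) m0)
     = D ?Q z (%a z0. LC M ?Q m (%b m0. pt H M (a .* b) (act M z0 m0)))" ..
  qed
  also have "... = LC ?T ?Q x (%a y. pt H M a (?\<phi> y))"
   by (simp add: tensor_LL_yd(2)[OF U M] unit_LL_yd(2))
  finally show "LC M ?Q (?\<phi> x) (pt H M) = LC ?T ?Q x (%a y. pt H M a (?\<phi> y))" .
 qed simp
 \<comment> \<open>The inverse sends m to 1 \<otimes> m projected into the tensor product, that is,
   to \<Delta>(1)(1 \<otimes> m).\<close>
 let ?\<psi> = "%m. ldiag UL (act UL) M (act M) uH (pt UL M uH m)"
 have \<psi>: "?\<psi> m = D (UL ** M) uH (%u v. pt UL M (et u) (act M v m))" if "m .: M" for m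
  using that by (simp add: ldiag_pt[OF yd_LL_lact[OF U] yd_LL_lact[OF M]])
 show "left_lunit TL UL M \<in> Iso LL (TL UL M) M" unfolding eq
 proof (rule LL_inverse(3)[OF arr])
  fix m assume m [simp]: "m .: M"
  show "?\<psi> m .: ?T" using retractD(7)[OF tensor_LL_retract[OF U M]] by simp
  have "?\<phi> (?\<psi> m) = m"
   using D_eps_mult(1)[of uH M "%x. act M x m"] by (simp add: \<psi>)
  then show "restrict ?\<phi> (carrier ?T) (?\<psi> m) = m" using \<open>?\<psi> m .: ?T\<close> by simp
 next
  fix x assume x [simp]: "x .: ?T"
  let ?V = "UL ** M"
  have "?\<psi> (?\<phi> x) = D ?V uH (%u v. pt UL M (et u) (act M v (?\<phi> x)))" by (rule \<psi>) simp
  also have "... = D ?V uH (%u v. Sw UL M ?V x (%z m. pt UL M (et u) (act M (v .* z) m)))"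
   by simp
  also have "... = Sw UL M ?V x (%z m. D ?V uH (%u v. pt UL M (et u) (act M (v .* z) m)))"
   by (rule Sw_swap) simp_all
  also have "... = Sw UL M ?V x (%z m. D ?V uH (%u v. pt UL M (act UL u z) (act M v m)))"
  proof (rule Sw_eqI)
   fix z m assume z: "z .: UL" and m [simp]: "m .: M"
   have zt: "z \<in> Ht" and [simp]: "z .: H" using z by simp_all
   show "D ?V uH (%u v. pt UL M (et u) (act M (v .* z) m)) = D ?V uH (%u v. pt UL M (act UL u z) (act M v m))"
    using D_one_Ht[OF zt, of ?V "%a b. pt UL M (et a) (act M b m)"] zt by simp
  qed
  also have "... = x" using tensor_LL_Sw_unit(2)[OF U M x, of ?V "pt UL M"] by simp
  finally show "?\<psi> (restrict ?\<phi> (carrier ?T) x) = x" by simp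
 qed
qed

text \<open>The element \<open>esb z\<close> of H_s satisfies
  \<open>et\<close>(\<open>esb z\<close>) = z for z in H_t, so the rule for \<lambda>(ym) with y in
  H_s makes the coaction of \<open>esb z\<close> m equal to m_[-1] z \<otimes> m_[0].\<close>

lemma runit_LL:
 assumes M: "yd_LL R H M"
 shows "left_runit H TL UL M = (TL M UL, restrict (%x. Sw M UL M x (%m z. act M (esb z) m)) (carrier (TL M UL)), M)"
  "left_runit H TL UL M \<in> Iso LL (TL M UL) M"
proof -
 note U = unit_LL_yd(1)
 note [simp] = yd_LL_simps[OF M] yd_LL_simps[OF U] tensor_LL_simps[OF M U] unit_LL_pt[OF yd_LL_module[OF M]]
  lin_simps(4)[OF yd_LL_coact(1)[OF M] yd_LL_module[OF M] tensor_module[OF H_module yd_LL_module[OF M]]]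
 let ?T = "TL M UL" and ?\<phi> = "%x. Sw M UL M x (%m z. act M (esb z) m)"
 show eq: "left_runit H TL UL M = (?T, restrict ?\<phi> (carrier ?T), M)"
  by (auto simp: left_runit_def sweedler_Sw[of M UL] intro!: restrict_ext)
 have arr: "arrLL ?T (restrict ?\<phi> (carrier ?T)) M"
 proof (rule arrLLI_id[OF tensor_LL_yd(1)[OF M U] M])
  fix h x assume h [simp]: "h .: H" and x [simp]: "x .: ?T"
  have "?\<phi> (act ?T h x) = D M h (%u v. Sw M UL M x (%m z. act M (esb (v .* z) .* u) m))"
   by (simp add: tensor_LL_Sw_act[OF M U])
  also have "... = Sw M UL M x (%m z. D M h (%u v. act M (esb (v .* z) .* u) m))"
   by (rule Sw_swap) simp_all
  also have "... = act M h (?\<phi> x)"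
   by (simp add: D_eps_sb_mult[of h _ M "%y. act M y _"])
  finally show "?\<phi> (act ?T h x) = act M h (?\<phi> x)" .
 next
  fix x assume x [simp]: "x .: ?T"
  let ?Q = "H ** M"
  have "LC M ?Q (?\<phi> x) (pt H M) = Sw M UL ?Q x (%m z. LC M ?Q (act M (esb z) m) (pt H M))"
   by simp
  also have "... = Sw M UL ?Q x (%m z. LC M ?Q m (%a m0. pt H M (a .* z) m0))"
   using LL_act_Hs[OF M, of _ "esb _" ?Q "pt H M"] by (intro Sw_eqI) simp
  also have "... = Sw M UL ?Q x (%m z. LC M ?Q m (%a m0. D ?Q z (%b z0. pt H M (a .* b) (act M (esb z0) m0))))"
  proof (rule Sw_eqI)
   fix z m assume z: "z .: UL" and m [simp]: "m .: M"
   have zt: "z \<in> Ht" and [simp]: "z .: H" using z by simp_all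
   have "LC M ?Q m (%a m0. D ?Q z (%b z0. pt H M (a .* b) (act M (esb z0) m0)))
     = LC M ?Q m (%a m0. D ?Q uH (%u v. pt H M (a .* u .* z) (act M (esb v) m0)))"
    by (simp add: D_Ht(2)[OF zt])
   also have "... = D ?Q uH (%u v. LC M ?Q m (%a m0. pt H M (a .* u .* z) (act M (esb v) m0)))"
    by (rule Sw_swap) simp_all
   \<comment> \<open>Balancedness over H_s moves \<open>esb v\<close> from m_[0] into the H-leg next
     to u, where the sum of \<open>esb v .* u\<close> over \<Delta>(1) is 1.\<close>
   also have "... = D ?Q uH (%u v. LC M ?Q m (%a m0. pt H M (a .* esb v .* u .* z) m0))"
   proof (rule Sw_eqI)
    fix u v assume [simp]: "u .: H" "v .: H"
    show "LC M ?Q m (%a m0. pt H M (a .* u .* z) (act M (esb v) m0)) = LC M ?Q m (%a m0. pt H M (a .* esb v .* u .* z) m0)"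
     using LL_Hs[OF M m, of "esb v" ?Q "%a m0. pt H M (a .* u .* z) m0"] by simp
   qed
   also have "... = LC M ?Q m (%a m0. D ?Q uH (%u v. pt H M (a .* esb v .* u .* z) m0))"
    by (rule Sw_swap) simp_all
   also have "... = LC M ?Q m (%a m0. pt H M (a .* z) m0)"
   proof (rule Sw_eqI)
    fix a m0 assume [simp]: "a .: H" "m0 .: M"
    show "D ?Q uH (%u v. pt H M (a .* esb v .* u .* z) m0) = pt H M (a .* z) m0"
     using D_eps_mult(2)[of uH ?Q "%y. pt H M (a .* y .* z) m0"] by simp
   qed
   finally show "LC M ?Q m (%a m0. pt H M (a .* z) m0)
     = LC M ?Q m (%a m0. D ?Q z (%b z0. pt H M (a .* b) (act M (esb z0) m0)))" ..
  qed
  also have "... = LC ?T ?Q x (%a y. pt H M a (?\<phi> y))"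
   by (simp add: tensor_LL_yd(2)[OF M U] unit_LL_yd(2))
  finally show "LC M ?Q (?\<phi> x) (pt H M) = LC ?T ?Q x (%a y. pt H M a (?\<phi> y))" .
 qed simp
 let ?\<psi> = "%m. ldiag M (act M) UL (act UL) uH (pt M UL m uH)"
 have \<psi>: "?\<psi> m = D (M ** UL) uH (%u v. pt M UL (act M u m) (et v))" if "m .: M" for m
  using that by (simp add: ldiag_pt[OF yd_LL_lact[OF M] yd_LL_lact[OF U]])
 show "left_runit H TL UL M \<in> Iso LL (TL M UL) M" unfolding eq
 proof (rule LL_inverse(3)[OF arr])
  fix m assume m [simp]: "m .: M"
  show "?\<psi> m .: ?T" using retractD(7)[OF tensor_LL_retract[OF M U]] by simp
  have "?\<phi> (?\<psi> m) = m"
   using D_eps_mult(2)[of uH M "%x. act M x m"] by (simp add: \<psi>)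
  then show "restrict ?\<phi> (carrier ?T) (?\<psi> m) = m" using \<open>?\<psi> m .: ?T\<close> by simp
 next
  fix x assume x [simp]: "x .: ?T"
  let ?V = "M ** UL"
  have "?\<psi> (?\<phi> x) = D ?V uH (%u v. pt M UL (act M u (?\<phi> x)) (et v))" by (rule \<psi>) simp
  also have "... = D ?V uH (%u v. Sw M UL ?V x (%m z. pt M UL (act M (u .* esb z) m) (et v)))"
   by simp
  also have "... = Sw M UL ?V x (%m z. D ?V uH (%u v. pt M UL (act M (u .* esb z) m) (et v)))"
   by (rule Sw_swap) simp_all
  also have "... = Sw M UL ?V x (%m z. D ?V uH (%u v. pt M UL (act M u m) (act UL v z)))"
  proof (rule Sw_eqI)
   fix z m assume z: "z .: UL" and m [simp]: "m .: M"
   have zt: "z \<in> Ht" and [simp]: "z .: H" using z by simp_all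
   show "D ?V uH (%u v. pt M UL (act M (u .* esb z) m) (et v)) = D ?V uH (%u v. pt M UL (act M u m) (act UL v z))"
    using D_one_Hs[of "esb z" ?V "%a b. pt M UL (act M a m) (et b)"] zt by simp
  qed
  also have "... = x" using tensor_LL_Sw_unit(2)[OF M U x, of ?V "pt M UL"] by simp
  finally show "?\<psi> (restrict ?\<phi> (carrier ?T) x) = x" by simp
 qed
qed

subsection \<open>The braiding\<close>

abbreviation brLL where "brLL M N x \<equiv> Sw M N (N ** M) x (%m n. LC M (N ** M) m (%a m0. pt N M (act N a n) m0))"
text \<open>The map n \<otimes> m to m_[0] \<otimes> T(m_[-1]) n. It is literally the left-right
  braiding for the coaction twisted by T, which is why the inverse braiding appears on the
  left-right side.\<close>

abbreviation brLL_inv where "brLL_inv M N y \<equiv> Sw N M (M ** N) y (%n m. LC M (M ** N) m (%a m0. pt M N m0 (act N (T a) n)))"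

lemma braid_LL_eq:
 assumes M: "yd_LL R H M" and N: "yd_LL R H N"
 shows "braid_LL R TL M N = (TL M N, restrict (brLL M N) (carrier (TL M N)), TL N M)"
proof -
 note [simp] = yd_LL_simps[OF M] yd_LL_simps[OF N] tensor_LL_simps[OF M N]
 have conv: "m .: M ==> sweedler (N ** M) (coact M m) g = LC M (N ** M) m g" for m g
  by (rule sweedler_Sw; simp)
 show ?thesis by (auto simp: braid_LL_def sweedler_Sw[of M N] conv intro!: restrict_ext)
qed

text \<open>Linearity is the compatibility condition of M; colinearity combines coassociativity of
  the coaction of M with the compatibility condition of N.\<close>

lemma braid_LL_arr:
 assumes M: "yd_LL R H M" and N: "yd_LL R H N"
 shows "arrLL (TL M N) (restrict (brLL M N) (carrier (TL M N))) (TL N M)"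
proof -
 note [simp] = yd_LL_simps[OF M] yd_LL_simps[OF N] tensor_LL_simps[OF M N]
 let ?V = "N ** M"
 show ?thesis
 proof (rule arrLLI_tensor[OF tensor_LL_yd(1)[OF M N] N M])
  fix x assume x [simp]: "x .: (TL M N)"
  have "ldiag N (act N) M (act M) uH (brLL M N x)
    = D ?V uH (%u v. Sw M N ?V x (%m n. LC M ?V m (%a m0. pt N M (act N (u .* a) n) (act M v m0))))"
   by (simp add: ldiag_eq)
  also have "... = Sw M N ?V x (%m n. D ?V uH (%u v. LC M ?V m (%a m0. pt N M (act N (u .* a) n) (act M v m0))))"
   by (rule Sw_swap) simp_all
  also have "... = brLL M N x"
   by (simp add: LL_unit[OF M, of _ ?V "%a m0. pt N M (act N a _) m0"])
  finally show "ldiag N (act N) M (act M) uH (brLL M N x) = brLL M N x" .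
  fix h assume h [simp]: "h .: H"
  have "brLL M N (act (TL M N) h x)
    = D ?V h (%u v. Sw M N ?V x (%m n. LC M ?V (act M u m) (%a m0. pt N M (act N (a .* v) n) m0)))"
   by (simp add: tensor_LL_Sw_act[OF M N])
  also have "... = Sw M N ?V x (%m n. D ?V h (%u v. LC M ?V (act M u m) (%a m0. pt N M (act N (a .* v) n) m0)))"
   by (rule Sw_swap) simp_all
  also have "... = Sw M N ?V x (%m n. D ?V h (%u v. LC M ?V m (%a m0. pt N M (act N (u .* a) n) (act M v m0))))"
   by (simp add: LL_yd[OF M, of _ h ?V "%a m0. pt N M (act N a _) m0"])
  also have "... = D ?V h (%u v. Sw M N ?V x (%m n. LC M ?V m (%a m0. pt N M (act N (u .* a) n) (act M v m0))))"
   by (rule Sw_swap) simp_all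
  also have "... = ldiag N (act N) M (act M) h (brLL M N x)" by (simp add: ldiag_eq)
  finally show "brLL M N (act (TL M N) h x) = ldiag N (act N) M (act M) h (brLL M N x)" .
 next
  fix x assume x [simp]: "x .: (TL M N)"
  let ?Q = "H ** ?V"
  have "Sw N M ?Q (brLL M N x) (%m n. LC N ?Q m (%a m0. LC M ?Q n (%b n0. pt H ?V (a .* b) (pt N M m0 n0))))
   = Sw M N ?Q x (%m n. LC M ?Q m (%a m0. LC N ?Q (act N a n) (%b n0. LC M ?Q m0 (%c m1. pt H ?V (b .* c) (pt N M n0 m1)))))"
   by simp
  also have "... = Sw M N ?Q x (%m n. LC M ?Q m (%a m0. LC M ?Q m0 (%c m1. LC N ?Q n (%b n0. pt H ?V (a .* b) (pt N M (act N c n0) m1)))))"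
  proof (rule Sw_eqI)
   fix m n assume [simp]: "m .: M" "n .: N"
   have "LC M ?Q m (%a m0. LC N ?Q (act N a n) (%b n0. LC M ?Q m0 (%c m1. pt H ?V (b .* c) (pt N M n0 m1))))
    = LC M ?Q m (%a m0. LC M ?Q m0 (%c m1. LC N ?Q (act N a n) (%b n0. pt H ?V (b .* c) (pt N M n0 m1))))"
    by (rule Sw_eqI, rule Sw_swap) simp_all
   also have "... = LC M ?Q m (%a m1. D ?Q a (%u c. LC N ?Q (act N u n) (%b n0. pt H ?V (b .* c) (pt N M n0 m1))))"
    by (rule LC_coassoc[OF yd_LL_D(2)[OF M], symmetric]) simp_all
   also have "... = LC M ?Q m (%a m1. D ?Q a (%u c. LC N ?Q n (%b n0. pt H ?V (u .* b) (pt N M (act N c n0) m1))))"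
    by (simp add: LL_yd[OF N, of _ _ ?Q "%b n0. pt H ?V b (pt N M n0 _)"])
   also have "... = LC M ?Q m (%a m0. LC M ?Q m0 (%c m1. LC N ?Q n (%b n0. pt H ?V (a .* b) (pt N M (act N c n0) m1))))"
    by (rule LC_coassoc[OF yd_LL_D(2)[OF M]]) simp_all
   finally show "LC M ?Q m (%a m0. LC N ?Q (act N a n) (%b n0. LC M ?Q m0 (%c m1. pt H ?V (b .* c) (pt N M n0 m1)))) = ..." .
  qed
  also have "... = Sw M N ?Q x (%m n. LC M ?Q m (%a m0. LC N ?Q n (%b n0. LC M ?Q m0 (%c m1. pt H ?V (a .* b) (pt N M (act N c n0) m1)))))"
   by (rule Sw_eqI, rule Sw_eqI, rule Sw_swap) simp_all
  also have "... = LC (TL M N) ?Q x (%a y. pt H ?V a (brLL M N y))"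
   by (simp add: tensor_LL_yd(2)[OF M N])
  finally show "Sw N M ?Q (brLL M N x) (%m n. LC N ?Q m (%a m0. LC M ?Q n (%b n0. pt H ?V (a .* b) (pt N M m0 n0))))
    = LC (TL M N) ?Q x (%a y. pt H ?V a (brLL M N y))" .
 qed simp
qed

text \<open>In the two composites the iterated coaction contracts through h2 T(h1) =
  \<open>esb h\<close> and T(h2) h1 = \<open>etb h\<close>. Unfolding these projections and applying
  counitality to the pairing turns the result into the action of \<Delta>(1), which is trivial on
  elements of the tensor product.\<close>

lemma braid_LL_inv:
 assumes M: "yd_LL R H M" and N: "yd_LL R H N"
 shows "y .: (TL N M) ==> brLL_inv M N y .: (TL M N)"
  "y .: (TL N M) ==> brLL M N (brLL_inv M N y) = y"
  "x .: (TL M N) ==> brLL_inv M N (brLL M N x) = x"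
proof -
 note [simp] = yd_LL_simps[OF M] yd_LL_simps[OF N] tensor_LL_simps[OF M N] tensor_LL_simps[OF N M]
 note [simp] = bilin_simps(4)[OF lactD(2)[OF yd_LL_lact[OF N]] H_module yd_LL_module[OF N] yd_LL_module[OF N]]
 let ?V = "N ** M" and ?W = "M ** N"
 {
  assume y [simp]: "y .: (TL N M)"
  have "ldiag M (act M) N (act N) uH (brLL_inv M N y)
    = D ?W uH (%u v. Sw N M ?W y (%n m. LC M ?W m (%a m0. pt M N (act M u m0) (act N (v .* T a) n))))"
   by (simp add: ldiag_eq)
  also have "... = Sw N M ?W y (%n m. D ?W uH (%u v. LC M ?W m (%a m0. pt M N (act M u m0) (act N (v .* T a) n))))"
   by (rule Sw_swap) simp_all
  also have "... = brLL_inv M N y"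
  proof (rule Sw_eqI)
   fix n m assume [simp]: "n .: N" "m .: M"
   have "D ?W uH (%u v. LC M ?W m (%a m0. pt M N (act M u m0) (act N (v .* T a) n)))
     = D ?W uH (%u v. LC M ?W m (%a m0. pt M N (act M (es u) m0) (act N (v .* T a) n)))"
    by (rule D_one_eps(2)[symmetric]) simp_all
   \<comment> \<open>The left leg of \<Delta>(1) is carried over from m_[0] to the other factor,
     where T reverses its order so that v T(u) meets and contracts to \<open>esb\<close> of 1, which
     is 1.\<close>
   also have "... = D ?W uH (%u v. LC M ?W m (%a m0. pt M N m0 (act N (v .* T (a .* es u)) n)))"
   proof (rule Sw_eqI)
    fix u v assume [simp]: "u .: H" "v .: H"
    show "LC M ?W m (%a m0. pt M N (act M (es u) m0) (act N (v .* T a) n))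
      = LC M ?W m (%a m0. pt M N m0 (act N (v .* T (a .* es u)) n))"
     by (rule LL_Hs[OF M, symmetric]) simp_all
   qed
   also have "... = D ?W uH (%u v. LC M ?W m (%a m0. pt M N m0 (act N (v .* T (a .* u)) n)))"
    by (rule D_one_eps(2)) simp_all
   also have "... = LC M ?W m (%a m0. D ?W uH (%u v. pt M N m0 (act N (v .* T u .* T a) n)))"
    by (subst Sw_swap) simp_all
   also have "... = LC M ?W m (%a m0. pt M N m0 (act N (T a) n))"
   proof (rule Sw_eqI)
    fix a m0 assume [simp]: "a .: H" "m0 .: M"
    have "esb uH = uH" using D_counit(2)[of uH H "%x. x"] by (simp add: eps_D(3))
    then show "D ?W uH (%u v. pt M N m0 (act N (v .* T u .* T a) n)) = pt M N m0 (act N (T a) n)"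
     using D_antipode_inv(1)[of uH ?W "%w. pt M N m0 (act N (w .* T a) n)"] by simp
   qed
   finally show "D ?W uH (%u v. LC M ?W m (%a m0. pt M N (act M u m0) (act N (v .* T a) n)))
     = LC M ?W m (%a m0. pt M N m0 (act N (T a) n))" .
  qed
  finally show "brLL_inv M N y .: (TL M N)" by (simp add: tensor_LL_carrier_iff[OF M N])
  have "brLL M N (brLL_inv M N y)
    = Sw N M ?V y (%n m. LC M ?V m (%a m0. LC M ?V m0 (%b m1. pt N M (act N (b .* T a) n) m1)))"
   by simp
  also have "... = Sw N M ?V y (%n m. LC M ?V m (%a m0. D ?V a (%b c. pt N M (act N (c .* T b) n) m0)))"
   by (rule Sw_eqI, rule LC_coassoc[OF yd_LL_D(2)[OF M], symmetric]) simp_all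
  also have "... = Sw N M ?V y (%n m. LC M ?V m (%a m0. pt N M (act N (esb a) n) m0))"
   by (simp add: D_antipode_inv(1)[of _ ?V "%w. pt N M (act N w _) _"])
  also have "... = Sw N M ?V y (%n m. D ?V uH (%u v. pt N M (act N u n) (act M v m)))"
  proof (rule Sw_eqI)
   fix n m assume [simp]: "n .: N" "m .: M"
   have "LC M ?V m (%a m0. pt N M (act N (esb a) n) m0)
     = LC M ?V m (%a m0. D ?V uH (%u v. eH (v .* a) *[?V] pt N M (act N u n) m0))"
    by (simp add: eps_D(3))
   also have "... = D ?V uH (%u v. LC M ?V m (%a m0. eH (v .* a) *[?V] pt N M (act N u n) m0))"
    by (rule Sw_swap) simp_all
   also have "... = D ?V uH (%u v. LC M ?V m (%a m0. eH (et v .* a) *[?V] pt N M (act N u n) m0))"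
    by (rule D_one_eps(1)[symmetric]) simp_all
   also have "... = D ?V uH (%u v. pt N M (act N u n) (act M (et v) m))"
    by (simp add: LL_counit_Ht[OF M, of _ "et _" ?V "%x. pt N M (act N _ n) x"])
   also have "... = D ?V uH (%u v. pt N M (act N u n) (act M v m))"
    by (rule D_one_eps(1)) simp_all
   finally show "LC M ?V m (%a m0. pt N M (act N (esb a) n) m0) = ..." .
  qed
  also have "... = y" using tensor_LL_Sw_unit(2)[OF N M y, of ?V "pt N M"] by simp
  finally show "brLL M N (brLL_inv M N y) = y" .
 }
 assume x [simp]: "x .: (TL M N)"
 have "brLL_inv M N (brLL M N x)
   = Sw M N ?W x (%m n. LC M ?W m (%a m0. LC M ?W m0 (%b m1. pt M N m1 (act N (T b .* a) n))))"
  by simp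
 also have "... = Sw M N ?W x (%m n. LC M ?W m (%a m0. D ?W a (%b c. pt M N m0 (act N (T c .* b) n))))"
  by (rule Sw_eqI, rule LC_coassoc[OF yd_LL_D(2)[OF M], symmetric]) simp_all
 also have "... = Sw M N ?W x (%m n. LC M ?W m (%a m0. pt M N m0 (act N (etb a) n)))"
  by (simp add: D_antipode_inv(2)[of _ ?W "%w. pt M N _ (act N w _)"])
 also have "... = Sw M N ?W x (%m n. D ?W uH (%u v. pt M N (act M u m) (act N v n)))"
 proof (rule Sw_eqI)
  fix m n assume [simp]: "n .: N" "m .: M"
  have "LC M ?W m (%a m0. pt M N m0 (act N (etb a) n))
    = LC M ?W m (%a m0. D ?W uH (%u v. eH (a .* u) *[?W] pt M N m0 (act N v n)))"
   by (simp add: eps_D(4))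
  also have "... = D ?W uH (%u v. LC M ?W m (%a m0. eH (a .* u) *[?W] pt M N m0 (act N v n)))"
   by (rule Sw_swap) simp_all
  also have "... = D ?W uH (%u v. LC M ?W m (%a m0. eH (a .* es u) *[?W] pt M N m0 (act N v n)))"
   by (rule D_one_eps(2)[symmetric]) simp_all
  also have "... = D ?W uH (%u v. pt M N (act M (es u) m) (act N v n))"
  proof (rule Sw_eqI)
   fix u v assume [simp]: "u .: H" "v .: H"
   show "LC M ?W m (%a m0. eH (a .* es u) *[?W] pt M N m0 (act N v n)) = pt M N (act M (es u) m) (act N v n)"
    using LL_Hs[OF M, of m "es u" ?W "%a m0. eH a *[?W] pt M N m0 (act N v n)"]
     LC_counit[OF yd_LL_D(2)[OF M], of m ?W "%x. pt M N (act M (es u) x) (act N v n)"] by simp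
  qed
  also have "... = D ?W uH (%u v. pt M N (act M u m) (act N v n))"
   by (rule D_one_eps(2)) simp_all
  finally show "LC M ?W m (%a m0. pt M N m0 (act N (etb a) n)) = ..." .
 qed
 also have "... = x" using tensor_LL_Sw_unit(2)[OF M N x, of ?W "pt M N"] by simp
 finally show "brLL_inv M N (brLL M N x) = x" .
qed

lemma braid_LL_iso:
 assumes M: "yd_LL R H M" and N: "yd_LL R H N"
 shows "braid_LL R TL M N \<in> Iso LL (TL M N) (TL N M)"
  "inverse_arrows LL (braid_LL R TL M N) (TL N M, restrict (brLL_inv M N) (carrier (TL N M)), TL M N)"
proof -
 note i = LL_inverse[OF braid_LL_arr[OF M N], of "brLL_inv M N"]
 show "braid_LL R TL M N \<in> Iso LL (TL M N) (TL N M)"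
  unfolding braid_LL_eq[OF M N] by (rule i(3)) (simp_all add: braid_LL_inv[OF M N])
 show "inverse_arrows LL (braid_LL R TL M N) (TL N M, restrict (brLL_inv M N) (carrier (TL N M)), TL M N)"
  unfolding braid_LL_eq[OF M N] by (rule i(2)) (simp_all add: braid_LL_inv[OF M N])
qed

end

context weak_hopf_bij
begin

subsection \<open>The associativity constraint\<close>

text \<open>Evaluation of a trilinear map on an element of a triple tensor product, here for the
  left bracketing and in \<open>S3r\<close> for the right one. Such elements are determined by one
  of these evaluations in the ambient triple tensor product, so rebracketing is verified through
  them.\<close>

abbreviation S3 where "S3 A B C P x f \<equiv> Sw (TL A B) C P x (%y c. Sw A B P y (%a b. f a b c))"
abbreviation S3r where "S3r A B C P w f \<equiv> Sw A (TL B C) P w (%a u. Sw B C P u (%b c. f a b c))"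

definition ascLL where
 "ascLL A B C x = corestrict R A (TL B C) A (B ** C) (S3 A B C (A ** (B ** C)) x (%a b c. pt A (B ** C) a (pt B C b c)))"

definition ascLL' where
 "ascLL' A B C w = corestrict R (TL A B) C (A ** B) C (S3r A B C ((A ** B) ** C) w (%a b c. pt (A ** B) C (pt A B a b) c))"

context
 fixes A B C :: "('k, 'u) yd_module"
 assumes A: "yd_LL R H A" and B: "yd_LL R H B" and C: "yd_LL R H C"
begin

lemmas ABC_simps = yd_LL_simps[OF A] yd_LL_simps[OF B] yd_LL_simps[OF C]
 tensor_LL_simps[OF A B] tensor_LL_simps[OF B C]
 tensor_LL_simps[OF tensor_LL_yd(1)[OF A B] C] tensor_LL_simps[OF A tensor_LL_yd(1)[OF B C]]

lemma S3_act:
 assumes h: "h .: H" and x: "x .: (TL (TL A B) C)" and P: "module R P" and f: "trilin A B C P f"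
 shows "S3 A B C P (act (TL (TL A B) C) h x) f
  = D P h (%u r. D P r (%v w. S3 A B C P x (%a b c. f (act A u a) (act B v b) (act C w c))))"
proof -
 note AB = tensor_LL_yd(1)[OF A B]
 note [simp] = ABC_simps yd_LL_simps(1-5)[OF AB] h x P trilin_simps[OF f _ _ _ P]
 have "S3 A B C P (act (TL (TL A B) C) h x) f
   = D P h (%u w. Sw (TL A B) C P x (%y c. D P u (%p q. Sw A B P y (%a b. f (act A p a) (act B q b) (act C w c)))))"
  by (simp add: tensor_LL_Sw_act[OF AB C] tensor_LL_Sw_act[OF A B])
 also have "... = D P h (%u w. D P u (%p q. S3 A B C P x (%a b c. f (act A p a) (act B q b) (act C w c))))"
  by (rule Sw_eqI, rule Sw_swap) simp_all
 also have "... = D P h (%u r. D P r (%v w. S3 A B C P x (%a b c. f (act A u a) (act B v b) (act C w c))))"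
  by (rule coassoc) simp_all
 finally show ?thesis .
qed

lemma S3r_ldiag:
 assumes h: "h .: H" and w: "w .: (A ** TL B C)" and P: "module R P" and f: "trilin A B C P f"
 shows "S3r A B C P (ldiag A (act A) (TL B C) (act (TL B C)) h w) f
  = D P h (%u r. D P r (%p q. S3r A B C P w (%a b c. f (act A u a) (act B p b) (act C q c))))"
proof -
 note BC = tensor_LL_yd(1)[OF B C]
 note [simp] = ABC_simps yd_LL_simps(1-5)[OF BC] h w P trilin_simps[OF f _ _ _ P]
 have "S3r A B C P (ldiag A (act A) (TL B C) (act (TL B C)) h w) f
   = D P h (%u r. Sw A (TL B C) P w (%a y. D P r (%p q. Sw B C P y (%b c. f (act A u a) (act B p b) (act C q c)))))"
  by (simp add: Sw_ldiag[OF yd_LL_lact[OF A] yd_LL_lact[OF BC]] tensor_LL_Sw_act[OF B C])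
 also have "... = D P h (%u r. D P r (%p q. S3r A B C P w (%a b c. f (act A u a) (act B p b) (act C q c))))"
  by (rule Sw_eqI, rule Sw_swap) simp_all
 finally show ?thesis .
qed

lemma S3_ldiag:
 assumes h: "h .: H" and x: "x .: (TL A B ** C)" and P: "module R P" and f: "trilin A B C P f"
 shows "S3 A B C P (ldiag (TL A B) (act (TL A B)) C (act C) h x) f
  = D P h (%u r. D P r (%v w. S3 A B C P x (%a b c. f (act A u a) (act B v b) (act C w c))))"
proof -
 note AB = tensor_LL_yd(1)[OF A B]
 note [simp] = ABC_simps yd_LL_simps(1-5)[OF AB] h x P trilin_simps[OF f _ _ _ P]
 have "S3 A B C P (ldiag (TL A B) (act (TL A B)) C (act C) h x) f
   = D P h (%u w. Sw (TL A B) C P x (%y c. D P u (%p q. Sw A B P y (%a b. f (act A p a) (act B q b) (act C w c)))))"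
  by (simp add: Sw_ldiag[OF yd_LL_lact[OF AB] yd_LL_lact[OF C]] tensor_LL_Sw_act[OF A B])
 also have "... = D P h (%u w. D P u (%p q. S3 A B C P x (%a b c. f (act A p a) (act B q b) (act C w c))))"
  by (rule Sw_eqI, rule Sw_swap) simp_all
 also have "... = D P h (%u r. D P r (%v w. S3 A B C P x (%a b c. f (act A u a) (act B v b) (act C w c))))"
  by (rule coassoc) simp_all
 finally show ?thesis .
qed

text \<open>The first part says that the threefold coproduct of 1 acts trivially. For the second it
  is inserted, and \<Delta>(1) on the last two factors is absorbed by \<Delta> of its second leg;
  this shows that a left-bracketed element lies in A \<otimes> (B \<otimes>_t C) after
  rebracketing.\<close>

lemma S3_unit:
 assumes x: "x .: (TL (TL A B) C)" and P: "module R P" and f: "trilin A B C P f"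
 shows "D P uH (%u r. D P r (%v w. S3 A B C P x (%a b c. f (act A u a) (act B v b) (act C w c)))) = S3 A B C P x f"
  "S3 A B C P x (%a b c. D P uH (%s t. f a (act B s b) (act C t c))) = S3 A B C P x f"
proof -
 note AB = tensor_LL_yd(1)[OF A B]
 note [simp] = ABC_simps yd_LL_simps(1-5)[OF AB] x P trilin_simps[OF f _ _ _ P]
 have un: "D P uH (%u r. D P r (%v w. S3 A B C P x (%a b c. g (act A u a) (act B v b) (act C w c)))) = S3 A B C P x g"
  if "trilin A B C P g" for g
  using S3_act[OF hone_closed x P that] yd_LL_simps(2)[OF tensor_LL_yd(1)[OF AB C] x] by simp
 show "D P uH (%u r. D P r (%v w. S3 A B C P x (%a b c. f (act A u a) (act B v b) (act C w c)))) = S3 A B C P x f"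
  by (rule un[OF f])
 have "S3 A B C P x (%a b c. D P uH (%s t. f a (act B s b) (act C t c)))
  = D P uH (%u r. D P r (%v w. S3 A B C P x (%a b c. D P uH (%s t. f (act A u a) (act B (s .* v) b) (act C (t .* w) c)))))"
  using un[of "%a b c. D P uH (%s t. f a (act B s b) (act C t c))"] by simp
 also have "... = D P uH (%u r. D P uH (%s t. D P r (%v w. S3 A B C P x (%a b c. f (act A u a) (act B (s .* v) b) (act C (t .* w) c)))))"
 proof (rule Sw_eqI)
  fix u r assume [simp]: "u .: H" "r .: H"
  have "S3 A B C P x (%a b c. D P uH (%s t. f (act A u a) (act B (s .* v) b) (act C (t .* w) c)))
    = D P uH (%s t. S3 A B C P x (%a b c. f (act A u a) (act B (s .* v) b) (act C (t .* w) c)))"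
   if [simp]: "v .: H" "w .: H" for v w
  proof -
   have "S3 A B C P x (%a b c. D P uH (%s t. f (act A u a) (act B (s .* v) b) (act C (t .* w) c)))
     = Sw (TL A B) C P x (%y c. D P uH (%s t. Sw A B P y (%a b. f (act A u a) (act B (s .* v) b) (act C (t .* w) c))))"
    by (rule Sw_eqI, rule Sw_swap) simp_all
   also have "... = D P uH (%s t. S3 A B C P x (%a b c. f (act A u a) (act B (s .* v) b) (act C (t .* w) c)))"
    by (rule Sw_swap) simp_all
   finally show ?thesis .
  qed
  then have "D P r (%v w. S3 A B C P x (%a b c. D P uH (%s t. f (act A u a) (act B (s .* v) b) (act C (t .* w) c))))
    = D P r (%v w. D P uH (%s t. S3 A B C P x (%a b c. f (act A u a) (act B (s .* v) b) (act C (t .* w) c))))"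
   by simp
  also have "... = D P uH (%s t. D P r (%v w. S3 A B C P x (%a b c. f (act A u a) (act B (s .* v) b) (act C (t .* w) c))))"
   by (rule Sw_swap) simp_all
  finally show "D P r (%v w. S3 A B C P x (%a b c. D P uH (%s t. f (act A u a) (act B (s .* v) b) (act C (t .* w) c)))) = ..." .
 qed
 also have "... = D P uH (%u r. D P r (%v w. S3 A B C P x (%a b c. f (act A u a) (act B v b) (act C w c))))"
  by (simp add: D_one(1)[of _ P "%v w. S3 A B C P x (%a b c. f (act A _ a) (act B v b) (act C w c))"])
 also have "... = S3 A B C P x f" by (rule un[OF f])
 finally show "S3 A B C P x (%a b c. D P uH (%s t. f a (act B s b) (act C t c))) = S3 A B C P x f" .
qed

lemma S3r_unit:
 assumes w: "w .: (TL A (TL B C))" and P: "module R P" and f: "trilin A B C P f"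
 shows "D P uH (%u r. D P r (%p q. S3r A B C P w (%a b c. f (act A u a) (act B p b) (act C q c)))) = S3r A B C P w f"
  "S3r A B C P w (%a b c. D P uH (%s t. f (act A s a) (act B t b) c)) = S3r A B C P w f"
proof -
 note BC = tensor_LL_yd(1)[OF B C]
 note [simp] = ABC_simps yd_LL_simps(1-5)[OF BC] w P trilin_simps[OF f _ _ _ P]
 have un: "D P uH (%u r. D P r (%p q. S3r A B C P w (%a b c. g (act A u a) (act B p b) (act C q c)))) = S3r A B C P w g"
  if "trilin A B C P g" for g
  using S3r_ldiag[OF hone_closed _ P that, of w] w tensor_LL_carrier_iff[OF A BC] by simp
 show "D P uH (%u r. D P r (%p q. S3r A B C P w (%a b c. f (act A u a) (act B p b) (act C q c)))) = S3r A B C P w f"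
  by (rule un[OF f])
 have "S3r A B C P w (%a b c. D P uH (%s t. f (act A s a) (act B t b) c))
  = D P uH (%u r. D P r (%p q. S3r A B C P w (%a b c. D P uH (%s t. f (act A (s .* u) a) (act B (t .* p) b) (act C q c)))))"
  using un[of "%a b c. D P uH (%s t. f (act A s a) (act B t b) c)"] by simp
 also have "... = D P uH (%r q. D P r (%u p. S3r A B C P w (%a b c. D P uH (%s t. f (act A (s .* u) a) (act B (t .* p) b) (act C q c)))))"
  by (rule coassoc[symmetric]) simp_all
 also have "... = D P uH (%r q. D P uH (%s t. D P r (%u p. S3r A B C P w (%a b c. f (act A (s .* u) a) (act B (t .* p) b) (act C q c)))))"
 proof (rule Sw_eqI)
  fix r q assume [simp]: "r .: H" "q .: H"
  have "S3r A B C P w (%a b c. D P uH (%s t. f (act A (s .* u) a) (act B (t .* p) b) (act C q c)))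
    = D P uH (%s t. S3r A B C P w (%a b c. f (act A (s .* u) a) (act B (t .* p) b) (act C q c)))"
   if [simp]: "u .: H" "p .: H" for u p
  proof -
   have "S3r A B C P w (%a b c. D P uH (%s t. f (act A (s .* u) a) (act B (t .* p) b) (act C q c)))
     = Sw A (TL B C) P w (%a y. D P uH (%s t. Sw B C P y (%b c. f (act A (s .* u) a) (act B (t .* p) b) (act C q c))))"
    by (rule Sw_eqI, rule Sw_swap) simp_all
   also have "... = D P uH (%s t. S3r A B C P w (%a b c. f (act A (s .* u) a) (act B (t .* p) b) (act C q c)))"
    by (rule Sw_swap) simp_all
   finally show ?thesis .
  qed
  then have "D P r (%u p. S3r A B C P w (%a b c. D P uH (%s t. f (act A (s .* u) a) (act B (t .* p) b) (act C q c))))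
    = D P r (%u p. D P uH (%s t. S3r A B C P w (%a b c. f (act A (s .* u) a) (act B (t .* p) b) (act C q c))))"
   by simp
  also have "... = D P uH (%s t. D P r (%u p. S3r A B C P w (%a b c. f (act A (s .* u) a) (act B (t .* p) b) (act C q c))))"
   by (rule Sw_swap) simp_all
  finally show "D P r (%u p. S3r A B C P w (%a b c. D P uH (%s t. f (act A (s .* u) a) (act B (t .* p) b) (act C q c)))) = ..." .
 qed
 also have "... = D P uH (%r q. D P r (%u p. S3r A B C P w (%a b c. f (act A u a) (act B p b) (act C q c))))"
  by (simp add: D_one(1)[of _ P "%u p. S3r A B C P w (%a b c. f (act A u a) (act B p b) (act C _ c))"])
 also have "... = D P uH (%u r. D P r (%p q. S3r A B C P w (%a b c. f (act A u a) (act B p b) (act C q c))))"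
  by (rule coassoc) simp_all
 also have "... = S3r A B C P w f" by (rule un[OF f])
 finally show "S3r A B C P w (%a b c. D P uH (%s t. f (act A s a) (act B t b) c)) = S3r A B C P w f" .
qed

lemma S3r_inc:
 assumes "w .: (A ** TL B C)"
 shows "S3r A B C (A ** (B ** C)) w (%a b c. pt A (B ** C) a (pt B C b c)) = inc A (TL B C) A (B ** C) w"
proof (rule Sw_eqI)
 note [simp] = ABC_simps
 fix a u assume "a .: A" "u .: (TL B C)"
 then show "Sw B C (A ** (B ** C)) u (%b c. pt A (B ** C) a (pt B C b c)) = pt A (B ** C) a u"
  using pt_Sw(2)[of A "B ** C" B C "pt B C" a u] by simp
qed

lemma S3_inc:
 assumes "x .: (TL A B ** C)"
 shows "S3 A B C ((A ** B) ** C) x (%a b c. pt (A ** B) C (pt A B a b) c) = inc (TL A B) C (A ** B) C x"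
proof (rule Sw_eqI)
 note [simp] = ABC_simps
 fix u c assume "u .: (TL A B)" "c .: C"
 then show "Sw A B ((A ** B) ** C) u (%a b. pt (A ** B) C (pt A B a b) c) = pt (A ** B) C u c"
  using pt_Sw(1)[of "A ** B" C A B "pt A B" c u] by simp
qed

lemma S3r_ext:
 assumes "w .: (A ** TL B C)" "w' .: (A ** TL B C)"
  and "S3r A B C (A ** (B ** C)) w (%a b c. pt A (B ** C) a (pt B C b c))
   = S3r A B C (A ** (B ** C)) w' (%a b c. pt A (B ** C) a (pt B C b c))"
 shows "w = w'"
 using inc_inj[OF retract_id[OF yd_LL_module[OF A]] tensor_LL_retract[OF B C] assms(1,2)] assms(3)
 by (simp only: S3r_inc[OF assms(1)] S3r_inc[OF assms(2)])

lemma S3_ext: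
 assumes "x .: (TL A B ** C)" "x' .: (TL A B ** C)"
  and "S3 A B C ((A ** B) ** C) x (%a b c. pt (A ** B) C (pt A B a b) c)
   = S3 A B C ((A ** B) ** C) x' (%a b c. pt (A ** B) C (pt A B a b) c)"
 shows "x = x'"
 using inc_inj[OF tensor_LL_retract[OF A B] retract_id[OF yd_LL_module[OF C]] assms(1,2)] assms(3)
 by (simp only: S3_inc[OF assms(1)] S3_inc[OF assms(2)])

text \<open>Invariance under \<Delta>(1) on B and C makes the corestriction meaningful; invariance
  under the threefold coproduct of 1 then places its value in A \<otimes>_t (B \<otimes>_t C). The
  evaluation rule is all that later proofs need.\<close>

lemma ascLL_facts:
 assumes x: "x .: (TL (TL A B) C)"
 shows "ascLL A B C x .: (TL A (TL B C))"
  "module R (P :: ('k, 'p, 'q) module_scheme) ==> trilin A B C P f ==> S3r A B C P (ascLL A B C x) f = S3 A B C P x f"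
  "ascLL A B C x = Sw A (B ** C) (A ** TL B C) (S3 A B C (A ** (B ** C)) x (%a b c. pt A (B ** C) a (pt B C b c)))
   (%a u. pt A (TL B C) a (ldiag B (act B) C (act C) uH u))"
proof -
 note AB = tensor_LL_yd(1)[OF A B] and BC = tensor_LL_yd(1)[OF B C]
 note [simp] = ABC_simps yd_LL_simps(1-5)[OF AB] yd_LL_simps(1-5)[OF BC] x
 note rA = retract_id[OF yd_LL_module[OF A]] and rBC = tensor_LL_retract[OF B C]
 let ?W = "A ** (B ** C)" and ?p = "%a b c. pt A (B ** C) a (pt B C b c)"
 let ?F = "S3 A B C ?W x ?p"
 have F: "?F .: ?W" by simp
 have "Sw A (B ** C) ?W ?F (%a u. pt A (B ** C) a (ldiag B (act B) C (act C) uH u))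
   = S3 A B C ?W x (%a b c. D ?W uH (%s t. ?p a (act B s b) (act C t c)))"
  by (simp add: ldiag_pt[OF yd_LL_lact[OF B] yd_LL_lact[OF C]] retractD[OF rBC]
   lact_simps(3-5)[OF lact_ldiag[OF yd_LL_lact[OF B] yd_LL_lact[OF C]]])
 also have "... = ?F" by (rule S3_unit(2)) simp_all
 finally have fx: "Sw A (B ** C) ?W ?F (%a u. pt A (B ** C) a (ldiag B (act B) C (act C) uH u)) = ?F" .
 note cr = corestrict_retract[OF rA rBC F fx, folded ascLL_def]
 show "ascLL A B C x = Sw A (B ** C) (A ** TL B C) ?F (%a u. pt A (TL B C) a (ldiag B (act B) C (act C) uH u))"
  by (rule cr(1))
 have ev: "S3r A B C Q (ascLL A B C x) g = S3 A B C Q x g" if Q: "module R Q" and g: "trilin A B C Q g"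
  for Q :: "('k, 'pp, 'qq) module_scheme" and g
 proof -
  note [simp] = Q trilin_simps[OF g _ _ _ Q]
  show ?thesis unfolding ascLL_def by (subst Sw_corestrict[OF rA rBC F fx]) simp_all
 qed
 show "module R P ==> trilin A B C P f ==> S3r A B C P (ascLL A B C x) f = S3 A B C P x f"
  by (rule ev)
 have "ldiag A (act A) (TL B C) (act (TL B C)) uH (ascLL A B C x) = ascLL A B C x"
 proof (rule S3r_ext)
  show "S3r A B C ?W (ldiag A (act A) (TL B C) (act (TL B C)) uH (ascLL A B C x)) ?p = S3r A B C ?W (ascLL A B C x) ?p"
   using S3_unit(1)[OF x, of ?W ?p] cr(2) by (simp add: S3r_ldiag ev)
 qed (use cr(2) ldiag_closed[OF yd_LL_lact[OF A] yd_LL_lact[OF BC] hone_closed] in simp_all)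
 then show "ascLL A B C x .: (TL A (TL B C))" using cr(2) tensor_LL_carrier_iff[OF A BC] by simp
qed

lemma ascLL'_facts:
 assumes w: "w .: (TL A (TL B C))"
 shows "ascLL' A B C w .: (TL (TL A B) C)"
  "module R (P :: ('k, 'p, 'q) module_scheme) ==> trilin A B C P f ==> S3 A B C P (ascLL' A B C w) f = S3r A B C P w f"
proof -
 note AB = tensor_LL_yd(1)[OF A B] and BC = tensor_LL_yd(1)[OF B C]
 note [simp] = ABC_simps yd_LL_simps(1-5)[OF AB] yd_LL_simps(1-5)[OF BC] w
 note rC = retract_id[OF yd_LL_module[OF C]] and rAB = tensor_LL_retract[OF A B]
 let ?W = "(A ** B) ** C" and ?p = "%a b c. pt (A ** B) C (pt A B a b) c"
 let ?F = "S3r A B C ?W w ?p"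
 have F: "?F .: ?W" by simp
 have "Sw (A ** B) C ?W ?F (%u c. pt (A ** B) C (ldiag A (act A) B (act B) uH u) c)
   = S3r A B C ?W w (%a b c. D ?W uH (%s t. ?p (act A s a) (act B t b) c))"
  by (simp add: ldiag_pt[OF yd_LL_lact[OF A] yd_LL_lact[OF B]] retractD[OF rAB]
   lact_simps(3-5)[OF lact_ldiag[OF yd_LL_lact[OF A] yd_LL_lact[OF B]]])
 also have "... = ?F" by (rule S3r_unit(2)) simp_all
 finally have fx: "Sw (A ** B) C ?W ?F (%u c. pt (A ** B) C (ldiag A (act A) B (act B) uH u) c) = ?F" .
 note cr = corestrict_retract[OF rAB rC F fx, folded ascLL'_def]
 have ev: "S3 A B C Q (ascLL' A B C w) g = S3r A B C Q w g" if Q: "module R Q" and g: "trilin A B C Q g"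
  for Q :: "('k, 'pp, 'qq) module_scheme" and g
 proof -
  note [simp] = Q trilin_simps[OF g _ _ _ Q]
  show ?thesis unfolding ascLL'_def by (subst Sw_corestrict[OF rAB rC F fx]) simp_all
 qed
 show "module R P ==> trilin A B C P f ==> S3 A B C P (ascLL' A B C w) f = S3r A B C P w f"
  by (rule ev)
 have "ldiag (TL A B) (act (TL A B)) C (act C) uH (ascLL' A B C w) = ascLL' A B C w"
 proof (rule S3_ext)
  show "S3 A B C ?W (ldiag (TL A B) (act (TL A B)) C (act C) uH (ascLL' A B C w)) ?p = S3 A B C ?W (ascLL' A B C w) ?p"
   using S3r_unit(1)[OF w, of ?W ?p] cr(2) by (simp add: S3_ldiag ev)
 qed (use cr(2) ldiag_closed[OF yd_LL_lact[OF AB] yd_LL_lact[OF C] hone_closed] in simp_all)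
 then show "ascLL' A B C w .: (TL (TL A B) C)" using cr(2) tensor_LL_carrier_iff[OF AB C] by simp
qed

lemma ascLL_ascLL':
 "w .: (TL A (TL B C)) ==> ascLL A B C (ascLL' A B C w) = w"
 "x .: (TL (TL A B) C) ==> ascLL' A B C (ascLL A B C x) = x"
proof -
 note [simp] = ABC_simps ascLL_facts(1) ascLL'_facts(1)
 show "w .: (TL A (TL B C)) ==> ascLL A B C (ascLL' A B C w) = w"
  by (rule S3r_ext) (simp_all add: ascLL_facts(2) ascLL'_facts(2))
 show "x .: (TL (TL A B) C) ==> ascLL' A B C (ascLL A B C x) = x"
  by (rule S3_ext) (simp_all add: ascLL_facts(2) ascLL'_facts(2))
qed

lemma assoc_LL_eq:
 "assoc_arrow R TL A B C = (TL (TL A B) C, restrict (ascLL A B C) (carrier (TL (TL A B) C)), TL A (TL B C))"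
proof -
 note [simp] = ABC_simps
 have "sweedler (A ** (B ** C)) x (%y p. sweedler (A ** (B ** C)) y (%m n. pt A (B ** C) m (pt B C n p)))
   = S3 A B C (A ** (B ** C)) x (%a b c. pt A (B ** C) a (pt B C b c))" if "x .: (TL (TL A B) C)" for x
 proof -
  have "sweedler (A ** (B ** C)) x (%y p. sweedler (A ** (B ** C)) y (%m n. pt A (B ** C) m (pt B C n p)))
   = Sw (TL A B) C (A ** (B ** C)) x (%y p. sweedler (A ** (B ** C)) y (%m n. pt A (B ** C) m (pt B C n p)))"
   by (rule sweedler_Sw) (simp_all add: that)
  also have "... = S3 A B C (A ** (B ** C)) x (%a b c. pt A (B ** C) a (pt B C b c))"
   by (rule Sw_eqI, rule sweedler_Sw) simp_all
  finally show ?thesis .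
 qed
 then show ?thesis by (auto simp: assoc_arrow_def ascLL_def intro!: restrict_ext)
qed

text \<open>Colinearity is compared in H \<otimes> (A \<otimes> (B \<otimes> C)), where both
  coactions become the product of the three H-legs, equal by associativity of H. The retraction
  witnessing injectivity projects first into A \<otimes> (B \<otimes>_t C) and then into the
  object.\<close>

lemma assoc_LL_arr: "arrLL (TL (TL A B) C) (restrict (ascLL A B C) (carrier (TL (TL A B) C))) (TL A (TL B C))"
proof -
 note AB = tensor_LL_yd(1)[OF A B] and BC = tensor_LL_yd(1)[OF B C]
 note X = tensor_LL_yd(1)[OF AB C] and Y = tensor_LL_yd(1)[OF A BC]
 note [simp] = ABC_simps yd_LL_simps[OF X] yd_LL_simps(1-5)[OF AB] yd_LL_simps(1-5)[OF BC] ascLL_facts(1)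
 note rA = retract_id[OF yd_LL_module[OF A]] and rBC = tensor_LL_retract[OF B C] and rY = tensor_LL_retract[OF A BC]
 note [simp] = retractD[OF rBC] lin_compose[OF retractD(4)[OF rBC]]
 let ?W = "A ** (B ** C)" and ?p = "%a b c. pt A (B ** C) a (pt B C b c)"
 let ?\<Phi> = "%x. S3 A B C ?W x ?p" and ?Y = "TL A (TL B C)" and ?X = "TL (TL A B) C"
 let ?q = "%z. Sw A (B ** C) (A ** TL B C) z (%a u. pt A (TL B C) a (ldiag B (act B) C (act C) uH u))"
 let ?j = "inc A (TL B C) A (B ** C)"
 have l: "ascLL A B C \<in> lin ?X (A ** TL B C)"
  by (rule lin_eqI[of "%x. ?q (?\<Phi> x)"]) (simp_all add: ascLL_facts(3))
 have lY: "ascLL A B C \<in> lin ?X ?Y" by (rule lin_retract_corange[OF rY l]) simp_all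
 have q: "(%z. ldiag A (act A) (TL B C) (act (TL B C)) uH (?q z)) \<in> lin ?W ?Y"
  by (rule lin_compose[OF retractD(4)[OF rY]]) simp
 show ?thesis
 proof (rule arrLLI[OF X Y lY _ _ _ q, where j = ?j])
  fix h x assume [simp]: "h .: H" "x .: ?X"
  have [simp]: "act ?Y h (ascLL A B C x) .: ?Y" using lact_simps(3)[OF yd_LL_lact[OF Y]] by simp
  show "ascLL A B C (act ?X h x) = act ?Y h (ascLL A B C x)"
  proof (rule S3r_ext)
   show "S3r A B C ?W (ascLL A B C (act ?X h x)) ?p = S3r A B C ?W (act ?Y h (ascLL A B C x)) ?p"
    by (simp add: ascLL_facts(2) S3_act tensor_LL_act[OF A BC] S3r_ldiag)
  qed simp_all
 next
  fix y assume y: "y .: ?Y"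
  then have "?q (?j y) = y" using inc_inject[OF rA rBC, of y] by simp
  then show "ldiag A (act A) (TL B C) (act (TL B C)) uH (?q (?j y)) = y" using y retractD(5)[OF rY] by simp
 next
  fix x assume x [simp]: "x .: ?X"
  let ?Q = "H ** ?W"
  let ?G = "%a b c. LC A ?Q a (%h a0. LC B ?Q b (%k b0. LC C ?Q c (%l c0. pt H ?W (h .* k .* l) (?p a0 b0 c0))))"
  have "LC ?Y ?Q (ascLL A B C x) (%a y. pt H ?W a (?j y))
    = S3r A B C ?Q (ascLL A B C x) ?G"
  proof -
   have "LC ?Y ?Q (ascLL A B C x) (%a y. pt H ?W a (?j y))
    = Sw A (TL B C) ?Q (ascLL A B C x) (%a u. LC A ?Q a (%h a0. LC (TL B C) ?Q u (%k u0. pt H ?W (h .* k) (pt A (B ** C) a0 u0))))"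
    by (simp add: tensor_LL_yd(2)[OF A BC] yd_LL_simps(6-)[OF BC])
   also have "... = Sw A (TL B C) ?Q (ascLL A B C x) (%a u. LC A ?Q a (%h a0. Sw B C ?Q u (%b c.
      LC B ?Q b (%k b0. LC C ?Q c (%l c0. pt H ?W (h .* k .* l) (?p a0 b0 c0))))))"
    by (simp add: tensor_LL_yd(2)[OF B C])
   also have "... = S3r A B C ?Q (ascLL A B C x) ?G"
    by (rule Sw_eqI, rule Sw_swap) simp_all
   finally show ?thesis .
  qed
  also have "... = S3 A B C ?Q x ?G" by (rule ascLL_facts(2)) simp_all
  also have "... = LC ?X ?Q x (%a y. pt H ?W a (?\<Phi> y))"
  proof -
   have "LC ?X ?Q x (%a y. pt H ?W a (?\<Phi> y))
    = Sw (TL A B) C ?Q x (%y c. LC (TL A B) ?Q y (%h y0. LC C ?Q c (%l c0. Sw A B ?Q y0 (%a0 b0. pt H ?W (h .* l) (?p a0 b0 c0)))))"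
    by (simp add: tensor_LL_yd(2)[OF AB C])
   also have "... = Sw (TL A B) C ?Q x (%y c. Sw A B ?Q y (%a b. ?G a b c))"
    by (simp add: tensor_LL_yd(2)[OF A B])
   finally show ?thesis ..
  qed
  also have "... = LC ?X ?Q x (%a y. pt H ?W a (?j (ascLL A B C y)))"
   by (simp add: S3r_inc[symmetric] ascLL_facts(2))
  finally show "LC ?Y ?Q (ascLL A B C x) (%a y. pt H ?W a (?j y)) = LC ?X ?Q x (%a y. pt H ?W a (?j (ascLL A B C y)))" .
 qed simp_all
qed

lemma assoc_LL_iso:
 "assoc_arrow R TL A B C \<in> Iso LL (TL (TL A B) C) (TL A (TL B C))"
 "inverse_arrows LL (assoc_arrow R TL A B C)
  (TL A (TL B C), restrict (ascLL' A B C) (carrier (TL A (TL B C))), TL (TL A B) C)"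
proof -
 note i = LL_inverse[OF assoc_LL_arr, of "ascLL' A B C"]
 show "assoc_arrow R TL A B C \<in> Iso LL (TL (TL A B) C) (TL A (TL B C))"
  unfolding assoc_LL_eq by (rule i(3)) (simp_all add: ascLL_facts(1) ascLL'_facts(1) ascLL_ascLL')
 show "inverse_arrows LL (assoc_arrow R TL A B C)
  (TL A (TL B C), restrict (ascLL' A B C) (carrier (TL A (TL B C))), TL (TL A B) C)"
  unfolding assoc_LL_eq by (rule i(2)) (simp_all add: ascLL_facts(1) ascLL'_facts(1) ascLL_ascLL')
qed

end

end

context weak_hopf_bij
begin

subsection \<open>The braided monoidal category of left-left modules\<close>

text \<open>The underlying function of the tensor product of two arrows. Separating functions from
  arrow triples allows the coherence axioms to be checked elementwise; the same is done for the
  braiding and the constraints.\<close>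

definition tnLL where
 "tnLL M N M' N' f g = restrict (%x. Sw M N (M' ** N') x (%m n. pt M' N' (f m) (g n))) (carrier (TL M N))"

definition cLL where "cLL M N = restrict (brLL M N) (carrier (TL M N))"
definition aLL where "aLL M N P = restrict (ascLL M N P) (carrier (TL (TL M N) P))"
definition aLL' where "aLL' M N P = restrict (ascLL' M N P) (carrier (TL M (TL N P)))"

lemma tnLL:
 assumes f: "arrLL M f M'" and g: "arrLL N g N'"
 shows "tensor_arrow R TL (M, f, M') (N, g, N') = (TL M N, tnLL M N M' N' f g, TL M' N')"
  "arrLL (TL M N) (tnLL M N M' N' f g) (TL M' N')"
  "tnLL M N M' N' f g \<in> lin (TL M N) (TL M' N')"
  "x .: (TL M N) ==> tnLL M N M' N' f g x .: (TL M' N')"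
  "x .: (TL M N) ==> module R (P :: ('k, 'p, 'q) module_scheme) ==> bilin M' N' P G ==>
   Sw M' N' P (tnLL M N M' N' f g x) G = Sw M N P x (%m n. G (f m) (g n))"
proof -
 show "tensor_arrow R TL (M, f, M') (N, g, N') = (TL M N, tnLL M N M' N' f g, TL M' N')"
  "arrLL (TL M N) (tnLL M N M' N' f g) (TL M' N')"
  using tensor_arrow_LL[OF f g] by (simp_all add: tnLL_def)
 then show "tnLL M N M' N' f g \<in> lin (TL M N) (TL M' N')"
  "x .: (TL M N) ==> tnLL M N M' N' f g x .: (TL M' N')"
  by (auto dest: arrLLD(4) arrLL_closed)
 note [simp] = yd_LL_simps(1-5)[OF arrLLD(1)[OF f]] yd_LL_simps(1-5)[OF arrLLD(2)[OF f]]
  yd_LL_simps(1-5)[OF arrLLD(1)[OF g]] yd_LL_simps(1-5)[OF arrLLD(2)[OF g]]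
  tensor_LL_simps[OF arrLLD(1)[OF f] arrLLD(1)[OF g]]
  lin_simps[OF arrLLD(4)[OF f]] lin_simps[OF arrLLD(4)[OF g]] arrLLD(4)[OF f] arrLLD(4)[OF g]
  arrLL_closed[OF f] arrLL_closed[OF g]
 assume "x .: (TL M N)" "module R P" "bilin M' N' P G"
 then show "Sw M' N' P (tnLL M N M' N' f g x) G = Sw M N P x (%m n. G (f m) (g n))"
  unfolding tnLL_def by simp
qed

lemma cLL:
 assumes M: "yd_LL R H M" and N: "yd_LL R H N"
 shows "braid_LL R TL M N = (TL M N, cLL M N, TL N M)"
  "arrLL (TL M N) (cLL M N) (TL N M)"
  "cLL M N \<in> lin (TL M N) (TL N M)"
  "x .: (TL M N) ==> cLL M N x .: (TL N M)"
  "x .: (TL M N) ==> module R (P :: ('k, 'p, 'q) module_scheme) ==> bilin N M P G ==>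
   Sw N M P (cLL M N x) G = Sw M N P x (%m n. LC M P m (%a m0. G (act N a n) m0))"
proof -
 show "braid_LL R TL M N = (TL M N, cLL M N, TL N M)" "arrLL (TL M N) (cLL M N) (TL N M)"
  using braid_LL_eq[OF M N] braid_LL_arr[OF M N] by (simp_all add: cLL_def)
 then show "cLL M N \<in> lin (TL M N) (TL N M)" "x .: (TL M N) ==> cLL M N x .: (TL N M)"
  by (auto dest: arrLLD(4) arrLL_closed)
 note [simp] = yd_LL_simps[OF M] yd_LL_simps[OF N] tensor_LL_simps[OF M N]
 assume "x .: (TL M N)" "module R P" "bilin N M P G"
 then show "Sw N M P (cLL M N x) G = Sw M N P x (%m n. LC M P m (%a m0. G (act N a n) m0))"
  unfolding cLL_def by simp
qed

lemma aLL:
 assumes M: "yd_LL R H M" and N: "yd_LL R H N" and Q: "yd_LL R H Q"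
 shows "assoc_arrow R TL M N Q = (TL (TL M N) Q, aLL M N Q, TL M (TL N Q))"
  "arrLL (TL (TL M N) Q) (aLL M N Q) (TL M (TL N Q))"
  "aLL M N Q \<in> lin (TL (TL M N) Q) (TL M (TL N Q))"
  "x .: (TL (TL M N) Q) ==> aLL M N Q x .: (TL M (TL N Q))"
  "x .: (TL (TL M N) Q) ==> module R (P :: ('k, 'p, 'q) module_scheme) ==> trilin M N Q P f ==>
   S3r M N Q P (aLL M N Q x) f = S3 M N Q P x f"
proof -
 show "assoc_arrow R TL M N Q = (TL (TL M N) Q, aLL M N Q, TL M (TL N Q))"
  "arrLL (TL (TL M N) Q) (aLL M N Q) (TL M (TL N Q))"
  using assoc_LL_eq[OF M N Q] assoc_LL_arr[OF M N Q] by (simp_all add: aLL_def)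
 then show "aLL M N Q \<in> lin (TL (TL M N) Q) (TL M (TL N Q))"
  "x .: (TL (TL M N) Q) ==> aLL M N Q x .: (TL M (TL N Q))"
  by (auto dest: arrLLD(4) arrLL_closed)
 assume "x .: (TL (TL M N) Q)" "module R P" "trilin M N Q P f"
 then show "S3r M N Q P (aLL M N Q x) f = S3 M N Q P x f"
  unfolding aLL_def by (simp add: ascLL_facts(2)[OF M N Q])
qed

lemma (in category) Inv_eq:
 assumes f: "inverse_arrows C f g" shows "Inv C f = g"
 unfolding Inv_def
proof (rule the_equality[where a = g])
 show "inverse_arrows C f g" by (rule f)
next
 fix g' assume g': "inverse_arrows C f g'"
 have F: "f \<in> Hom C (Dom C f) (Cod C f)" using f by (simp add: Hom_def inverse_arrows_def)
 have G: "g \<in> Hom C (Cod C f) (Dom C f)" "g' \<in> Hom C (Cod C f) (Dom C f)"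
  using f g' by (simp_all add: inverse_arrows_def)
 have "g' = Comp C g' (Comp C f g)" using f comp_id_right[OF G(2)] by (simp add: inverse_arrows_def)
 also have "... = g" using g' comp_assoc[OF G(1) F G(2)] comp_id_left[OF G(1)] by (simp add: inverse_arrows_def)
 finally show "g' = g" .
qed

lemma aLL':
 assumes M: "yd_LL R H M" and N: "yd_LL R H N" and Q: "yd_LL R H Q"
 shows "Inv LL (assoc_arrow R TL M N Q) = (TL M (TL N Q), aLL' M N Q, TL (TL M N) Q)"
  "arrLL (TL M (TL N Q)) (aLL' M N Q) (TL (TL M N) Q)"
  "aLL' M N Q \<in> lin (TL M (TL N Q)) (TL (TL M N) Q)"
  "x .: (TL M (TL N Q)) ==> aLL' M N Q x .: (TL (TL M N) Q)"
  "x .: (TL M (TL N Q)) ==> module R (P :: ('k, 'p, 'q) module_scheme) ==> trilin M N Q P f ==>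
   S3 M N Q P (aLL' M N Q x) f = S3r M N Q P x f"
proof -
 interpret category LL by (rule category_LL)
 note iso = assoc_LL_iso(2)[OF M N Q, folded aLL'_def]
 show "Inv LL (assoc_arrow R TL M N Q) = (TL M (TL N Q), aLL' M N Q, TL (TL M N) Q)"
  by (rule Inv_eq[OF iso])
 show a: "arrLL (TL M (TL N Q)) (aLL' M N Q) (TL (TL M N) Q)"
  using iso unfolding inverse_arrows_def Hom_def arrLL_def by (simp add: aLL(1)[OF M N Q])
 then show "aLL' M N Q \<in> lin (TL M (TL N Q)) (TL (TL M N) Q)"
  "x .: (TL M (TL N Q)) ==> aLL' M N Q x .: (TL (TL M N) Q)"
  by (auto dest: arrLLD(4) arrLL_closed)
 assume "x .: (TL M (TL N Q))" "module R P" "trilin M N Q P f"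
 then show "S3 M N Q P (aLL' M N Q x) f = S3r M N Q P x f"
  unfolding aLL'_def by (simp add: ascLL'_facts(2)[OF M N Q])
qed

lemma assoc_natural_LL:
 assumes f: "arrLL M f M'" and g: "arrLL N g N'" and h: "arrLL Q h Q'" and x: "x .: (TL (TL M N) Q)"
 shows "aLL M' N' Q' (tnLL (TL M N) Q (TL M' N') Q' (tnLL M N M' N' f g) h x)
  = tnLL M (TL N Q) M' (TL N' Q') f (tnLL N Q N' Q' g h) (aLL M N Q x)"
proof -
 note M = arrLLD(1)[OF f] and M' = arrLLD(2)[OF f] and N = arrLLD(1)[OF g] and N' = arrLLD(2)[OF g]
  and Q = arrLLD(1)[OF h] and Q' = arrLLD(2)[OF h]
 note fg = tnLL[OF f g] and gh = tnLL[OF g h]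
 note fgh = tnLL[OF fg(2) h] and fgh' = tnLL[OF f gh(2)]
 note [simp] = ABC_simps[OF M N Q] ABC_simps[OF M' N' Q'] fg(3-5) gh(3-5) fgh(3-5) fgh'(3-5)
  arrLLD(4)[OF f] arrLLD(4)[OF g] arrLLD(4)[OF h] lin_simps[OF arrLLD(4)[OF f]] lin_simps[OF arrLLD(4)[OF g]]
  lin_simps[OF arrLLD(4)[OF h]] arrLL_closed[OF f] arrLL_closed[OF g] arrLL_closed[OF h]
  aLL(3-5)[OF M N Q] aLL(3-5)[OF M' N' Q'] x
 show ?thesis by (rule S3r_ext[OF M' N' Q']) simp_all
qed

text \<open>Both sides are included into M \<otimes> (N \<otimes> (P \<otimes> Q)) by a split
  monomorphism, where every associativity constraint just rebrackets and only the nesting of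
  Sweedler sums has to be compared.\<close>

lemma pentagon_LL:
 assumes M: "yd_LL R H M" and N: "yd_LL R H N" and P: "yd_LL R H P" and Q: "yd_LL R H Q"
  and x: "x .: (TL (TL (TL M N) P) Q)"
 shows "tnLL M (TL (TL N P) Q) M (TL N (TL P Q)) (\<lambda>x\<in>carrier M. x) (aLL N P Q)
   (aLL M (TL N P) Q (tnLL (TL (TL M N) P) Q (TL M (TL N P)) Q (aLL M N P) (\<lambda>x\<in>carrier Q. x) x))
  = aLL M N (TL P Q) (aLL (TL M N) P Q x)"
proof -
 note MN = tensor_LL_yd(1)[OF M N] and NP = tensor_LL_yd(1)[OF N P] and PQ = tensor_LL_yd(1)[OF P Q]
 note NPQ = tensor_LL_yd(1)[OF N PQ] and NPQ' = tensor_LL_yd(1)[OF NP Q]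
 note [simp] = ABC_simps[OF M N P] ABC_simps[OF N P Q] ABC_simps[OF M NP Q] ABC_simps[OF M N PQ] ABC_simps[OF MN P Q]
  tensor_LL_simps[OF M NPQ] tensor_LL_simps[OF M NPQ']
  tensor_LL_simps[OF tensor_LL_yd(1)[OF M NP] Q] tensor_LL_simps[OF tensor_LL_yd(1)[OF MN P] Q]
  aLL(3-5)[OF M N P] aLL(3-5)[OF N P Q] aLL(3-5)[OF M NP Q] aLL(3-5)[OF M N PQ] aLL(3-5)[OF MN P Q]
  tnLL(3-5)[OF arrLL_id[OF M] aLL(2)[OF N P Q]] tnLL(3-5)[OF aLL(2)[OF M N P] arrLL_id[OF Q]] x
 note rN = retract_id[OF yd_LL_module[OF N]] and rPQ = tensor_LL_retract[OF P Q] and rY = tensor_LL_retract[OF N PQ]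
 note [simp] = retractD[OF rPQ] lin_compose[OF retractD(4)[OF rPQ]]
 let ?Y = "TL N (TL P Q)" and ?W = "N ** (P ** Q)"
 let ?j = "inc N (TL P Q) N (P ** Q)"
 let ?q = "%z. Sw N (P ** Q) (N ** TL P Q) z (%a u. pt N (TL P Q) a (ldiag P (act P) Q (act Q) uH u))"
 have j: "?j y = S3r N P Q ?W y (%a b c. pt N (P ** Q) a (pt P Q b c))" if "y .: ?Y" for y
  using S3r_inc[OF N P Q, of y] that by simp
 have q: "(%z. ldiag N (act N) (TL P Q) (act (TL P Q)) uH (?q z)) \<in> lin ?W ?Y"
  by (rule lin_compose[OF retractD(4)[OF rY]]) simp
 have qj: "ldiag N (act N) (TL P Q) (act (TL P Q)) uH (?q (?j y)) = y" if y: "y .: ?Y" for y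
 proof -
  have "?q (?j y) = y" using inc_inject[OF rN rPQ, of y] y by simp
  then show ?thesis using y tensor_LL_carrier_iff[OF N PQ] by simp
 qed
 have jl: "(%y. S3r N P Q ?W y (%a b c. pt N (P ** Q) a (pt P Q b c))) \<in> lin ?Y ?W" by simp
 show ?thesis
 proof (rule split_inject[OF _ _ _ jl q])
  fix y assume "y .: ?Y"
  then show "ldiag N (act N) (TL P Q) (act (TL P Q)) uH (?q (S3r N P Q ?W y (%a b c. pt N (P ** Q) a (pt P Q b c)))) = y"
   using qj[of y] j[of y] by simp
 next
  let ?X = "M ** ?W" and ?F = "%m n p q. pt M ?W m (pt N (P ** Q) n (pt P Q p q))"
  let ?z = "aLL (TL M N) P Q x"
  have push: "pt M ?W m (S3r N P Q ?W u (%a b c. pt N (P ** Q) a (pt P Q b c))) = S3r N P Q ?X u (?F m)"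
   if "m .: M" "u .: ?Y" for m u
   using that by (simp add: pt_Sw(2))
  \<comment> \<open>The bracketing (MN)(PQ) in the middle of one path leads to two nestings of the
    same sum, depending on which pair is opened first.\<close>
  have "Sw (TL M N) (TL P Q) ?X ?z (%y v. Sw M N ?X y (%m n. Sw P Q ?X v (%p q. ?F m n p q)))
   = Sw (TL M N) (TL P Q) ?X ?z (%y v. Sw P Q ?X v (%p q. Sw M N ?X y (%m n. ?F m n p q)))"
   by (rule Sw_eqI, rule Sw_swap) simp_all
  then show "Sw M ?Y ?X (tnLL M (TL (TL N P) Q) M (TL N (TL P Q)) (\<lambda>x\<in>carrier M. x) (aLL N P Q)
    (aLL M (TL N P) Q (tnLL (TL (TL M N) P) Q (TL M (TL N P)) Q (aLL M N P) (\<lambda>x\<in>carrier Q. x) x)))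
    (%a y. pt M ?W a (S3r N P Q ?W y (%a b c. pt N (P ** Q) a (pt P Q b c))))
   = Sw M ?Y ?X (aLL M N (TL P Q) ?z) (%a y. pt M ?W a (S3r N P Q ?W y (%a b c. pt N (P ** Q) a (pt P Q b c))))"
   by (simp add: push)
 qed simp_all
qed

section \<open>Coherence of the unit constraints\<close>

definition lLL where "lLL M = restrict (%x. Sw UL M M x (%z m. act M z m)) (carrier (TL UL M))"
definition rLL where "rLL M = restrict (%x. Sw M UL M x (%m z. act M (esb z) m)) (carrier (TL M UL))"

lemma lLL:
 assumes M: "yd_LL R H M"
 shows "left_lunit TL UL M = (TL UL M, lLL M, M)" "arrLL (TL UL M) (lLL M) M" "lLL M \<in> lin (TL UL M) M"
  "x .: (TL UL M) ==> lLL M x = Sw UL M M x (%z m. act M z m)"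
 using lunit_LL[OF M] unfolding lLL_def[symmetric] by (auto simp: Iso_def Hom_LL lLL_def dest: arrLLD(4))

lemma rLL:
 assumes M: "yd_LL R H M"
 shows "left_runit H TL UL M = (TL M UL, rLL M, M)" "arrLL (TL M UL) (rLL M) M" "rLL M \<in> lin (TL M UL) M"
  "x .: (TL M UL) ==> rLL M x = Sw M UL M x (%m z. act M (esb z) m)"
 using runit_LL[OF M] unfolding rLL_def[symmetric] by (auto simp: Iso_def Hom_LL rLL_def dest: arrLLD(4))

lemma lunit_natural_LL:
 assumes f: "arrLL M f N" and x: "x .: (TL UL M)"
 shows "lLL N (tnLL UL M UL N (\<lambda>x\<in>carrier UL. x) f x) = f (lLL M x)"
proof -
 note M = arrLLD(1)[OF f] and N = arrLLD(2)[OF f]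
 note U = unit_LL_yd(1)
 note [simp] = yd_LL_simps[OF M] yd_LL_simps[OF N] yd_LL_simps[OF U] tensor_LL_simps[OF U M] tensor_LL_simps[OF U N]
  tnLL(3-5)[OF arrLL_id[OF U] f] lLL(3,4)[OF M] lLL(3,4)[OF N] arrLLD(4,5)[OF f] lin_simps[OF arrLLD(4)[OF f]] x
  arrLL_closed[OF f]
 show ?thesis by simp
qed

lemma runit_natural_LL:
 assumes f: "arrLL M f N" and x: "x .: (TL M UL)"
 shows "rLL N (tnLL M UL N UL f (\<lambda>x\<in>carrier UL. x) x) = f (rLL M x)"
proof -
 note M = arrLLD(1)[OF f] and N = arrLLD(2)[OF f]
 note U = unit_LL_yd(1)
 note [simp] = yd_LL_simps[OF M] yd_LL_simps[OF N] yd_LL_simps[OF U] tensor_LL_simps[OF M U] tensor_LL_simps[OF N U]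
  tnLL(3-5)[OF f arrLL_id[OF U]] rLL(3,4)[OF M] rLL(3,4)[OF N] arrLLD(4,5)[OF f] lin_simps[OF arrLLD(4)[OF f]] x
  arrLL_closed[OF f]
 show ?thesis by simp
qed

text \<open>After inserting \<Delta>(1) the two sides differ by whether z acts on M as
  \<open>esb z\<close> or on N as z. Moving \<open>esb z\<close> across \<Delta>(1) turns it into
  \<open>et\<close>(\<open>esb z\<close>) = z.\<close>

lemma triangle_LL:
 assumes M: "yd_LL R H M" and N: "yd_LL R H N" and x: "x .: (TL (TL M UL) N)"
 shows "tnLL M (TL UL N) M N (\<lambda>x\<in>carrier M. x) (lLL N) (aLL M UL N x)
  = tnLL (TL M UL) N M N (rLL M) (\<lambda>x\<in>carrier N. x) x"
proof -
 note U = unit_LL_yd(1)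
 note tl = tnLL[OF arrLL_id[OF M] lLL(2)[OF N]] and tr = tnLL[OF rLL(2)[OF M] arrLL_id[OF N]]
 note [simp] = ABC_simps[OF M U N] aLL(3-5)[OF M U N] x tensor_LL_simps[OF M N] lLL(3,4)[OF N] rLL(3,4)[OF M]
  tl(3-5) tr(3-5)
 let ?P = "M ** N"
 let ?l = "tnLL M (TL UL N) M N (\<lambda>x\<in>carrier M. x) (lLL N) (aLL M UL N x)"
  and ?r = "tnLL (TL M UL) N M N (rLL M) (\<lambda>x\<in>carrier N. x) x"
 have un: "Sw M N ?P y (%m n. D ?P uH (%u v. pt M N (act M u m) (act N v n))) = y" if "y .: (TL M N)" for y
  using tensor_LL_Sw_unit(2)[OF M N that, of ?P "pt M N"] that by simp
 have one: "D ?P uH (%u v. pt M N (act M (u .* esb z) m) (act N v n)) = D ?P uH (%u v. pt M N (act M u m) (act N (v .* z) n))"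
  if "m .: M" "z .: UL" "n .: N" for m z n
  using D_one_Hs[of "esb z" ?P "%u v. pt M N (act M u m) (act N v n)"] that by simp
 have sw: "D ?P uH (%u v. Sw UL N ?P w (%z n. pt M N (act M u m) (act N (v .* z) n)))
  = Sw UL N ?P w (%z n. D ?P uH (%u v. pt M N (act M u m) (act N (v .* z) n)))"
  if "m .: M" "w .: (TL UL N)" for m w
  by (rule Sw_swap) (use that in simp_all)
 have sw': "D ?P uH (%u v. Sw M UL ?P w (%m z. pt M N (act M (u .* esb z) m) (act N v n)))
  = Sw M UL ?P w (%m z. D ?P uH (%u v. pt M N (act M (u .* esb z) m) (act N v n)))"
  if "n .: N" "w .: (TL M UL)" for n w
  by (rule Sw_swap) (use that in simp_all)
 have "?l = S3 M UL N ?P x (%m z n. D ?P uH (%u v. pt M N (act M u m) (act N (v .* z) n)))"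
  by (subst un[of ?l, symmetric]) (simp_all add: sw)
 moreover have "?r = S3 M UL N ?P x (%m z n. D ?P uH (%u v. pt M N (act M (u .* esb z) m) (act N v n)))"
  by (subst un[of ?r, symmetric]) (simp_all add: sw')
 ultimately show ?thesis by (simp add: one)
qed

lemma braid_natural_LL:
 assumes f: "arrLL M f M'" and g: "arrLL N g N'" and x: "x .: (TL M N)"
 shows "cLL M' N' (tnLL M N M' N' f g x) = tnLL N M N' M' g f (cLL M N x)"
proof -
 note M = arrLLD(1)[OF f] and M' = arrLLD(2)[OF f] and N = arrLLD(1)[OF g] and N' = arrLLD(2)[OF g]
 note fg = tnLL[OF f g] and gf = tnLL[OF g f]
 note [simp] = yd_LL_simps[OF M] yd_LL_simps[OF N] yd_LL_simps[OF M'] yd_LL_simps[OF N'] fg(3-5) gf(3-5)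
  tensor_LL_simps[OF M N] tensor_LL_simps[OF M' N'] tensor_LL_simps[OF N M] tensor_LL_simps[OF N' M']
  arrLLD(4,5)[OF f] arrLLD(4,5)[OF g] arrLLD(6)[OF f] lin_simps[OF arrLLD(4)[OF f]] lin_simps[OF arrLLD(4)[OF g]]
  arrLL_closed[OF f] arrLL_closed[OF g] cLL(3-5)[OF M N] cLL(3-5)[OF M' N'] x
 have "Sw N' M' (N' ** M') (cLL M' N' (tnLL M N M' N' f g x)) (pt N' M')
  = Sw N' M' (N' ** M') (tnLL N M N' M' g f (cLL M N x)) (pt N' M')"
  by (simp del: Sw_id)
 then show ?thesis by simp
qed

text \<open>Braiding past N \<otimes>_t P lets m_[-1] act diagonally, while the other path uses the
  iterated coaction of m; the two agree by coassociativity of the coaction of M.\<close>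

lemma hexagon_1_LL:
 assumes M: "yd_LL R H M" and N: "yd_LL R H N" and P: "yd_LL R H P" and x: "x .: (TL (TL M N) P)"
 shows "aLL N P M (cLL M (TL N P) (aLL M N P x))
  = tnLL N (TL M P) N (TL P M) (\<lambda>x\<in>carrier N. x) (cLL M P)
    (aLL N M P (tnLL (TL M N) P (TL N M) P (cLL M N) (\<lambda>x\<in>carrier P. x) x))"
proof -
 note NP = tensor_LL_yd(1)[OF N P] and MP = tensor_LL_yd(1)[OF M P] and MN = tensor_LL_yd(1)[OF M N]
 note [simp] = ABC_simps[OF M N P] ABC_simps[OF N P M] ABC_simps[OF N M P]
  tensor_LL_simps[OF M NP] yd_LL_simps[OF NP]
  aLL(3-5)[OF M N P] aLL(3-5)[OF N P M] aLL(3-5)[OF N M P] cLL(3-5)[OF M NP] cLL(3-5)[OF M N] cLL(3-5)[OF M P]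
  tnLL(3-5)[OF arrLL_id[OF N] cLL(2)[OF M P]] tnLL(3-5)[OF cLL(2)[OF M N] arrLL_id[OF P]] x
 let ?W = "N ** (P ** M)" and ?p = "%n p m. pt N (P ** M) n (pt P M p m)"
 show ?thesis
 proof (rule S3r_ext[OF N P M])
  have sw: "LC M ?W m (%a m0. D ?W a (%a b. Sw N P ?W u (%n p. ?p (act N a n) (act P b p) m0)))
   = Sw N P ?W u (%n p. LC M ?W m (%a m0. D ?W a (%a b. ?p (act N a n) (act P b p) m0)))"
   if "m .: M" "u .: (TL N P)" for m u
  proof -
   have "LC M ?W m (%a m0. D ?W a (%a b. Sw N P ?W u (%n p. ?p (act N a n) (act P b p) m0)))
    = LC M ?W m (%a m0. Sw N P ?W u (%n p. D ?W a (%a b. ?p (act N a n) (act P b p) m0)))"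
    by (rule Sw_eqI, rule Sw_swap) (use that in simp_all)
   also have "... = Sw N P ?W u (%n p. LC M ?W m (%a m0. D ?W a (%a b. ?p (act N a n) (act P b p) m0)))"
    by (rule Sw_swap) (use that in simp_all)
   finally show ?thesis .
  qed
  have "Sw M (TL N P) ?W (aLL M N P x) (%m u. LC M ?W m (%a m0. Sw N P ?W (act (TL N P) a u) (%n p. ?p n p m0)))
   = S3r M N P ?W (aLL M N P x) (%m n p. LC M ?W m (%a m0. D ?W a (%a b. ?p (act N a n) (act P b p) m0)))"
   by (simp add: tensor_LL_Sw_act[OF N P] sw)
  moreover have "LC M ?W m (%a m0. D ?W a (%a b. ?p (act N a n) (act P b p) m0))
   = LC M ?W m (%a m0. LC M ?W m0 (%b m0. ?p (act N a n) (act P b p) m0))"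
   if "m .: M" "n .: N" "p .: P" for m n p
   by (rule LC_coassoc[OF yd_LL_D(2)[OF M] yd_LL_module[OF M]]) (use that in simp_all)
  ultimately show "S3r N P M ?W (aLL N P M (cLL M (TL N P) (aLL M N P x))) ?p
   = S3r N P M ?W (tnLL N (TL M P) N (TL P M) (\<lambda>x\<in>carrier N. x) (cLL M P)
    (aLL N M P (tnLL (TL M N) P (TL N M) P (cLL M N) (\<lambda>x\<in>carrier P. x) x))) ?p"
   by simp
 qed simp_all
qed

text \<open>The coaction of M \<otimes>_t N multiplies the two H-legs, which is successive action on
  P; beyond associativity of the action only an interchange of sums is involved.\<close>

lemma hexagon_2_LL:
 assumes M: "yd_LL R H M" and N: "yd_LL R H N" and P: "yd_LL R H P" and w: "w .: (TL M (TL N P))"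
 shows "aLL' P M N (cLL (TL M N) P (aLL' M N P w))
  = tnLL (TL M P) N (TL P M) N (cLL M P) (\<lambda>x\<in>carrier N. x)
    (aLL' M P N (tnLL M (TL N P) M (TL P N) (\<lambda>x\<in>carrier M. x) (cLL N P) w))"
proof -
 note NP = tensor_LL_yd(1)[OF N P] and MP = tensor_LL_yd(1)[OF M P] and MN = tensor_LL_yd(1)[OF M N]
 note [simp] = ABC_simps[OF M N P] ABC_simps[OF P M N] ABC_simps[OF M P N]
  tensor_LL_simps[OF MN P] yd_LL_simps[OF MN]
  aLL'(3-5)[OF M N P] aLL'(3-5)[OF P M N] aLL'(3-5)[OF M P N] cLL(3-5)[OF MN P] cLL(3-5)[OF N P] cLL(3-5)[OF M P]
  tnLL(3-5)[OF arrLL_id[OF M] cLL(2)[OF N P]] tnLL(3-5)[OF cLL(2)[OF M P] arrLL_id[OF N]] w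
 let ?W = "(P ** M) ** N" and ?p = "%p m n. pt (P ** M) N (pt P M p m) n"
 show ?thesis
 proof (rule S3_ext[OF P M N])
  have sw: "LC N ?W n (%b n0. LC M ?W m (%a m0. ?p (act P (a .* b) p) m0 n0))
   = LC M ?W m (%a m0. LC N ?W n (%b n0. ?p (act P (a .* b) p) m0 n0))"
   if "m .: M" "n .: N" "p .: P" for m n p
   by (rule Sw_swap) (use that in simp_all)
  have "S3 P M N ?W (aLL' P M N (cLL (TL M N) P (aLL' M N P w))) ?p
   = Sw (TL M N) P ?W (aLL' M N P w) (%u p. LC (TL M N) ?W u (%a u0. Sw M N ?W u0 (%m n. ?p (act P a p) m n)))"
   by simp
  also have "... = S3 M N P ?W (aLL' M N P w) (%m n p. LC M ?W m (%a m0. LC N ?W n (%b n0. ?p (act P (a .* b) p) m0 n0)))"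
   by (rule Sw_eqI) (simp add: tensor_LL_yd(2)[OF M N])
  finally show "S3 P M N ?W (aLL' P M N (cLL (TL M N) P (aLL' M N P w))) ?p
   = S3 P M N ?W (tnLL (TL M P) N (TL P M) N (cLL M P) (\<lambda>x\<in>carrier N. x)
    (aLL' M P N (tnLL M (TL N P) M (TL P N) (\<lambda>x\<in>carrier M. x) (cLL N P) w))) ?p"
   by (simp add: sw)
 qed simp_all
qed

theorem braided_LL: "braided_monoidal_category LL"
proof -
 interpret category LL by (rule category_LL)
 have O: "M \<in> Obj LL \<longleftrightarrow> yd_LL R H M" for M by simp
 show ?thesis
 \<comment> \<open>The numbered cases are the monoidal axioms followed by the braiding axioms, in
   the order of their declaration; those of a category are discharged by the interpretation.\<close>
 proof (unfold_locales, goal_cases)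
  case (1 M N) then show ?case by (simp add: tensor_LL_yd(1))
 next
  case (2 f M M' g N N') then show ?case by (auto simp: Hom_LL tnLL)
 next
  case (3 M N)
  then have M: "yd_LL R H M" and N: "yd_LL R H N" by simp_all
  note [simp] = yd_LL_simps(1-5)[OF M] yd_LL_simps(1-5)[OF N] tensor_LL_simps[OF M N]
  show ?case by (auto simp: yd_id_def tnLL(1)[OF arrLL_id[OF M] arrLL_id[OF N]] tnLL_def intro!: restrict_ext)
 next
  case (4 \<phi> M M' \<phi>' M'' \<psi> N N' \<psi>' N'')
  then obtain f f' g g' where e: "\<phi> = (M, f, M')" "\<phi>' = (M', f', M'')" "\<psi> = (N, g, N')" "\<psi>' = (N', g', N'')"
   and f: "arrLL M f M'" and f': "arrLL M' f' M''" and g: "arrLL N g N'" and g': "arrLL N' g' N''"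
   unfolding Hom_LL by blast
  note c = arrLL_comp[OF f f'] arrLL_comp[OF g g']
  have "compose (carrier (TL M N)) (tnLL M' N' M'' N'' f' g') (tnLL M N M' N' f g)
   = tnLL M N M'' N'' (compose (carrier M) f' f) (compose (carrier N) g' g)"
  proof (rule arrLL_eqI[OF arrLL_comp[OF tnLL(2)[OF f g] tnLL(2)[OF f' g']] tnLL(2)[OF c]])
   note M = arrLLD(1)[OF f] and N = arrLLD(1)[OF g] and M' = arrLLD(1)[OF f'] and N' = arrLLD(1)[OF g']
    and M'' = arrLLD(2)[OF f'] and N'' = arrLLD(2)[OF g']
   note [simp] = yd_LL_simps(1-5)[OF M] yd_LL_simps(1-5)[OF N] yd_LL_simps(1-5)[OF M'] yd_LL_simps(1-5)[OF N']
    yd_LL_simps(1-5)[OF M''] yd_LL_simps(1-5)[OF N''] tensor_LL_simps[OF M N] tensor_LL_simps[OF M' N'] tensor_LL_simps[OF M'' N'']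
    tnLL(3-5)[OF f g] tnLL(3-5)[OF f' g'] tnLL(3-5)[OF c] arrLLD(4)[OF f] arrLLD(4)[OF g] arrLLD(4)[OF f'] arrLLD(4)[OF g']
    arrLL_closed[OF f] arrLL_closed[OF f'] arrLL_closed[OF g] arrLL_closed[OF g']
    lin_simps[OF arrLLD(4)[OF f]] lin_simps[OF arrLLD(4)[OF g]] lin_simps[OF arrLLD(4)[OF f']] lin_simps[OF arrLLD(4)[OF g']]
   fix x assume x [simp]: "x .: (TL M N)"
   let ?l = "tnLL M' N' M'' N'' f' g' (tnLL M N M' N' f g x)"
    and ?r = "tnLL M N M'' N'' (compose (carrier M) f' f) (compose (carrier N) g' g) x"
   have "Sw M'' N'' (M'' ** N'') ?l (pt M'' N'') = Sw M'' N'' (M'' ** N'') ?r (pt M'' N'')"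
    by (simp del: Sw_id add: compose_eq)
   then show "compose (carrier (TL M N)) (tnLL M' N' M'' N'' f' g') (tnLL M N M' N' f g) x = ?r"
    by (simp add: compose_eq)
  qed
  then show ?case by (simp add: e tnLL(1)[OF f g] tnLL(1)[OF f' g'] tnLL(1)[OF c])
 next
  case 5 show ?case by (simp add: unit_LL_yd(1))
 next
  case (6 M N P) then show ?case by (simp add: assoc_LL_iso(1))
 next
  case (7 \<phi> M M' \<psi> N N' \<chi> Q Q')
  then obtain f g h where e: "\<phi> = (M, f, M')" "\<psi> = (N, g, N')" "\<chi> = (Q, h, Q')"
   and f: "arrLL M f M'" and g: "arrLL N g N'" and h: "arrLL Q h Q'" unfolding Hom_LL by blast
  note o = arrLLD(1)[OF f] arrLLD(1)[OF g] arrLLD(1)[OF h] and o' = arrLLD(2)[OF f] arrLLD(2)[OF g] arrLLD(2)[OF h]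
  show ?case
   by (simp add: e tnLL(1)[OF f g] tnLL(1)[OF g h] tnLL(1)[OF tnLL(2)[OF f g] h] tnLL(1)[OF f tnLL(2)[OF g h]]
     aLL(1)[OF o] aLL(1)[OF o'] assoc_natural_LL[OF f g h])
    (rule compose_eqI, rule assoc_natural_LL[OF f g h])
 next
  case (8 M) then show ?case by (simp add: lunit_LL(2))
 next
  case (9 \<phi> M N)
  then obtain f where e: "\<phi> = (M, f, N)" and f: "arrLL M f N" unfolding Hom_LL by blast
  show ?case
   by (simp add: e yd_id_def tnLL(1)[OF arrLL_id[OF unit_LL_yd(1)] f] lLL(1)[OF arrLLD(1)[OF f]] lLL(1)[OF arrLLD(2)[OF f]])
    (rule compose_eqI, rule lunit_natural_LL[OF f])
 next
  case (10 M) then show ?case by (simp add: runit_LL(2))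
 next
  case (11 \<phi> M N)
  then obtain f where e: "\<phi> = (M, f, N)" and f: "arrLL M f N" unfolding Hom_LL by blast
  show ?case
   by (simp add: e yd_id_def tnLL(1)[OF f arrLL_id[OF unit_LL_yd(1)]] rLL(1)[OF arrLLD(1)[OF f]] rLL(1)[OF arrLLD(2)[OF f]])
    (rule compose_eqI, rule runit_natural_LL[OF f])
 next
  case (12 M N P Q)
  then have o: "yd_LL R H M" "yd_LL R H N" "yd_LL R H P" "yd_LL R H Q" by simp_all
  note t = tensor_LL_yd(1)[OF o(1,2)] tensor_LL_yd(1)[OF o(2,3)] tensor_LL_yd(1)[OF o(3,4)]
  note a1 = aLL[OF o(1-3)] and a2 = aLL[OF o(2-4)] and a3 = aLL[OF o(1) t(2) o(4)] and a4 = aLL[OF o(1,2) t(3)] and a5 = aLL[OF t(1) o(3,4)]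
  show ?case
   by (simp add: yd_id_def a1(1) a2(1) a3(1) a4(1) a5(1) tnLL(1)[OF arrLL_id[OF o(1)] a2(2)] tnLL(1)[OF a1(2) arrLL_id[OF o(4)]])
    (rule compose_eqI, simp add: compose_eq pentagon_LL[OF o])
 next
  case (13 M N)
  then have o: "yd_LL R H M" "yd_LL R H N" by simp_all
  note u = unit_LL_yd(1)
  note t = tnLL[OF arrLL_id[OF o(1)] lLL(2)[OF o(2)]] tnLL[OF rLL(2)[OF o(1)] arrLL_id[OF o(2)]]
  note a = aLL[OF o(1) u o(2)]
  have "compose (carrier (TL (TL M UL) N)) (tnLL M (TL UL N) M N (\<lambda>x\<in>carrier M. x) (lLL N)) (aLL M UL N)
   = tnLL (TL M UL) N M N (rLL M) (\<lambda>x\<in>carrier N. x)"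
   by (rule arrLL_eqI[OF arrLL_comp[OF a(2) t(2)] t(7)]) (simp add: compose_eq triangle_LL[OF o])
  then show ?case by (simp add: yd_id_def lLL(1)[OF o(2)] rLL(1)[OF o(1)] a(1) t(1) t(6))
 next
  case (14 M N) then show ?case by (simp add: braid_LL_iso(1))
 next
  case (15 \<phi> M M' \<psi> N N')
  then obtain f g where e: "\<phi> = (M, f, M')" "\<psi> = (N, g, N')"
   and f: "arrLL M f M'" and g: "arrLL N g N'" unfolding Hom_LL by blast
  show ?case
   by (simp add: e tnLL(1)[OF f g] tnLL(1)[OF g f] cLL(1)[OF arrLLD(1)[OF f] arrLLD(1)[OF g]] cLL(1)[OF arrLLD(2)[OF f] arrLLD(2)[OF g]])
    (rule compose_eqI, rule braid_natural_LL[OF f g])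
 next
  case (16 M N P)
  then have o: "yd_LL R H M" "yd_LL R H N" "yd_LL R H P" by simp_all
  note c = cLL[OF o(1) tensor_LL_yd(1)[OF o(2,3)]] cLL[OF o(1,2)] cLL[OF o(1,3)]
  note a = aLL(1)[OF o] aLL(1)[OF o(2,3,1)] aLL(1)[OF o(2,1,3)]
  show ?case
   by (simp add: yd_id_def a c(1) c(6) c(11) tnLL(1)[OF arrLL_id[OF o(2)] c(12)] tnLL(1)[OF c(7) arrLL_id[OF o(3)]])
    (rule compose_eqI, simp add: compose_eq hexagon_1_LL[OF o])
 next
  case (17 M N P)
  then have o: "yd_LL R H M" "yd_LL R H N" "yd_LL R H P" by simp_all
  note c = cLL[OF tensor_LL_yd(1)[OF o(1,2)] o(3)] cLL[OF o(1,3)] cLL[OF o(2,3)]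
  note a = aLL'(1)[OF o] aLL'(1)[OF o(3,1,2)] aLL'(1)[OF o(1,3,2)]
  show ?case
   by (simp add: yd_id_def a c(1) c(6) c(11) tnLL(1)[OF arrLL_id[OF o(1)] c(12)] tnLL(1)[OF c(7) arrLL_id[OF o(2)]])
    (rule compose_eqI, simp add: compose_eq hexagon_2_LL[OF o])
 qed
qed

end

subsection \<open>Transport of braided monoidal structures\<close>

context category
begin

abbreviation cmp (infixr \<open>oo\<close> 55) where "g oo f \<equiv> Comp C g f"

lemma arr_Hom: "f \<in> Arr C ==> f \<in> Hom C (Dom C f) (Cod C f)"
 by (simp add: Hom_def)

lemma Hom_arr:
 assumes "f \<in> Hom C A B"
 shows "f \<in> Arr C" "Dom C f = A" "Cod C f = B" "A \<in> Obj C" "B \<in> Obj C"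
 using assms dom_obj cod_obj by (auto simp: Hom_def)

lemma comp_arr [simp]:
 assumes "f \<in> Arr C" "g \<in> Arr C" "Dom C g = Cod C f"
 shows "g oo f \<in> Arr C" "Dom C (g oo f) = Dom C f" "Cod C (g oo f) = Cod C g"
 using Hom_arr[OF comp_hom[of f "Dom C f" "Cod C f" g "Cod C g"]] assms by (auto simp: Hom_def)

lemma comp_assoc' [simp]:
 assumes "f \<in> Arr C" "g \<in> Arr C" "h \<in> Arr C" "Dom C g = Cod C f" "Dom C h = Cod C g"
 shows "(h oo g) oo f = h oo (g oo f)"
 using comp_assoc[of f "Dom C f" "Cod C f" g "Cod C g" h "Cod C h"] assms by (auto simp: Hom_def)

lemma id_arr [simp]: "A \<in> Obj C ==> Id C A \<in> Arr C" "A \<in> Obj C ==> Dom C (Id C A) = A" "A \<in> Obj C ==> Cod C (Id C A) = A"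
 using id_hom by (auto simp: Hom_def)

lemma comp_id [simp]:
 "f \<in> Arr C ==> A = Dom C f ==> f oo Id C A = f" "f \<in> Arr C ==> B = Cod C f ==> Id C B oo f = f"
 using comp_id_right[OF arr_Hom] comp_id_left[OF arr_Hom] by simp_all

lemma arr_obj [simp]: "f \<in> Arr C ==> Dom C f \<in> Obj C" "f \<in> Arr C ==> Cod C f \<in> Obj C"
 using dom_obj cod_obj by auto

text \<open>Composites are normalised by nesting to the right, so an equation between two-arrow
  composites does not match inside a longer one; this form applies it at the head of a
  composite.\<close>

lemma reassoc:
 assumes e: "g oo f = g' oo f'" and "f \<in> Arr C" "g \<in> Arr C" "Dom C g = Cod C f" "f' \<in> Arr C" "g' \<in> Arr C" "Dom C g' = Cod C f'"
  and k: "k \<in> Arr C" "Cod C k = Dom C f"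
 shows "g oo (f oo k) = g' oo (f' oo k)"
proof -
 have "Dom C f' = Dom C f" using e assms by (metis comp_arr(2))
 then have "(g oo f) oo k = g oo (f oo k)" "(g' oo f') oo k = g' oo (f' oo k)"
  using assms(2-) by simp_all
 then show ?thesis by (simp only: e)
qed

definition iso where "iso f \<longleftrightarrow> (\<exists>g. inverse_arrows C f g)"

lemma Iso_iff: "f \<in> Iso C A B \<longleftrightarrow> f \<in> Hom C A B \<and> iso f"
 by (simp add: Iso_def iso_def)

lemma isoE:
 assumes "iso f"
 obtains g where "f \<in> Arr C" "g \<in> Arr C" "Dom C g = Cod C f" "Cod C g = Dom C f"
  "g oo f = Id C (Dom C f)" "f oo g = Id C (Cod C f)"
 using assms unfolding iso_def inverse_arrows_def Hom_def by auto

lemma isoI: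
 assumes "f \<in> Arr C" "g \<in> Arr C" "Dom C g = Cod C f" "Cod C g = Dom C f"
  "g oo f = Id C (Dom C f)" "f oo g = Id C (Cod C f)"
 shows "iso f"
 using assms unfolding iso_def inverse_arrows_def Hom_def by auto

lemma iso_arr: "iso f ==> f \<in> Arr C" by (erule isoE)

lemma iso_id: "A \<in> Obj C ==> iso (Id C A)"
 by (rule isoI[where g = "Id C A"]) simp_all

lemma iso_comp:
 assumes f: "iso f" and g: "iso g" and d: "Dom C g = Cod C f" shows "iso (g oo f)"
proof -
 obtain f' where f': "f \<in> Arr C" "f' \<in> Arr C" "Dom C f' = Cod C f" "Cod C f' = Dom C f"
  "f' oo f = Id C (Dom C f)" "f oo f' = Id C (Cod C f)" using isoE[OF f] by blast
 obtain g' where g': "g \<in> Arr C" "g' \<in> Arr C" "Dom C g' = Cod C g" "Cod C g' = Dom C g"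
  "g' oo g = Id C (Dom C g)" "g oo g' = Id C (Cod C g)" using isoE[OF g] by blast
 have "g' oo (g oo f) = f" using f' g' d comp_assoc'[of f g g'] by simp
 moreover have "f oo (f' oo g') = g'" using f' g' d comp_assoc'[of g' f' f] by simp
 ultimately show ?thesis using f' g' d by (intro isoI[where g = "f' oo g'"]) simp_all
qed

lemma iso_cancel:
 assumes h: "iso h" and f: "f \<in> Arr C" "Cod C f = Dom C h" and g: "g \<in> Arr C" "Cod C g = Dom C h"
  and e: "h oo f = h oo g"
 shows "f = g"
proof -
 obtain h' where h': "h \<in> Arr C" "h' \<in> Arr C" "Dom C h' = Cod C h" "Cod C h' = Dom C h"
  "h' oo h = Id C (Dom C h)" using isoE[OF h] by blast
 have "(h' oo h) oo f = (h' oo h) oo g" using f g h'(1-4) e by simp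
 then show ?thesis using h'(5) f g by simp
qed

lemma iso_divide:
 assumes x: "iso x" and y: "iso y" and a: "a \<in> Arr C" "Cod C a = Dom C x" and e: "x oo a = y"
 shows "iso a"
proof -
 obtain x' where x': "x \<in> Arr C" "x' \<in> Arr C" "Dom C x' = Cod C x" "Cod C x' = Dom C x"
  "x' oo x = Id C (Dom C x)" "x oo x' = Id C (Cod C x)" using isoE[OF x] by blast
 have c: "Cod C y = Cod C x" using x' a e by auto
 have "a = x' oo y" using comp_assoc'[of a x x'] x' a e by simp
 moreover have "iso x'" using x' by (intro isoI[where g = x]) simp_all
 ultimately show ?thesis using iso_comp[OF y] x' c by simp
qed

lemma Inv:
 assumes "iso f"
 shows "Inv C f \<in> Arr C" "Dom C (Inv C f) = Cod C f" "Cod C (Inv C f) = Dom C f"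
  "Inv C f oo f = Id C (Dom C f)" "f oo Inv C f = Id C (Cod C f)" "iso (Inv C f)"
proof -
 obtain g where "inverse_arrows C f g" using assms by (auto simp: iso_def)
 then have "inverse_arrows C f (Inv C f)" using Inv_eq by simp
 then show i: "Inv C f \<in> Arr C" "Dom C (Inv C f) = Cod C f" "Cod C (Inv C f) = Dom C f"
  "Inv C f oo f = Id C (Dom C f)" "f oo Inv C f = Id C (Cod C f)"
  by (auto simp: inverse_arrows_def Hom_def)
 show "iso (Inv C f)" by (rule isoI[where g = f]) (use i iso_arr[OF assms] in simp_all)
qed

lemma iso_divide_Inv:
 assumes x: "iso x" and y: "iso y" and a: "a \<in> Arr C" "Cod C a = Dom C x" and e: "x oo a = y"
 shows "x = y oo Inv C a"
proof -
 have i: "iso a" by (rule iso_divide[OF assms])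
 have "y oo Inv C a = x oo (a oo Inv C a)"
  using comp_assoc'[of "Inv C a" a x] Inv[OF i] a iso_arr[OF x] e by simp
 then show ?thesis using Inv[OF i] a iso_arr[OF x] by simp
qed

end

context monoidal_category
begin

lemma tens_arr [simp]:
 assumes "f \<in> Arr C" "g \<in> Arr C"
 shows "TensA C f g \<in> Arr C" "Dom C (TensA C f g) = TensO C (Dom C f) (Dom C g)"
  "Cod C (TensA C f g) = TensO C (Cod C f) (Cod C g)"
 using tens_hom[OF arr_Hom[OF assms(1)] arr_Hom[OF assms(2)]] by (auto simp: Hom_def)

lemma assoc_arr [simp]:
 assumes "A \<in> Obj C" "B \<in> Obj C" "E \<in> Obj C"
 shows "Assoc C A B E \<in> Arr C" "Dom C (Assoc C A B E) = TensO C (TensO C A B) E"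
  "Cod C (Assoc C A B E) = TensO C A (TensO C B E)" "iso (Assoc C A B E)"
 using assoc_iso[OF assms] by (auto simp: Iso_iff Hom_def)

lemma unit_arr [simp]:
 assumes "A \<in> Obj C"
 shows "LUnit C A \<in> Arr C" "Dom C (LUnit C A) = TensO C (Unit C) A" "Cod C (LUnit C A) = A" "iso (LUnit C A)"
  "RUnit C A \<in> Arr C" "Dom C (RUnit C A) = TensO C A (Unit C)" "Cod C (RUnit C A) = A" "iso (RUnit C A)"
 using lunit_iso[OF assms] runit_iso[OF assms] by (auto simp: Iso_iff Hom_def)

end

lemma (in braided_monoidal_category) braid_arr [simp]:
 assumes "A \<in> Obj C" "B \<in> Obj C"
 shows "Braid C A B \<in> Arr C" "Dom C (Braid C A B) = TensO C A B" "Cod C (Braid C A B) = TensO C B A" "iso (Braid C A B)"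
 using braid_iso[OF assms] by (auto simp: Iso_iff Hom_def)

text \<open>The target \<open>C\<close> is assumed to be a category whose tensor product merely has
  the correct sources and targets; functoriality is derived. Bijectivity on objects and fullness
  allow every object and arrow of \<open>C\<close> to be written as an image from
  \<open>D\<close>.\<close>

locale tensor_transport = D: braided_monoidal_category D + C: category C
 for D :: "('o, 'a) braided_cat" and C :: "('p, 'b) braided_cat" +
 fixes Fo :: "'o => 'p" and Fa :: "'a => 'b" and phi0 :: 'b and phi :: "'o => 'o => 'b"
 assumes Fo_bij: "bij_betw Fo (Obj D) (Obj C)"
  and Fa_hom: "!!f M N. f \<in> Hom D M N ==> Fa f \<in> Hom C (Fo M) (Fo N)"
  and Fa_full: "!!g M N. M \<in> Obj D ==> N \<in> Obj D ==> g \<in> Hom C (Fo M) (Fo N) ==> \<exists>f\<in>Hom D M N. Fa f = g"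
  and Fa_id: "!!M. M \<in> Obj D ==> Fa (Id D M) = Id C (Fo M)"
  and Fa_comp: "!!f g M N P. f \<in> Hom D M N ==> g \<in> Hom D N P ==> Fa (Comp D g f) = Comp C (Fa g) (Fa f)"
  and Unit_obj: "Unit C \<in> Obj C"
  and TensO_obj: "!!M N. M \<in> Obj D ==> N \<in> Obj D ==> TensO C (Fo M) (Fo N) \<in> Obj C"
  and TensA_hom: "!!f g M M' N N'. f \<in> Hom D M M' ==> g \<in> Hom D N N'
   ==> TensA C (Fa f) (Fa g) \<in> Hom C (TensO C (Fo M) (Fo N)) (TensO C (Fo M') (Fo N'))"
  and phi0_iso: "phi0 \<in> Iso C (Unit C) (Fo (Unit D))"
  and phi_iso: "!!M N. M \<in> Obj D ==> N \<in> Obj D ==> phi M N \<in> Iso C (TensO C (Fo M) (Fo N)) (Fo (TensO D M N))"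
  and phi_nat: "!!f g M M' N N'. f \<in> Hom D M M' ==> g \<in> Hom D N N'
   ==> Comp C (phi M' N') (TensA C (Fa f) (Fa g)) = Comp C (Fa (TensA D f g)) (phi M N)"
begin

notation C.cmp (infixr \<open>oo\<close> 55)
abbreviation tO (infixr \<open>\<star>\<close> 60) where "A \<star> B \<equiv> TensO C A B"
abbreviation tA (infixr \<open><>\<close> 60) where "f <> g \<equiv> TensA C f g"
abbreviation dO (infixr \<open>\<oslash>\<close> 60) where "A \<oslash> B \<equiv> TensO D A B"

lemma Fo_obj [simp]: "M \<in> Obj D ==> Fo M \<in> Obj C"
 using Fo_bij by (auto simp: bij_betw_def)

lemma Fa_arr [simp]: "f \<in> Arr D ==> Fa f \<in> Arr C" "f \<in> Arr D ==> Dom C (Fa f) = Fo (Dom D f)"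
 "f \<in> Arr D ==> Cod C (Fa f) = Fo (Cod D f)"
 using Fa_hom[OF D.arr_Hom] by (auto simp: Hom_def)

lemma Fa_comp': "f \<in> Arr D ==> g \<in> Arr D ==> Dom D g = Cod D f ==> Fa (Comp D g f) = Fa g oo Fa f"
 using Fa_comp[OF D.arr_Hom, of f g "Cod D g"] by (simp add: Hom_def)

lemma ObjE: assumes "A \<in> Obj C" obtains M where "M \<in> Obj D" "A = Fo M"
 using Fo_bij assms by (auto simp: bij_betw_def)

lemma ArrE: assumes "g \<in> Arr C" obtains f where "f \<in> Arr D" "g = Fa f"
proof -
 obtain M N where "M \<in> Obj D" "Dom C g = Fo M" "N \<in> Obj D" "Cod C g = Fo N"
  using ObjE[OF C.arr_obj(1)[OF assms]] ObjE[OF C.arr_obj(2)[OF assms]] by metis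
 then obtain f where "f \<in> Hom D M N" "Fa f = g" using Fa_full[of M N g] assms by (auto simp: Hom_def)
 then show ?thesis using that by (auto simp: Hom_def)
qed

lemma tens_obj' [simp]: "A \<in> Obj C ==> B \<in> Obj C ==> A \<star> B \<in> Obj C"
 by (metis ObjE TensO_obj)

lemma tens_arr' [simp]:
 assumes "f \<in> Arr C" "g \<in> Arr C"
 shows "f <> g \<in> Arr C" "Dom C (f <> g) = Dom C f \<star> Dom C g" "Cod C (f <> g) = Cod C f \<star> Cod C g"
proof -
 obtain f' g' where f': "f' \<in> Arr D" "f = Fa f'" "g' \<in> Arr D" "g = Fa g'" using assms ArrE by metis
 have "f <> g \<in> Hom C (Dom C f \<star> Dom C g) (Cod C f \<star> Cod C g)"
  using TensA_hom[OF D.arr_Hom[OF f'(1)] D.arr_Hom[OF f'(3)]] f' by simp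
 then show "f <> g \<in> Arr C" "Dom C (f <> g) = Dom C f \<star> Dom C g" "Cod C (f <> g) = Cod C f \<star> Cod C g"
  by (auto simp: Hom_def)
qed

lemma phi_arr [simp]:
 assumes "M \<in> Obj D" "N \<in> Obj D"
 shows "phi M N \<in> Arr C" "Dom C (phi M N) = Fo M \<star> Fo N" "Cod C (phi M N) = Fo (M \<oslash> N)" "C.iso (phi M N)"
 using phi_iso[OF assms] by (auto simp: C.Iso_iff Hom_def)

lemma phi0_arr [simp]: "phi0 \<in> Arr C" "Dom C phi0 = Unit C" "Cod C phi0 = Fo (Unit D)" "C.iso phi0"
 using phi0_iso by (auto simp: C.Iso_iff Hom_def)

lemma D_obj [simp]: "M \<in> Obj D ==> N \<in> Obj D ==> M \<oslash> N \<in> Obj D" "Unit D \<in> Obj D"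
 by (rule D.tens_obj D.unit_obj; assumption?)+

lemma phi_nat':
 assumes "f \<in> Arr D" "g \<in> Arr D" "M = Cod D f" "N = Cod D g"
 shows "phi M N oo (Fa f <> Fa g) = Fa (TensA D f g) oo phi (Dom D f) (Dom D g)"
 using phi_nat[OF D.arr_Hom D.arr_Hom] assms by simp

text \<open>The pattern for all transported axioms: compose with an invertible structure arrow, move
  it across by naturality, use the axiom of \<open>D\<close>, and cancel the structure
  arrow.\<close>

lemma tens_id': assumes "A \<in> Obj C" "B \<in> Obj C" shows "Id C A <> Id C B = Id C (A \<star> B)"
proof -
 obtain M N where M: "M \<in> Obj D" "A = Fo M" "N \<in> Obj D" "B = Fo N" using assms ObjE by metis
 show ?thesis
 proof (rule C.iso_cancel[of "phi M N"])
  show "phi M N oo (Id C A <> Id C B) = phi M N oo Id C (A \<star> B)"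
   using phi_nat'[of "Id D M" "Id D N" M N] M by (simp add: Fa_id D.tens_id)
 qed (use M in simp_all)
qed

lemma tens_comp':
 assumes "f \<in> Arr C" "f' \<in> Arr C" "Dom C f' = Cod C f" "g \<in> Arr C" "g' \<in> Arr C" "Dom C g' = Cod C g"
 shows "(f' oo f) <> (g' oo g) = (f' <> g') oo (f <> g)"
proof -
 obtain M where M: "M \<in> Obj D" "Dom C f = Fo M" using ObjE[OF C.arr_obj(1)[OF assms(1)]] .
 obtain M' where M': "M' \<in> Obj D" "Cod C f = Fo M'" using ObjE[OF C.arr_obj(2)[OF assms(1)]] .
 obtain M'' where M'': "M'' \<in> Obj D" "Cod C f' = Fo M''" using ObjE[OF C.arr_obj(2)[OF assms(2)]] .
 obtain N where N: "N \<in> Obj D" "Dom C g = Fo N" using ObjE[OF C.arr_obj(1)[OF assms(4)]] .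
 obtain N' where N': "N' \<in> Obj D" "Cod C g = Fo N'" using ObjE[OF C.arr_obj(2)[OF assms(4)]] .
 obtain N'' where N'': "N'' \<in> Obj D" "Cod C g' = Fo N''" using ObjE[OF C.arr_obj(2)[OF assms(5)]] .
 obtain a where a: "a \<in> Hom D M M'" "Fa a = f" using Fa_full[of M M' f] M M' assms by (auto simp: Hom_def)
 obtain a' where a': "a' \<in> Hom D M' M''" "Fa a' = f'" using Fa_full[of M' M'' f'] M' M'' assms by (auto simp: Hom_def)
 obtain b where b: "b \<in> Hom D N N'" "Fa b = g" using Fa_full[of N N' g] N N' assms by (auto simp: Hom_def)
 obtain b' where b': "b' \<in> Hom D N' N''" "Fa b' = g'" using Fa_full[of N' N'' g'] N' N'' assms by (auto simp: Hom_def)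
 note [simp] = D.Hom_arr[OF a(1)] D.Hom_arr[OF a'(1)] D.Hom_arr[OF b(1)] D.Hom_arr[OF b'(1)] assms M M' M'' N N' N''
 have n: "phi M'' N'' oo (f' <> g') = Fa (TensA D a' b') oo phi M' N'" "phi M' N' oo (f <> g) = Fa (TensA D a b) oo phi M N"
  using phi_nat[OF a'(1) b'(1)] phi_nat[OF a(1) b(1)] a(2) a'(2) b(2) b'(2) by simp_all
 show ?thesis
 proof (rule C.iso_cancel[of "phi M'' N''"])
  have "phi M'' N'' oo ((f' oo f) <> (g' oo g)) = Fa (Comp D (TensA D a' b') (TensA D a b)) oo phi M N"
   using phi_nat[OF D.comp_hom[OF a(1) a'(1)] D.comp_hom[OF b(1) b'(1)]] a a' b b'
   by (simp add: Fa_comp' D.tens_comp[OF a(1) a'(1) b(1) b'(1)])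
  also have "... = Fa (TensA D a' b') oo phi M' N' oo (f <> g)" by (simp add: Fa_comp' n)
  also have "... = phi M'' N'' oo ((f' <> g') oo (f <> g))" by (rule C.reassoc[OF n(1)[symmetric]]) simp_all
  finally show "phi M'' N'' oo ((f' oo f) <> (g' oo g)) = phi M'' N'' oo ((f' <> g') oo (f <> g))" .
 qed simp_all
qed

lemma iso_tens:
 assumes "C.iso f" "C.iso g" shows "C.iso (f <> g)"
proof -
 obtain f' where f': "f \<in> Arr C" "f' \<in> Arr C" "Dom C f' = Cod C f" "Cod C f' = Dom C f"
  "f' oo f = Id C (Dom C f)" "f oo f' = Id C (Cod C f)" using C.isoE[OF assms(1)] by blast
 obtain g' where g': "g \<in> Arr C" "g' \<in> Arr C" "Dom C g' = Cod C g" "Cod C g' = Dom C g"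
  "g' oo g = Id C (Dom C g)" "g oo g' = Id C (Cod C g)" using C.isoE[OF assms(2)] by blast
 show ?thesis by (rule C.isoI[where g = "f' <> g'"]) (use f' g' in \<open>simp_all add: tens_comp'[symmetric] tens_id'\<close>)
qed

lemma Fa_iso: assumes "D.iso f" shows "C.iso (Fa f)"
proof -
 obtain f' where f': "f \<in> Arr D" "f' \<in> Arr D" "Dom D f' = Cod D f" "Cod D f' = Dom D f"
  "Comp D f' f = Id D (Dom D f)" "Comp D f f' = Id D (Cod D f)" using D.isoE[OF assms(1)] by blast
 show ?thesis by (rule C.isoI[where g = "Fa f'"]) (use f' in \<open>simp_all add: Fa_comp'[symmetric] Fa_id\<close>)
qed

text \<open>The structure isomorphism for a left-bracketed triple product; \<open>R3\<close> is the
  one for the right bracketing. Compatibility of the functor with associativity is the equation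
  relating \<open>L3\<close> and \<open>R3\<close>.\<close>

definition L3 where "L3 M N P = phi (M \<oslash> N) P oo (phi M N <> Id C (Fo P))"
definition R3 where "R3 M N P = phi M (N \<oslash> P) oo (Id C (Fo M) <> phi N P)"

lemma L3 [simp]:
 assumes "M \<in> Obj D" "N \<in> Obj D" "P \<in> Obj D"
 shows "L3 M N P \<in> Arr C" "Dom C (L3 M N P) = (Fo M \<star> Fo N) \<star> Fo P" "Cod C (L3 M N P) = Fo ((M \<oslash> N) \<oslash> P)" "C.iso (L3 M N P)"
  "R3 M N P \<in> Arr C" "Dom C (R3 M N P) = Fo M \<star> (Fo N \<star> Fo P)" "Cod C (R3 M N P) = Fo (M \<oslash> (N \<oslash> P))" "C.iso (R3 M N P)"
 using assms by (simp_all add: L3_def R3_def C.iso_comp iso_tens C.iso_id)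

text \<open>In a reversed category the associativity constraint is the inverse of the given arrow.\<close>

lemma assoc_from_inverse:
 assumes o: "M \<in> Obj D" "N \<in> Obj D" "P \<in> Obj D"
  and a: "a \<in> Hom C (Fo M \<star> (Fo N \<star> Fo P)) ((Fo M \<star> Fo N) \<star> Fo P)"
  and e: "Fa (Assoc D M N P) oo L3 M N P oo a = R3 M N P"
 shows "Inv C a \<in> Hom C ((Fo M \<star> Fo N) \<star> Fo P) (Fo M \<star> (Fo N \<star> Fo P))"
  "Fa (Assoc D M N P) oo L3 M N P = R3 M N P oo Inv C a" "C.iso a"
proof -
 note [simp] = o C.Hom_arr(1-3)[OF a]
 have x: "C.iso (Fa (Assoc D M N P) oo L3 M N P)" by (simp add: C.iso_comp Fa_iso)
 have e': "(Fa (Assoc D M N P) oo L3 M N P) oo a = R3 M N P" using e by simp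
 show i: "C.iso a" by (rule C.iso_divide[OF x _ _ _ e']) simp_all
 show "Inv C a \<in> Hom C ((Fo M \<star> Fo N) \<star> Fo P) (Fo M \<star> (Fo N \<star> Fo P))" using C.Inv[OF i] by (simp add: Hom_def)
 show "Fa (Assoc D M N P) oo L3 M N P = R3 M N P oo Inv C a" by (rule C.iso_divide_Inv[OF x _ _ _ e']) simp_all
qed

end

text \<open>The constraints and the braiding of \<open>C\<close> need only have the correct ends and
  satisfy the four equations of a braided monoidal functor. As these tie them to invertible arrows
  of \<open>D\<close>, invertibility, naturality and coherence follow.\<close>

locale braided_transport = tensor_transport D C Fo Fa phi0 phi
 for D :: "('o, 'a) braided_cat" and C :: "('p, 'b) braided_cat" and Fo Fa phi0 phi +
 assumes Assoc_hom: "!!M N P. M \<in> Obj D ==> N \<in> Obj D ==> P \<in> Obj D ==>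
   Assoc C (Fo M) (Fo N) (Fo P) \<in> Hom C (TensO C (TensO C (Fo M) (Fo N)) (Fo P)) (TensO C (Fo M) (TensO C (Fo N) (Fo P)))"
  and LUnit_hom: "!!M. M \<in> Obj D ==> LUnit C (Fo M) \<in> Hom C (TensO C (Unit C) (Fo M)) (Fo M)"
  and RUnit_hom: "!!M. M \<in> Obj D ==> RUnit C (Fo M) \<in> Hom C (TensO C (Fo M) (Unit C)) (Fo M)"
  and Braid_hom: "!!M N. M \<in> Obj D ==> N \<in> Obj D ==>
   Braid C (Fo M) (Fo N) \<in> Hom C (TensO C (Fo M) (Fo N)) (TensO C (Fo N) (Fo M))"
  and assoc_eq: "!!M N P. M \<in> Obj D ==> N \<in> Obj D ==> P \<in> Obj D ==>
   Comp C (Fa (Assoc D M N P)) (L3 M N P) = Comp C (R3 M N P) (Assoc C (Fo M) (Fo N) (Fo P))"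
  and lunit_eq: "!!M. M \<in> Obj D ==>
   Comp C (Fa (LUnit D M)) (Comp C (phi (Unit D) M) (TensA C phi0 (Id C (Fo M)))) = LUnit C (Fo M)"
  and runit_eq: "!!M. M \<in> Obj D ==>
   Comp C (Fa (RUnit D M)) (Comp C (phi M (Unit D)) (TensA C (Id C (Fo M)) phi0)) = RUnit C (Fo M)"
  and braid_eq: "!!M N. M \<in> Obj D ==> N \<in> Obj D ==>
   Comp C (Fa (Braid D M N)) (phi M N) = Comp C (phi N M) (Braid C (Fo M) (Fo N))"
begin

lemma assoc_arr' [simp]:
 assumes "A \<in> Obj C" "B \<in> Obj C" "E \<in> Obj C"
 shows "Assoc C A B E \<in> Arr C" "Dom C (Assoc C A B E) = (A \<star> B) \<star> E"
  "Cod C (Assoc C A B E) = A \<star> (B \<star> E)" "C.iso (Assoc C A B E)"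
proof -
 obtain M N P where o: "M \<in> Obj D" "A = Fo M" "N \<in> Obj D" "B = Fo N" "P \<in> Obj D" "E = Fo P" using assms ObjE by metis
 show a: "Assoc C A B E \<in> Arr C" "Dom C (Assoc C A B E) = (A \<star> B) \<star> E" "Cod C (Assoc C A B E) = A \<star> (B \<star> E)"
  using Assoc_hom[OF o(1,3,5)] o by (auto simp: Hom_def)
 have i: "C.iso (Fa (Assoc D M N P) oo L3 M N P)" using o by (simp add: C.iso_comp Fa_iso)
 show "C.iso (Assoc C A B E)"
  by (rule C.iso_divide[OF _ i _ _ assoc_eq[OF o(1,3,5), symmetric, folded o(2,4,6)]]) (use a o in simp_all)
qed

lemma braid_arr' [simp]:
 assumes "A \<in> Obj C" "B \<in> Obj C"
 shows "Braid C A B \<in> Arr C" "Dom C (Braid C A B) = A \<star> B" "Cod C (Braid C A B) = B \<star> A" "C.iso (Braid C A B)"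
proof -
 obtain M N where o: "M \<in> Obj D" "A = Fo M" "N \<in> Obj D" "B = Fo N" using assms ObjE by metis
 show a: "Braid C A B \<in> Arr C" "Dom C (Braid C A B) = A \<star> B" "Cod C (Braid C A B) = B \<star> A"
  using Braid_hom[OF o(1,3)] o by (auto simp: Hom_def)
 have i: "C.iso (Fa (Braid D M N) oo phi M N)" using o by (simp add: C.iso_comp Fa_iso)
 show "C.iso (Braid C A B)"
  by (rule C.iso_divide[OF _ i _ _ braid_eq[OF o(1,3), symmetric, folded o(2,4)]]) (use a o in simp_all)
qed

lemma unit_arr' [simp]:
 assumes "A \<in> Obj C"
 shows "LUnit C A \<in> Arr C" "Dom C (LUnit C A) = Unit C \<star> A" "Cod C (LUnit C A) = A" "C.iso (LUnit C A)"
  "RUnit C A \<in> Arr C" "Dom C (RUnit C A) = A \<star> Unit C" "Cod C (RUnit C A) = A" "C.iso (RUnit C A)"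
proof -
 obtain M where o: "M \<in> Obj D" "A = Fo M" using assms ObjE by metis
 show "LUnit C A \<in> Arr C" "Dom C (LUnit C A) = Unit C \<star> A" "Cod C (LUnit C A) = A"
  "RUnit C A \<in> Arr C" "Dom C (RUnit C A) = A \<star> Unit C" "Cod C (RUnit C A) = A"
  using LUnit_hom[OF o(1)] RUnit_hom[OF o(1)] o by (auto simp: Hom_def)
 show "C.iso (LUnit C A)" "C.iso (RUnit C A)"
  using o Unit_obj by (simp_all add: lunit_eq[symmetric] runit_eq[symmetric] C.iso_comp iso_tens C.iso_id Fa_iso)
qed

lemma tens_r: "A \<in> Obj C ==> f \<in> Arr C ==> g \<in> Arr C ==> Dom C g = Cod C f ==>
  (Id C A <> g) oo (Id C A <> f) = Id C A <> (g oo f)"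
 using tens_comp'[of "Id C A" "Id C A" f g] by simp

lemma tens_l: "A \<in> Obj C ==> f \<in> Arr C ==> g \<in> Arr C ==> Dom C g = Cod C f ==>
  (g <> Id C A) oo (f <> Id C A) = (g oo f) <> Id C A"
 using tens_comp'[of f g "Id C A" "Id C A"] by simp

lemma interchange: "f \<in> Arr C ==> g \<in> Arr C ==> A = Cod C g ==> B = Dom C f ==> A' = Dom C g ==> B' = Cod C f ==>
  (f <> Id C A) oo (Id C B <> g) = (Id C B' <> g) oo (f <> Id C A')"
 using tens_comp'[of "Id C (Dom C f)" f g "Id C (Cod C g)"] tens_comp'[of f "Id C (Cod C f)" "Id C (Dom C g)" g] by simp

lemma L3_nat:
 assumes "f \<in> Arr D" "g \<in> Arr D" "h \<in> Arr D"
 shows "L3 (Cod D f) (Cod D g) (Cod D h) oo ((Fa f <> Fa g) <> Fa h)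
  = Fa (TensA D (TensA D f g) h) oo L3 (Dom D f) (Dom D g) (Dom D h)"
proof -
 note [simp] = assms
 let ?fg = "TensA D f g"
 have "(phi (Cod D f) (Cod D g) <> Id C (Fo (Cod D h))) oo ((Fa f <> Fa g) <> Fa h)
   = (Fa ?fg oo phi (Dom D f) (Dom D g)) <> (Fa h oo Id C (Fo (Dom D h)))"
  by (subst tens_comp'[symmetric]) (simp_all add: phi_nat')
 also have "... = (Fa ?fg <> Fa h) oo (phi (Dom D f) (Dom D g) <> Id C (Fo (Dom D h)))"
  by (rule tens_comp') simp_all
 finally show ?thesis
  using C.reassoc[OF phi_nat'[of ?fg h "Cod D ?fg" "Cod D h"], of "phi (Dom D f) (Dom D g) <> Id C (Fo (Dom D h))"]
  by (simp add: L3_def)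
qed

lemma R3_nat:
 assumes "f \<in> Arr D" "g \<in> Arr D" "h \<in> Arr D"
 shows "R3 (Cod D f) (Cod D g) (Cod D h) oo (Fa f <> (Fa g <> Fa h))
  = Fa (TensA D f (TensA D g h)) oo R3 (Dom D f) (Dom D g) (Dom D h)"
proof -
 note [simp] = assms
 let ?gh = "TensA D g h"
 have "(Id C (Fo (Cod D f)) <> phi (Cod D g) (Cod D h)) oo (Fa f <> (Fa g <> Fa h))
   = (Fa f oo Id C (Fo (Dom D f))) <> (Fa ?gh oo phi (Dom D g) (Dom D h))"
  by (subst tens_comp'[symmetric]) (simp_all add: phi_nat')
 also have "... = (Fa f <> Fa ?gh) oo (Id C (Fo (Dom D f)) <> phi (Dom D g) (Dom D h))"
  by (rule tens_comp') simp_all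
 finally show ?thesis
  using C.reassoc[OF phi_nat'[of f ?gh "Cod D f" "Cod D ?gh"], of "Id C (Fo (Dom D f)) <> phi (Dom D g) (Dom D h)"]
  by (simp add: R3_def)
qed

lemma assoc_nat':
 assumes "f \<in> Arr C" "g \<in> Arr C" "h \<in> Arr C"
 shows "Assoc C (Cod C f) (Cod C g) (Cod C h) oo ((f <> g) <> h)
  = (f <> (g <> h)) oo Assoc C (Dom C f) (Dom C g) (Dom C h)"
proof -
 obtain u v w where o: "u \<in> Arr D" "f = Fa u" "v \<in> Arr D" "g = Fa v" "w \<in> Arr D" "h = Fa w" using assms ArrE by metis
 note [simp] = o
 let ?M = "Dom D u" and ?N = "Dom D v" and ?P = "Dom D w" and ?M' = "Cod D u" and ?N' = "Cod D v" and ?P' = "Cod D w"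
 let ?a = "Assoc D ?M ?N ?P" and ?a' = "Assoc D ?M' ?N' ?P'"
 let ?b = "Assoc C (Fo ?M) (Fo ?N) (Fo ?P)" and ?b' = "Assoc C (Fo ?M') (Fo ?N') (Fo ?P')"
 let ?l = "TensA D (TensA D u v) w" and ?r = "TensA D u (TensA D v w)"
 have d: "Fa ?a' oo Fa ?l = Fa ?r oo Fa ?a"
  using D.assoc_natural[OF D.arr_Hom[of u] D.arr_Hom[of v] D.arr_Hom[of w]]
  by (simp add: Fa_comp'[symmetric])
 have "R3 ?M' ?N' ?P' oo (?b' oo ((f <> g) <> h)) = Fa ?a' oo (L3 ?M' ?N' ?P' oo ((f <> g) <> h))"
  by (rule C.reassoc[OF assoc_eq[symmetric]]) simp_all
 also have "... = Fa ?a' oo (Fa ?l oo L3 ?M ?N ?P)" by (simp add: L3_nat)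
 also have "... = Fa ?r oo (Fa ?a oo L3 ?M ?N ?P)" by (rule C.reassoc[OF d]) simp_all
 also have "... = Fa ?r oo (R3 ?M ?N ?P oo ?b)" by (simp add: assoc_eq)
 also have "... = R3 ?M' ?N' ?P' oo ((f <> (g <> h)) oo ?b)"
  unfolding o by (rule C.reassoc[OF R3_nat[symmetric]]) simp_all
 finally show ?thesis by - (rule C.iso_cancel[of "R3 ?M' ?N' ?P'"]; simp)
qed

lemma braid_nat':
 assumes "f \<in> Arr C" "g \<in> Arr C"
 shows "Braid C (Cod C f) (Cod C g) oo (f <> g) = (g <> f) oo Braid C (Dom C f) (Dom C g)"
proof -
 obtain u v where o: "u \<in> Arr D" "f = Fa u" "v \<in> Arr D" "g = Fa v" using assms ArrE by metis
 note [simp] = o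
 let ?M = "Dom D u" and ?N = "Dom D v" and ?M' = "Cod D u" and ?N' = "Cod D v"
 let ?c = "Braid D ?M ?N" and ?c' = "Braid D ?M' ?N'"
 let ?b = "Braid C (Fo ?M) (Fo ?N)" and ?b' = "Braid C (Fo ?M') (Fo ?N')"
 have d: "Fa ?c' oo Fa (TensA D u v) = Fa (TensA D v u) oo Fa ?c"
  using D.braid_natural[OF D.arr_Hom[of u] D.arr_Hom[of v]] by (simp add: Fa_comp'[symmetric])
 have "phi ?N' ?M' oo (?b' oo (f <> g)) = Fa ?c' oo (phi ?M' ?N' oo (f <> g))"
  by (rule C.reassoc[OF braid_eq[symmetric]]) simp_all
 also have "... = Fa ?c' oo (Fa (TensA D u v) oo phi ?M ?N)" by (simp add: phi_nat')
 also have "... = Fa (TensA D v u) oo (Fa ?c oo phi ?M ?N)" by (rule C.reassoc[OF d]) simp_all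
 also have "... = Fa (TensA D v u) oo (phi ?N ?M oo ?b)" by (simp add: braid_eq)
 also have "... = phi ?N' ?M' oo ((g <> f) oo ?b)"
  unfolding o by (rule C.reassoc[OF phi_nat'[symmetric]]) simp_all
 finally show ?thesis by - (rule C.iso_cancel[of "phi ?N' ?M'"]; simp)
qed

lemma lunit_nat':
 assumes "f \<in> Arr C"
 shows "LUnit C (Cod C f) oo (Id C (Unit C) <> f) = f oo LUnit C (Dom C f)"
proof -
 obtain u where o: "u \<in> Arr D" "f = Fa u" using assms ArrE by metis
 note [simp] = o Unit_obj
 let ?M = "Dom D u" and ?M' = "Cod D u" and ?i = "Id D (Unit D)"
 have d: "Fa (LUnit D ?M') oo Fa (TensA D ?i u) = Fa u oo Fa (LUnit D ?M)"
  using D.lunit_natural[OF D.arr_Hom[of u]] by (simp add: Fa_comp'[symmetric])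
 have i: "(phi0 <> Id C (Fo ?M')) oo (Id C (Unit C) <> Fa u) = (Fa ?i <> Fa u) oo (phi0 <> Id C (Fo ?M))"
  by (simp add: interchange[of phi0 "Fa u"] Fa_id)
 have n: "phi (Unit D) ?M' oo (Fa ?i <> Fa u) = Fa (TensA D ?i u) oo phi (Unit D) ?M"
  by (simp add: phi_nat')
 let ?k = "phi0 <> Id C (Fo ?M)"
 have "LUnit C (Fo ?M') oo (Id C (Unit C) <> f)
  = Fa (LUnit D ?M') oo (phi (Unit D) ?M' oo ((Fa ?i <> Fa u) oo ?k))"
  using i by (simp add: lunit_eq[symmetric])
 also have "... = Fa (LUnit D ?M') oo (Fa (TensA D ?i u) oo (phi (Unit D) ?M oo ?k))"
  using C.reassoc[OF n, of ?k] by simp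
 also have "... = Fa u oo (Fa (LUnit D ?M) oo (phi (Unit D) ?M oo ?k))" by (rule C.reassoc[OF d]) simp_all
 finally show ?thesis by (simp add: lunit_eq)
qed

lemma runit_nat':
 assumes "f \<in> Arr C"
 shows "RUnit C (Cod C f) oo (f <> Id C (Unit C)) = f oo RUnit C (Dom C f)"
proof -
 obtain u where o: "u \<in> Arr D" "f = Fa u" using assms ArrE by metis
 note [simp] = o Unit_obj
 let ?M = "Dom D u" and ?M' = "Cod D u" and ?i = "Id D (Unit D)"
 have d: "Fa (RUnit D ?M') oo Fa (TensA D u ?i) = Fa u oo Fa (RUnit D ?M)"
  using D.runit_natural[OF D.arr_Hom[of u]] by (simp add: Fa_comp'[symmetric])
 have i: "(Id C (Fo ?M') <> phi0) oo (Fa u <> Id C (Unit C)) = (Fa u <> Fa ?i) oo (Id C (Fo ?M) <> phi0)"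
  using interchange[of "Fa u" phi0 "Fo (Unit D)" "Fo ?M" "Unit C" "Fo ?M'"] by (simp add: Fa_id)
 have n: "phi ?M' (Unit D) oo (Fa u <> Fa ?i) = Fa (TensA D u ?i) oo phi ?M (Unit D)"
  by (simp add: phi_nat')
 let ?k = "Id C (Fo ?M) <> phi0"
 have "RUnit C (Fo ?M') oo (f <> Id C (Unit C))
  = Fa (RUnit D ?M') oo (phi ?M' (Unit D) oo ((Fa u <> Fa ?i) oo ?k))"
  using i by (simp add: runit_eq[symmetric])
 also have "... = Fa (RUnit D ?M') oo (Fa (TensA D u ?i) oo (phi ?M (Unit D) oo ?k))"
  using C.reassoc[OF n, of ?k] by simp
 also have "... = Fa u oo (Fa (RUnit D ?M) oo (phi ?M (Unit D) oo ?k))" by (rule C.reassoc[OF d]) simp_all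
 finally show ?thesis by (simp add: runit_eq)
qed

section \<open>Hexagon, triangle and pentagon in the target category\<close>

context
 fixes M N P :: 'o
 assumes o [simp]: "M \<in> Obj D" "N \<in> Obj D" "P \<in> Obj D"
begin

lemma R3_braid: "R3 N P M oo (Id C (Fo N) <> Braid C (Fo M) (Fo P)) = Fa (TensA D (Id D N) (Braid D M P)) oo R3 N M P"
proof -
 let ?n = "Id C (Fo N)" and ?c = "Braid D M P"
 have n: "phi N (P \<oslash> M) oo (?n <> Fa ?c) = Fa (TensA D (Id D N) ?c) oo phi N (M \<oslash> P)"
  using phi_nat'[of "Id D N" ?c N "P \<oslash> M"] by (simp add: Fa_id)
 have "R3 N P M oo (?n <> Braid C (Fo M) (Fo P)) = phi N (P \<oslash> M) oo ((?n <> Fa ?c) oo (?n <> phi M P))"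
  by (simp add: R3_def tens_r braid_eq)
 also have "... = Fa (TensA D (Id D N) ?c) oo (phi N (M \<oslash> P) oo (?n <> phi M P))"
  by (rule C.reassoc[OF n]) simp_all
 finally show ?thesis by (simp add: R3_def)
qed

lemma L3_braid: "L3 N M P oo (Braid C (Fo M) (Fo N) <> Id C (Fo P)) = Fa (TensA D (Braid D M N) (Id D P)) oo L3 M N P"
proof -
 let ?n = "Id C (Fo P)" and ?c = "Braid D M N"
 have n: "phi (N \<oslash> M) P oo (Fa ?c <> ?n) = Fa (TensA D ?c (Id D P)) oo phi (M \<oslash> N) P"
  using phi_nat'[of ?c "Id D P" "N \<oslash> M" P] by (simp add: Fa_id)
 have "L3 N M P oo (Braid C (Fo M) (Fo N) <> ?n) = phi (N \<oslash> M) P oo ((Fa ?c <> ?n) oo (phi M N <> ?n))"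
  by (simp add: L3_def tens_l braid_eq)
 also have "... = Fa (TensA D ?c (Id D P)) oo (phi (M \<oslash> N) P oo (phi M N <> ?n))"
  by (rule C.reassoc[OF n]) simp_all
 finally show ?thesis by (simp add: L3_def)
qed

lemma assoc_inv: "L3 M N P oo Inv C (Assoc C (Fo M) (Fo N) (Fo P)) = Fa (Inv D (Assoc D M N P)) oo R3 M N P"
proof -
 let ?a = "Assoc C (Fo M) (Fo N) (Fo P)" and ?b = "Assoc D M N P"
 note i = C.Inv[of ?a] D.Inv[of ?b]
 note [simp] = i
 have d: "Fa (Inv D ?b) oo Fa ?b = Id C (Fo ((M \<oslash> N) \<oslash> P))" by (simp add: Fa_comp'[symmetric] Fa_id)
 have "Fa (Inv D ?b) oo (R3 M N P oo ?a) = (Fa (Inv D ?b) oo Fa ?b) oo L3 M N P"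
  by (simp add: assoc_eq[symmetric])
 then have e: "Fa (Inv D ?b) oo (R3 M N P oo ?a) = L3 M N P" by (simp add: d)
 have "L3 M N P oo Inv C ?a = (Fa (Inv D ?b) oo (R3 M N P oo ?a)) oo Inv C ?a" by (simp only: e)
 also have "... = Fa (Inv D ?b) oo R3 M N P" by simp
 finally show ?thesis .
qed

text \<open>Both paths are followed by \<open>R3\<close>. Naturality of the braiding of
  \<open>C\<close> moves the structure arrow for N and P past it, after which the path is the image
  of the corresponding path in \<open>D\<close> following \<open>L3\<close>.\<close>

lemma hexagon_1':
 "Assoc C (Fo N) (Fo P) (Fo M) oo (Braid C (Fo M) (Fo N \<star> Fo P) oo Assoc C (Fo M) (Fo N) (Fo P))
  = (Id C (Fo N) <> Braid C (Fo M) (Fo P)) oo (Assoc C (Fo N) (Fo M) (Fo P) oo (Braid C (Fo M) (Fo N) <> Id C (Fo P)))"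
proof (rule C.iso_cancel[of "R3 N P M"])
 let ?a = "Assoc C (Fo M) (Fo N) (Fo P)" and ?b = "Braid C (Fo M) (Fo N \<star> Fo P)" and ?c = "Braid D M (N \<oslash> P)"
 have b: "(phi N P <> Id C (Fo M)) oo ?b = Braid C (Fo M) (Fo (N \<oslash> P)) oo (Id C (Fo M) <> phi N P)"
  using braid_nat'[of "Id C (Fo M)" "phi N P"] by simp
 have "R3 N P M oo (Assoc C (Fo N) (Fo P) (Fo M) oo (?b oo ?a)) = Fa (Assoc D N P M) oo (L3 N P M oo (?b oo ?a))"
  by (rule C.reassoc[OF assoc_eq[symmetric]]) simp_all
 also have "L3 N P M oo (?b oo ?a) = phi (N \<oslash> P) M oo (Braid C (Fo M) (Fo (N \<oslash> P)) oo ((Id C (Fo M) <> phi N P) oo ?a))"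
  using C.reassoc[OF b, of ?a] by (simp add: L3_def)
 also have "... = Fa ?c oo (phi M (N \<oslash> P) oo ((Id C (Fo M) <> phi N P) oo ?a))"
  by (rule C.reassoc[OF braid_eq[symmetric]]) simp_all
 also have "... = Fa ?c oo (R3 M N P oo ?a)" by (simp add: R3_def)
 also have "... = Fa ?c oo (Fa (Assoc D M N P) oo L3 M N P)" by (simp add: assoc_eq)
 also have "Fa (Assoc D N P M) oo ... = Fa (Comp D (Assoc D N P M) (Comp D ?c (Assoc D M N P))) oo L3 M N P"
  by (simp add: Fa_comp')
 also have "... = Fa (TensA D (Id D N) (Braid D M P)) oo (Fa (Assoc D N M P) oo (Fa (TensA D (Braid D M N) (Id D P)) oo L3 M N P))"
  by (simp add: D.hexagon_1 Fa_comp')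
 also have "... = Fa (TensA D (Id D N) (Braid D M P)) oo (Fa (Assoc D N M P) oo (L3 N M P oo (Braid C (Fo M) (Fo N) <> Id C (Fo P))))"
  by (simp only: L3_braid)
 also have "... = Fa (TensA D (Id D N) (Braid D M P)) oo (R3 N M P oo (Assoc C (Fo N) (Fo M) (Fo P) oo (Braid C (Fo M) (Fo N) <> Id C (Fo P))))"
  by (subst C.reassoc[OF assoc_eq]) simp_all
 also have "... = R3 N P M oo ((Id C (Fo N) <> Braid C (Fo M) (Fo P)) oo (Assoc C (Fo N) (Fo M) (Fo P) oo (Braid C (Fo M) (Fo N) <> Id C (Fo P))))"
  by (rule C.reassoc[OF R3_braid[symmetric]]) simp_all
 finally show "R3 N P M oo (Assoc C (Fo N) (Fo P) (Fo M) oo (?b oo ?a)) = ..." .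
qed simp_all

end

lemma hexagon_2':
 assumes o [simp]: "M \<in> Obj D" "N \<in> Obj D" "P \<in> Obj D"
 shows "Inv C (Assoc C (Fo P) (Fo M) (Fo N)) oo (Braid C (Fo M \<star> Fo N) (Fo P) oo Inv C (Assoc C (Fo M) (Fo N) (Fo P)))
  = (Braid C (Fo M) (Fo P) <> Id C (Fo N)) oo (Inv C (Assoc C (Fo M) (Fo P) (Fo N)) oo (Id C (Fo M) <> Braid C (Fo N) (Fo P)))"
proof -
 let ?a = "Inv C (Assoc C (Fo M) (Fo N) (Fo P))" and ?b = "Braid C (Fo M \<star> Fo N) (Fo P)" and ?c = "Braid D (M \<oslash> N) P"
 note [simp] = C.Inv[of "Assoc C (Fo M) (Fo N) (Fo P)"] C.Inv[of "Assoc C (Fo P) (Fo M) (Fo N)"] C.Inv[of "Assoc C (Fo M) (Fo P) (Fo N)"]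
  D.Inv[of "Assoc D M N P"] D.Inv[of "Assoc D P M N"] D.Inv[of "Assoc D M P N"]
 have b: "(Id C (Fo P) <> phi M N) oo ?b = Braid C (Fo (M \<oslash> N)) (Fo P) oo (phi M N <> Id C (Fo P))"
  using braid_nat'[of "phi M N" "Id C (Fo P)"] by simp
 have "L3 P M N oo (Inv C (Assoc C (Fo P) (Fo M) (Fo N)) oo (?b oo ?a)) = Fa (Inv D (Assoc D P M N)) oo (R3 P M N oo (?b oo ?a))"
  by (rule C.reassoc[OF assoc_inv[OF o(3,1,2)]]) simp_all
 also have "R3 P M N oo (?b oo ?a) = phi P (M \<oslash> N) oo (Braid C (Fo (M \<oslash> N)) (Fo P) oo ((phi M N <> Id C (Fo P)) oo ?a))"
  using C.reassoc[OF b, of ?a] by (simp add: R3_def)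
 also have "... = Fa ?c oo (phi (M \<oslash> N) P oo ((phi M N <> Id C (Fo P)) oo ?a))"
  by (rule C.reassoc[OF braid_eq[symmetric]]) simp_all
 also have "... = Fa ?c oo (L3 M N P oo ?a)" by (simp add: L3_def)
 also have "... = Fa ?c oo (Fa (Inv D (Assoc D M N P)) oo R3 M N P)" by (simp add: assoc_inv[OF o])
 also have "Fa (Inv D (Assoc D P M N)) oo ... = Fa (Comp D (Inv D (Assoc D P M N)) (Comp D ?c (Inv D (Assoc D M N P)))) oo R3 M N P"
  by (simp add: Fa_comp')
 also have "... = Fa (TensA D (Braid D M P) (Id D N)) oo (Fa (Inv D (Assoc D M P N)) oo (Fa (TensA D (Id D M) (Braid D N P)) oo R3 M N P))"
  by (simp add: D.hexagon_2 Fa_comp')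
 also have "... = Fa (TensA D (Braid D M P) (Id D N)) oo (Fa (Inv D (Assoc D M P N)) oo (R3 M P N oo (Id C (Fo M) <> Braid C (Fo N) (Fo P))))"
  by (simp only: R3_braid[OF o(2,1,3)])
 also have "... = Fa (TensA D (Braid D M P) (Id D N)) oo (L3 M P N oo (Inv C (Assoc C (Fo M) (Fo P) (Fo N)) oo (Id C (Fo M) <> Braid C (Fo N) (Fo P))))"
  by (subst C.reassoc[OF assoc_inv[OF o(1,3,2), symmetric]]) simp_all
 also have "... = L3 P M N oo ((Braid C (Fo M) (Fo P) <> Id C (Fo N)) oo (Inv C (Assoc C (Fo M) (Fo P) (Fo N)) oo (Id C (Fo M) <> Braid C (Fo N) (Fo P))))"
  by (rule C.reassoc[OF L3_braid[OF o(1,3,2), symmetric]]) simp_all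
 finally have "L3 P M N oo (Inv C (Assoc C (Fo P) (Fo M) (Fo N)) oo (?b oo ?a)) = ..." .
 then show ?thesis by - (rule C.iso_cancel[of "L3 P M N"]; simp)
qed

text \<open>The unit constraints of \<open>C\<close> are composites containing \<open>phi0\<close>,
  so naturality of the associativity constraint is used to carry \<open>phi0\<close> across before
  the triangle of \<open>D\<close> applies.\<close>

lemma triangle':
 assumes o [simp]: "M \<in> Obj D" "N \<in> Obj D"
 shows "(Id C (Fo M) <> LUnit C (Fo N)) oo Assoc C (Fo M) (Unit C) (Fo N) = RUnit C (Fo M) <> Id C (Fo N)"
proof -
 note [simp] = Unit_obj
 let ?I = "Unit D" and ?m = "Id C (Fo M)" and ?n = "Id C (Fo N)"
 let ?a = "Assoc C (Fo M) (Unit C) (Fo N)" and ?k = "(?m <> phi0) <> ?n"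
 have n: "phi M N oo (?m <> Fa (LUnit D N)) = Fa (TensA D (Id D M) (LUnit D N)) oo phi M (?I \<oslash> N)"
  using phi_nat'[of "Id D M" "LUnit D N" M N] by (simp add: Fa_id)
 have n': "phi M N oo (Fa (RUnit D M) <> ?n) = Fa (TensA D (RUnit D M) (Id D N)) oo phi (M \<oslash> ?I) N"
  using phi_nat'[of "RUnit D M" "Id D N" M N] by (simp add: Fa_id)
 have a: "(?m <> (phi0 <> ?n)) oo ?a = Assoc C (Fo M) (Fo ?I) (Fo N) oo ?k"
  using assoc_nat'[of ?m phi0 ?n] by simp
 have d: "Fa (TensA D (Id D M) (LUnit D N)) oo Fa (Assoc D M ?I N) = Fa (TensA D (RUnit D M) (Id D N))"
  by (simp add: Fa_comp'[symmetric] D.triangle)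
 have "phi M N oo ((?m <> LUnit C (Fo N)) oo ?a)
  = phi M N oo ((?m <> Fa (LUnit D N)) oo ((?m <> phi ?I N) oo ((?m <> (phi0 <> ?n)) oo ?a)))"
  by (simp add: lunit_eq[symmetric] tens_r[symmetric])
 also have "... = Fa (TensA D (Id D M) (LUnit D N)) oo (phi M (?I \<oslash> N) oo ((?m <> phi ?I N) oo (Assoc C (Fo M) (Fo ?I) (Fo N) oo ?k)))"
  unfolding a by (rule C.reassoc[OF n]) simp_all
 also have "... = Fa (TensA D (Id D M) (LUnit D N)) oo (R3 M ?I N oo (Assoc C (Fo M) (Fo ?I) (Fo N) oo ?k))"
  by (simp add: R3_def)
 also have "... = Fa (TensA D (Id D M) (LUnit D N)) oo (Fa (Assoc D M ?I N) oo (L3 M ?I N oo ?k))"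
  by (subst C.reassoc[OF assoc_eq[symmetric]]) simp_all
 also have "... = (Fa (TensA D (Id D M) (LUnit D N)) oo Fa (Assoc D M ?I N)) oo (L3 M ?I N oo ?k)" by simp
 also have "... = Fa (TensA D (RUnit D M) (Id D N)) oo (phi (M \<oslash> ?I) N oo ((phi M ?I <> ?n) oo ?k))"
  unfolding d by (simp add: L3_def)
 also have "... = phi M N oo ((Fa (RUnit D M) <> ?n) oo ((phi M ?I <> ?n) oo ?k))"
  by (rule C.reassoc[OF n'[symmetric]]) simp_all
 also have "... = phi M N oo (RUnit C (Fo M) <> ?n)"
  by (simp add: runit_eq[symmetric] tens_l)
 finally show ?thesis by - (rule C.iso_cancel[of "phi M N"]; simp)
qed

text \<open>Both paths are followed by the structure isomorphism \<open>?\<Psi>\<close> of the fully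
  right-bracketed fourfold product and rewritten as an image of a path in \<open>D\<close> preceded
  by \<open>?K\<close>, the one of the left-bracketed product. The images agree by the pentagon of
  \<open>D\<close>.\<close>

lemma pentagon':
 assumes o [simp]: "M \<in> Obj D" "N \<in> Obj D" "P \<in> Obj D" "Q \<in> Obj D"
 shows "(Id C (Fo M) <> Assoc C (Fo N) (Fo P) (Fo Q)) oo
   (Assoc C (Fo M) (Fo N \<star> Fo P) (Fo Q) oo (Assoc C (Fo M) (Fo N) (Fo P) <> Id C (Fo Q)))
  = Assoc C (Fo M) (Fo N) (Fo P \<star> Fo Q) oo Assoc C (Fo M \<star> Fo N) (Fo P) (Fo Q)"
proof -
 let ?m = "Id C (Fo M)" and ?n = "Id C (Fo N)" and ?q = "Id C (Fo Q)"
 let ?a = "Assoc C (Fo M) (Fo N) (Fo P)" and ?a3 = "Assoc C (Fo M) (Fo N \<star> Fo P) (Fo Q)" and ?b = "Assoc C (Fo N) (Fo P) (Fo Q)"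
 let ?X = "Fa (TensA D (Id D M) (Assoc D N P Q))" and ?Y = "Fa (Assoc D M (N \<oslash> P) Q)"
  and ?Z = "Fa (TensA D (Assoc D M N P) (Id D Q))"
 let ?U = "Fa (Assoc D M N (P \<oslash> Q))" and ?V = "Fa (Assoc D (M \<oslash> N) P Q)"
 let ?K = "phi ((M \<oslash> N) \<oslash> P) Q oo (L3 M N P <> ?q)"
 let ?\<Psi> = "phi M (N \<oslash> (P \<oslash> Q)) oo (?m <> R3 N P Q)"
 have n1: "phi M (N \<oslash> (P \<oslash> Q)) oo (?m <> Fa (Assoc D N P Q)) = ?X oo phi M ((N \<oslash> P) \<oslash> Q)"
  using phi_nat'[of "Id D M" "Assoc D N P Q"] by (simp add: Fa_id)
 have n2: "(?m <> (phi N P <> ?q)) oo ?a3 = Assoc C (Fo M) (Fo (N \<oslash> P)) (Fo Q) oo ((?m <> phi N P) <> ?q)"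
  using assoc_nat'[of ?m "phi N P" ?q] by simp
 have n3: "phi (M \<oslash> (N \<oslash> P)) Q oo (Fa (Assoc D M N P) <> ?q) = ?Z oo phi ((M \<oslash> N) \<oslash> P) Q"
  using phi_nat'[of "Assoc D M N P" "Id D Q"] by (simp add: Fa_id)
 have "?\<Psi> oo ((?m <> ?b) oo (?a3 oo (?a <> ?q)))
  = phi M (N \<oslash> (P \<oslash> Q)) oo (((?m <> R3 N P Q) oo (?m <> ?b)) oo (?a3 oo (?a <> ?q)))" by simp
 also have "(?m <> R3 N P Q) oo (?m <> ?b) = (?m <> Fa (Assoc D N P Q)) oo (?m <> L3 N P Q)"
  by (simp add: tens_r assoc_eq)
 also have "phi M (N \<oslash> (P \<oslash> Q)) oo (... oo (?a3 oo (?a <> ?q)))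
  = phi M (N \<oslash> (P \<oslash> Q)) oo ((?m <> Fa (Assoc D N P Q)) oo ((?m <> L3 N P Q) oo (?a3 oo (?a <> ?q))))" by simp
 also have "... = ?X oo (phi M ((N \<oslash> P) \<oslash> Q) oo ((?m <> L3 N P Q) oo (?a3 oo (?a <> ?q))))"
  by (rule C.reassoc[OF n1]) simp_all
 also have "(?m <> L3 N P Q) oo (?a3 oo (?a <> ?q)) = (?m <> phi (N \<oslash> P) Q) oo ((?m <> (phi N P <> ?q)) oo (?a3 oo (?a <> ?q)))"
  by (simp add: L3_def tens_r[symmetric])
 also have "(?m <> (phi N P <> ?q)) oo (?a3 oo (?a <> ?q)) = Assoc C (Fo M) (Fo (N \<oslash> P)) (Fo Q) oo (((?m <> phi N P) <> ?q) oo (?a <> ?q))"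
  by (rule C.reassoc[OF n2]) simp_all
 also have "((?m <> phi N P) <> ?q) oo (?a <> ?q) = ((?m <> phi N P) oo ?a) <> ?q" by (simp add: tens_l)
 also have "phi M ((N \<oslash> P) \<oslash> Q) oo ((?m <> phi (N \<oslash> P) Q) oo (Assoc C (Fo M) (Fo (N \<oslash> P)) (Fo Q) oo (((?m <> phi N P) oo ?a) <> ?q)))
  = R3 M (N \<oslash> P) Q oo (Assoc C (Fo M) (Fo (N \<oslash> P)) (Fo Q) oo (((?m <> phi N P) oo ?a) <> ?q))"
  by (simp add: R3_def)
 also have "... = ?Y oo (L3 M (N \<oslash> P) Q oo (((?m <> phi N P) oo ?a) <> ?q))"
  by (rule C.reassoc[OF assoc_eq[symmetric]]) simp_all
 also have "L3 M (N \<oslash> P) Q oo (((?m <> phi N P) oo ?a) <> ?q) = phi (M \<oslash> (N \<oslash> P)) Q oo ((R3 M N P oo ?a) <> ?q)"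
  by (simp add: L3_def R3_def tens_l)
 also have "... = phi (M \<oslash> (N \<oslash> P)) Q oo ((Fa (Assoc D M N P) <> ?q) oo (L3 M N P <> ?q))"
  by (simp add: assoc_eq[symmetric] tens_l)
 also have "... = ?Z oo ?K" by (rule C.reassoc[OF n3]) simp_all
 finally have 1: "?\<Psi> oo ((?m <> ?b) oo (?a3 oo (?a <> ?q))) = ?X oo (?Y oo (?Z oo ?K))" .
 let ?c = "Assoc C (Fo M) (Fo N) (Fo P \<star> Fo Q)" and ?d = "Assoc C (Fo M \<star> Fo N) (Fo P) (Fo Q)"
 let ?mn = "Id C (Fo M \<star> Fo N)" and ?mn' = "Id C (Fo (M \<oslash> N))"
 have n4: "(?m <> (?n <> phi P Q)) oo ?c = Assoc C (Fo M) (Fo N) (Fo (P \<oslash> Q)) oo (?mn <> phi P Q)"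
  using assoc_nat'[of ?m ?n "phi P Q"] by (simp add: tens_id')
 have n5: "(phi M N <> Id C (Fo P \<star> Fo Q)) oo ?d = Assoc C (Fo (M \<oslash> N)) (Fo P) (Fo Q) oo ((phi M N <> Id C (Fo P)) <> ?q)"
  using assoc_nat'[of "phi M N" "Id C (Fo P)" ?q] by (simp add: tens_id')
 have "?\<Psi> oo (?c oo ?d) = R3 M N (P \<oslash> Q) oo ((?m <> (?n <> phi P Q)) oo (?c oo ?d))"
  by (simp add: R3_def tens_r[symmetric])
 also have "(?m <> (?n <> phi P Q)) oo (?c oo ?d) = Assoc C (Fo M) (Fo N) (Fo (P \<oslash> Q)) oo ((?mn <> phi P Q) oo ?d)"
  by (rule C.reassoc[OF n4]) simp_all
 also have "R3 M N (P \<oslash> Q) oo ... = ?U oo (L3 M N (P \<oslash> Q) oo ((?mn <> phi P Q) oo ?d))"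
  by (rule C.reassoc[OF assoc_eq[symmetric]]) simp_all
 also have "L3 M N (P \<oslash> Q) oo ((?mn <> phi P Q) oo ?d)
  = phi (M \<oslash> N) (P \<oslash> Q) oo (((phi M N <> Id C (Fo (P \<oslash> Q))) oo (?mn <> phi P Q)) oo ?d)"
  by (simp add: L3_def)
 also have "(phi M N <> Id C (Fo (P \<oslash> Q))) oo (?mn <> phi P Q) = (?mn' <> phi P Q) oo (phi M N <> Id C (Fo P \<star> Fo Q))"
  by (rule interchange) simp_all
 also have "phi (M \<oslash> N) (P \<oslash> Q) oo (... oo ?d) = R3 (M \<oslash> N) P Q oo ((phi M N <> Id C (Fo P \<star> Fo Q)) oo ?d)"
  by (simp add: R3_def)
 also have "... = ?V oo (L3 (M \<oslash> N) P Q oo ((phi M N <> Id C (Fo P)) <> ?q))"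
  unfolding n5 by (rule C.reassoc[OF assoc_eq[symmetric]]) simp_all
 also have "L3 (M \<oslash> N) P Q oo ((phi M N <> Id C (Fo P)) <> ?q) = ?K"
  by (simp add: L3_def tens_l)
 finally have 2: "?\<Psi> oo (?c oo ?d) = ?U oo (?V oo ?K)" .
 have p: "?X oo (?Y oo ?Z) = ?U oo ?V" using D.pentagon[OF o] by (simp add: Fa_comp'[symmetric])
 have "?X oo (?Y oo (?Z oo ?K)) = (?X oo (?Y oo ?Z)) oo ?K" by simp
 also have "... = ?U oo (?V oo ?K)" unfolding p by simp
 finally have "?\<Psi> oo ((?m <> ?b) oo (?a3 oo (?a <> ?q))) = ?\<Psi> oo (?c oo ?d)" using 1 2 by argo
 then show ?thesis by - (rule C.iso_cancel[of ?\<Psi>]; simp add: C.iso_comp iso_tens C.iso_id)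
qed

theorem transported: "braided_monoidal_functor D C Fo Fa phi0 phi"
proof -
 note [simp] = Unit_obj
 have B: "braided_monoidal_category C"
 proof (unfold_locales, goal_cases)
  case (2 f M M' g N N') then show ?case by (auto simp: Hom_def)
 next
  case (4 f M M' f' M'' g N N' g' N'') then show ?case by (auto simp: Hom_def tens_comp')
 next
  case (6 M N P) then show ?case by (simp add: C.Iso_iff Hom_def)
 next
  case (7 f M M' g N N' h P P') then show ?case using assoc_nat'[of f g h] by (auto simp: Hom_def)
 next
  case (8 M) then show ?case by (simp add: C.Iso_iff Hom_def)
 next
  case (9 f M N) then show ?case using lunit_nat'[of f] by (auto simp: Hom_def)
 next
  case (10 M) then show ?case by (simp add: C.Iso_iff Hom_def)
 next
  case (11 f M N) then show ?case using runit_nat'[of f] by (auto simp: Hom_def)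
 next
  case (12 M N P Q) then show ?case by (metis ObjE pentagon')
 next
  case (13 M N) then show ?case by (metis ObjE triangle')
 next
  case (14 M N) then show ?case by (simp add: C.Iso_iff Hom_def)
 next
  case (15 f M M' g N N') then show ?case using braid_nat'[of f g] by (auto simp: Hom_def)
 next
  case (16 M N P) then show ?case by (metis ObjE hexagon_1')
 next
  case (17 M N P) then show ?case by (metis ObjE hexagon_2')
 qed (simp_all add: tens_id')
 interpret B: braided_monoidal_category C by (rule B)
 show ?thesis
 proof (unfold_locales, goal_cases)
  case (7 f M M' g N N') then show ?case by (rule phi_nat)
 next
  case (8 M N P) then show ?case using assoc_eq[of M N P] by (simp add: L3_def R3_def)
 qed (auto simp: Fa_hom Fa_id Fa_comp phi0_iso phi_iso lunit_eq runit_eq braid_eq)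
qed

end

context weak_hopf_bij
begin

subsection \<open>Changing the side of an action or a coaction\<close>

text \<open>The twisting map is a parameter because T leads in one direction and S back:
  \<open>toR T\<close> is inverted by \<open>toL S\<close>, and \<open>toL T\<close> by
  \<open>toR S\<close>, on the respective classes of modules.\<close>

definition toR :: "('u => 'u) => ('k, 'u) yd_module => ('k, 'u) yd_module" where
 "toR \<sigma> M = M\<lparr>coact := restrict (%m. LC M (M ** H) m (%a x. pt M H x (\<sigma> a))) (carrier M)\<rparr>"

definition toL :: "('u => 'u) => ('k, 'u) yd_module => ('k, 'u) yd_module" where
 "toL \<sigma> M = M\<lparr>coact := restrict (%m. RC M (H ** M) m (%x a. pt H M (\<sigma> a) x)) (carrier M)\<rparr>"

definition opR :: "('k, 'u) yd_module => ('k, 'u) yd_module" where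
 "opR M = M\<lparr>act := restrict2 (carrier M) (carrier H) (%m h. act M (S h) m)\<rparr>"

definition opL :: "('k, 'u) yd_module => ('k, 'u) yd_module" where
 "opL M = M\<lparr>act := restrict2 (carrier H) (carrier M) (%h m. act M m (T h))\<rparr>"

lemma side_sel [simp]:
 "carrier (toR \<sigma> M) = carrier M" "carrier (toL \<sigma> M) = carrier M" "carrier (opR M) = carrier M" "carrier (opL M) = carrier M"
 "add (toR \<sigma> M) = add M" "add (toL \<sigma> M) = add M" "add (opR M) = add M" "add (opL M) = add M"
 "zero (toR \<sigma> M) = zero M" "zero (toL \<sigma> M) = zero M" "zero (opR M) = zero M" "zero (opL M) = zero M"
 "smult (toR \<sigma> M) = smult M" "smult (toL \<sigma> M) = smult M" "smult (opR M) = smult M" "smult (opL M) = smult M"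
 "mult (toR \<sigma> M) = mult M" "mult (toL \<sigma> M) = mult M" "mult (opR M) = mult M" "mult (opL M) = mult M"
 "one (toR \<sigma> M) = one M" "one (toL \<sigma> M) = one M" "one (opR M) = one M" "one (opL M) = one M"
 "act (toR \<sigma> M) = act M" "act (toL \<sigma> M) = act M" "coact (opR M) = coact M" "coact (opL M) = coact M"
 by (simp_all add: toR_def toL_def opR_def opL_def)

lemma side_act [simp]:
 "m .: M ==> h .: H ==> act (opR M) m h = act M (S h) m"
 "m .: M ==> h .: H ==> act (opL M) h m = act M m (T h)"
 "m .: M ==> coact (toR \<sigma> M) m = LC M (M ** H) m (%a x. pt M H x (\<sigma> a))"
 "m .: M ==> coact (toL \<sigma> M) m = RC M (H ** M) m (%x a. pt H M (\<sigma> a) x)"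
 by (simp_all add: toR_def toL_def opR_def opL_def)

lemma side_mod_eq: "mod_eq (toR \<sigma> M) M" "mod_eq (toL \<sigma> M) M" "mod_eq (opR M) M" "mod_eq (opL M) M" "mod_eq N N"
 by (simp_all add: mod_eq_def)

text \<open>Changing sides leaves the underlying module alone, hence tensor products and elementary
  tensors are equal as values, not only isomorphic; the equalities of objects needed for strictness
  rest on this.\<close>

lemma side_tensor [simp]:
 "toR \<sigma> M ** N = M ** N" "toL \<sigma> M ** N = M ** N" "opR M ** N = M ** N" "opL M ** N = M ** N"
 "N ** toR \<sigma> M = N ** M" "N ** toL \<sigma> M = N ** M" "N ** opR M = N ** M" "N ** opL M = N ** M"
 "pt (toR \<sigma> M) N = pt M N" "pt (toL \<sigma> M) N = pt M N" "pt (opR M) N = pt M N" "pt (opL M) N = pt M N"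
 "pt N (toR \<sigma> M) = pt N M" "pt N (toL \<sigma> M) = pt N M" "pt N (opR M) = pt N M" "pt N (opL M) = pt N M"
 by (rule mod_eq_tensor side_mod_eq)+

lemma side_module [simp]:
 "module R (toR \<sigma> M) = module R M" "module R (toL \<sigma> M) = module R M" "module R (opR M) = module R M" "module R (opL M) = module R M"
 by (rule mod_eq_module, rule side_mod_eq)+

lemma side_lin [simp]:
 "lin (toR \<sigma> M) N = lin M N" "lin (toL \<sigma> M) N = lin M N" "lin (opR M) N = lin M N" "lin (opL M) N = lin M N"
 "lin N (toR \<sigma> M) = lin N M" "lin N (toL \<sigma> M) = lin N M" "lin N (opR M) = lin N M" "lin N (opL M) = lin N M"
 by (rule mod_eq_lin side_mod_eq)+

lemma side_Sw [simp]:
 "Sw (toR \<sigma> M) N P x f = Sw M N P x f" "Sw (toL \<sigma> M) N P x f = Sw M N P x f"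
 "Sw (opR M) N P x f = Sw M N P x f" "Sw (opL M) N P x f = Sw M N P x f"
 "Sw N (toR \<sigma> M) P x f = Sw N M P x f" "Sw N (toL \<sigma> M) P x f = Sw N M P x f"
 "Sw N (opR M) P x f = Sw N M P x f" "Sw N (opL M) P x f = Sw N M P x f"
 "Sw N P (toR \<sigma> M) x f = Sw N P M x f" "Sw N P (toL \<sigma> M) x f = Sw N P M x f"
 "Sw N P (opR M) x f = Sw N P M x f" "Sw N P (opL M) x f = Sw N P M x f"
 by (rule mod_eq_Sw side_mod_eq)+

lemma side_Sw_tensor [simp]:
 "Sw N P (toR \<sigma> M ** Q) x f = Sw N P (M ** Q) x f" "Sw N P (toL \<sigma> M ** Q) x f = Sw N P (M ** Q) x f"
 "Sw N P (opR M ** Q) x f = Sw N P (M ** Q) x f" "Sw N P (opL M ** Q) x f = Sw N P (M ** Q) x f"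
 "Sw N P (Q ** toR \<sigma> M) x f = Sw N P (Q ** M) x f" "Sw N P (Q ** toL \<sigma> M) x f = Sw N P (Q ** M) x f"
 "Sw N P (Q ** opR M) x f = Sw N P (Q ** M) x f" "Sw N P (Q ** opL M) x f = Sw N P (Q ** M) x f"
 unfolding side_tensor by (rule HOL.refl)+

lemma side_sweedler [simp]:
 "sweedler (toR \<sigma> M) x f = sweedler M x f" "sweedler (toL \<sigma> M) x f = sweedler M x f"
 "sweedler (opR M) x f = sweedler M x f" "sweedler (opL M) x f = sweedler M x f"
 by (simp_all add: sweedler_def)

lemma right_comodule_lin: "right_comodule R H M ==> coact M \<in> lin M (M ** H)"
 by (simp add: right_comodule_def)

lemma right_coact_simps:
 assumes "right_comodule R H M" "module R M"
 shows "coact M \<in> lin M (M ** H)" "!!a. a .: M ==> coact M a .: (M ** H)"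
  "!!g A. g \<in> lin A M ==> (%x. coact M (g x)) \<in> lin A (M ** H)"
  "!!r a. r .: R ==> a .: M ==> coact M (r *[M] a) = r *[M ** H] coact M a"
 using right_comodule_lin[OF assms(1)]
  lin_simps(1-3)[OF right_comodule_lin[OF assms(1)] assms(2) tensor_module[OF assms(2) H_module]]
 by (simp_all only:)

lemma RC_coassoc:
 assumes M: "right_comodule R H M" "module R M" and m: "m .: M"
  and P: "module R P" and f: "trilin M H H P f"
 shows "RC M P m (%x a. D P a (%b c. f x b c)) = RC M P m (%x a. RC M P x (%y b. f y b a))"
proof -
 note [simp] = M(2) right_coact_simps[OF M] m P trilin_simps[OF f M(2) H_module H_module P]
 let ?Q = "(M ** H) ** H"
 have co: "sweedler ?Q (coact M m) (%x a. pt (M ** H) H (coact M x) a)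
    = sweedler ?Q (coact M m) (%x a. sweedler ?Q (comult H a) (%b c. pt (M ** H) H (pt M H x b) c))"
  using M(1) m by (simp add: right_comodule_def)
 have conv: "sweedler Q (coact M m) g = RC M Q m g" for Q :: "('k, 'u) module" and g
  by (rule sweedler_Sw) simp_all
 show ?thesis
  using arg_cong[OF co, of "%x. Sw (M ** H) H P x (%u a. Sw M H P u (%x b. f x b a))"]
  by (simp add: comult_sweedler conv)
qed

lemma RC_counit:
 assumes M: "right_comodule R H M" "module R M" and m: "m .: M"
  and P: "module R P" and f: "f \<in> lin M P"
 shows "RC M P m (%x a. eH a *[P] f x) = f m"
proof -
 note [simp] = M(2) right_coact_simps[OF M] m P lin_simps[OF f M(2) P]
 have "sweedler M (coact M m) (%x a. eH a *[M] x) = m"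
  using M(1) m by (simp add: right_comodule_def)
 then have "RC M M m (%x a. eH a *[M] x) = m" by (subst sweedler_Sw[symmetric]) simp_all
 from arg_cong[OF this, of f] show ?thesis by simp
qed

lemma left_comoduleI:
 assumes mod [simp]: "module R M" and l: "coact M \<in> lin M (H ** M)"
  and co: "!!m. m .: M ==> LC M (H ** (H ** M)) m (%a x. D (H ** (H ** M)) a (%b c. pt H (H ** M) b (pt H M c x)))
   = LC M (H ** (H ** M)) m (%a x. pt H (H ** M) a (coact M x))"
  and cu: "!!m. m .: M ==> LC M M m (%a x. eH a *[M] x) = m"
 shows "left_comodule R H M"
proof -
 note [simp] = lin_closed[OF l]
 have conv: "m .: M ==> sweedler Q (coact M m) g = LC M Q m g" for Q :: "('k, 'pp, 'qq) module_scheme" and g m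
  by (rule sweedler_Sw) simp_all
 show ?thesis unfolding left_comodule_def
  using l co cu by (simp add: conv comult_sweedler)
qed

lemma right_comoduleI:
 assumes mod [simp]: "module R M" and l: "coact M \<in> lin M (M ** H)"
  and co: "!!m. m .: M ==> RC M ((M ** H) ** H) m (%x a. D ((M ** H) ** H) a (%b c. pt (M ** H) H (pt M H x b) c))
   = RC M ((M ** H) ** H) m (%x a. pt (M ** H) H (coact M x) a)"
  and cu: "!!m. m .: M ==> RC M M m (%x a. eH a *[M] x) = m"
 shows "right_comodule R H M"
proof -
 note [simp] = lin_closed[OF l]
 have conv: "m .: M ==> sweedler Q (coact M m) g = RC M Q m g" for Q :: "('k, 'pp, 'qq) module_scheme" and g m
  by (rule sweedler_Sw) simp_all
 show ?thesis unfolding right_comodule_def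
  using l co[symmetric] cu by (simp add: conv comult_sweedler)
qed

text \<open>S and T are the twists that occur. What is used of them is linearity, preservation of
  the counit and reversal of the comultiplication.\<close>

definition anticomult :: "('u => 'u) => bool" where
 "anticomult \<sigma> \<longleftrightarrow> \<sigma> = S \<or> \<sigma> = T"

lemma anticomultD:
 assumes "anticomult \<sigma>"
 shows "\<sigma> \<in> lin H H" "!!h. h .: H ==> \<sigma> h .: H" "!!g A. g \<in> lin A H ==> (%x. \<sigma> (g x)) \<in> lin A H"
  "!!r h. r .: R ==> h .: H ==> \<sigma> (r *[H] h) = r *[H] \<sigma> h"
  "!!h P p. h .: H ==> module R P ==> p .: P ==> eH (\<sigma> h) *[P] p = eH h *[P] p"
  "!!h P f. h .: H ==> module R P ==> bilin H H P f ==> D P (\<sigma> h) f = D P h (%a b. f (\<sigma> b) (\<sigma> a))"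
proof -
 show l: "\<sigma> \<in> lin H H" using assms antipode_lin antipode_inv_lin by (auto simp: anticomult_def)
 show "!!h. h .: H ==> \<sigma> h .: H" "!!g A. g \<in> lin A H ==> (%x. \<sigma> (g x)) \<in> lin A H"
  "!!r h. r .: R ==> h .: H ==> \<sigma> (r *[H] h) = r *[H] \<sigma> h"
  using lin_closed[OF l] lin_compose[OF l] lin_smult[OF l] by auto
 show "!!h P p. h .: H ==> module R P ==> p .: P ==> eH (\<sigma> h) *[P] p = eH h *[P] p"
  using assms counit_antipode counit_antipode_inv by (auto simp: anticomult_def)
 fix h P f assume "h .: H" "module R P" "bilin H H P f"
 then show "D P (\<sigma> h) f = D P h (%a b. f (\<sigma> b) (\<sigma> a))"
  using assms D_antipode_arg[of h P f] D_antipode_inv_arg[of h P f] unfolding anticomult_def by blast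
qed

lemma anticomult_antipode: "anticomult S" "anticomult T"
 by (simp_all add: anticomult_def)

text \<open>Reversal of the comultiplication converts the left coassociativity law into the right
  one.\<close>

lemma right_comodule_toR:
 assumes \<sigma>: "anticomult \<sigma>" and M: "left_comodule R H M" "module R M"
 shows "right_comodule R H (toR \<sigma> M)"
proof (rule right_comoduleI)
 note [simp] = M(2) left_coact_simps[OF M] anticomultD(1-5)[OF \<sigma>] anticomultD(6)[OF \<sigma>]
 show "module R (toR \<sigma> M)" by simp
 show "coact (toR \<sigma> M) \<in> lin (toR \<sigma> M) (toR \<sigma> M ** H)"
  by (rule lin_eqI[of "%m. LC M (M ** H) m (%a x. pt M H x (\<sigma> a))"]) simp_all
 fix m assume "m .: (toR \<sigma> M)"
 then have [simp]: "m .: M" by simp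
 let ?Q = "(M ** H) ** H"
 have "LC M ?Q m (%a x. D ?Q a (%b c. pt (M ** H) H (pt M H x (\<sigma> c)) (\<sigma> b)))
  = LC M ?Q m (%a x. LC M ?Q x (%c y. pt (M ** H) H (pt M H y (\<sigma> c)) (\<sigma> a)))"
  by (rule LC_coassoc[OF M]) simp_all
 then show "RC (toR \<sigma> M) ((toR \<sigma> M ** H) ** H) m (%x a. D ((toR \<sigma> M ** H) ** H) a (%b c. pt (toR \<sigma> M ** H) H (pt (toR \<sigma> M) H x b) c))
  = RC (toR \<sigma> M) ((toR \<sigma> M ** H) ** H) m (%x a. pt (toR \<sigma> M ** H) H (coact (toR \<sigma> M) x) a)"
  unfolding side_tensor by simp
 show "RC (toR \<sigma> M) (toR \<sigma> M) m (%x a. eH a *[toR \<sigma> M] x) = m"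
  using LC_counit[OF M, of m M "%x. x"] by simp
qed

lemma left_comodule_toL:
 assumes \<sigma>: "anticomult \<sigma>" and M: "right_comodule R H M" "module R M"
 shows "left_comodule R H (toL \<sigma> M)"
proof (rule left_comoduleI)
 note [simp] = M(2) right_coact_simps[OF M] anticomultD(1-5)[OF \<sigma>] anticomultD(6)[OF \<sigma>]
 show "module R (toL \<sigma> M)" by simp
 show "coact (toL \<sigma> M) \<in> lin (toL \<sigma> M) (H ** toL \<sigma> M)"
  by (rule lin_eqI[of "%m. RC M (H ** M) m (%x a. pt H M (\<sigma> a) x)"]) simp_all
 fix m assume "m .: (toL \<sigma> M)"
 then have [simp]: "m .: M" by simp
 let ?Q = "H ** (H ** M)"
 have "RC M ?Q m (%x a. D ?Q a (%b c. pt H (H ** M) (\<sigma> c) (pt H M (\<sigma> b) x)))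
  = RC M ?Q m (%x a. RC M ?Q x (%y b. pt H (H ** M) (\<sigma> a) (pt H M (\<sigma> b) y)))"
  by (rule RC_coassoc[OF M]) simp_all
 then show "LC (toL \<sigma> M) (H ** (H ** toL \<sigma> M)) m (%a x. D (H ** (H ** toL \<sigma> M)) a (%b c. pt H (H ** toL \<sigma> M) b (pt H (toL \<sigma> M) c x)))
  = LC (toL \<sigma> M) (H ** (H ** toL \<sigma> M)) m (%a x. pt H (H ** toL \<sigma> M) a (coact (toL \<sigma> M) x))"
  unfolding side_tensor by simp
 show "LC (toL \<sigma> M) (toL \<sigma> M) m (%a x. eH a *[toL \<sigma> M] x) = m"
  using RC_counit[OF M, of m M "%x. x"] by simp
qed

lemma side_module_iff [simp]:
 "left_module R H M ==> left_module R H (toR \<sigma> M)" "left_module R H M ==> left_module R H (toL \<sigma> M)"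
 "right_module R H M ==> right_module R H (toR \<sigma> M)" "right_module R H M ==> right_module R H (toL \<sigma> M)"
 by (simp_all add: left_module_def right_module_def extensional_module_def) (simp_all add: toR_def toL_def)

lemma side_comodule_iff [simp]:
 "right_comodule R H (opR M) \<longleftrightarrow> right_comodule R H M" "right_comodule R H (opL M) \<longleftrightarrow> right_comodule R H M"
 "left_comodule R H (opR M) \<longleftrightarrow> left_comodule R H M" "left_comodule R H (opL M) \<longleftrightarrow> left_comodule R H M"
 by (simp_all add: left_comodule_def right_comodule_def)

lemma right_module_opR: assumes M: "left_module R H M" shows "right_module R H (opR M)"
proof -
 note [simp] = left_act_simps[OF M]
 have e: "extensional_module R M" using M by (simp add: left_module_def)
 have 1: "(%m. act (opR M) m h) \<in> lin M M" if "h .: H" for h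
  by (rule lin_eqI[of "%m. act M (S h) m"]) (use that in simp_all)
 have 2: "act (opR M) m \<in> lin H M" if "m .: M" for m
  by (rule lin_eqI[of "%h. act M (S h) m"]) (use that in simp_all)
 have 3: "act (opR M) = restrict2 (carrier M) (carrier H) (act (opR M))" by (simp add: opR_def)
 show ?thesis unfolding right_module_def
  using e 1 2 3 by (simp add: extensional_module_def)
qed

lemma right_act_simps:
 assumes M: "right_module R H M"
 shows "module R M" "!!m. m .: M ==> act M m uH = m"
  "!!m g h. m .: M ==> g .: H ==> h .: H ==> act M (act M m g) h = act M m (g .* h)"
  "!!m h. m .: M ==> h .: H ==> act M m h .: M"
  "!!m. m .: M ==> act M m \<in> lin H M" "!!h. h .: H ==> (%m. act M m h) \<in> lin M M"
 using M lin_closed[of "%m. act M m _" M M] by (simp_all add: right_module_def)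

lemma left_module_opL: assumes M: "right_module R H M" shows "left_module R H (opL M)"
proof -
 note [simp] = right_act_simps[OF M]
 have e: "extensional_module R M" using M by (simp add: right_module_def)
 have 1: "act (opL M) h \<in> lin M M" if "h .: H" for h
  by (rule lin_eqI[of "%m. act M m (T h)"]) (use that in simp_all)
 have 2: "(%h. act (opL M) h m) \<in> lin H M" if "m .: M" for m
  by (rule lin_eqI[OF lin_compose[OF right_act_simps(5)[OF M that] antipode_inv_lin]]) (use that in simp_all)
 have 3: "act (opL M) = restrict2 (carrier H) (carrier M) (act (opL M))" by (simp add: opL_def)
 show ?thesis unfolding left_module_def
  using e 1 2 3 by (simp add: extensional_module_def)
qed

lemma restrict2_eqI:
 assumes "f = restrict2 A B f" and "!!x y. x \<in> A ==> y \<in> B ==> g x y = f x y" shows "restrict2 A B g = f"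
proof (intro ext)
 fix x y show "restrict2 A B g x y = f x y"
  using fun_cong[OF fun_cong[OF assms(1), of x], of y] assms(2) by (auto simp: restrict2_def)
qed

lemma opL_opR: assumes M: "left_module R H M" shows "opL (opR M) = M"
proof -
 have "act (opL (opR M)) = act M"
  unfolding opL_def[of "opR M"] using M left_act_simps[OF M]
  by (auto intro!: restrict2_eqI simp: left_module_def)
 then show ?thesis by (intro yd_module.equality) simp_all
qed

lemma opR_opL: assumes M: "right_module R H M" shows "opR (opL M) = M"
proof -
 have "act (opR (opL M)) = act M"
  unfolding opR_def[of "opL M"] using M
  by (auto intro!: restrict2_eqI simp: right_module_def)
 then show ?thesis by (intro yd_module.equality) simp_all
qed

lemma toL_toR:
 assumes M: "left_comodule R H M" "module R M" and e: "coact M \<in> extensional (carrier M)"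
  and s: "!!h. h .: H ==> \<tau> (\<sigma> h) = h" "\<sigma> \<in> lin H H" "\<tau> \<in> lin H H"
 shows "toL \<tau> (toR \<sigma> M) = M"
proof -
 note [simp] = M(2) left_coact_simps[OF M] s(1) lin_simps[OF s(2)] lin_simps[OF s(3)] s(2,3)
 have "coact (toL \<tau> (toR \<sigma> M)) = coact M"
  by (rule extensionalityI[OF _ e]) (simp add: toL_def, simp)
 then show ?thesis by (intro yd_module.equality) simp_all
qed

lemma toR_toL:
 assumes M: "right_comodule R H M" "module R M" and e: "coact M \<in> extensional (carrier M)"
  and s: "!!h. h .: H ==> \<tau> (\<sigma> h) = h" "\<sigma> \<in> lin H H" "\<tau> \<in> lin H H"
 shows "toR \<tau> (toL \<sigma> M) = M"
proof -
 note [simp] = M(2) right_coact_simps[OF M] s(1) lin_simps[OF s(2)] lin_simps[OF s(3)] s(2,3)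
 have "coact (toR \<tau> (toL \<sigma> M)) = coact M"
  by (rule extensionalityI[OF _ e]) (simp add: toR_def, simp)
 then show ?thesis by (intro yd_module.equality) simp_all
qed

lemma op_to_commute: "opR (toL \<sigma> M) = toL \<sigma> (opR M)" "opR (toR \<sigma> M) = toR \<sigma> (opR M)"
  "opL (toL \<sigma> M) = toL \<sigma> (opL M)" "opL (toR \<sigma> M) = toR \<sigma> (opL M)"
proof -
 have "coact (toL \<sigma> (opR M)) = coact (toL \<sigma> M)" "coact (toR \<sigma> (opR M)) = coact (toR \<sigma> M)"
  "coact (toL \<sigma> (opL M)) = coact (toL \<sigma> M)" "coact (toR \<sigma> (opL M)) = coact (toR \<sigma> M)"
  by (simp_all add: toL_def toR_def)
 moreover have "act (opR (toL \<sigma> M)) = act (opR M)" "act (opR (toR \<sigma> M)) = act (opR M)"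
  "act (opL (toL \<sigma> M)) = act (opL M)" "act (opL (toR \<sigma> M)) = act (opL M)"
  by (simp_all add: opL_def opR_def)
 ultimately show "opR (toL \<sigma> M) = toL \<sigma> (opR M)" "opR (toR \<sigma> M) = toR \<sigma> (opR M)"
  "opL (toL \<sigma> M) = toL \<sigma> (opL M)" "opL (toR \<sigma> M) = toR \<sigma> (opL M)"
  by (intro yd_module.equality; simp)+
qed

end

context weak_hopf_bij
begin

subsection \<open>Yetter-Drinfeld conditions on the four sides\<close>

lemma yd_LL_iff:
 assumes M: "left_module R H M" "left_comodule R H M"
 shows "yd_LL R H M \<longleftrightarrow>
  (\<forall>m\<in>carrier M. D (H ** M) uH (%u v. LC M (H ** M) m (%a x. pt H M (u .* a) (act M v x))) = coact M m) \<and>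
  (\<forall>m\<in>carrier M. \<forall>h\<in>carrier H. D (H ** M) h (%u v. LC M (H ** M) m (%a x. pt H M (u .* a) (act M v x)))
   = D (H ** M) h (%u v. LC M (H ** M) (act M u m) (%a x. pt H M (a .* v) x)))"
proof -
 note [simp] = left_act_simps[OF M(1)] left_coact_simps[OF M(2) left_act_simps(1)[OF M(1)]]
 have conv: "m .: M ==> sweedler Q (coact M m) g = LC M Q m g" for Q :: "('k, 'pp, 'qq) module_scheme" and g m
  by (rule sweedler_Sw) simp_all
 have "ldiag H (mult H) M (act M) uH (coact M m) = D (H ** M) uH (%u v. LC M (H ** M) m (%a x. pt H M (u .* a) (act M v x)))"
  if "m .: M" for m
  by (rule ldiag_eq) (use that in simp_all)
 then show ?thesis unfolding yd_LL_def using M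
  by (simp add: tensor_t_iff[OF lact_H left_module_lact[OF M(1)]] comult_sweedler conv)
qed

lemma yd_LR_iff:
 assumes M: "left_module R H M" "right_comodule R H M"
 shows "yd_LR R H M \<longleftrightarrow>
  (\<forall>m\<in>carrier M. D (M ** H) uH (%u v. RC M (M ** H) m (%x a. pt M H (act M u x) (v .* a))) = coact M m) \<and>
  (\<forall>m\<in>carrier M. \<forall>h\<in>carrier H. D (M ** H) h (%u v. RC M (M ** H) m (%x a. pt M H (act M u x) (v .* a)))
   = D (M ** H) h (%u v. RC M (M ** H) (act M v m) (%x a. pt M H x (a .* u))))"
proof -
 note [simp] = left_act_simps[OF M(1)] right_coact_simps[OF M(2) left_act_simps(1)[OF M(1)]]
 have conv: "m .: M ==> sweedler Q (coact M m) g = RC M Q m g" for Q :: "('k, 'pp, 'qq) module_scheme" and g m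
  by (rule sweedler_Sw) simp_all
 have "ldiag M (act M) H (mult H) uH (coact M m) = D (M ** H) uH (%u v. RC M (M ** H) m (%x a. pt M H (act M u x) (v .* a)))"
  if "m .: M" for m
  by (rule ldiag_eq) (use that in simp_all)
 then show ?thesis unfolding yd_LR_def using M
  by (simp add: tensor_t_iff[OF left_module_lact[OF M(1)] lact_H] comult_sweedler conv)
qed

text \<open>Right modules are treated as left modules over the opposite algebra via the antipode.\<close>

lemma right_diag_eq:
 assumes M: "left_module R H M" and N: "left_module R H N" and h: "h .: H" and x: "x .: (M ** N)"
 shows "right_diag R (opR M) (act (opR M)) (opR N) (act (opR N)) x (comult H h)
  = D (M ** N) h (%u v. Sw M N (M ** N) x (%m n. pt M N (act M (S u) m) (act N (S v) n)))"
proof -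
 note [simp] = left_act_simps[OF M] left_act_simps[OF N] h x
 have "sweedler (M ** N) x (%m n. sweedler (M ** N) (comult H h) (%a b. pt M N (act (opR M) m a) (act (opR N) n b)))
  = Sw M N (M ** N) x (%m n. D (M ** N) h (%a b. pt M N (act (opR M) m a) (act (opR N) n b)))"
  by (simp add: sweedler_Sw[of M N] comult_sweedler)
 also have "... = Sw M N (M ** N) x (%m n. D (M ** N) h (%u v. pt M N (act M (S u) m) (act N (S v) n)))"
  by simp
 also have "... = D (M ** N) h (%u v. Sw M N (M ** N) x (%m n. pt M N (act M (S u) m) (act N (S v) n)))"
  by (rule Sw_swap) simp_all
 finally show ?thesis unfolding right_diag_def by simp
qed

lemma tensor_s_iff_image:
 assumes p: "!!x. x .: V ==> p x .: V" "!!x. x .: V ==> p (p x) = p x"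
 shows "x \<in> p ` carrier V \<longleftrightarrow> x .: V \<and> p x = x"
 using p by (metis (no_types, lifting) image_iff)

text \<open>Right modules are presented as \<open>opR M\<close> with \<open>M\<close> a left module,
  which turns the right-right conditions into Sweedler identities about a left action through S. The
  range condition is again a fixed-point condition, the projection being idempotent since
  \<Delta>(1) is.\<close>

lemma yd_RR_iff:
 assumes M: "left_module R H M" "right_comodule R H M"
 shows "yd_RR R H (opR M) \<longleftrightarrow>
  (\<forall>m\<in>carrier M. D (M ** H) uH (%u v. RC M (M ** H) m (%x a. pt M H (act M (S u) x) (a .* v))) = coact M m) \<and>
  (\<forall>m\<in>carrier M. \<forall>h\<in>carrier H. D (M ** H) h (%u v. RC M (M ** H) m (%x a. pt M H (act M (S u) x) (a .* v)))
   = D (M ** H) h (%u v. RC M (M ** H) (act M (S v) m) (%x a. pt M H x (u .* a))))"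
proof -
 note [simp] = left_act_simps[OF M(1)] right_coact_simps[OF M(2) left_act_simps(1)[OF M(1)]]
 have conv: "m .: M ==> sweedler Q (coact M m) g = RC M Q m g" for Q :: "('k, 'pp, 'qq) module_scheme" and g m
  by (rule sweedler_Sw) simp_all
 let ?p = "%x. D (M ** H) uH (%u v. Sw M H (M ** H) x (%m a. pt M H (act M (S u) m) (a .* v)))"
 have p: "right_diag R (opR M) (act (opR M)) H (mult H) x (comult H h)
   = D (M ** H) h (%u v. Sw M H (M ** H) x (%m a. pt M H (act M (S u) m) (a .* v)))"
  if [simp]: "x .: (M ** H)" "h .: H" for x h
 proof -
  have "sweedler (M ** H) x (%m n. sweedler (M ** H) (comult H h) (%a b. pt M H (act (opR M) m a) (n .* b)))
   = Sw M H (M ** H) x (%m n. D (M ** H) h (%a b. pt M H (act (opR M) m a) (n .* b)))"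
   by (simp add: sweedler_Sw[of M H] comult_sweedler)
  also have "... = Sw M H (M ** H) x (%m n. D (M ** H) h (%u v. pt M H (act M (S u) m) (n .* v)))"
   by simp
  also have "... = D (M ** H) h (%u v. Sw M H (M ** H) x (%m n. pt M H (act M (S u) m) (n .* v)))"
   by (rule Sw_swap) simp_all
  finally show ?thesis unfolding right_diag_def by simp
 qed
 have pp: "?p (?p x) = ?p x" if [simp]: "x .: (M ** H)" for x
 proof -
  let ?G = "%u v. Sw M H (M ** H) x (%m a. pt M H (act M (S u) m) (a .* v))"
  have "?p (?p x) = D (M ** H) uH (%c d. D (M ** H) uH (%a b. ?G (a .* c) (b .* d)))" by simp
  also have "... = D (M ** H) uH (%a b. D (M ** H) uH (%c d. ?G (a .* c) (b .* d)))" by (rule Sw_swap) simp_all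
  also have "... = D (M ** H) (uH .* uH) ?G" by (rule D_mult[symmetric]) simp_all
  finally show ?thesis by simp
 qed
 have "tensor_s R H (opR M) (act (opR M)) H (mult H) = ?p ` carrier (M ** H)"
  unfolding tensor_s_def by (simp add: p)
 then have "x \<in> tensor_s R H (opR M) (act (opR M)) H (mult H) \<longleftrightarrow> x .: (M ** H) \<and> ?p x = x" for x
  using tensor_s_iff_image[of "M ** H" ?p x] pp by simp
 then show ?thesis unfolding yd_RR_def using M right_module_opR[OF M(1)]
  by (simp add: comult_sweedler conv)
qed

lemma yd_RL_iff:
 assumes M: "left_module R H M" "left_comodule R H M"
 shows "yd_RL R H (opR M) \<longleftrightarrow>
  (\<forall>m\<in>carrier M. D (H ** M) uH (%u v. LC M (H ** M) m (%a x. pt H M (a .* u) (act M (S v) x))) = coact M m) \<and>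
  (\<forall>m\<in>carrier M. \<forall>h\<in>carrier H. D (H ** M) h (%u v. LC M (H ** M) (act M (S u) m) (%a x. pt H M (v .* a) x))
   = D (H ** M) h (%u v. LC M (H ** M) m (%a x. pt H M (a .* u) (act M (S v) x))))"
proof -
 note [simp] = left_act_simps[OF M(1)] left_coact_simps[OF M(2) left_act_simps(1)[OF M(1)]]
 have conv: "m .: M ==> sweedler Q (coact M m) g = LC M Q m g" for Q :: "('k, 'pp, 'qq) module_scheme" and g m
  by (rule sweedler_Sw) simp_all
 let ?p = "%x. D (H ** M) uH (%u v. Sw H M (H ** M) x (%a m. pt H M (a .* u) (act M (S v) m)))"
 have p: "right_diag R H (mult H) (opR M) (act (opR M)) x (comult H h)
   = D (H ** M) h (%u v. Sw H M (H ** M) x (%a m. pt H M (a .* u) (act M (S v) m)))"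
  if [simp]: "x .: (H ** M)" "h .: H" for x h
 proof -
  have "sweedler (H ** M) x (%m n. sweedler (H ** M) (comult H h) (%a b. pt H M (m .* a) (act (opR M) n b)))
   = Sw H M (H ** M) x (%m n. D (H ** M) h (%a b. pt H M (m .* a) (act (opR M) n b)))"
   by (simp add: sweedler_Sw[of H M] comult_sweedler)
  also have "... = Sw H M (H ** M) x (%m n. D (H ** M) h (%u v. pt H M (m .* u) (act M (S v) n)))"
   by simp
  also have "... = D (H ** M) h (%u v. Sw H M (H ** M) x (%m n. pt H M (m .* u) (act M (S v) n)))"
   by (rule Sw_swap) simp_all
  finally show ?thesis unfolding right_diag_def by simp
 qed
 have pp: "?p (?p x) = ?p x" if [simp]: "x .: (H ** M)" for x
 proof -
  let ?G = "%u v. Sw H M (H ** M) x (%a m. pt H M (a .* u) (act M (S v) m))"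
  have "?p (?p x) = D (H ** M) uH (%c d. D (H ** M) uH (%a b. ?G (a .* c) (b .* d)))" by simp
  also have "... = D (H ** M) uH (%a b. D (H ** M) uH (%c d. ?G (a .* c) (b .* d)))" by (rule Sw_swap) simp_all
  also have "... = D (H ** M) (uH .* uH) ?G" by (rule D_mult[symmetric]) simp_all
  finally show ?thesis by simp
 qed
 have "tensor_s R H H (mult H) (opR M) (act (opR M)) = ?p ` carrier (H ** M)"
  unfolding tensor_s_def by (simp add: p)
 then have "x \<in> tensor_s R H H (mult H) (opR M) (act (opR M)) \<longleftrightarrow> x .: (H ** M) \<and> ?p x = x" for x
  using tensor_s_iff_image[of "H ** M" ?p x] pp by simp
 then show ?thesis unfolding yd_RL_def using M right_module_opR[OF M(1)]
  by (simp add: comult_sweedler conv)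
qed

text \<open>The compatibility condition solved for the coaction: \<lambda>(hm) = h1 m_[-1] S(h3)
  \<otimes> h2 m_[0]. Undoing the condition produces h2 S(h3) = \<open>et\<close>(h2), which turns
  into \<Delta>(1) and is absorbed by the condition at 1.\<close>

lemma LL_act:
 assumes M: "yd_LL R H M" and m: "m .: M" and h: "h .: H" and P: "module R P" and f: "bilin H M P f"
 shows "LC M P (act M h m) f = D P h (%u r. D P r (%v w. LC M P m (%a x. f (u .* a .* S w) (act M v x))))"
proof -
 note [simp] = yd_LL_simps[OF M] m h P bilin_simps[OF f H_module yd_LL_module[OF M] P]
 have "D P h (%u r. D P r (%v w. LC M P m (%a x. f (u .* a .* S w) (act M v x))))
   = D P h (%r w. D P r (%u v. LC M P m (%a x. f (u .* a .* S w) (act M v x))))"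
  by (rule coassoc[symmetric]) simp_all
 also have "... = D P h (%r w. D P r (%u v. LC M P (act M u m) (%a x. f (a .* v .* S w) x)))"
 proof (rule Sw_eqI)
  fix r w assume [simp]: "r .: H" "w .: H"
  show "D P r (%u v. LC M P m (%a x. f (u .* a .* S w) (act M v x))) = D P r (%u v. LC M P (act M u m) (%a x. f (a .* v .* S w) x))"
   using LL_yd[OF M m, of r P "%a x. f (a .* S w) x"] by simp
 qed
 also have "... = D P h (%u r. D P r (%v w. LC M P (act M u m) (%a x. f (a .* v .* S w) x)))"
  by (rule coassoc) simp_all
 also have "... = D P h (%u r. LC M P (act M u m) (%a x. f (a .* et r) x))"
 proof (rule Sw_eqI)
  fix u r assume [simp]: "u .: H" "r .: H"
  show "D P r (%v w. LC M P (act M u m) (%a x. f (a .* v .* S w) x)) = LC M P (act M u m) (%a x. f (a .* et r) x)"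
   by (rule D_antipode(2)[of r P "%y. LC M P (act M u m) (%a x. f (a .* y) x)"]) simp_all
 qed
 also have "... = D P uH (%u v. LC M P (act M (u .* h) m) (%a x. f (a .* v) x))"
  by (rule D_eps(1)[of h P "%u r. LC M P (act M u m) (%a x. f (a .* r) x)"]) simp_all
 also have "... = LC M P (act M h m) f" using LL_unit'[OF M _ P f, of "act M h m"] by simp
 finally show ?thesis ..
qed

text \<open>The explicit coaction of h2 m is multiplied on the left by S(h1); the product S(h1) h2
  contracts to \<open>es\<close>, which the range condition absorbs. Applying T to the H-leg yields
  the left-right compatibility condition.\<close>

lemma LL_star:
 assumes M: "yd_LL R H M" and m: "m .: M" and h: "h .: H" and P: "module R P" and f: "bilin H M P f"
 shows "D P h (%u v. LC M P (act M v m) (%a x. f (S u .* a) x)) = D P h (%u v. LC M P m (%a x. f (a .* S v) (act M u x)))"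
proof -
 note [simp] = yd_LL_simps[OF M] m h P bilin_simps[OF f H_module yd_LL_module[OF M] P]
 let ?K = "%y r. D P r (%q w. LC M P m (%a x. f (y .* a .* S w) (act M q x)))"
 have "D P h (%u v. LC M P (act M v m) (%a x. f (S u .* a) x)) = D P h (%u v. D P v (%p r. ?K (S u .* p) r))"
  by (simp add: LL_act[OF M m _ P])
 also have "... = D P h (%t r. D P t (%u p. ?K (S u .* p) r))"
  by (rule coassoc[symmetric]) simp_all
 also have "... = D P h (%t r. ?K (es t) r)"
 proof (rule Sw_eqI)
  fix t r assume [simp]: "t .: H" "r .: H"
  show "D P t (%u p. ?K (S u .* p) r) = ?K (es t) r"
   by (rule D_antipode(1)[of t P "%y. ?K y r"]) simp_all
 qed
 also have "... = D P h (%s w. D P s (%t q. LC M P m (%a x. f (es t .* a .* S w) (act M q x))))"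
  by (rule coassoc[symmetric]) simp_all
 also have "... = D P h (%s w. LC M P m (%a x. f (a .* S w) (act M s x)))"
 proof (rule Sw_eqI)
  fix s w assume [simp]: "s .: H" "w .: H"
  have "D P s (%t q. LC M P m (%a x. f (es t .* a .* S w) (act M q x)))
   = D P uH (%u v. LC M P m (%a x. f (u .* a .* S w) (act M (s .* v) x)))"
   by (rule D_eps(2)[of s P "%t q. LC M P m (%a x. f (t .* a .* S w) (act M q x))"]) simp_all
  also have "... = LC M P m (%a x. f (a .* S w) (act M s x))"
   using LL_unit[OF M m P, of "%a x. f (a .* S w) (act M s x)"] by simp
  finally show "D P s (%t q. LC M P m (%a x. f (es t .* a .* S w) (act M q x))) = LC M P m (%a x. f (a .* S w) (act M s x))" .
 qed
 finally show ?thesis .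
qed

text \<open>At h = 1 the left side of \<open>LL_star\<close> can be evaluated, because \<lambda> is
  known on H_t m and S(1_1) 1_2 = 1. Twisted by T, this is the range condition for the left-right
  coaction.\<close>

lemma LL_star_unit:
 assumes M: "yd_LL R H M" and m: "m .: M" and P: "module R P" and f: "bilin H M P f"
 shows "D P uH (%u v. LC M P m (%a x. f (a .* S v) (act M u x))) = LC M P m f"
proof -
 note [simp] = yd_LL_simps[OF M] m P bilin_simps[OF f H_module yd_LL_module[OF M] P]
 have "D P uH (%u v. LC M P m (%a x. f (a .* S v) (act M u x))) = D P uH (%u v. LC M P (act M v m) (%a x. f (S u .* a) x))"
  by (rule LL_star[OF M m _ P f, symmetric]) simp
 also have "... = D P uH (%u v. LC M P (act M (et v) m) (%a x. f (S u .* a) x))"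
  by (rule D_one_eps(1)[of P "%u v. LC M P (act M v m) (%a x. f (S u .* a) x)", symmetric]) simp_all
 also have "... = D P uH (%u v. LC M P m (%a x. f (S u .* et v .* a) x))"
  by (rule Sw_eqI, rule LL_act_Ht[OF M m _ P]) simp_all
 also have "... = D P uH (%u v. LC M P m (%a x. f ((S u .* v) .* a) x))"
  using D_one_eps(1)[of P "%u v. LC M P m (%a x. f (S u .* v .* a) x)"] by simp
 also have "... = LC M P m (%a x. f (es uH .* a) x)"
  by (rule D_antipode(1)[of uH P "%y. LC M P m (%a x. f (y .* a) x)"]) simp_all
 finally show ?thesis by (simp add: eps_hone)
qed

lemma yd_LR_toR: assumes M: "yd_LL R H M" shows "yd_LR R H (toR T M)"
proof -
 note [simp] = yd_LL_simps[OF M]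
 have lr: "left_module R H (toR T M)" "right_comodule R H (toR T M)"
  using right_comodule_toR[OF anticomult_antipode(2) yd_LL_D(2)[OF M] yd_LL_module[OF M]] yd_LL_D(1)[OF M] by simp_all
 show ?thesis unfolding yd_LR_iff[OF lr]
  using LL_star[OF M _ _ _ , of _ _ "M ** H" "%a x. pt M H x (T a)"]
   LL_star_unit[OF M, of _ "M ** H" "%a x. pt M H x (T a)"] by simp
qed

section \<open>Left-right modules as left-left modules\<close>

lemma yd_LR_D: "yd_LR R H M ==> left_module R H M" "yd_LR R H M ==> right_comodule R H M" "yd_LR R H M ==> module R M"
 using left_module_simps(1) by (auto simp: yd_LR_def)

lemma yd_LR_coact:
 assumes "yd_LR R H M"
 shows "coact M \<in> lin M (M ** H)" "!!a. a .: M ==> coact M a .: (M ** H)"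
  "!!g A. g \<in> lin A M ==> (%x. coact M (g x)) \<in> lin A (M ** H)"
  "!!r a. r .: R ==> a .: M ==> coact M (r *[M] a) = r *[M ** H] coact M a"
 using right_coact_simps[OF yd_LR_D(2,3)[OF assms]] by (simp_all only:)

lemmas yd_LR_simps = left_act_simps[OF yd_LR_D(1)] yd_LR_coact

lemma LR_unit:
 assumes M: "yd_LR R H M" and m: "m .: M" and P: "module R P" and f: "bilin M H P f"
 shows "D P uH (%u v. RC M P m (%x a. f (act M u x) (v .* a))) = RC M P m f"
proof -
 note [simp] = yd_LR_simps[OF M] m P bilin_simps[OF f yd_LR_D(3)[OF M] H_module P]
 have "D (M ** H) uH (%u v. RC M (M ** H) m (%x a. pt M H (act M u x) (v .* a))) = coact M m"
  using M m yd_LR_iff[OF yd_LR_D(1,2)[OF M]] by blast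
 from arg_cong[OF this, of "%x. Sw M H P x f"] show ?thesis using f by simp
qed

lemma LR_yd:
 assumes M: "yd_LR R H M" and m: "m .: M" and h: "h .: H" and P: "module R P" and f: "bilin M H P f"
 shows "D P h (%u v. RC M P m (%x a. f (act M u x) (v .* a))) = D P h (%u v. RC M P (act M v m) (%x a. f x (a .* u)))"
proof -
 note [simp] = yd_LR_simps[OF M] m h P bilin_simps[OF f yd_LR_D(3)[OF M] H_module P]
 have "D (M ** H) h (%u v. RC M (M ** H) m (%x a. pt M H (act M u x) (v .* a)))
   = D (M ** H) h (%u v. RC M (M ** H) (act M v m) (%x a. pt M H x (a .* u)))"
  using M m h yd_LR_iff[OF yd_LR_D(1,2)[OF M]] by blast
 from arg_cong[OF this, of "%x. Sw M H P x f"] show ?thesis using f by simp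
qed

lemma LR_unit':
 assumes M: "yd_LR R H M" and m: "m .: M" and P: "module R P" and f: "bilin M H P f"
 shows "D P uH (%u v. RC M P (act M v m) (%x a. f x (a .* u))) = RC M P m f"
 using LR_yd[OF M m hone_closed P f] LR_unit[OF M m P f] by simp

lemma LR_act_Hs:
 assumes M: "yd_LR R H M" and m: "m .: M" and y: "y \<in> Hs" and P: "module R P" and f: "bilin M H P f"
 shows "RC M P (act M y m) f = RC M P m (%x a. f x (y .* a))"
proof -
 note [simp] = yd_LR_simps[OF M] m P bilin_simps[OF f yd_LR_D(3)[OF M] H_module P]
 have [simp]: "y .: H" using y by simp
 have "RC M P (act M y m) f = D P uH (%u v. RC M P (act M (v .* y) m) (%x a. f x (a .* u)))"
  using LR_unit'[OF M _ P f, of "act M y m"] by simp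
 also have "... = D P y (%u v. RC M P (act M v m) (%x a. f x (a .* u)))" by (simp add: D_Hs(1)[OF y])
 also have "... = D P y (%u v. RC M P m (%x a. f (act M u x) (v .* a)))"
  by (rule LR_yd[OF M, symmetric]) (simp_all add: f)
 also have "... = D P uH (%u v. RC M P m (%x a. f (act M u x) (y .* v .* a)))" by (simp add: D_Hs(2)[OF y])
 also have "... = RC M P m (%x a. f x (y .* a))"
  using LR_unit[OF M m P, of "%x a. f x (y .* a)"] by simp
 finally show ?thesis .
qed

text \<open>The left-right analogue of the solved form: \<rho>(hm) = h2 m_[0] \<otimes> h3 m_[1]
  T(h1), obtained from the contraction h2 T(h1) = \<open>esb h\<close>.\<close>

lemma LR_act:
 assumes M: "yd_LR R H M" and m: "m .: M" and h: "h .: H" and P: "module R P" and f: "bilin M H P f"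
 shows "RC M P (act M h m) f = D P h (%u r. D P r (%v w. RC M P m (%x a. f (act M v x) (w .* a .* T u))))"
proof -
 note [simp] = yd_LR_simps[OF M] m h P bilin_simps[OF f yd_LR_D(3)[OF M] H_module P]
 have "D P h (%u r. D P r (%v w. RC M P m (%x a. f (act M v x) (w .* a .* T u))))
   = D P h (%u r. D P r (%v w. RC M P (act M w m) (%x a. f x (a .* v .* T u))))"
 proof (rule Sw_eqI)
  fix u r assume [simp]: "u .: H" "r .: H"
  show "D P r (%v w. RC M P m (%x a. f (act M v x) (w .* a .* T u))) = D P r (%v w. RC M P (act M w m) (%x a. f x (a .* v .* T u)))"
   using LR_yd[OF M m, of r P "%x a. f x (a .* T u)"] by simp
 qed
 also have "... = D P h (%t w. D P t (%u v. RC M P (act M w m) (%x a. f x (a .* v .* T u))))"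
  by (rule coassoc[symmetric]) simp_all
 also have "... = D P h (%t w. RC M P (act M w m) (%x a. f x (a .* esb t)))"
 proof (rule Sw_eqI)
  fix t w assume [simp]: "t .: H" "w .: H"
  show "D P t (%u v. RC M P (act M w m) (%x a. f x (a .* v .* T u))) = RC M P (act M w m) (%x a. f x (a .* esb t))"
   by (rule D_antipode_inv(1)[of t P "%y. RC M P (act M w m) (%x a. f x (a .* y))"]) simp_all
 qed
 also have "... = D P uH (%u v. RC M P (act M (v .* h) m) (%x a. f x (a .* u)))"
  by (rule D_eps(3)[of h P "%t w. RC M P (act M w m) (%x a. f x (a .* t))"]) simp_all
 also have "... = RC M P (act M h m) f" using LR_unit'[OF M _ P f, of "act M h m"] by simp
 finally show ?thesis ..
qed

text \<open>The counterpart of \<open>LL_star\<close> for the way back: applying S to the H-leg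
  gives the left-left compatibility condition.\<close>

lemma LR_star:
 assumes M: "yd_LR R H M" and m: "m .: M" and h: "h .: H" and P: "module R P" and f: "bilin M H P f"
 shows "D P h (%u v. RC M P (act M u m) (%x a. f x (T v .* a))) = D P h (%u v. RC M P m (%x a. f (act M v x) (a .* T u)))"
proof -
 note [simp] = yd_LR_simps[OF M] m h P bilin_simps[OF f yd_LR_D(3)[OF M] H_module P]
 let ?G = "%p q y. RC M P m (%x a. f (act M q x) (y .* a .* T p))"
 have "D P h (%u v. RC M P (act M u m) (%x a. f x (T v .* a))) = D P h (%u v. D P u (%p r. D P r (%q w. ?G p q (T v .* w))))"
  by (simp add: LR_act[OF M m _ P])
 also have "... = D P h (%p s. D P s (%r v. D P r (%q w. ?G p q (T v .* w))))"
  by (rule coassoc) simp_all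
 also have "... = D P h (%p s. D P s (%q t. D P t (%w v. ?G p q (T v .* w))))"
  by (rule Sw_eqI, rule coassoc) simp_all
 also have "... = D P h (%p s. D P s (%q t. ?G p q (etb t)))"
 proof (intro Sw_eqI)
  fix p s q t assume [simp]: "p .: H" "s .: H" "q .: H" "t .: H"
  show "D P t (%w v. ?G p q (T v .* w)) = ?G p q (etb t)"
   by (rule D_antipode_inv(2)[of t P "%y. ?G p q y"]) simp_all
 qed
 also have "... = D P h (%p s. RC M P m (%x a. f (act M s x) (a .* T p)))"
 proof (rule Sw_eqI)
  fix p s assume [simp]: "p .: H" "s .: H"
  have "D P s (%q t. ?G p q (etb t)) = D P uH (%u v. ?G p (s .* u) v)"
   by (rule D_eps(4)[of s P "%q t. ?G p q t"]) simp_all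
  also have "... = RC M P m (%x a. f (act M s x) (a .* T p))"
   using LR_unit[OF M m P, of "%x a. f (act M s x) (a .* T p)"] by simp
  finally show "D P s (%q t. ?G p q (etb t)) = RC M P m (%x a. f (act M s x) (a .* T p))" .
 qed
 finally show ?thesis .
qed

lemma LR_star_unit:
 assumes M: "yd_LR R H M" and m: "m .: M" and P: "module R P" and f: "bilin M H P f"
 shows "D P uH (%u v. RC M P m (%x a. f (act M v x) (a .* T u))) = RC M P m f"
proof -
 note [simp] = yd_LR_simps[OF M] m P bilin_simps[OF f yd_LR_D(3)[OF M] H_module P]
 have "D P uH (%u v. RC M P m (%x a. f (act M v x) (a .* T u))) = D P uH (%u v. RC M P (act M u m) (%x a. f x (T v .* a)))"
  by (rule LR_star[OF M m _ P f, symmetric]) simp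
 also have "... = D P uH (%u v. RC M P (act M (es u) m) (%x a. f x (T v .* a)))"
  by (rule D_one_eps(2)[of P "%u v. RC M P (act M u m) (%x a. f x (T v .* a))", symmetric]) simp_all
 also have "... = D P uH (%u v. RC M P m (%x a. f x (T v .* es u .* a)))"
  by (rule Sw_eqI, rule LR_act_Hs[OF M m _ P]) simp_all
 also have "... = D P uH (%u v. RC M P m (%x a. f x ((T v .* u) .* a)))"
  using D_one_eps(2)[of P "%u v. RC M P m (%x a. f x (T v .* u .* a))"] by simp
 also have "... = RC M P m (%x a. f x (etb uH .* a))"
  by (rule D_antipode_inv(2)[of uH P "%y. RC M P m (%x a. f x (y .* a))"]) simp_all
 finally show ?thesis using antipode_inv_eps(2)[of uH] by (simp add: eps_hone)
qed

lemma yd_LL_toL: assumes M: "yd_LR R H M" shows "yd_LL R H (toL S M)"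
proof -
 note [simp] = yd_LR_simps[OF M]
 have lr: "left_module R H (toL S M)" "left_comodule R H (toL S M)"
  using left_comodule_toL[OF anticomult_antipode(1) yd_LR_D(2,3)[OF M]] yd_LR_D(1)[OF M] by simp_all
 show ?thesis unfolding yd_LL_iff[OF lr]
  using LR_star[OF M, of _ _ "H ** M" "%x a. pt H M (S a) x"]
   LR_star_unit[OF M, of _ "H ** M" "%x a. pt H M (S a) x"] by simp
qed

text \<open>Since \<Delta>(S(h)) = S(h2) \<otimes> S(h1), the right-right condition at h for the
  action through S and the coaction twisted by T is the left-left condition at S(h).\<close>

lemma yd_RR_opR: assumes M: "yd_LL R H M" shows "yd_RR R H (opR (toR T M))"
proof -
 note [simp] = yd_LL_simps[OF M]
 let ?f = "%a x. pt M H x (T a)"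
 have lr: "left_module R H (toR T M)" "right_comodule R H (toR T M)"
  using yd_LR_D(1,2)[OF yd_LR_toR[OF M]] by simp_all
 have 1: "D (M ** H) uH (%u v. LC M (M ** H) m (%a x. ?f (S v .* a) (act M (S u) x))) = LC M (M ** H) m ?f" if "m .: M" for m
  using D_one_antipode[of "M ** H" "%p q. LC M (M ** H) m (%a x. ?f (p .* a) (act M q x))"] LL_unit[OF M that, of "M ** H" ?f] that
  by simp
 have 2: "D (M ** H) h (%u v. LC M (M ** H) m (%a x. ?f (S v .* a) (act M (S u) x)))
  = D (M ** H) h (%u v. LC M (M ** H) (act M (S v) m) (%a x. ?f (a .* S u) x))" if "m .: M" "h .: H" for m h
  using D_antipode_arg[of h "M ** H" "%p q. LC M (M ** H) m (%a x. ?f (p .* a) (act M q x))"]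
   D_antipode_arg[of h "M ** H" "%p q. LC M (M ** H) (act M p m) (%a x. ?f (a .* q) x)"]
   LL_yd[OF M that(1), of "S h" "M ** H" ?f] that
  by simp
 show ?thesis unfolding yd_RR_iff[OF lr] using 1 2 by simp
qed

lemma yd_RL_opR: assumes M: "yd_LR R H M" shows "yd_RL R H (toL T (opR M))"
proof -
 note [simp] = yd_LR_simps[OF M]
 let ?f = "%x a. pt H M (T a) x"
 have lr: "left_module R H (toL T M)" "left_comodule R H (toL T M)"
  using left_comodule_toL[OF anticomult_antipode(2) yd_LR_D(2,3)[OF M]] yd_LR_D(1)[OF M] by simp_all
 have 1: "D (H ** M) uH (%u v. RC M (H ** M) m (%x a. ?f (act M (S v) x) (S u .* a))) = RC M (H ** M) m ?f" if "m .: M" for m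
  using D_one_antipode[of "H ** M" "%p q. RC M (H ** M) m (%x a. ?f (act M p x) (q .* a))"] LR_unit[OF M that, of "H ** M" ?f] that
  by simp
 have 2: "D (H ** M) h (%u v. RC M (H ** M) m (%x a. ?f (act M (S v) x) (S u .* a)))
  = D (H ** M) h (%u v. RC M (H ** M) (act M (S u) m) (%x a. ?f x (a .* S v)))" if "m .: M" "h .: H" for m h
  using D_antipode_arg[of h "H ** M" "%p q. RC M (H ** M) m (%x a. ?f (act M p x) (q .* a))"]
   D_antipode_arg[of h "H ** M" "%p q. RC M (H ** M) (act M q m) (%x a. ?f x (a .* p))"]
   LR_yd[OF M that(1), of "S h" "H ** M" ?f] that
  by simp
 show ?thesis unfolding op_to_commute(1)[symmetric] yd_RL_iff[OF lr] using 1 2 by simp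
qed

section \<open>Right modules read back as left modules\<close>

lemma yd_RR_D:
 assumes "yd_RR R H M"
 shows "right_module R H M" "right_comodule R H M" "module R M" "coact M \<in> extensional (carrier M)"
 using assms by (auto simp: yd_RR_def right_module_def extensional_module_def)

lemma yd_RL_D:
 assumes "yd_RL R H M"
 shows "right_module R H M" "left_comodule R H M" "module R M" "coact M \<in> extensional (carrier M)"
 using assms by (auto simp: yd_RL_def right_module_def extensional_module_def)

lemma yd_ext:
 "yd_LL R H M ==> coact M \<in> extensional (carrier M)" "yd_LR R H M ==> coact M \<in> extensional (carrier M)"
 by (auto simp: yd_LL_def yd_LR_def left_module_def extensional_module_def)

text \<open>The left-left condition at h is recovered from the right-right condition at T(h), as
  S(T(h)) = h.\<close>

lemma yd_LL_opL: assumes N: "yd_RR R H N" shows "yd_LL R H (toL S (opL N))"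
proof -
 let ?M = "opL N"
 have M: "left_module R H ?M" "right_comodule R H ?M" using left_module_opL yd_RR_D[OF N] by simp_all
 have NM: "yd_RR R H (opR ?M)" using N opR_opL[OF yd_RR_D(1)[OF N]] by simp
 define M where "M = ?M"
 note M = M[folded M_def] and NM = NM[folded M_def]
 note [simp] = left_act_simps[OF M(1)] right_coact_simps[OF M(2) left_act_simps(1)[OF M(1)]]
 let ?f = "%x a. pt H M (S a) x"
 have lr: "left_module R H (toL S M)" "left_comodule R H (toL S M)"
  using left_comodule_toL[OF anticomult_antipode(1) M(2)] M(1) by simp_all
 have U: "D (H ** M) uH (%u v. RC M (H ** M) m (%x a. ?f (act M (S u) x) (a .* v))) = RC M (H ** M) m ?f" if "m .: M" for m
 proof -
  have "D (M ** H) uH (%u v. RC M (M ** H) m (%x a. pt M H (act M (S u) x) (a .* v))) = coact M m"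
   using NM[unfolded yd_RR_iff[OF M]] that by blast
  from arg_cong[OF this, of "%z. Sw M H (H ** M) z ?f"] that show ?thesis by simp
 qed
 have Y: "D (H ** M) h (%u v. RC M (H ** M) m (%x a. ?f (act M (S u) x) (a .* v)))
  = D (H ** M) h (%u v. RC M (H ** M) (act M (S v) m) (%x a. ?f x (u .* a)))" if "m .: M" "h .: H" for m h
 proof -
  have "D (M ** H) h (%u v. RC M (M ** H) m (%x a. pt M H (act M (S u) x) (a .* v)))
   = D (M ** H) h (%u v. RC M (M ** H) (act M (S v) m) (%x a. pt M H x (u .* a)))"
   using NM[unfolded yd_RR_iff[OF M]] that by blast
  from arg_cong[OF this, of "%z. Sw M H (H ** M) z ?f"] that show ?thesis by simp
 qed
 have 1: "D (H ** M) uH (%u v. RC M (H ** M) m (%x a. pt H M (u .* S a) (act M v x))) = RC M (H ** M) m ?f" if "m .: M" for m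
  using D_one_antipode[of "H ** M" "%p q. RC M (H ** M) m (%x a. pt H M (p .* S a) (act M q x))"] U[OF that] that by simp
 have 2: "D (H ** M) h (%u v. RC M (H ** M) m (%x a. pt H M (u .* S a) (act M v x)))
  = D (H ** M) h (%u v. RC M (H ** M) (act M u m) (%x a. pt H M (S a .* v) x))" if "m .: M" "h .: H" for m h
  using D_antipode_arg[of "T h" "H ** M" "%p q. RC M (H ** M) m (%x a. pt H M (p .* S a) (act M q x))"]
   D_antipode_arg[of "T h" "H ** M" "%p q. RC M (H ** M) (act M p m) (%x a. pt H M (S a .* q) x)"]
   Y[OF that(1), of "T h"] that by simp
 have "yd_LL R H (toL S M)" unfolding yd_LL_iff[OF lr] using 1 2 by simp
 then show ?thesis by (simp add: M_def)
qed

lemma yd_LR_opL: assumes N: "yd_RL R H N" shows "yd_LR R H (toR S (opL N))"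
proof -
 let ?M = "opL N"
 have M: "left_module R H ?M" "left_comodule R H ?M" using left_module_opL yd_RL_D[OF N] by simp_all
 have NM: "yd_RL R H (opR ?M)" using N opR_opL[OF yd_RL_D(1)[OF N]] by simp
 define M where "M = ?M"
 note M = M[folded M_def] and NM = NM[folded M_def]
 note [simp] = left_act_simps[OF M(1)] left_coact_simps[OF M(2) left_act_simps(1)[OF M(1)]]
 let ?f = "%a x. pt M H x (S a)"
 have lr: "left_module R H (toR S M)" "right_comodule R H (toR S M)"
  using right_comodule_toR[OF anticomult_antipode(1) M(2)] M(1) by simp_all
 have U: "D (M ** H) uH (%u v. LC M (M ** H) m (%a x. ?f (a .* u) (act M (S v) x))) = LC M (M ** H) m ?f" if "m .: M" for m
 proof -
  have "D (H ** M) uH (%u v. LC M (H ** M) m (%a x. pt H M (a .* u) (act M (S v) x))) = coact M m"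
   using NM[unfolded yd_RL_iff[OF M]] that by blast
  from arg_cong[OF this, of "%z. Sw H M (M ** H) z ?f"] that show ?thesis by simp
 qed
 have Y: "D (M ** H) h (%u v. LC M (M ** H) (act M (S u) m) (%a x. ?f (v .* a) x))
  = D (M ** H) h (%u v. LC M (M ** H) m (%a x. ?f (a .* u) (act M (S v) x)))" if "m .: M" "h .: H" for m h
 proof -
  have "D (H ** M) h (%u v. LC M (H ** M) (act M (S u) m) (%a x. pt H M (v .* a) x))
   = D (H ** M) h (%u v. LC M (H ** M) m (%a x. pt H M (a .* u) (act M (S v) x)))"
   using NM[unfolded yd_RL_iff[OF M]] that by blast
  from arg_cong[OF this, of "%z. Sw H M (M ** H) z ?f"] that show ?thesis by simp
 qed
 have 1: "D (M ** H) uH (%u v. LC M (M ** H) m (%a x. pt M H (act M u x) (v .* S a))) = LC M (M ** H) m ?f" if "m .: M" for m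
  using D_one_antipode[of "M ** H" "%p q. LC M (M ** H) m (%a x. pt M H (act M p x) (q .* S a))"] U[OF that] that by simp
 have 2: "D (M ** H) h (%u v. LC M (M ** H) m (%a x. pt M H (act M u x) (v .* S a)))
  = D (M ** H) h (%u v. LC M (M ** H) (act M v m) (%a x. pt M H x (S a .* u)))" if "m .: M" "h .: H" for m h
  using D_antipode_arg[of "T h" "M ** H" "%p q. LC M (M ** H) m (%a x. pt M H (act M p x) (q .* S a))"]
   D_antipode_arg[of "T h" "M ** H" "%p q. LC M (M ** H) (act M q m) (%a x. pt M H x (S a .* p))"]
   Y[OF that(1), of "T h"] that by simp
 have "yd_LR R H (toR S M)" unfolding yd_LR_iff[OF lr] using 1 2 by simp
 then show ?thesis by (simp add: M_def)
qed

end

subsection \<open>Isomorphisms of categories of modules with action and coaction\<close>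

text \<open>An object bijection that keeps carriers and underlying functions. Arrows are triples and
  composition refers only to carriers and functions, so the category axioms of \<open>C\<close>
  follow from those of \<open>D\<close>.\<close>

locale yd_link = D: category D
 for D C :: "(('k, 'u) yd_module, ('k, 'u) yd_arrow) braided_cat" and Fo :: "('k, 'u) yd_module => ('k, 'u) yd_module" +
 assumes D_sel: "Dom D = fst" "Cod D = snd \<circ> snd" "Id D = yd_id" "Comp D = yd_comp"
  and C_sel: "Dom C = fst" "Cod C = snd \<circ> snd" "Id C = yd_id" "Comp C = yd_comp"
  and C_arr: "!!M f N. (M, f, N) \<in> Arr C ==> M \<in> Obj C \<and> N \<in> Obj C"
  and Fo_bij: "bij_betw Fo (Obj D) (Obj C)"
  and Fo_carrier [simp]: "!!M. carrier (Fo M) = carrier M"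
  and Fo_arr: "!!M f N. M \<in> Obj D ==> N \<in> Obj D ==> (Fo M, f, Fo N) \<in> Arr C \<longleftrightarrow> (M, f, N) \<in> Arr D"
begin

definition Fa where "Fa = (%(M, f :: 'u => 'u, N). (Fo M, f, Fo N))"

lemma Fa_simp [simp]: "Fa (M, f, N) = (Fo M, f, Fo N)" by (simp add: Fa_def)

lemma D_arr: "(M, f, N) \<in> Arr D ==> M \<in> Obj D \<and> N \<in> Obj D"
 using D.dom_obj[of "(M, f, N)"] D.cod_obj[of "(M, f, N)"] by (simp add: D_sel)

lemma HomD_iff: "\<phi> \<in> Hom D M N \<longleftrightarrow> (\<exists>f. \<phi> = (M, f, N) \<and> (M, f, N) \<in> Arr D)"
 by (cases \<phi>) (auto simp: Hom_def D_sel C_sel)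

lemma HomC_iff: "\<phi> \<in> Hom C M N \<longleftrightarrow> (\<exists>f. \<phi> = (M, f, N) \<and> (M, f, N) \<in> Arr C)"
 by (cases \<phi>) (auto simp: Hom_def D_sel C_sel)

lemma Fa_hom: "\<phi> \<in> Hom D M N ==> Fa \<phi> \<in> Hom C (Fo M) (Fo N)"
 using Fo_arr D_arr by (fastforce simp: HomD_iff HomC_iff)

lemma Fa_full:
 assumes M: "M \<in> Obj D" and N: "N \<in> Obj D" and g: "\<gamma> \<in> Hom C (Fo M) (Fo N)"
 shows "\<exists>\<phi>\<in>Hom D M N. Fa \<phi> = \<gamma>"
proof -
 obtain f where f: "\<gamma> = (Fo M, f, Fo N)" "(Fo M, f, Fo N) \<in> Arr C" using g HomC_iff by blast
 then have "(M, f, N) \<in> Hom D M N" using Fo_arr[OF M N] HomD_iff by blast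
 then show ?thesis using f(1) Fa_simp by blast
qed

lemma Fa_id: "Fa (Id D M) = Id C (Fo M)"
 by (simp add: yd_id_def D_sel C_sel)

lemma Fa_comp: "Fa (Comp D \<psi> \<phi>) = Comp C (Fa \<psi>) (Fa \<phi>)"
 by (cases \<phi>, cases \<psi>) (simp add: yd_comp_def D_sel C_sel)

lemma ObjC: assumes "A \<in> Obj C" obtains M where "M \<in> Obj D" "A = Fo M"
 using Fo_bij assms by (auto simp: bij_betw_def)

lemma HomC: assumes "\<gamma> \<in> Hom C A B" obtains \<phi> M N where "\<phi> \<in> Hom D M N" "A = Fo M" "B = Fo N" "\<gamma> = Fa \<phi>" "M \<in> Obj D" "N \<in> Obj D"
proof -
 have "A \<in> Obj C" "B \<in> Obj C" using assms C_arr by (auto simp: HomC_iff)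
 then obtain M N where "M \<in> Obj D" "A = Fo M" "N \<in> Obj D" "B = Fo N" by (metis ObjC)
 then show ?thesis using that Fa_full[of M N \<gamma>] assms by blast
qed

lemma Fo_inj: "M \<in> Obj D ==> N \<in> Obj D ==> Fo M = Fo N ==> M = N"
 using Fo_bij by (auto simp: bij_betw_def dest: inj_onD)

lemma category_C: "category C"
proof (unfold_locales, goal_cases)
 case (1 f) then show ?case using C_arr by (cases f) (auto simp: C_sel)
next
 case (2 f) then show ?case using C_arr by (cases f) (auto simp: C_sel)
next
 case (3 A) then show ?case by (metis ObjC Fa_id Fa_hom D.id_hom)
next
 case (4 f A B g E)
 obtain \<phi> M N where f: "\<phi> \<in> Hom D M N" "A = Fo M" "B = Fo N" "f = Fa \<phi>" "N \<in> Obj D" by (rule HomC[OF 4(1)])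
 obtain \<psi> N' P where g: "\<psi> \<in> Hom D N' P" "B = Fo N'" "E = Fo P" "g = Fa \<psi>" "N' \<in> Obj D" by (rule HomC[OF 4(2)])
 have "N' = N" using f g Fo_inj by simp
 then show ?case using Fa_hom[OF D.comp_hom[OF f(1), of \<psi> P]] f g by (simp add: Fa_comp)
next
 case (5 f A B)
 obtain \<phi> M N where f: "\<phi> \<in> Hom D M N" "A = Fo M" "f = Fa \<phi>" by (rule HomC[OF 5])
 then show ?case using D.comp_id_right[OF f(1)] by (metis Fa_comp Fa_id)
next
 case (6 f A B)
 obtain \<phi> M N where f: "\<phi> \<in> Hom D M N" "B = Fo N" "f = Fa \<phi>" by (rule HomC[OF 6])
 then show ?case using D.comp_id_left[OF f(1)] by (metis Fa_comp Fa_id)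
next
 case (7 f A B g E h K)
 obtain \<phi> M N where f: "\<phi> \<in> Hom D M N" "B = Fo N" "f = Fa \<phi>" "N \<in> Obj D" by (rule HomC[OF 7(1)])
 obtain \<psi> N' P where g: "\<psi> \<in> Hom D N' P" "B = Fo N'" "E = Fo P" "g = Fa \<psi>" "N' \<in> Obj D" "P \<in> Obj D" by (rule HomC[OF 7(2)])
 obtain \<chi> P' Q where h: "\<chi> \<in> Hom D P' Q" "E = Fo P'" "h = Fa \<chi>" "P' \<in> Obj D" by (rule HomC[OF 7(3)])
 have e: "N' = N" "P' = P" using f g h Fo_inj by simp_all
 show ?case using D.comp_assoc[OF f(1) g(1)[unfolded e] h(1)[unfolded e]] f g h by (metis Fa_comp)
qed

lemma Fa_bij: "bij_betw Fa (Arr D) (Arr C)"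
proof (rule bij_betw_imageI)
 show "inj_on Fa (Arr D)"
 proof (rule inj_onI)
  fix \<phi> \<psi> assume a: "\<phi> \<in> Arr D" "\<psi> \<in> Arr D" "Fa \<phi> = Fa \<psi>"
  obtain M f N M' f' N' where m: "\<phi> = (M, f, N)" "\<psi> = (M', f', N')" by (metis prod_cases3)
  then show "\<phi> = \<psi>" using a Fo_inj[of M M'] Fo_inj[of N N'] D_arr[of M f N] D_arr[of M' f' N'] by simp
 qed
 show "Fa ` Arr D = Arr C"
 proof (intro equalityI subsetI)
  fix \<gamma> assume "\<gamma> \<in> Fa ` Arr D"
  then obtain \<phi> where p: "\<gamma> = Fa \<phi>" "\<phi> \<in> Arr D" by blast
  obtain M f N where "\<phi> = (M, f, N)" by (metis prod_cases3)
  then show "\<gamma> \<in> Arr C" using Fo_arr[of M N f] D_arr[of M f N] p by simp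
 next
  fix \<gamma> assume "\<gamma> \<in> Arr C"
  then have "\<gamma> \<in> Hom C (Dom C \<gamma>) (Cod C \<gamma>)" by (simp add: Hom_def)
  then obtain \<phi> M N where "\<phi> \<in> Hom D M N" and "\<gamma> = Fa \<phi>" by (rule HomC)
  then have "\<phi> \<in> Arr D" by (simp add: Hom_def)
  then show "\<gamma> \<in> Fa ` Arr D" unfolding \<open>\<gamma> = Fa \<phi>\<close> by (rule imageI)
 qed
qed

lemma Fa_inverse: assumes "inverse_arrows D \<phi> \<psi>" shows "inverse_arrows C (Fa \<phi>) (Fa \<psi>)" "Inv C (Fa \<phi>) = Fa \<psi>" "Inv D \<phi> = \<psi>"
proof -
 interpret C: category C by (rule category_C)
 obtain M f N where m: "\<phi> = (M, f, N)" by (metis prod_cases3)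
 have F: "\<phi> \<in> Hom D M N" and G: "\<psi> \<in> Hom D N M" and c: "Comp D \<psi> \<phi> = Id D M" "Comp D \<phi> \<psi> = Id D N"
  using assms unfolding inverse_arrows_def by (auto simp: m Hom_def D_sel C_sel)
 show i: "inverse_arrows C (Fa \<phi>) (Fa \<psi>)"
  unfolding inverse_arrows_def Fa_comp[symmetric] c Fa_id
  using Fa_hom[OF F] Fa_hom[OF G] by (auto simp: Hom_def m Fa_id D_sel C_sel)
 show "Inv C (Fa \<phi>) = Fa \<psi>" by (rule C.Inv_eq[OF i])
 show "Inv D \<phi> = \<psi>" by (rule D.Inv_eq[OF assms])
qed

end

locale strict_yd_link = yd_link D C Fo
 for D C :: "(('k, 'u) yd_module, ('k, 'u) yd_arrow) braided_cat" and Fo +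
 assumes D_braided: "braided_monoidal_category D"
  and Fo_Unit: "Unit C = Fo (Unit D)"
  and Fo_TensO: "!!M N. M \<in> Obj D ==> N \<in> Obj D ==> TensO C (Fo M) (Fo N) = Fo (TensO D M N)"
  and Fa_TensA: "!!\<phi> \<psi>. \<phi> \<in> Arr D ==> \<psi> \<in> Arr D ==> TensA C (Fa \<phi>) (Fa \<psi>) = Fa (TensA D \<phi> \<psi>)"
  and Fa_Assoc: "!!M N P. M \<in> Obj D ==> N \<in> Obj D ==> P \<in> Obj D ==> Assoc C (Fo M) (Fo N) (Fo P) = Fa (Assoc D M N P)"
  and Fa_LUnit: "!!M. M \<in> Obj D ==> LUnit C (Fo M) = Fa (LUnit D M)"
  and Fa_RUnit: "!!M. M \<in> Obj D ==> RUnit C (Fo M) = Fa (RUnit D M)"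
  and Fa_Braid: "!!M N. M \<in> Obj D ==> N \<in> Obj D ==> Braid C (Fo M) (Fo N) = Fa (Braid D M N)"
begin

lemma Fo_obj: "M \<in> Obj D ==> Fo M \<in> Obj C"
 using Fo_bij by (auto simp: bij_betw_def)

text \<open>The strict case of the transport theorem, with identity arrows as structure
  isomorphisms.\<close>

lemma iso: "D \<cong>\<^sub>b\<^sub>r C"
proof -
 interpret B: braided_monoidal_category D by (rule D_braided)
 interpret C: category C by (rule category_C)
 note [simp] = Fo_obj B.tens_obj B.unit_obj
 have fa [simp]: "\<phi> \<in> Arr D ==> Fa \<phi> \<in> Arr C" "\<phi> \<in> Arr D ==> Dom C (Fa \<phi>) = Fo (Dom D \<phi>)" "\<phi> \<in> Arr D ==> Cod C (Fa \<phi>) = Fo (Cod D \<phi>)" for \<phi>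
  using Fa_hom[OF D.arr_Hom] by (auto simp: Hom_def)
 note [simp] = Fo_Unit Fo_TensO Fa_TensA Fa_Assoc Fa_LUnit Fa_RUnit Fa_Braid Fa_id Fa_comp
 have T: "tensor_transport D C Fo Fa (Id C (Fo (Unit D))) (%M N. Id C (Fo (TensO D M N)))"
  by unfold_locales (use Fo_bij Fa_hom Fa_full in \<open>auto simp: C.Iso_iff C.iso_id Hom_def\<close>)
 interpret T: tensor_transport D C Fo Fa "Id C (Fo (Unit D))" "%M N. Id C (Fo (TensO D M N))" by (rule T)
 have ids: "TensA C (Id C (Fo M)) (Id C (Fo N)) = Id C (Fo (TensO D M N))" if "M \<in> Obj D" "N \<in> Obj D" for M N
  using T.tens_id'[of "Fo M" "Fo N"] that by simp
 have "braided_transport D C Fo Fa (Id C (Fo (Unit D))) (%M N. Id C (Fo (TensO D M N)))"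
  by unfold_locales (auto simp: Hom_def T.L3_def T.R3_def ids)
 then have "braided_monoidal_functor D C Fo Fa (Id C (Fo (Unit D))) (%M N. Id C (Fo (TensO D M N)))"
  by (rule braided_transport.transported)
 then show ?thesis unfolding braided_monoidal_isomorphic_def using Fo_bij Fa_bij by blast
qed

lemma braided_C: "braided_monoidal_category C"
proof -
 obtain Go Ga g0 g where "braided_monoidal_functor D C Go Ga g0 g"
  using iso unfolding braided_monoidal_isomorphic_def by auto
 then show ?thesis by (rule braided_monoidal_functor.axioms(2))
qed

text \<open>A functor on \<open>D\<close> factors through the strict isomorphism \<open>D \<cong> C\<close>.\<close>

lemma iso_factor:
 assumes G: "braided_monoidal_functor D E Go Ga g0 g" and Gb: "bij_betw Go (Obj D) (Obj E)" "bij_betw Ga (Arr D) (Arr E)"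
 shows "C \<cong>\<^sub>b\<^sub>r E"
proof -
 interpret G: braided_monoidal_functor D E Go Ga g0 g by (rule G)
 interpret C: braided_monoidal_category C by (rule braided_C)
 let ?o = "inv_into (Obj D) Fo" and ?a = "inv_into (Arr D) Fa"
 have o [simp]: "?o (Fo M) = M" if "M \<in> Obj D" for M
  using Fo_bij that by (auto simp: bij_betw_def inv_into_f_f)
 have a [simp]: "?a (Fa \<phi>) = \<phi>" if "\<phi> \<in> Arr D" for \<phi>
  using Fa_bij that by (auto simp: bij_betw_def inv_into_f_f)
 have h: "\<phi> \<in> Hom D M N ==> ?a (Fa \<phi>) = \<phi>" for \<phi> M N by (simp add: Hom_def)
 note [simp] = G.C.tens_obj G.C.unit_obj
 have F: "braided_monoidal_functor C E (Go \<circ> ?o) (Ga \<circ> ?a) g0 (%A B. g (?o A) (?o B))"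
 proof (unfold_locales, goal_cases)
  case (1 A) then show ?case by (auto elim!: ObjC simp: G.functor_obj)
 next
  case (2 f A B)
  obtain \<phi> M N where f: "\<phi> \<in> Hom D M N" "A = Fo M" "B = Fo N" "f = Fa \<phi>" "M \<in> Obj D" "N \<in> Obj D" by (rule HomC[OF 2])
  then show ?case using G.functor_hom[OF f(1)] by (simp add: h[OF f(1)])
 next
  case (3 A) then show ?case
   by (auto elim!: ObjC simp: Fa_id[symmetric] G.functor_id)
 next
  case (4 f A B k E')
  obtain \<phi> M N where f: "\<phi> \<in> Hom D M N" "B = Fo N" "f = Fa \<phi>" "N \<in> Obj D" by (rule HomC[OF 4(1)])
  obtain \<psi> N' P where k: "\<psi> \<in> Hom D N' P" "B = Fo N'" "k = Fa \<psi>" "N' \<in> Obj D" by (rule HomC[OF 4(2)])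
  have e: "N' = N" using f k Fo_inj by simp
  show ?case using G.functor_comp[OF f(1) k(1)[unfolded e]] h[OF D.comp_hom[OF f(1) k(1)[unfolded e]]] h[OF f(1)] h[OF k(1)]
   by (simp add: f(3) k(3) Fa_comp[symmetric])
 next
  case 5 show ?case using G.phi0_iso by (simp add: Fo_Unit)
 next
  case (6 A B) then show ?case by (auto elim!: ObjC simp: Fo_TensO G.phi_iso)
 next
  case (7 f A A' k B B')
  obtain \<phi> M M' where f: "\<phi> \<in> Hom D M M'" "A = Fo M" "A' = Fo M'" "f = Fa \<phi>" "M \<in> Obj D" "M' \<in> Obj D" by (rule HomC[OF 7(1)])
  obtain \<psi> N N' where k: "\<psi> \<in> Hom D N N'" "B = Fo N" "B' = Fo N'" "k = Fa \<psi>" "N \<in> Obj D" "N' \<in> Obj D" by (rule HomC[OF 7(2)])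
  have "\<phi> \<in> Arr D" "\<psi> \<in> Arr D" using f(1) k(1) by (simp_all add: Hom_def)
  then show ?case using G.phi_natural[OF f(1) k(1)] by (simp add: f k Fa_TensA)
 next
  case (8 A B B') then show ?case
   by (auto elim!: ObjC simp: Fo_TensO Fa_Assoc G.phi_assoc)
 next
  case (9 A) then show ?case by (auto elim!: ObjC simp: Fo_Unit Fa_LUnit G.phi_lunit)
 next
  case (10 A) then show ?case by (auto elim!: ObjC simp: Fo_Unit Fa_RUnit G.phi_runit)
 next
  case (11 A B) then show ?case by (auto elim!: ObjC simp: Fa_Braid G.phi_braid)
 qed
 show ?thesis unfolding braided_monoidal_isomorphic_def
  using F bij_betw_trans[OF bij_betw_inv_into[OF Fo_bij] Gb(1)] bij_betw_trans[OF bij_betw_inv_into[OF Fa_bij] Gb(2)]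
  by (intro exI conjI)
qed

end

section \<open>Arrows and object bijections between the four categories\<close>

context weak_hopf_bij
begin

text \<open>One direction evaluates the colinearity equation through \<sigma>, the other through its
  left inverse \<tau>; hence the equivalence rather than an implication.\<close>

lemma colinear_toR:
 assumes M: "left_comodule R H M" "module R M" and N: "left_comodule R H N" "module R N"
  and f: "f \<in> lin M N" and s: "anticomult \<sigma>" "anticomult \<tau>" "!!h. h .: H ==> \<tau> (\<sigma> h) = h"
 shows "right_colinear R H (toR \<sigma> M, f, toR \<sigma> N) \<longleftrightarrow> left_colinear R H (M, f, N)"
proof -
 note [simp] = M(2) N(2) left_coact_simps[OF M] left_coact_simps[OF N] lin_simps[OF f M(2) N(2)] f
  anticomultD(1-4)[OF s(1)] anticomultD(1-4)[OF s(2)] s(3)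
 let ?r = "%m. LC M (N ** H) m (%a x. pt N H (f x) (\<sigma> a))" and ?r' = "%m. LC N (N ** H) m (%a x. pt N H x (\<sigma> a))"
 let ?l = "%m. LC M (H ** N) m (%a x. pt H N a (f x))"
 have 1: "right_colinear R H (toR \<sigma> M, f, toR \<sigma> N) \<longleftrightarrow> (\<forall>m\<in>carrier M. ?r' (f m) = ?r m)"
  by (simp add: right_colinear_def sweedler_Sw[of M H])
 have 2: "left_colinear R H (M, f, N) \<longleftrightarrow> (\<forall>m\<in>carrier M. coact N (f m) = ?l m)"
  by (simp add: left_colinear_def sweedler_Sw[of H M])
 have 3: "?r' (f m) = ?r m \<longleftrightarrow> coact N (f m) = ?l m" if [simp]: "m .: M" for m
 proof
  assume "?r' (f m) = ?r m"
  from arg_cong[OF this, of "%z. Sw N H (H ** N) z (%x a. pt H N (\<tau> a) x)"] show "coact N (f m) = ?l m" by simp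
 next
  assume "coact N (f m) = ?l m"
  from arg_cong[OF this, of "%z. Sw H N (N ** H) z (%a x. pt N H x (\<sigma> a))"] show "?r' (f m) = ?r m" by simp
 qed
 show ?thesis unfolding 1 2 using 3 by simp
qed

lemma yd_arrows_iff: "(M, f, N) \<in> yd_arrows obj linear colinear \<longleftrightarrow>
  obj M \<and> obj N \<and> f \<in> extensional (carrier M) \<and> linear (M, f, N) \<and> colinear (M, f, N)"
 by (simp add: yd_arrows_def)

lemma arr_toR:
 assumes M: "yd_LL R H M" and N: "yd_LL R H N"
 shows "(toR T M, f, toR T N) \<in> Arr (YD_LR R H) \<longleftrightarrow> (M, f, N) \<in> Arr LL"
proof -
 have "f \<in> lin M N ==> right_colinear R H (toR T M, f, toR T N) \<longleftrightarrow> left_colinear R H (M, f, N)"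
  using colinear_toR[OF yd_LL_D(2)[OF M] yd_LL_module[OF M] yd_LL_D(2)[OF N] yd_LL_module[OF N] _ anticomult_antipode(2,1)] by simp
 then show ?thesis using M N yd_LR_toR
  by (auto simp: YD_LR_def YD_LL_def yd_arrows_iff left_linear_def)
qed

lemma toL_toR_T: "yd_LL R H M ==> toL S (toR T M) = M"
 by (rule toL_toR) (simp_all add: yd_LL_D yd_LL_module yd_ext antipode_lin antipode_inv_lin)

lemma toR_toL_S: "yd_LR R H M ==> toR T (toL S M) = M"
 by (rule toR_toL) (simp_all add: yd_LR_D yd_ext antipode_lin antipode_inv_lin)

lemma yd_RR_opR': assumes M: "yd_LR R H M" shows "yd_RR R H (opR M)"
 using yd_RR_opR[OF yd_LL_toL[OF M]] toR_toL_S[OF M] by simp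

lemma yd_LR_opL': assumes N: "yd_RR R H N" shows "yd_LR R H (opL N)"
proof -
 have "toR T (toL S (opL N)) = opL N"
  by (rule toR_toL) (simp_all add: yd_RR_D[OF N] antipode_lin antipode_inv_lin)
 then show ?thesis using yd_LR_toR[OF yd_LL_opL[OF N]] by simp
qed

lemma arr_opR:
 assumes M: "yd_LR R H M" and N: "yd_LR R H N"
 shows "(opR M, f, opR N) \<in> Arr (YD_RR R H) \<longleftrightarrow> (M, f, N) \<in> Arr (YD_LR R H)"
proof -
 have l: "right_linear R H (opR M, f, opR N) \<longleftrightarrow> left_linear R H (M, f, N)"
 proof -
  have "(\<forall>h\<in>carrier H. \<forall>m\<in>carrier M. f (act M (S h) m) = act N (S h) (f m)) \<longleftrightarrow>
    (\<forall>h\<in>carrier H. \<forall>m\<in>carrier M. f (act M h m) = act N h (f m))"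
   using antipode_inv_simps antipode_simps(1) by metis
  then show ?thesis by (auto simp: right_linear_def left_linear_def lin_closed)
 qed
 have c: "right_colinear R H (opR M, f, opR N) \<longleftrightarrow> right_colinear R H (M, f, N)"
  by (simp add: right_colinear_def)
 show ?thesis using M N yd_RR_opR' l c by (auto simp: YD_LR_def YD_RR_def yd_arrows_iff)
qed

lemma yd_RL_toL: assumes N: "yd_RR R H N" shows "yd_RL R H (toL T N)"
 using yd_RL_opR[OF yd_LR_opL'[OF N]] opR_opL[OF yd_RR_D(1)[OF N]] by simp

lemma yd_RR_toR: assumes N: "yd_RL R H N" shows "yd_RR R H (toR S N)"
 using yd_RR_opR'[OF yd_LR_opL[OF N]] opR_opL[OF yd_RL_D(1)[OF N]] by (simp add: op_to_commute)

lemma toR_toL_T: "yd_RR R H M ==> toR S (toL T M) = M"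
 by (rule toR_toL) (simp_all add: yd_RR_D antipode_lin antipode_inv_lin)

lemma toL_toR_S: "yd_RL R H M ==> toL T (toR S M) = M"
 by (rule toL_toR) (simp_all add: yd_RL_D antipode_lin antipode_inv_lin)

lemma arr_toL:
 assumes M: "yd_RR R H M" and N: "yd_RR R H N"
 shows "(toL T M, f, toL T N) \<in> Arr (YD_RL R H) \<longleftrightarrow> (M, f, N) \<in> Arr (YD_RR R H)"
proof -
 note Ml = yd_RL_toL[OF M] and Nl = yd_RL_toL[OF N]
 have "f \<in> lin M N ==> right_colinear R H (toR S (toL T M), f, toR S (toL T N)) \<longleftrightarrow> left_colinear R H (toL T M, f, toL T N)"
  by (rule colinear_toR[OF yd_RL_D(2,3)[OF Ml] yd_RL_D(2,3)[OF Nl] _ anticomult_antipode(1,2)]) simp_all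
 then show ?thesis using M N Ml Nl
  by (auto simp: YD_RL_def YD_RR_def yd_arrows_iff right_linear_def toR_toL_T[OF M] toR_toL_T[OF N])
qed

lemma obj_bij:
 "bij_betw (toR T) (Collect (yd_LL R H)) (Collect (yd_LR R H))"
 "bij_betw opR (Collect (yd_LR R H)) (Collect (yd_RR R H))"
 "bij_betw (toL T) (Collect (yd_RR R H)) (Collect (yd_RL R H))"
proof -
 show "bij_betw (toR T) (Collect (yd_LL R H)) (Collect (yd_LR R H))"
  by (rule bij_betw_byWitness[where f' = "toL S"]) (auto simp: toL_toR_T toR_toL_S yd_LR_toR yd_LL_toL)
 show "bij_betw opR (Collect (yd_LR R H)) (Collect (yd_RR R H))"
  by (rule bij_betw_byWitness[where f' = opL])
   (auto simp: opL_opR opR_opL yd_LR_D yd_RR_D yd_RR_opR' yd_LR_opL')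
 show "bij_betw (toL T) (Collect (yd_RR R H)) (Collect (yd_RL R H))"
  by (rule bij_betw_byWitness[where f' = "toR S"]) (auto simp: toL_toR_S toR_toL_T yd_RL_toL yd_RR_toR)
qed

end

section \<open>Data of the inverse-braided and reversed categories\<close>

lemma cat_in_sel [simp]:
 "Obj (cat_in C) = Obj C" "Arr (cat_in C) = Arr C" "Dom (cat_in C) = Dom C" "Cod (cat_in C) = Cod C" "Id (cat_in C) = Id C"
 "Comp (cat_in C) = Comp C" "TensO (cat_in C) = TensO C" "TensA (cat_in C) = TensA C" "Unit (cat_in C) = Unit C"
 "Assoc (cat_in C) = Assoc C" "LUnit (cat_in C) = LUnit C" "RUnit (cat_in C) = RUnit C" "Braid (cat_in C) M N = Inv C (Braid C N M)"
 by (simp_all add: cat_in_def)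

lemma cat_bar_sel [simp]:
 "Obj (cat_bar C) = Obj C" "Arr (cat_bar C) = Arr C" "Dom (cat_bar C) = Dom C" "Cod (cat_bar C) = Cod C" "Id (cat_bar C) = Id C"
 "Comp (cat_bar C) = Comp C" "TensO (cat_bar C) M N = TensO C N M" "TensA (cat_bar C) f g = TensA C g f" "Unit (cat_bar C) = Unit C"
 "Assoc (cat_bar C) M N P = Inv C (Assoc C P N M)" "LUnit (cat_bar C) = RUnit C" "RUnit (cat_bar C) = LUnit C"
 "Braid (cat_bar C) M N = Braid C N M"
 by (simp_all add: cat_bar_def)

lemma cat_inverse_arrows [simp]:
 "inverse_arrows (cat_in C) = inverse_arrows C" "inverse_arrows (cat_bar C) = inverse_arrows C"
 by (simp_all add: inverse_arrows_def Hom_def fun_eq_iff)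

lemma cat_Inv [simp]: "Inv (cat_in C) = Inv C" "Inv (cat_bar C) = Inv C"
 by (simp_all add: Inv_def fun_eq_iff)

lemma cat_Hom [simp]: "Hom (cat_in C) = Hom C" "Hom (cat_bar C) = Hom C"
 by (simp_all add: Hom_def fun_eq_iff)

context weak_hopf_bij
begin

subsection \<open>Left-left and left-right modules\<close>

abbreviation "LR \<equiv> YD_LR R H"
abbreviation TLR where "TLR \<equiv> tensor_LR R H"
abbreviation ULR where "ULR \<equiv> unit_LR R H"

lemma LR_sel [simp]:
 "Obj LR = Collect (yd_LR R H)" "Dom LR = fst" "Cod LR = snd \<circ> snd" "Id LR = yd_id" "Comp LR = yd_comp"
 "TensO LR = TLR" "TensA LR = tensor_arrow R TLR" "Unit LR = ULR" "Assoc LR = assoc_arrow R TLR"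
 "LUnit LR = left_lunit TLR ULR" "RUnit LR = left_runit H TLR ULR" "Braid LR = braid_LR R TLR"
 by (simp_all add: YD_LR_def)

lemma left_object_toR:
 assumes "!!x. x \<in> A ==> \<rho> x = LC (left_object R H V A \<alpha> \<rho>') (left_object R H V A \<alpha> \<rho>' ** H) x
   (%a x. pt (left_object R H V A \<alpha> \<rho>') H x (T a))"
 shows "left_object R H V A \<alpha> \<rho> = toR T (left_object R H V A \<alpha> \<rho>')"
 using assms by (intro yd_module.equality) (simp_all add: toR_def cong: restrict_cong)

lemma side_tensor_t [simp]:
 "tensor_t R H (toR \<sigma> M) \<alpha> (toR \<sigma> N) \<beta> = tensor_t R H M \<alpha> N \<beta>"
 "left_diag R (toR \<sigma> M) \<alpha> (toR \<sigma> N) \<beta> = left_diag R M \<alpha> N \<beta>"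
 by (simp_all add: tensor_t_def left_diag_def fun_eq_iff)

text \<open>The prescribed coaction z2 \<otimes> T(z1) is \<Delta>(z) with its first leg twisted.
  The two sides differ only in how they are corestricted, so they are compared in H \<otimes>
  H.\<close>

lemma unit_LR_toR: "ULR = toR T UL"
proof -
 have "Ht = carrier UL" by (simp add: carrier_unit_LL)
 let ?A = "submod R H Ht"
 have eq: "mod_eq UL ?A" unfolding unit_LL_def by (rule mod_eq_left_object)
 have r: "retract et ?A H" using retract_unit_LL eq unfolding retract_def
  by (simp add: mod_eq_module[OF eq, symmetric] mod_eq_lin[OF eq, of H H, symmetric] mod_eq_lin[OF _ eq, of H H, symmetric] mod_eq_def)
 have "corestrict R ?A H H H (sweedler (H ** H) (comult H z) (%z1 z2. pt H H z2 (T z1))) = LC UL (UL ** H) z (%a x. pt UL H x (T a))"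
  if z: "z \<in> Ht" for z
 proof -
  note [simp] = yd_LL_simps[OF unit_LL_yd(1)]
  let ?w = "LC UL (UL ** H) z (%a x. pt UL H x (T a))"
  have [simp]: "z .: UL" "z .: H" using z by simp_all
  have w: "?w .: (?A ** H)" unfolding mod_eq_tensor(1)[OF mod_eq_sym[OF eq] side_mod_eq(5)[of H]] by simp
  have "inc UL H H H ?w = LC UL (H ** H) z (%a x. pt H H x (T a))" by simp
  also have "... = D (H ** H) z (%z1 z2. pt H H z2 (T z1))"
   by (rule unit_LL_yd(2)) (simp_all add: z)
  finally have "inc ?A H H H ?w = sweedler (H ** H) (comult H z) (%z1 z2. pt H H z2 (T z1))"
   unfolding mod_eq_Sw[OF mod_eq_sym[OF eq] side_mod_eq(5)[of H] side_mod_eq(5)[of "H ** H"]] by (simp add: comult_sweedler)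
  then show ?thesis using corestrict_inc[OF r retract_id[OF H_module] w] by simp
 qed
 then show ?thesis unfolding unit_LR_def unit_LL_def by (rule left_object_toR)
qed

text \<open>Twisting the product coaction gives T(ab) = T(b) T(a), which is the reversed product in
  the left-right formula; the objects are therefore equal and no structure isomorphism is
  required.\<close>

lemma tensor_LR_toR:
 assumes M: "yd_LL R H M" and N: "yd_LL R H N"
 shows "TLR (toR T M) (toR T N) = toR T (TL M N)"
proof -
 let ?A = "tensor_t R H M (act M) N (act N)" and ?V = "M ** N"
 let ?S = "submod R ?V ?A"
 note lo = tensor_LL_eq[OF M N]
 have eq: "mod_eq (TL M N) ?S" unfolding lo by (rule mod_eq_left_object)
 note r0 = tensor_LL_retract[OF M N]
 have r: "retract (ldiag M (act M) N (act N) uH) ?S ?V" using r0 eq unfolding retract_def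
  by (simp add: mod_eq_module[OF eq, symmetric] mod_eq_lin[OF eq, of ?V ?V, symmetric] mod_eq_lin[OF _ eq, of ?V ?V, symmetric] mod_eq_def)
 note [simp] = yd_LL_simps[OF M] yd_LL_simps[OF N] yd_LL_simps[OF tensor_LL_yd(1)[OF M N]] tensor_LL_simps[OF M N]
 let ?Q = "?V ** H"
 have "corestrict R ?S H ?V H (sweedler ?Q x (%m n. sweedler ?Q (coact (toR T M) m) (%m0 a.
   sweedler ?Q (coact (toR T N) n) (%n0 b. pt ?V H (pt M N m0 n0) (b .* a)))))
  = LC (TL M N) (TL M N ** H) x (%a u. pt (TL M N) H u (T a))" if x: "x \<in> ?A" for x
 proof -
  let ?w = "LC (TL M N) (TL M N ** H) x (%a u. pt (TL M N) H u (T a))"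
  have x' [simp]: "x .: (TL M N)" using x unfolding lo by simp
  have w: "?w .: (?S ** H)" unfolding mod_eq_tensor(1)[OF mod_eq_sym[OF eq] side_mod_eq(5)[of H]] by simp
  have "inc (TL M N) H ?V H ?w = LC (TL M N) ?Q x (%a u. pt ?V H u (T a))" by simp
  also have "... = Sw M N ?Q x (%m n. LC M ?Q m (%a m0. LC N ?Q n (%b n0. pt ?V H (pt M N m0 n0) (T (a .* b)))))"
   by (rule tensor_LL_yd(2)[OF M N]) simp_all
  also have "... = sweedler ?Q x (%m n. sweedler ?Q (coact (toR T M) m) (%m0 a.
   sweedler ?Q (coact (toR T N) n) (%n0 b. pt ?V H (pt M N m0 n0) (b .* a))))"
   by (simp add: sweedler_Sw[of M N] sweedler_Sw[of M H] sweedler_Sw[of N H])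
  finally have "inc ?S H ?V H ?w = sweedler ?Q x (%m n. sweedler ?Q (coact (toR T M) m) (%m0 a.
   sweedler ?Q (coact (toR T N) n) (%n0 b. pt ?V H (pt M N m0 n0) (b .* a))))"
   unfolding mod_eq_Sw[OF mod_eq_sym[OF eq] side_mod_eq(5)[of H] side_mod_eq(5)[of ?Q]] .
  then show ?thesis using corestrict_inc[OF r retract_id[OF H_module] w] by simp
 qed
 then show ?thesis unfolding tensor_LR_def left_tensor_def side_tensor side_tensor_t side_sel lo
  by (rule left_object_toR)
qed

lemma strict_LL_LR: "strict_yd_link LL (cat_in LR) (toR T)"
proof -
 interpret LL: category LL by (rule category_LL)
 interpret yd_link LL "cat_in LR" "toR T"
  by unfold_locales (auto simp: arr_toR obj_bij(1), auto simp: YD_LR_def yd_arrows_iff)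
 show ?thesis
 proof (rule strict_yd_link.intro[OF yd_link_axioms strict_yd_link_axioms.intro[OF braided_LL]])
  show "Unit (cat_in LR) = toR T (Unit LL)" by (simp add: unit_LR_toR)
  fix M N assume "M \<in> Obj LL" "N \<in> Obj LL"
  then have M: "yd_LL R H M" and N: "yd_LL R H N" by simp_all
  show "TensO (cat_in LR) (toR T M) (toR T N) = toR T (TensO LL M N)" by (simp add: tensor_LR_toR[OF M N])
 next
  fix \<phi> \<psi> assume a: "\<phi> \<in> Arr LL" "\<psi> \<in> Arr LL"
  obtain M f M' N g N' where e: "\<phi> = (M, f, M')" "\<psi> = (N, g, N')" by (metis prod_cases3)
  then have o: "yd_LL R H M" "yd_LL R H M'" "yd_LL R H N" "yd_LL R H N'"
   using D_arr[of M f M'] D_arr[of N g N'] a by simp_all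
  show "TensA (cat_in LR) (Fa \<phi>) (Fa \<psi>) = Fa (TensA LL \<phi> \<psi>)"
   by (simp add: e tensor_arrow_def tensor_LR_toR[OF o(1,3)] tensor_LR_toR[OF o(2,4)])
 next
  fix M N P assume "M \<in> Obj LL" "N \<in> Obj LL" "P \<in> Obj LL"
  then have o: "yd_LL R H M" "yd_LL R H N" "yd_LL R H P" by simp_all
  show "Assoc (cat_in LR) (toR T M) (toR T N) (toR T P) = Fa (Assoc LL M N P)"
   by (simp add: assoc_arrow_def corestrict_def tensor_LR_toR[OF o(1,2)] tensor_LR_toR[OF o(2,3)]
    tensor_LR_toR[OF tensor_LL_yd(1)[OF o(1,2)] o(3)] tensor_LR_toR[OF o(1) tensor_LL_yd(1)[OF o(2,3)]])
 next
  fix M assume "M \<in> Obj LL"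
  then have o: "yd_LL R H M" by simp
  note t = tensor_LR_toR[OF unit_LL_yd(1) o] tensor_LR_toR[OF o unit_LL_yd(1)]
  show "LUnit (cat_in LR) (toR T M) = Fa (LUnit LL M)" "RUnit (cat_in LR) (toR T M) = Fa (RUnit LL M)"
   by (simp_all add: left_lunit_def left_runit_def unit_LR_toR t)
 next
  fix M N assume "M \<in> Obj LL" "N \<in> Obj LL"
  then have M: "yd_LL R H M" and N: "yd_LL R H N" by simp_all
  note [simp] = yd_LL_simps[OF M] yd_LL_simps[OF N] tensor_LL_simps[OF N M]
  \<comment> \<open>The left-right braiding of the swapped pair is the inverse left-left braiding,
    by its very formula; inverting it, as \<open>cat_in\<close> prescribes, returns the left-left
    braiding.\<close>
  have b: "braid_LR R TLR (toR T N) (toR T M) = Fa (TL N M, restrict (brLL_inv M N) (carrier (TL N M)), TL M N)"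
   by (auto simp: braid_LR_def tensor_LR_toR[OF M N] tensor_LR_toR[OF N M] sweedler_Sw[of N M] sweedler_Sw[of M H] intro!: restrict_ext)
  have i: "inverse_arrows LL (TL N M, restrict (brLL_inv M N) (carrier (TL N M)), TL M N) (braid_LL R TL M N)"
   using braid_LL_iso(2)[OF M N] braid_LL_eq[OF M N] unfolding inverse_arrows_def by (auto simp: Hom_def)
  show "Braid (cat_in LR) (toR T M) (toR T N) = Fa (Braid LL M N)"
   using Fa_inverse(2)[OF i] b by simp
 qed
qed

end

context weak_hopf_bij
begin

subsection \<open>Left-left and right-right modules\<close>

abbreviation "RR \<equiv> YD_RR R H"
abbreviation TRR where "TRR \<equiv> tensor_RR R H"
abbreviation URR where "URR \<equiv> unit_RR R H"
abbreviation K where "K M \<equiv> opR (toR T M)"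

lemma RR_sel [simp]:
 "Obj RR = Collect (yd_RR R H)" "Dom RR = fst" "Cod RR = snd \<circ> snd" "Id RR = yd_id" "Comp RR = yd_comp"
 "TensO RR = TRR" "TensA RR = tensor_arrow R TRR" "Unit RR = URR" "Assoc RR = assoc_arrow R TRR"
 "LUnit RR = right_lunit H TRR URR" "RUnit RR = right_runit TRR URR" "Braid RR = braid_RR R TRR"
 by (simp_all add: YD_RR_def)

lemma yd_link_K: "yd_link LL (cat_bar RR) K"
proof -
 interpret LL: category LL by (rule category_LL)
 have b: "bij_betw K (Collect (yd_LL R H)) (Collect (yd_RR R H))"
  using bij_betw_trans[OF obj_bij(1,2)] by (simp add: comp_def)
 show ?thesis
  by unfold_locales (auto simp: arr_opR arr_toR yd_LR_toR b, auto simp: YD_RR_def yd_arrows_iff)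
qed

interpretation K: yd_link LL "cat_bar RR" K by (rule yd_link_K)

lemma K_Fa: "K.Fa (M, f, N) = (K M, f, K N)" by (rule K.Fa_simp)

lemma right_object_simps [simp]:
 "carrier (right_object R H V A \<alpha> \<rho>) = A" "zero (right_object R H V A \<alpha> \<rho>) = zero V"
 "add (right_object R H V A \<alpha> \<rho>) = restrict2 A A (add V)"
 "smult (right_object R H V A \<alpha> \<rho>) = restrict2 (carrier R) A (smult V)"
 "mult (right_object R H V A \<alpha> \<rho>) = (%_ _. undefined)" "one (right_object R H V A \<alpha> \<rho>) = undefined"
 "act (right_object R H V A \<alpha> \<rho>) = restrict2 A (carrier H) \<alpha>"
 "coact (right_object R H V A \<alpha> \<rho>) = restrict \<rho> A"
 by (simp_all add: right_object_def module.extend_def submod_def)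

text \<open>Transport of structure along a linear bijection. It allows an object given on another
  set to be recognised as a Yetter-Drinfeld module without repeating the verification.\<close>

lemma iso_closure_LL:
 assumes X: "yd_LL R H X" and W: "module R W" "extensional_module R W" "act W = restrict2 (carrier H) (carrier W) (act W)"
  and i: "i \<in> lin W X" and j: "j \<in> lin X W" and ji: "!!w. w .: W ==> j (i w) = w"
  and ij: "!!x. x .: X ==> i (j x) = x"
  and a: "!!h w. h .: H ==> w .: W ==> act W h w = j (act X h (i w))"
  and c: "!!w. w .: W ==> coact W w = LC X (H ** W) (i w) (%a x. pt H W a (j x))"
 shows "yd_LL R H W" "arrLL W (restrict i (carrier W)) X"
  "inverse_arrows LL (W, restrict i (carrier W), X) (X, restrict j (carrier X), W)"
proof -
 note [simp] = yd_LL_simps[OF X] W(1) lin_simps[OF i W(1) yd_LL_module[OF X]] lin_simps[OF j yd_LL_module[OF X] W(1)] i j ji ij a c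
 have lm: "left_module R H W" unfolding left_module_def
 proof (intro conjI ballI W)
  fix h assume h [simp]: "h .: H"
  show "act W h \<in> lin W W" by (rule lin_eqI[of "%w. j (act X h (i w))"]) simp_all
 next
  fix w assume w [simp]: "w .: W"
  show "(%h. act W h w) \<in> lin H W" by (rule lin_eqI[of "%h. j (act X h (i w))"]) simp_all
 qed simp_all
 have lc: "left_comodule R H W"
 proof (rule left_comoduleI)
  show "coact W \<in> lin W (H ** W)" by (rule lin_eqI[of "%w. LC X (H ** W) (i w) (%a x. pt H W a (j x))"]) simp_all
  fix w assume w [simp]: "w .: W"
  let ?Q = "H ** (H ** W)"
  show "LC W ?Q w (%a x. D ?Q a (%b c. pt H (H ** W) b (pt H W c x))) = LC W ?Q w (%a x. pt H (H ** W) a (coact W x))"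
   using LC_coassoc[OF yd_LL_D(2)[OF X] yd_LL_module[OF X], of "i w" ?Q "%b c x. pt H (H ** W) b (pt H W c (j x))"] by simp
  show "LC W W w (%a x. eH a *[W] x) = w"
   using LC_counit[OF yd_LL_D(2)[OF X] yd_LL_module[OF X], of "i w" W j] by simp
 qed simp_all
 have U: "D (H ** W) uH (%u v. LC X (H ** W) m (%a x. pt H W (u .* a) (j (act X v x)))) = LC X (H ** W) m (%a x. pt H W a (j x))"
  if "m .: X" for m
  using LL_unit[OF X that, of "H ** W" "%a x. pt H W a (j x)"] by simp
 have Y: "D (H ** W) h (%u v. LC X (H ** W) m (%a x. pt H W (u .* a) (j (act X v x))))
  = D (H ** W) h (%u v. LC X (H ** W) (act X u m) (%a x. pt H W (a .* v) (j x)))"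
  if "m .: X" "h .: H" for m h
  using LL_yd[OF X that, of "H ** W" "%a x. pt H W a (j x)"] by simp
 show yd: "yd_LL R H W" unfolding yd_LL_iff[OF lm lc] using U Y by simp
 show ar: "arrLL W (restrict i (carrier W)) X" by (rule arrLLI_id[OF yd X i]) simp_all
 show "inverse_arrows LL (W, restrict i (carrier W), X) (X, restrict j (carrier X), W)"
  by (rule LL_inverse(2)[OF ar]) simp_all
qed

text \<open>The right-right version reduces to the left-left one: \<open>W\<close> is read as the
  left-left object \<open>toL S\<close> of \<open>opL W\<close>, and applying K to that gives
  \<open>W\<close> back.\<close>

lemma iso_closure_RR:
 assumes X: "yd_LL R H X" and W: "module R W" "extensional_module R W" "act W = restrict2 (carrier W) (carrier H) (act W)"
  and i: "i \<in> lin W X" and j: "j \<in> lin X W" and ji: "!!w. w .: W ==> j (i w) = w"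
  and ij: "!!x. x .: X ==> i (j x) = x"
  and a: "!!h w. h .: H ==> w .: W ==> act W w h = j (act X (S h) (i w))"
  and c: "!!w. w .: W ==> coact W w = LC X (W ** H) (i w) (%a x. pt W H (j x) (T a))"
 shows "yd_RR R H W" "inverse_arrows RR (W, restrict i (carrier W), K X) (K X, restrict j (carrier X), W)"
proof -
 note [simp] = yd_LL_simps[OF X] W(1) lin_simps[OF i W(1) yd_LL_module[OF X]] lin_simps[OF j yd_LL_module[OF X] W(1)] i j ji ij
 let ?W = "toL S (opL W)"
 have ext: "extensional_module R ?W" using W(2) by (simp add: extensional_module_def toL_def)
 have aW: "act ?W = restrict2 (carrier H) (carrier ?W) (act ?W)" by (simp add: opL_def)
 note cl = iso_closure_LL[OF X _ ext aW, of i j]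
 have pre: "module R ?W" "i \<in> lin ?W X" "j \<in> lin X ?W" "!!w. w .: ?W ==> j (i w) = w"
  "!!h w. h .: H ==> w .: ?W ==> act ?W h w = j (act X h (i w))"
  "!!w. w .: ?W ==> coact ?W w = LC X (H ** ?W) (i w) (%a x. pt H ?W a (j x))"
  using a c by simp_all
 note cl' = cl[OF pre(1-4) ij pre(5,6)]
 have "coact (K ?W) = coact W"
 proof (rule extensionalityI)
  show "coact W \<in> extensional (carrier W)" using W(2) by (simp add: extensional_module_def)
  show "coact (K ?W) \<in> extensional (carrier W)" by (simp add: toR_def)
  fix w assume "w .: W"
  then show "coact (K ?W) w = coact W w" using c by simp
 qed
 moreover have "act (K ?W) = act W" unfolding opR_def[of "toR T ?W"] using W(3)
  by (auto intro!: restrict2_eqI)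
 ultimately have e: "K ?W = W" by (intro yd_module.equality) simp_all
 show "yd_RR R H W" using yd_RR_opR[OF cl'(1)] e by simp
 show "inverse_arrows RR (W, restrict i (carrier W), K X) (K X, restrict j (carrier X), W)"
  using K.Fa_inverse(1)[OF cl'(3)] e by (simp add: K_Fa)
qed

definition flp where "flp N M z = Sw N M (M ** N) z (%n m. pt M N m n)"

lemma flp:
 assumes [simp]: "module R N" "module R M"
 shows "flp N M \<in> lin (N ** M) (M ** N)" "z .: (N ** M) ==> flp N M z .: (M ** N)"
  "z .: (N ** M) ==> flp M N (flp N M z) = z"
  "module R P ==> bilin M N P f ==> Sw M N P (flp N M z) f = Sw N M P z (%n m. f m n)"
  "n .: N ==> m .: M ==> flp N M (pt N M n m) = pt M N m n"
 unfolding flp_def[abs_def] by simp_all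

text \<open>The flip compensates the reversal in \<Delta>(S(h)) = S(h2) \<otimes> S(h1); this is the
  source of the reversed tensor product.\<close>

lemma right_diag_flp:
 assumes M: "yd_LL R H M" and N: "yd_LL R H N" and [simp]: "h .: H" "z .: (N ** M)"
 shows "right_diag R (K N) (act (K N)) (K M) (act (K M)) z (comult H h) = flp M N (ldiag M (act M) N (act N) (S h) (flp N M z))"
proof -
 note [simp] = yd_LL_simps[OF M] yd_LL_simps[OF N] flp(1-4)[OF yd_LL_module[OF N] yd_LL_module[OF M]]
 have "ldiag M (act M) N (act N) (S h) (flp N M z)
  = D (M ** N) (S h) (%p q. Sw N M (M ** N) z (%n m. pt M N (act M p m) (act N q n)))"
  by (simp add: ldiag_eq)
 also have "... = D (M ** N) h (%u v. Sw N M (M ** N) z (%n m. pt M N (act M (S v) m) (act N (S u) n)))"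
  by (rule D_antipode_arg) simp_all
 finally have e: "ldiag M (act M) N (act N) (S h) (flp N M z) = ..." .
 have "flp M N ... = D (N ** M) h (%u v. Sw N M (N ** M) z (%n m. pt N M (act N (S u) n) (act M (S v) m)))"
  by (simp add: flp_def)
 then show ?thesis
  using right_diag_eq[of "toR T N" "toR T M" h z] yd_LL_D(1)[OF M] yd_LL_D(1)[OF N] by (simp add: e)
qed

text \<open>The flip carries action, range and coaction of K N \<otimes>_s K M to those of K applied
  to M \<otimes>_t N; for the coaction this uses T(ab) = T(b) T(a). The two objects are different
  subsets of the universe, so the comparison is an isomorphism and not an equality.\<close>

lemma TRR_K:
 assumes M: "yd_LL R H M" and N: "yd_LL R H N"
 defines "Z \<equiv> TRR (K N) (K M)"
 shows "yd_RR R H Z"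
  "inverse_arrows RR (Z, restrict (flp N M) (carrier Z), K (TL M N)) (K (TL M N), restrict (flp M N) (carrier (TL M N)), Z)"
  "retract (%z. flp M N (ldiag M (act M) N (act N) uH (flp N M z))) Z (N ** M)"
  "z .: Z \<longleftrightarrow> z .: (N ** M) \<and> flp N M z .: (TL M N)"
  "z .: Z ==> coact Z z = LC (TL M N) (Z ** H) (flp N M z) (%a x. pt Z H (flp M N x) (T a))"
proof -
 note lM = yd_LL_lact[OF M] and lN = yd_LL_lact[OF N] and X = tensor_LL_yd(1)[OF M N]
 note fl = flp[OF yd_LL_module[OF N] yd_LL_module[OF M]] and fl' = flp[OF yd_LL_module[OF M] yd_LL_module[OF N]]
 note [simp] = yd_LL_simps[OF M] yd_LL_simps[OF N] yd_LL_simps[OF X] tensor_LL_simps[OF M N] fl fl'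
  lin_compose[OF fl(1)] lin_compose[OF fl'(1)]
 let ?V = "N ** M" and ?X = "TL M N" and ?A = "tensor_s R H (K N) (act (K N)) (K M) (act (K M))"
 let ?p = "%z. flp M N (ldiag M (act M) N (act N) uH (flp N M z))"
 let ?co = "%x. corestrict R (submod R ?V ?A) H ?V H
    (sweedler (?V ** H) x (%m n. sweedler (?V ** H) (coact (K N) m) (%m0 a.
      sweedler (?V ** H) (coact (K M) n) (%n0 b. pt ?V H (pt N M m0 n0) (a .* b)))))"
 let ?act = "%z h. right_diag R (K N) (act (K N)) (K M) (act (K M)) z (comult H h)"
 have Z: "Z = right_object R H ?V ?A ?act ?co"
  unfolding Z_def tensor_RR_def right_tensor_def side_tensor by (rule HOL.refl)
 note rX = tensor_LL_retract[OF M N]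
 note [simp] = retractD[OF rX] lin_compose[OF retractD(4)[OF rX]]
 have A: "?A = ?p ` carrier ?V"
  unfolding tensor_s_def by (simp add: right_diag_flp[OF M N])
 have pp: "?p (?p z) = ?p z" if "z .: ?V" for z using that by simp
 have Aiff: "z \<in> ?A \<longleftrightarrow> z .: ?V \<and> flp N M z .: ?X" for z
 proof -
  have 1: "z \<in> ?A \<longleftrightarrow> z .: ?V \<and> ?p z = z"
   unfolding A by (rule tensor_s_iff_image) simp_all
  have "?p z = z \<longleftrightarrow> flp N M z .: ?X" if z: "z .: ?V"
  proof
   assume "?p z = z"
   from arg_cong[OF this, of "flp N M"] have "ldiag M (act M) N (act N) uH (flp N M z) = flp N M z" using z by simp
   then show "flp N M z .: ?X" using retractD(7)[OF rX, of "flp N M z"] z by simp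
  next
   assume "flp N M z .: ?X"
   then show "?p z = z" using z by simp
  qed
  with 1 show ?thesis by blast
 qed
 show "z .: Z \<longleftrightarrow> z .: (N ** M) \<and> flp N M z .: (TL M N)"
  by (simp add: Z Aiff)
 have pl: "?p \<in> lin ?V ?V" by (simp add: lact_simps(5)[OF lact_ldiag[OF lM lN]])
 have r: "retract ?p Z ?V" and rs: "retract ?p (submod R ?V ?A) ?V"
  by (rule submodule_retract[OF _ pl pp]; simp add: Z A[symmetric])+
 then show "retract ?p Z ?V" by simp
 have eq: "mod_eq Z (submod R ?V ?A)" unfolding Z by (simp add: mod_eq_def)
 note [simp] = retractD(1)[OF r] retractD(3)[OF r]
 have cZ [simp]: "z .: Z ==> z .: ?V" "z .: Z ==> flp N M z .: ?X"
  "x .: ?X ==> flp M N x .: Z" for z x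
  by (auto simp: Z Aiff)
 have i: "flp N M \<in> lin Z ?X"
  by (rule lin_retract_corange[OF rX]) (use lin_retract[OF r fl(1)] in simp_all)
 have j: "flp M N \<in> lin ?X Z"
  by (rule lin_retract_corange[OF r]) (use lin_retract[OF rX fl'(1)] in simp_all)
 note [simp] = i j lin_simps(2-4)[OF j]
 have co: "coact Z z = LC ?X (Z ** H) (flp N M z) (%a x. pt Z H (flp M N x) (T a))" if z [simp]: "z .: Z" for z
 proof -
  let ?Q = "?V ** H"
  let ?w = "LC ?X (Z ** H) (flp N M z) (%a x. pt Z H (flp M N x) (T a))"
  have w: "?w .: (submod R ?V ?A ** H)"
   unfolding mod_eq_tensor(1)[OF mod_eq_sym[OF eq] side_mod_eq(5)[of H]] by simp
  have "inc Z H ?V H ?w = LC ?X ?Q (flp N M z) (%a x. pt ?V H (flp M N x) (T a))" by simp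
  also have "... = Sw M N ?Q (flp N M z) (%m n. LC M ?Q m (%a m0. LC N ?Q n (%b n0. pt ?V H (flp M N (pt M N m0 n0)) (T (a .* b)))))"
   by (rule tensor_LL_yd(2)[OF M N]) simp_all
  also have "... = Sw N M ?Q z (%n m. LC M ?Q m (%a m0. LC N ?Q n (%b n0. pt ?V H (pt N M n0 m0) (T b .* T a))))"
   by simp
  also have "... = Sw N M ?Q z (%n m. LC N ?Q n (%b n0. LC M ?Q m (%a m0. pt ?V H (pt N M n0 m0) (T b .* T a))))"
   by (rule Sw_eqI, rule Sw_swap) simp_all
  also have "... = sweedler ?Q z (%m n. sweedler ?Q (coact (K N) m) (%m0 a.
      sweedler ?Q (coact (K M) n) (%n0 b. pt ?V H (pt N M m0 n0) (a .* b))))"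
   by (simp add: sweedler_Sw[of N M] sweedler_Sw[of N H] sweedler_Sw[of M H])
  finally have "inc (submod R ?V ?A) H ?V H ?w = ..."
   unfolding mod_eq_Sw[OF mod_eq_sym[OF eq] side_mod_eq(5)[of H] side_mod_eq(5)[of ?Q]] .
  then have "?co z = ?w" using corestrict_inc[OF rs retract_id[OF H_module] w] by simp
  then show ?thesis using z by (simp add: Z)
 qed
 then show "z .: Z ==> coact Z z = LC ?X (Z ** H) (flp N M z) (%a x. pt Z H (flp M N x) (T a))" .
 have ext: "extensional_module R Z" "act Z = restrict2 (carrier Z) (carrier H) (act Z)"
  by (simp_all add: Z extensional_module_def)
 have a: "act Z z h = flp M N (act ?X (S h) (flp N M z))" if "h .: H" "z .: Z" for h z
 proof -
  have "act Z z h = ?act z h" using that by (simp add: Z)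
  then show ?thesis using that by (simp add: right_diag_flp[OF M N] tensor_LL_act[OF M N])
 qed
 note cl = iso_closure_RR[OF X _ ext i j _ _ a co]
 show "yd_RR R H Z"
  "inverse_arrows RR (Z, restrict (flp N M) (carrier Z), K ?X) (K ?X, restrict (flp M N) (carrier ?X), Z)"
  by (rule cl; simp)+
qed

text \<open>S restricts to a bijection from H_s onto H_t with inverse T. It matches the actions
  because S(\<open>es\<close>(h)) = \<open>et\<close>(S(h)), and the coactions because twisting
  \<Delta>(S(y)) by T in both legs recovers \<Delta>(y).\<close>

lemma URR_K:
 "yd_RR R H URR" "inverse_arrows RR (URR, restrict S (carrier URR), K UL) (K UL, restrict T (carrier UL), URR)"
 "carrier URR = Hs" "retract es URR H"
 "y .: URR ==> coact URR y = LC UL (URR ** H) (S y) (%a x. pt URR H (T x) (T a))"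
proof -
 note U = unit_LL_yd(1)
 note [simp] = yd_LL_simps[OF U]
 let ?A = "submod R H Hs"
 have im: "es ` carrier H = Hs" unfolding source_def ..
 show c: "carrier URR = Hs" by (simp add: unit_RR_def)
 have r: "retract es URR H" and rs: "retract es ?A H"
  by (rule submodule_retract[OF H_module eps_lin(2)]; simp add: im unit_RR_def)+
 then show "retract es URR H" by simp
 have eq: "mod_eq URR ?A" unfolding unit_RR_def by (simp add: mod_eq_def)
 note [simp] = retractD(1)[OF r] retractD(3)[OF r]
 have m [simp]: "y .: URR ==> y .: H" "y .: URR ==> S y .: UL" "z .: UL ==> T z .: URR" for y z
 proof -
  show "y .: URR ==> y .: H" by (simp add: c)
  show "y .: URR ==> S y .: UL" by (simp add: c antipode_Hs)
  assume "z .: UL"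
  then have "z \<in> Ht" by simp
  then have z: "z .: H" "et z = z" using Ht_iff by blast+
  have "T z = T (et z)" by (simp only: z(2))
  also have "... = esb z" by (rule antipode_inv_eps(1)[OF z(1)])
  finally show "T z .: URR" using z(1) by (simp add: c)
 qed
 have i: "S \<in> lin URR UL"
  by (rule lin_retract_corange[OF retract_unit_LL]) (use lin_retract[OF r antipode_lin] in simp_all)
 have j: "T \<in> lin UL URR"
  by (rule lin_retract_corange[OF r]) (use lin_retract[OF retract_unit_LL antipode_inv_lin] in simp_all)
 note [simp] = i j lin_simps(2-4)[OF j]
 have co: "coact URR y = LC UL (URR ** H) (S y) (%a x. pt URR H (T x) (T a))" if y [simp]: "y .: URR" for y
 proof -
  let ?w = "LC UL (URR ** H) (S y) (%a x. pt URR H (T x) (T a))"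
  have w: "?w .: (?A ** H)" unfolding mod_eq_tensor(1)[OF mod_eq_sym[OF eq] side_mod_eq(5)[of H]] by simp
  have "inc URR H H H ?w = LC UL (H ** H) (S y) (%a x. pt H H (T x) (T a))" by simp
  also have "... = D (H ** H) (S y) (%a x. pt H H (T x) (T a))"
   by (rule unit_LL_yd(2)) (use m(2)[OF y] in simp_all)
  also have "... = D (H ** H) y (%a b. pt H H (T (S a)) (T (S b)))"
   by (rule D_antipode_arg) simp_all
  also have "... = comult H y" by simp
  finally have "inc ?A H H H ?w = comult H y"
   unfolding mod_eq_Sw[OF mod_eq_sym[OF eq] side_mod_eq(5)[of H] side_mod_eq(5)[of "H ** H"]] .
  then have "corestrict R ?A H H H (comult H y) = ?w" using corestrict_inc[OF rs retract_id[OF H_module] w] by simp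
  then show ?thesis using y by (simp add: unit_RR_def)
 qed
 then show "y .: URR ==> coact URR y = LC UL (URR ** H) (S y) (%a x. pt URR H (T x) (T a))" .
 have ext: "extensional_module R URR" "act URR = restrict2 (carrier URR) (carrier H) (act URR)"
  by (simp_all add: unit_RR_def extensional_module_def)
 have a: "act URR y h = T (act UL (S h) (S y))" if "h .: H" "y .: URR" for h y
 proof -
  have [simp]: "h .: H" "y .: H" and y: "S y \<in> Ht" using that m(2)[of y] by simp_all
  have "act URR y h = es (y .* h)" using that by (simp add: unit_RR_def)
  also have "... = T (S (es (y .* h)))" by simp
  also have "S (es (y .* h)) = et (S h .* S y)" by (subst antipode_eps_s) simp_all
  finally show ?thesis using y by simp
 qed
 note cl = iso_closure_RR[OF U _ ext i j _ _ a co]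
 show "yd_RR R H URR" "inverse_arrows RR (URR, restrict S (carrier URR), K UL) (K UL, restrict T (carrier UL), URR)"
  by (rule cl; simp)+
qed

end

section \<open>The braided monoidal functor to reversed right-right modules\<close>

context weak_hopf_bij
begin

interpretation K: yd_link LL "cat_bar RR" K by (rule yd_link_K)

interpretation KC: category "cat_bar RR" by (rule K.category_C)

text \<open>The tensor product of K M and K N in the reversed category; the arguments of
  \<open>TRR\<close> are swapped accordingly.\<close>

abbreviation ZZ where "ZZ M N \<equiv> TRR (K N) (K M)"

definition phiRR where "phiRR M N = (ZZ M N, restrict (flp N M) (carrier (ZZ M N)), K (TL M N))"
definition phiRR' where "phiRR' M N = (K (TL M N), restrict (flp M N) (carrier (TL M N)), ZZ M N)"

lemma RR_comp: "f \<in> Hom RR A B ==> g \<in> Hom RR B E ==> yd_comp g f \<in> Hom RR A E"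
 using KC.comp_hom[of f A B g E] by simp

lemma RR_Hom_iff: "(A, f, B) \<in> Hom RR A' B' \<longleftrightarrow> A = A' \<and> B = B' \<and> (A, f, B) \<in> Arr RR"
 by (auto simp: Hom_def)

lemma RR_arr_iff: "(A, f, B) \<in> Arr RR \<longleftrightarrow> yd_RR R H A \<and> yd_RR R H B \<and> f \<in> extensional (carrier A) \<and>
  right_linear R H (A, f, B) \<and> right_colinear R H (A, f, B)"
 by (simp add: YD_RR_def yd_arrows_iff)

lemma RR_arrD: assumes "(A, f, B) \<in> Arr RR" shows "f \<in> lin A B" "x .: A ==> f x .: B"
 "yd_RR R H A" "yd_RR R H B"
 using assms lin_closed[of f A B x] by (auto simp: RR_arr_iff right_linear_def)

lemma K_hom: "arrLL M f N ==> (K M, f, K N) \<in> Hom RR (K M) (K N)"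
 using K.Fa_hom[OF Hom_LL_I] by (simp add: K_Fa)

lemma phiRR:
 assumes M: "yd_LL R H M" and N: "yd_LL R H N"
 shows "phiRR M N \<in> Hom RR (ZZ M N) (K (TL M N))" "phiRR' M N \<in> Hom RR (K (TL M N)) (ZZ M N)"
  "inverse_arrows RR (phiRR M N) (phiRR' M N)"
proof -
 show i: "inverse_arrows RR (phiRR M N) (phiRR' M N)" using TRR_K(2)[OF M N] by (simp add: phiRR_def phiRR'_def)
 then show "phiRR M N \<in> Hom RR (ZZ M N) (K (TL M N))" "phiRR' M N \<in> Hom RR (K (TL M N)) (ZZ M N)"
  by (auto simp: inverse_arrows_def Hom_def phiRR_def phiRR'_def)
qed

definition phi0RR where "phi0RR = (URR, restrict S (carrier URR), K UL)"

lemma phi0RR: "phi0RR \<in> Hom RR URR (K UL)" "inverse_arrows RR phi0RR (K UL, restrict T (carrier UL), URR)"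
 using URR_K(2) by (auto simp: phi0RR_def inverse_arrows_def Hom_def)

text \<open>Statements about arbitrary right-right objects are reduced through this to objects in
  the image of K.\<close>

lemma RR_obj_K: assumes A: "yd_RR R H A" shows "yd_LL R H (toL S (opL A))" "K (toL S (opL A)) = A"
 using yd_LL_opL[OF A] toR_toL_S[OF yd_LR_opL'[OF A]] opR_opL[OF yd_RR_D(1)[OF A]] by simp_all

lemma TRR_RR:
 assumes A: "yd_RR R H A" and B: "yd_RR R H B"
 shows "yd_RR R H (TRR A B)" "module R (TRR A B)" "z .: (TRR A B) ==> z .: (A ** B)"
  "(%x. x) \<in> lin (TRR A B) (A ** B)"
proof -
 note a = RR_obj_K[OF A] and b = RR_obj_K[OF B]
 note t = TRR_K[OF b(1) a(1), unfolded a(2) b(2)]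
 show "yd_RR R H (TRR A B)" by (rule t(1))
 then show "module R (TRR A B)" by (rule yd_RR_D(3))
 show "z .: (TRR A B) ==> z .: (A ** B)" using t(4)[of z] by simp
 show "(%x. x) \<in> lin (TRR A B) (A ** B)" using retractD(3)[OF t(3)] by simp
qed

text \<open>The tensor product of right-right arrows is the flip-conjugate of the left-left one.
  Writing it as a composite of known arrows yields at once that it is an arrow and that
  \<open>phiRR\<close> is natural.\<close>

lemma tensor_arrow_RR:
 assumes f: "arrLL M f M'" and g: "arrLL N g N'"
 shows "tensor_arrow R TRR (K N, g, K N') (K M, f, K M')
   = yd_comp (phiRR' M' N') (yd_comp (K.Fa (tensor_arrow R TL (M, f, M') (N, g, N'))) (phiRR M N))"
  "tensor_arrow R TRR (K N, g, K N') (K M, f, K M') \<in> Hom RR (ZZ M N) (ZZ M' N')"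
  "yd_comp (phiRR M' N') (tensor_arrow R TRR (K N, g, K N') (K M, f, K M'))
   = yd_comp (K.Fa (tensor_arrow R TL (M, f, M') (N, g, N'))) (phiRR M N)"
proof -
 note M = arrLLD(1)[OF f] and M' = arrLLD(2)[OF f] and N = arrLLD(1)[OF g] and N' = arrLLD(2)[OF g]
 note fl = flp[OF yd_LL_module[OF N] yd_LL_module[OF M]] flp[OF yd_LL_module[OF M'] yd_LL_module[OF N']]
  flp[OF yd_LL_module[OF N'] yd_LL_module[OF M']]
 note [simp] = yd_LL_simps[OF M] yd_LL_simps[OF N] yd_LL_simps[OF M'] yd_LL_simps[OF N']
  tensor_LL_simps[OF M N] tensor_LL_simps[OF M' N'] tnLL(3-5)[OF f g] fl
  arrLLD(4)[OF f] arrLLD(4)[OF g] lin_simps[OF arrLLD(4)[OF f]] lin_simps[OF arrLLD(4)[OF g]]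
  arrLL_closed[OF f] arrLL_closed[OF g] TRR_RR(3)[OF TRR_K(1)]
 have Z [simp]: "z .: (ZZ M N) ==> z .: (N ** M)" "z .: (ZZ M N) ==> flp N M z .: (TL M N)"
  "z .: (ZZ M' N') ==> z .: (N' ** M')" "y .: (TL M' N') ==> flp M' N' y .: (ZZ M' N')" for z y
  using TRR_K(4)[OF M N] TRR_K(4)[OF M' N'] by auto
 have p: "flp M' N' (tnLL M N M' N' f g (flp N M z)) = Sw N M (N' ** M') z (%n m. pt N' M' (g n) (f m))"
  if "z .: (ZZ M N)" for z
  using that unfolding flp_def[of M' N'] by simp
 show e: "tensor_arrow R TRR (K N, g, K N') (K M, f, K M')
   = yd_comp (phiRR' M' N') (yd_comp (K.Fa (tensor_arrow R TL (M, f, M') (N, g, N'))) (phiRR M N))"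
  by (auto simp: tensor_arrow_def[of R TRR] tnLL(1)[OF f g] K_Fa phiRR_def phiRR'_def compose_def sweedler_Sw[of N M] p intro!: restrict_ext)
 have F: "K.Fa (tensor_arrow R TL (M, f, M') (N, g, N')) \<in> Hom RR (K (TL M N)) (K (TL M' N'))"
  using K_hom[OF tnLL(2)[OF f g]] by (simp add: tnLL(1)[OF f g] K_Fa)
 show "tensor_arrow R TRR (K N, g, K N') (K M, f, K M') \<in> Hom RR (ZZ M N) (ZZ M' N')"
  unfolding e by (rule RR_comp[OF RR_comp[OF phiRR(1)[OF M N] F] phiRR(2)[OF M' N']])
 show "yd_comp (phiRR M' N') (tensor_arrow R TRR (K N, g, K N') (K M, f, K M'))
   = yd_comp (K.Fa (tensor_arrow R TL (M, f, M') (N, g, N'))) (phiRR M N)"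
  unfolding e by (auto simp: tnLL(1)[OF f g] K_Fa phiRR_def phiRR'_def compose_def intro!: restrict_ext)
qed

lemma tensor_transport_RR: "tensor_transport LL (cat_bar RR) K K.Fa phi0RR phiRR"
proof -
 interpret LL: braided_monoidal_category LL by (rule braided_LL)
 have o: "yd_LL R H M ==> yd_RR R H (K M)" for M using yd_RR_opR .
 show ?thesis
 proof (unfold_locales, goal_cases)
  case 1 show ?case by (rule K.Fo_bij)
 next
  case (2 f M N) then show ?case by (rule K.Fa_hom)
 next
  case (3 g M N) show ?case by (rule K.Fa_full[OF 3])
 next
  case (4 M) show ?case by (rule K.Fa_id)
 next
  case (5 f g M N P) show ?case by (rule K.Fa_comp)
 next
  case 6 show ?case by (simp add: URR_K(1))
 next
  case (7 M N) then show ?case by (simp add: TRR_RR(1) o)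
 next
  case (8 \<phi> \<psi> M M' N N')
  then obtain f g where e: "\<phi> = (M, f, M')" "\<psi> = (N, g, N')" and f: "arrLL M f M'" and g: "arrLL N g N'"
   unfolding Hom_LL by blast
  show ?case using tensor_arrow_RR(2)[OF f g] by (simp add: e K_Fa)
 next
  case 9 show ?case using phi0RR by (auto simp: Iso_def)
 next
  case (10 M N)
  then have M: "yd_LL R H M" and N: "yd_LL R H N" by simp_all
  have "phiRR M N \<in> Hom RR (ZZ M N) (K (TL M N)) \<and> (\<exists>g. inverse_arrows RR (phiRR M N) g)"
   using phiRR(1)[OF M N] phiRR(3)[OF M N] by blast
  then show ?case unfolding Iso_def by simp
 next
  case (11 \<phi> \<psi> M M' N N')
  then obtain f g where e: "\<phi> = (M, f, M')" "\<psi> = (N, g, N')" and f: "arrLL M f M'" and g: "arrLL N g N'"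
   unfolding Hom_LL by blast
  show ?case using tensor_arrow_RR(3)[OF f g] by (simp add: e K_Fa)
 qed
qed

interpretation T: tensor_transport LL "cat_bar RR" K K.Fa phi0RR phiRR by (rule tensor_transport_RR)

lemma tensor_hom_RR: "f \<in> Hom RR A A' ==> g \<in> Hom RR B B' ==> tensor_arrow R TRR g f \<in> Hom RR (TRR B A) (TRR B' A')"
 using T.tens_arr'[of f g] by (auto simp: Hom_def)

lemma id_RR: "yd_RR R H A ==> yd_id A \<in> Hom RR A A"
 using KC.id_hom[of A] by simp

text \<open>Reversing the order of three factors turns the left-left rebracketing around, so the
  right-right constraint corresponds to the inverse left-left one. It is shown to equal the
  composite \<open>?\<kappa>\<close> of known right-right arrows built around \<open>aLL'\<close>,
  whence it is itself an arrow and satisfies the coherence equation.\<close>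

lemma assoc_RR:
 assumes M: "yd_LL R H M" and N: "yd_LL R H N" and P: "yd_LL R H P"
 shows "assoc_arrow R TRR (K P) (K N) (K M) \<in> Hom RR (TRR (ZZ N P) (K M)) (TRR (K P) (ZZ M N))"
  "yd_comp (K.Fa (assoc_arrow R TL M N P)) (yd_comp (T.L3 M N P) (assoc_arrow R TRR (K P) (K N) (K M))) = T.R3 M N P"
proof -
 note MN = tensor_LL_yd(1)[OF M N] and NP = tensor_LL_yd(1)[OF N P]
 note kM = yd_RR_opR[OF M] and kN = yd_RR_opR[OF N] and kP = yd_RR_opR[OF P]
 note zMN = TRR_K(1)[OF M N] and zNP = TRR_K(1)[OF N P]
 let ?X = "TRR (ZZ N P) (K M)" and ?Y = "TRR (K P) (ZZ M N)"
 let ?k1 = "tensor_arrow R TRR (phiRR N P) (yd_id (K M))" and ?k5 = "tensor_arrow R TRR (yd_id (K P)) (phiRR' M N)"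
 let ?k3 = "(K (TL M (TL N P)), aLL' M N P, K (TL (TL M N) P))"
 let ?\<kappa> = "yd_comp ?k5 (yd_comp (phiRR' (TL M N) P) (yd_comp ?k3 (yd_comp (phiRR M (TL N P)) ?k1)))"
 have h1: "?k1 \<in> Hom RR ?X (ZZ M (TL N P))" by (rule tensor_hom_RR[OF id_RR[OF kM] phiRR(1)[OF N P]])
 have h5: "?k5 \<in> Hom RR (ZZ (TL M N) P) ?Y" by (rule tensor_hom_RR[OF phiRR(2)[OF M N] id_RR[OF kP]])
 have h3: "?k3 \<in> Hom RR (K (TL M (TL N P))) (K (TL (TL M N) P))" by (rule K_hom[OF aLL'(2)[OF M N P]])
 have hk: "?\<kappa> \<in> Hom RR ?X ?Y"
  by (rule RR_comp[OF RR_comp[OF RR_comp[OF RR_comp[OF h1 phiRR(1)[OF M NP]] h3] phiRR(2)[OF MN P]] h5])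
 note [simp] = yd_LL_simps[OF M] yd_LL_simps[OF N] yd_LL_simps[OF P] ABC_simps[OF M N P]
  flp(1,2,4)[OF yd_LL_module[OF N] yd_LL_module[OF M]] flp(1-4)[OF yd_LL_module[OF M] yd_LL_module[OF N]]
  flp(1-4)[OF yd_LL_module[OF P] yd_LL_module[OF N]]
  flp(1-4)[OF yd_LL_module[OF P] yd_LL_module[OF MN]] flp(1-4)[OF yd_LL_module[OF MN] yd_LL_module[OF P]]
  flp(1-4)[OF yd_LL_module[OF NP] yd_LL_module[OF M]] flp(1-4)[OF yd_LL_module[OF M] yd_LL_module[OF NP]]
  aLL'(3-5)[OF M N P] aLL(3-4)[OF M N P]
  yd_RR_D(3)[OF zMN] yd_RR_D(3)[OF zNP] TRR_RR(2,4)[OF kP kN, unfolded side_tensor] TRR_RR(2,4)[OF kN kM, unfolded side_tensor]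
  TRR_RR(2,4)[OF zNP kM, unfolded side_tensor] TRR_RR(2,4)[OF kP zMN, unfolded side_tensor]
 have Z [simp]: "z .: (ZZ M N) ==> z .: (N ** M)" "z .: (ZZ M N) ==> flp N M z .: (TL M N)"
  "y .: (TL M N) ==> flp M N y .: (ZZ M N)"
  "z .: (ZZ N P) ==> z .: (P ** N)" "z .: (ZZ N P) ==> flp P N z .: (TL N P)"
  "z .: (ZZ M (TL N P)) ==> z .: (TL N P ** M)"
  "z .: (ZZ M (TL N P)) ==> flp (TL N P) M z .: (TL M (TL N P))"
  "z .: (ZZ (TL M N) P) ==> z .: (P ** TL M N)"
  "y .: (TL (TL M N) P) ==> flp (TL M N) P y .: (ZZ (TL M N) P)"
  "z .: ?X ==> z .: (ZZ N P ** M)" "z .: ?Y ==> z .: (P ** ZZ M N)" for z y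
  using TRR_K(4)[OF M N] TRR_K(4)[OF N P] TRR_K(4)[OF M NP] TRR_K(4)[OF MN P] TRR_RR(3)[OF zNP kM, of z] TRR_RR(3)[OF kP zMN, of z]
  by auto
 have fNP [simp]: "flp P N \<in> lin (ZZ N P) (TL N P)" "!!g A. g \<in> lin A (ZZ N P) ==> (%x. flp P N (g x)) \<in> lin A (TL N P)"
  and fMN [simp]: "flp M N \<in> lin (TL M N) (ZZ M N)" "!!g A. g \<in> lin A (TL M N) ==> (%x. flp M N (g x)) \<in> lin A (ZZ M N)"
  and fMN' [simp]: "flp N M \<in> lin (ZZ M N) (TL M N)" "!!g A. g \<in> lin A (ZZ M N) ==> (%x. flp N M (g x)) \<in> lin A (TL M N)"
 proof -
  have 1: "restrict (flp P N) (carrier (ZZ N P)) \<in> lin (ZZ N P) (TL N P)" "restrict (flp N M) (carrier (ZZ M N)) \<in> lin (ZZ M N) (TL M N)"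
   "restrict (flp M N) (carrier (TL M N)) \<in> lin (TL M N) (ZZ M N)"
   using RR_arrD(1) phiRR(1)[OF N P] phiRR(1)[OF M N] phiRR(2)[OF M N] unfolding phiRR_def phiRR'_def RR_Hom_iff by fastforce+
  show a: "flp P N \<in> lin (ZZ N P) (TL N P)" by (rule lin_eqI[OF 1(1)]) (simp_all add: yd_RR_D(3)[OF zNP])
  show b: "flp M N \<in> lin (TL M N) (ZZ M N)" by (rule lin_eqI[OF 1(3)]) simp_all
  show c: "flp N M \<in> lin (ZZ M N) (TL M N)" by (rule lin_eqI[OF 1(2)]) (simp_all add: yd_RR_D(3)[OF zMN])
  show "!!g A. g \<in> lin A (ZZ N P) ==> (%x. flp P N (g x)) \<in> lin A (TL N P)"
   "!!g A. g \<in> lin A (TL M N) ==> (%x. flp M N (g x)) \<in> lin A (ZZ M N)"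
   "!!g A. g \<in> lin A (ZZ M N) ==> (%x. flp N M (g x)) \<in> lin A (TL M N)"
   using lin_compose[OF a] lin_compose[OF b] lin_compose[OF c] by auto
 qed
 have l [simp]: "flp M N \<in> lin (TL M N) (N ** M)"
  by (rule lin_retract[OF tensor_LL_retract[OF M N]]) simp
 note [simp] = lin_compose[OF l]
 let ?f1 = "%z. Sw (ZZ N P) M (TL N P ** M) z (%u m. pt (TL N P) M (flp P N u) m)"
 let ?f5 = "%z. Sw P (TL M N) (P ** ZZ M N) z (%p v. pt P (ZZ M N) p (flp M N v))"
 have k1: "?k1 = (?X, restrict ?f1 (carrier ?X), ZZ M (TL N P))"
  by (auto simp: tensor_arrow_def phiRR_def yd_id_def sweedler_Sw[of "ZZ N P" M] intro!: restrict_ext)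
 have k5: "?k5 = (ZZ (TL M N) P, restrict ?f5 (carrier (ZZ (TL M N) P)), ?Y)"
  by (auto simp: tensor_arrow_def phiRR'_def yd_id_def sweedler_Sw[of P "TL M N"] intro!: restrict_ext)
 have c1 [simp]: "?f1 z .: (ZZ M (TL N P))" if "z .: ?X" for z
  using RR_arrD(2)[of ?X "restrict ?f1 (carrier ?X)" "ZZ M (TL N P)" z] h1 that unfolding k1 RR_Hom_iff by simp
 have c5 [simp]: "?f5 z .: ?Y" if "z .: (ZZ (TL M N) P)" for z
  using RR_arrD(2)[of "ZZ (TL M N) P" "restrict ?f5 (carrier (ZZ (TL M N) P))" ?Y z] h5 that unfolding k5 RR_Hom_iff by simp
 let ?g = "%z. ?f5 (flp (TL M N) P (aLL' M N P (flp (TL N P) M (?f1 z))))"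
 have \<kappa>: "?\<kappa> = (?X, restrict ?g (carrier ?X), ?Y)"
  unfolding k1 k5 by (auto simp: phiRR_def phiRR'_def compose_def intro!: restrict_ext)
 have push: "pt P (N ** M) p (flp M N v) = Sw M N (P ** (N ** M)) v (%m n. pt P (N ** M) p (pt N M n m))"
  if "p .: P" "v .: (M ** N)" for p v
  using that by (simp add: flp_def pt_Sw(2))
 \<comment> \<open>The value of the composite is included into P \<otimes> (N \<otimes> M), where it
   visibly equals p \<otimes> (n \<otimes> m); uniqueness of corestriction then identifies it with
   the constraint.\<close>
 have a: "assoc_arrow R TRR (K P) (K N) (K M) = ?\<kappa>"
 proof -
  have "corestrict R P (ZZ M N) P (N ** M)
    (sweedler (P ** (N ** M)) z (%y p. sweedler (P ** (N ** M)) y (%m n. pt P (N ** M) m (pt N M n p)))) = ?g z"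
   if z: "z .: ?X" for z
  proof -
   let ?Q = "P ** (N ** M)"
   let ?k4 = "flp (TL M N) P (aLL' M N P (flp (TL N P) M (?f1 z)))"
   have "inc P (ZZ M N) P (N ** M) (?g z) = Sw P (TL M N) ?Q ?k4 (%p v. pt P (N ** M) p (flp M N v))"
    using z by simp
   also have "... = Sw P (TL M N) ?Q ?k4 (%p v. Sw M N ?Q v (%m n. pt P (N ** M) p (pt N M n m)))"
    by (rule Sw_eqI, rule push) simp_all
   also have "... = Sw (ZZ N P) M ?Q z (%u m. Sw P N ?Q u (%p n. pt P (N ** M) p (pt N M n m)))"
    using z by simp
   also have "... = sweedler ?Q z (%y p. sweedler ?Q y (%m n. pt P (N ** M) m (pt N M n p)))"
    using z by (simp add: sweedler_Sw[of "ZZ N P" M] sweedler_Sw[of P N])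
   finally have i: "inc P (ZZ M N) P (N ** M) (?g z) = sweedler ?Q z (%y p. sweedler ?Q y (%m n. pt P (N ** M) m (pt N M n p)))" .
   have "?g z .: (P ** ZZ M N)" using z by simp
   from corestrict_inc[OF retract_id[OF yd_LL_module[OF P]] TRR_K(3)[OF M N] this] show ?thesis unfolding i .
  qed
  then show ?thesis unfolding \<kappa>
   by (auto simp: assoc_arrow_def corestrict_def intro!: restrict_ext)
 qed
 show "assoc_arrow R TRR (K P) (K N) (K M) \<in> Hom RR ?X ?Y" unfolding a by (rule hk)
 let ?f6 = "%z. Sw P (ZZ M N) (P ** TL M N) z (%p v. pt P (TL M N) p (flp N M v))"
 have L3: "T.L3 M N P = (?Y, compose (carrier ?Y) (restrict (flp P (TL M N)) (carrier (ZZ (TL M N) P))) (restrict ?f6 (carrier ?Y)), K (TL (TL M N) P))"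
  unfolding T.L3_def by (auto simp: tensor_arrow_def phiRR_def yd_id_def sweedler_Sw[of P "ZZ M N"] compose_def intro!: restrict_ext)
 have R3: "T.R3 M N P = (?X, compose (carrier ?X) (restrict (flp (TL N P) M) (carrier (ZZ M (TL N P)))) (restrict ?f1 (carrier ?X)), K (TL M (TL N P)))"
  unfolding T.R3_def using k1 by (simp add: phiRR_def)
 have f65: "?f6 (?f5 k) = k" if "k .: (ZZ (TL M N) P)" for k
 proof -
  have "?f6 (?f5 k) = Sw P (TL M N) (P ** TL M N) k (%p v. pt P (TL M N) p (flp N M (flp M N v)))"
   using that by simp
  then show ?thesis using that by simp
 qed
 have aa: "aLL M N P (aLL' M N P w) = w" if "w .: (TL M (TL N P))" for w
  using that ascLL_ascLL'(1)[OF M N P] ascLL'_facts(1)[OF M N P] by (simp add: aLL_def aLL'_def)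
 have "compose (carrier ?X) (aLL M N P) (compose (carrier ?X)
   (compose (carrier ?Y) (restrict (flp P (TL M N)) (carrier (ZZ (TL M N) P))) (restrict ?f6 (carrier ?Y))) (restrict ?g (carrier ?X)))
  = compose (carrier ?X) (restrict (flp (TL N P) M) (carrier (ZZ M (TL N P)))) (restrict ?f1 (carrier ?X))"
 proof (rule compose_eqI)
  fix x assume x: "x .: ?X"
  let ?k2 = "flp (TL N P) M (?f1 x)"
  let ?k4 = "flp (TL M N) P (aLL' M N P ?k2)"
  have k2: "?k2 .: (TL M (TL N P))" by (rule Z(7), rule c1, rule x)
  have k3: "aLL' M N P ?k2 .: (TL (TL M N) P)" by (rule aLL'(4)[OF M N P k2])
  have k4: "?k4 .: (ZZ (TL M N) P)" by (rule Z(9)[OF k3])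
  have k5: "?g x .: ?Y" by (rule c5[OF k4])
  have fl: "flp P (TL M N) ?k4 = aLL' M N P ?k2"
   by (rule flp(3)[OF yd_LL_module[OF MN] yd_LL_module[OF P]]) (use k3 in simp)
  have "aLL M N P (flp P (TL M N) (?f6 (?g x))) = ?k2"
   unfolding f65[OF k4] fl by (rule aa[OF k2])
  then show "aLL M N P (compose (carrier ?X)
   (compose (carrier ?Y) (restrict (flp P (TL M N)) (carrier (ZZ (TL M N) P))) (restrict ?f6 (carrier ?Y))) (restrict ?g (carrier ?X)) x)
   = restrict (flp (TL N P) M) (carrier (ZZ M (TL N P))) (restrict ?f1 (carrier ?X) x)"
   by (simp only: compose_eq[OF x] restrict_apply'[OF x] compose_eq[OF k5] restrict_apply'[OF k5] f65[OF k4]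
     restrict_apply'[OF k4] restrict_apply'[OF c1[OF x]])
 qed
 then show "yd_comp (K.Fa (assoc_arrow R TL M N P)) (yd_comp (T.L3 M N P) (assoc_arrow R TRR (K P) (K N) (K M))) = T.R3 M N P"
  unfolding a \<kappa> L3 R3 aLL(1)[OF M N P] K_Fa yd_comp_simp by (simp only:)
qed

text \<open>Left and right unit constraints trade places under reversal. The formulas match because
  an element y of H_s satisfies \<open>esb\<close>(S(y)) = y = S(\<open>etb y\<close>).\<close>

lemma lunit_RR:
 assumes M: "yd_LL R H M"
 shows "yd_comp (K.Fa (left_lunit TL UL M)) (yd_comp (phiRR UL M) (tensor_arrow R TRR (yd_id (K M)) phi0RR)) = right_runit TRR URR (K M)"
  "yd_comp (K.Fa (left_runit H TL UL M)) (yd_comp (phiRR M UL) (tensor_arrow R TRR phi0RR (yd_id (K M)))) = right_lunit H TRR URR (K M)"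
proof -
 note U = unit_LL_yd(1) and kM = yd_RR_opR[OF M]
 note [simp] = yd_LL_simps[OF M] yd_LL_simps[OF U] retractD(1,3)[OF URR_K(4)] tensor_LL_simps[OF U M] tensor_LL_simps[OF M U]
  flp(1,2,4)[OF yd_LL_module[OF M] yd_LL_module[OF U]] flp(1,2,4)[OF yd_LL_module[OF U] yd_LL_module[OF M]]
  lLL(4)[OF M] rLL(4)[OF M] unit_LL_pt[OF yd_LL_module[OF M]]
 have m [simp]: "y .: URR ==> y .: H" "y .: URR ==> S y .: UL"
  "y .: URR ==> es y = y" "y .: URR ==> esb (S y) = y" for y
 proof -
  have 1: "y .: H" "es y = y" "S y .: UL" if "y .: URR"
  proof -
   have y: "y \<in> Hs" using that unfolding URR_K(3) .
   then show 2: "y .: H" "es y = y" using Hs_iff by blast+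
   show "S y .: UL" unfolding antipode_Hs[OF y] by (rule unit_LL_simps(3)[OF 2(1)])
  qed
  show "y .: URR ==> y .: H" "y .: URR ==> S y .: UL" "y .: URR ==> es y = y"
   by (rule 1; assumption)+
  assume y: "y .: URR"
  have "esb (S y) = T (et (S y))" by (rule antipode_inv_eps(1)[symmetric]) (use 1(1)[OF y] in simp)
  also have "et (S y) = S y" using 1(3)[OF y] Ht_iff unfolding carrier_unit_LL by blast
  also have "T (S y) = y" by (rule antipode_inv_simps(3)[OF 1(1)[OF y]])
  finally show "esb (S y) = y" .
 qed
 have S [simp]: "S \<in> lin URR UL"
  by (rule lin_retract_corange[OF retract_unit_LL]) (use lin_retract[OF URR_K(4) antipode_lin] in simp_all)
 note [simp] = lin_compose[OF S]
 have h1: "tensor_arrow R TRR (yd_id (K M)) phi0RR \<in> Hom RR (TRR (K M) URR) (ZZ UL M)"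
  by (rule tensor_hom_RR[OF phi0RR(1) id_RR[OF kM]])
 have h2: "tensor_arrow R TRR phi0RR (yd_id (K M)) \<in> Hom RR (TRR URR (K M)) (ZZ M UL)"
  by (rule tensor_hom_RR[OF id_RR[OF kM] phi0RR(1)])
 let ?f1 = "%z. Sw M URR (M ** UL) z (%m y. pt M UL m (S y))" and ?f2 = "%z. Sw URR M (UL ** M) z (%y m. pt UL M (S y) m)"
 let ?X1 = "TRR (K M) URR" and ?X2 = "TRR URR (K M)"
 have z [simp]: "z .: ?X1 ==> z .: (M ** URR)" "z .: ?X2 ==> z .: (URR ** M)" for z
  using TRR_RR(3)[OF kM URR_K(1), of z] TRR_RR(3)[OF URR_K(1) kM, of z] by simp_all
 have t1: "tensor_arrow R TRR (yd_id (K M)) phi0RR = (?X1, restrict ?f1 (carrier ?X1), ZZ UL M)"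
  by (auto simp: tensor_arrow_def phi0RR_def yd_id_def sweedler_Sw[of M URR] intro!: restrict_ext)
 have t2: "tensor_arrow R TRR phi0RR (yd_id (K M)) = (?X2, restrict ?f2 (carrier ?X2), ZZ M UL)"
  by (auto simp: tensor_arrow_def phi0RR_def yd_id_def sweedler_Sw[of URR M] intro!: restrict_ext)
 have c1: "?f1 z .: (ZZ UL M)" "flp M UL (?f1 z) .: (TL UL M)" if "z .: ?X1" for z
  using RR_arrD(2)[of ?X1 "restrict ?f1 (carrier ?X1)" "ZZ UL M" z] h1 that TRR_K(4)[OF U M] unfolding t1 RR_Hom_iff by simp_all
 have c2: "?f2 z .: (ZZ M UL)" "flp UL M (?f2 z) .: (TL M UL)" if "z .: ?X2" for z
  using RR_arrD(2)[of ?X2 "restrict ?f2 (carrier ?X2)" "ZZ M UL" z] h2 that TRR_K(4)[OF M U] unfolding t2 RR_Hom_iff by simp_all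
 have e1: "lLL M (flp M UL (?f1 z)) = sweedler M z (act (K M))" if x: "z .: ?X1" for z
 proof -
  have "lLL M (flp M UL (?f1 z)) = Sw UL M M (flp M UL (?f1 z)) (%z m. act M z m)" by (rule lLL(4)[OF M c1(2)[OF x]])
  also have "... = Sw M URR M z (%m y. act M (S y) m)" using x by simp
  also have "... = sweedler M z (act (K M))" using x by (simp add: sweedler_Sw[of M URR])
  finally show ?thesis .
 qed
 have e2: "rLL M (flp UL M (?f2 z)) = sweedler M z (%y m. act (K M) m (etb y))" if x: "z .: ?X2" for z
 proof -
  have "rLL M (flp UL M (?f2 z)) = Sw M UL M (flp UL M (?f2 z)) (%m z. act M (esb z) m)" by (rule rLL(4)[OF M c2(2)[OF x]])
  also have "... = Sw URR M M z (%y m. act M (esb (S y)) m)" using x by simp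
  also have "... = Sw URR M M z (%y m. act (K M) m (etb y))" by (rule Sw_eqI) simp
  also have "... = sweedler M z (%y m. act (K M) m (etb y))" using x by (simp add: sweedler_Sw[of URR M])
  finally show ?thesis .
 qed
 show "yd_comp (K.Fa (left_lunit TL UL M)) (yd_comp (phiRR UL M) (tensor_arrow R TRR (yd_id (K M)) phi0RR)) = right_runit TRR URR (K M)"
  unfolding t1 lLL(1)[OF M] K_Fa phiRR_def right_runit_def yd_comp_simp compose_def
  by (auto simp: restrict_apply' c1 e1 simp del: Sw_pt lLL(4)[OF M] intro!: restrict_ext)
 show "yd_comp (K.Fa (left_runit H TL UL M)) (yd_comp (phiRR M UL) (tensor_arrow R TRR phi0RR (yd_id (K M)))) = right_lunit H TRR URR (K M)"
  unfolding t2 rLL(1)[OF M] K_Fa phiRR_def right_lunit_def yd_comp_simp compose_def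
  by (auto simp: restrict_apply' c2 e2 simp del: Sw_pt rLL(4)[OF M] intro!: restrict_ext)
qed

text \<open>The right action of T(m_[-1]) on K N is the left action of S(T(m_[-1])) = m_[-1], so the
  two twists cancel and the braiding is the left-left one between flips, not its inverse.\<close>

lemma braid_RR:
 assumes M: "yd_LL R H M" and N: "yd_LL R H N"
 shows "braid_RR R TRR (K N) (K M) = yd_comp (phiRR' N M) (yd_comp (K.Fa (braid_LL R TL M N)) (phiRR M N))"
  "yd_comp (phiRR N M) (braid_RR R TRR (K N) (K M)) = yd_comp (K.Fa (braid_LL R TL M N)) (phiRR M N)"
proof -
 note fl = flp[OF yd_LL_module[OF N] yd_LL_module[OF M]] flp[OF yd_LL_module[OF M] yd_LL_module[OF N]]
 note [simp] = yd_LL_simps[OF M] yd_LL_simps[OF N] tensor_LL_simps[OF M N] tensor_LL_simps[OF N M] cLL(3-5)[OF M N] fl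
 have Z [simp]: "z .: (ZZ M N) ==> z .: (N ** M)" "z .: (ZZ M N) ==> flp N M z .: (TL M N)"
  "y .: (TL N M) ==> flp N M y .: (ZZ N M)" for z y
  using TRR_K(4)[OF M N] TRR_K(4)[OF N M] by auto
 have p: "flp N M (cLL M N (flp N M z)) = sweedler (M ** N) z (%m n. sweedler (M ** N) (coact (K M) n) (%n0 b. pt M N n0 (act (K N) m b)))"
  if z: "z .: (ZZ M N)" for z
 proof -
  have "flp N M (cLL M N (flp N M z)) = Sw N M (M ** N) z (%n m. LC M (M ** N) m (%a m0. pt M N m0 (act N a n)))"
   unfolding flp_def[of N M "cLL M N _"] using z by simp
  also have "... = sweedler (M ** N) z (%m n. sweedler (M ** N) (coact (K M) n) (%n0 b. pt M N n0 (act (K N) m b)))"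
   using z by (simp add: sweedler_Sw[of N M] sweedler_Sw[of M H])
  finally show ?thesis .
 qed
 show e: "braid_RR R TRR (K N) (K M) = yd_comp (phiRR' N M) (yd_comp (K.Fa (braid_LL R TL M N)) (phiRR M N))"
  unfolding cLL(1)[OF M N] K_Fa phiRR_def phiRR'_def braid_RR_def
  by (auto simp: compose_def p[unfolded side_tensor] intro!: restrict_ext)
 show "yd_comp (phiRR N M) (braid_RR R TRR (K N) (K M)) = yd_comp (K.Fa (braid_LL R TL M N)) (phiRR M N)"
  unfolding e cLL(1)[OF M N] K_Fa phiRR_def phiRR'_def
  by (auto simp: compose_def intro!: restrict_ext)
qed

lemma functor_LL_RR: "braided_monoidal_functor LL (cat_bar RR) K K.Fa phi0RR phiRR"
proof (rule braided_transport.transported)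
 interpret LL: braided_monoidal_category LL by (rule braided_LL)
 have phih: "!!M N. yd_LL R H M ==> yd_LL R H N ==> phiRR M N \<in> Hom RR (ZZ M N) (K (TL M N))" by (rule phiRR(1))
 show "braided_transport LL (cat_bar RR) K K.Fa phi0RR phiRR"
 proof (unfold_locales, goal_cases)
  case (1 M N P)
  then have o: "M \<in> Obj LL" "N \<in> Obj LL" "P \<in> Obj LL" "yd_LL R H M" "yd_LL R H N" "yd_LL R H P" by simp_all
  show ?case using T.assoc_from_inverse(1)[OF o(1-3), of "assoc_arrow R TRR (K P) (K N) (K M)"] assoc_RR[OF o(4-6)] by simp
 next
  case (2 M)
  then have M: "yd_LL R H M" by simp
  have "K.Fa (left_lunit TL UL M) \<in> Hom RR (K (TL UL M)) (K M)"
   using K_hom[OF lLL(2)[OF M]] by (simp add: lLL(1)[OF M] K_Fa)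
  from RR_comp[OF RR_comp[OF tensor_hom_RR[OF phi0RR(1) id_RR[OF yd_RR_opR[OF M]]] phih[OF unit_LL_yd(1) M]] this]
  show ?case by (simp add: lunit_RR(1)[OF M])
 next
  case (3 M)
  then have M: "yd_LL R H M" by simp
  have "K.Fa (left_runit H TL UL M) \<in> Hom RR (K (TL M UL)) (K M)"
   using K_hom[OF rLL(2)[OF M]] by (simp add: rLL(1)[OF M] K_Fa)
  from RR_comp[OF RR_comp[OF tensor_hom_RR[OF id_RR[OF yd_RR_opR[OF M]] phi0RR(1)] phih[OF M unit_LL_yd(1)]] this]
  show ?case by (simp add: lunit_RR(2)[OF M])
 next
  case (4 M N)
  then have M: "yd_LL R H M" and N: "yd_LL R H N" by simp_all
  have "K.Fa (braid_LL R TL M N) \<in> Hom RR (K (TL M N)) (K (TL N M))"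
   using K_hom[OF cLL(2)[OF M N]] by (simp add: cLL(1)[OF M N] K_Fa)
  from RR_comp[OF RR_comp[OF phih[OF M N] this] phiRR(2)[OF N M]]
  show ?case by (simp add: braid_RR(1)[OF M N])
 next
  case (5 M N P)
  then have o: "M \<in> Obj LL" "N \<in> Obj LL" "P \<in> Obj LL" "yd_LL R H M" "yd_LL R H N" "yd_LL R H P" by simp_all
  show ?case using T.assoc_from_inverse(2)[OF o(1-3), of "assoc_arrow R TRR (K P) (K N) (K M)"] assoc_RR[OF o(4-6)] by simp
 next
  case (6 M) then show ?case using lunit_RR(1)[of M] by simp
 next
  case (7 M) then show ?case using lunit_RR(2)[of M] by simp
 next
  case (8 M N) then show ?case using braid_RR(2)[of M N] by simp
 qed
qed

text \<open>The functor from left-left modules to reversed right-right modules is factored through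
  the strict isomorphism with the left-right category.\<close>

lemma iso_LR_RR: "cat_in LR \<cong>\<^sub>b\<^sub>r cat_bar RR"
proof -
 interpret L: strict_yd_link LL "cat_in LR" "toR T" by (rule strict_LL_LR)
 show ?thesis
  by (rule L.iso_factor[OF functor_LL_RR]) (use K.Fo_bij K.Fa_bij in simp_all)
qed

lemma braided_bar_RR: "braided_monoidal_category (cat_bar RR)"
 by (rule braided_monoidal_functor.axioms(2)[OF functor_LL_RR])

end

context weak_hopf_bij
begin

subsection \<open>Right-right and right-left modules\<close>

interpretation K: yd_link LL "cat_bar RR" K by (rule yd_link_K)

interpretation T: tensor_transport LL "cat_bar RR" K K.Fa phi0RR phiRR by (rule tensor_transport_RR)

abbreviation "RL \<equiv> YD_RL R H"
abbreviation TRL where "TRL \<equiv> tensor_RL R H"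
abbreviation URL where "URL \<equiv> unit_RL R H"

lemma RL_sel [simp]:
 "Obj RL = Collect (yd_RL R H)" "Dom RL = fst" "Cod RL = snd \<circ> snd" "Id RL = yd_id" "Comp RL = yd_comp"
 "TensO RL = TRL" "TensA RL = tensor_arrow R TRL" "Unit RL = URL" "Assoc RL = assoc_arrow R TRL"
 "LUnit RL = right_lunit H TRL URL" "RUnit RL = right_runit TRL URL" "Braid RL = braid_RL R TRL"
 by (simp_all add: YD_RL_def)

lemma right_object_toL:
 assumes "!!x. x \<in> A ==> \<rho> x = RC (right_object R H V A \<alpha> \<rho>') (H ** right_object R H V A \<alpha> \<rho>') x
   (%x a. pt H (right_object R H V A \<alpha> \<rho>') (T a) x)"
 shows "right_object R H V A \<alpha> \<rho> = toL T (right_object R H V A \<alpha> \<rho>')"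
 using assms by (intro yd_module.equality) (simp_all add: toL_def cong: restrict_cong)

lemma side_tensor_s [simp]:
 "tensor_s R H (toL \<sigma> M) \<alpha> (toL \<sigma> N) \<beta> = tensor_s R H M \<alpha> N \<beta>"
 "right_diag R (toL \<sigma> M) \<alpha> (toL \<sigma> N) \<beta> = right_diag R M \<alpha> N \<beta>"
 by (simp_all add: tensor_s_def right_diag_def fun_eq_iff)

text \<open>Expressed through the unit of the left-left category, both coactions apply T twice to
  one leg and once to the other; the comparison takes place in H \<otimes> H after expanding
  \<Delta>(S(y)).\<close>

lemma unit_RL_toL: "URL = toL T URR"
proof -
 let ?A = "submod R H Hs"
 note U = unit_LL_yd(1)
 note r = URR_K(4)
 have eq: "mod_eq URR ?A" unfolding unit_RR_def by (simp add: mod_eq_def)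
 have rs: "retract es ?A H" using r eq unfolding retract_def
  by (simp add: mod_eq_module[OF eq, symmetric] mod_eq_lin[OF eq, of H H, symmetric] mod_eq_lin[OF _ eq, of H H, symmetric] mod_eq_def)
 note [simp] = yd_LL_simps[OF U] retractD(1,3)[OF r]
 have "(K UL, restrict T (carrier UL), URR) \<in> Arr RR"
  using phi0RR(2) unfolding inverse_arrows_def Hom_def by blast
 from RR_arrD(1)[OF this] have j': "restrict T (carrier UL) \<in> lin UL URR" by (simp only: side_lin)
 have j: "T \<in> lin UL URR" by (rule lin_eqI[OF j']) simp_all
 have [simp]: "y .: URR ==> y .: H" for y using retractD(6)[OF r] by blast
 note [simp] = j lin_simps[OF j yd_LL_module[OF U] retractD(1)[OF r]]
 have "corestrict R H ?A H H (sweedler (H ** H) (comult H y) (%y1 y2. pt H H (T y2) y1)) = RC URR (H ** URR) y (%x a. pt H URR (T a) x)"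
  if y: "y \<in> Hs" for y
 proof -
  have y' [simp]: "y .: H" and yU: "y .: URR" using y by (simp_all add: URR_K(3))
  have Sy: "S y \<in> Ht" unfolding antipode_Hs[OF y] by simp
  let ?w = "LC UL (H ** URR) (S y) (%a x. pt H URR (T (T a)) (T x))"
  have e: "RC URR (H ** URR) y (%x a. pt H URR (T a) x) = ?w"
   unfolding URR_K(5)[OF yU] using Sy by simp
  have w: "?w .: (H ** ?A)" unfolding mod_eq_tensor(1)[OF side_mod_eq(5)[of H] mod_eq_sym[OF eq]] using Sy by simp
  have "inc H URR H H ?w = LC UL (H ** H) (S y) (%a x. pt H H (T (T a)) (T x))" using Sy by simp
  also have "... = D (H ** H) (S y) (%a x. pt H H (T (T a)) (T x))"
   by (rule unit_LL_yd(2)) (simp_all add: Sy)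
  also have "... = D (H ** H) y (%a b. pt H H (T (T (S b))) (T (S a)))"
   by (rule D_antipode_arg) simp_all
  also have "... = sweedler (H ** H) (comult H y) (%y1 y2. pt H H (T y2) y1)" by (simp add: comult_sweedler)
  finally have "inc H ?A H H ?w = ..."
   unfolding mod_eq_Sw[OF side_mod_eq(5)[of H] mod_eq_sym[OF eq] side_mod_eq(5)[of "H ** H"]] .
  then show ?thesis using corestrict_inc[OF retract_id[OF H_module] rs w] unfolding e by simp
 qed
 then show ?thesis unfolding unit_RL_def unit_RR_def by (rule right_object_toL)
qed

text \<open>The coaction now carries T twice, and two reversals cancel: T(T(ab)) = T(T(a)) T(T(b)).
  Since the tensor factors are flipped, this is the reversed product required by the right-left
  formula.\<close>

lemma tensor_RL_K:
 assumes M: "yd_LL R H M" and N: "yd_LL R H N"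
 shows "TRL (toL T (K N)) (toL T (K M)) = toL T (ZZ M N)"
proof -
 note X = tensor_LL_yd(1)[OF M N]
 note fl = flp[OF yd_LL_module[OF N] yd_LL_module[OF M]] and fl' = flp[OF yd_LL_module[OF M] yd_LL_module[OF N]]
 let ?V = "N ** M" and ?X = "TL M N" and ?A = "tensor_s R H (K N) (act (K N)) (K M) (act (K M))"
 let ?co = "%x. corestrict R (submod R ?V ?A) H ?V H
    (sweedler (?V ** H) x (%m n. sweedler (?V ** H) (coact (K N) m) (%m0 a.
      sweedler (?V ** H) (coact (K M) n) (%n0 b. pt ?V H (pt N M m0 n0) (a .* b)))))"
 have Z: "ZZ M N = right_object R H ?V ?A (%z h. right_diag R (K N) (act (K N)) (K M) (act (K M)) z (comult H h)) ?co"
  unfolding tensor_RR_def right_tensor_def side_tensor by (rule HOL.refl)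
 have eq: "mod_eq (ZZ M N) (submod R ?V ?A)" unfolding Z by (simp add: mod_eq_def)
 note r = TRR_K(3)[OF M N]
 have rs: "retract (%z. flp M N (ldiag M (act M) N (act N) uH (flp N M z))) (submod R ?V ?A) ?V"
  using r eq unfolding retract_def
  by (simp add: mod_eq_module[OF eq, symmetric] mod_eq_lin[OF eq, of ?V ?V, symmetric] mod_eq_lin[OF _ eq, of ?V ?V, symmetric] mod_eq_def)
 note [simp] = yd_LL_simps[OF M] yd_LL_simps[OF N] yd_LL_simps[OF X] tensor_LL_simps[OF M N] fl fl'
  lin_compose[OF fl(1)] lin_compose[OF fl'(1)] retractD(1,3)[OF r]
 have "(K ?X, restrict (flp M N) (carrier ?X), ZZ M N) \<in> Arr RR"
  using phiRR(2)[OF M N] unfolding phiRR'_def RR_Hom_iff by blast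
 from RR_arrD(1)[OF this] have j': "restrict (flp M N) (carrier ?X) \<in> lin ?X (ZZ M N)" by (simp only: side_lin)
 have j: "flp M N \<in> lin ?X (ZZ M N)" by (rule lin_eqI[OF j']) simp_all
 have [simp]: "z .: (ZZ M N) ==> z .: ?V" for z using retractD(6)[OF r] by blast
 note [simp] = j lin_simps[OF j yd_LL_module[OF X] retractD(1)[OF r]]
 let ?Q = "H ** ?V"
 have "corestrict R H (submod R ?V ?A) H ?V (sweedler ?Q x (%m n. sweedler ?Q (coact (toL T (K N)) m) (%a m0.
   sweedler ?Q (coact (toL T (K M)) n) (%b n0. pt H ?V (b .* a) (pt N M m0 n0)))))
  = RC (ZZ M N) (H ** ZZ M N) x (%u a. pt H (ZZ M N) (T a) u)" if x: "x \<in> ?A" for x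
 proof -
  have xZ: "x .: (ZZ M N)" using x unfolding Z by simp
  have x1 [simp]: "x .: ?V" "flp N M x .: ?X" using xZ TRR_K(4)[OF M N] by blast+
  let ?w = "LC ?X (H ** ZZ M N) (flp N M x) (%a u. pt H (ZZ M N) (T (T a)) (flp M N u))"
  have e: "RC (ZZ M N) (H ** ZZ M N) x (%u a. pt H (ZZ M N) (T a) u) = ?w"
   unfolding TRR_K(5)[OF M N xZ] by simp
  have w: "?w .: (H ** submod R ?V ?A)"
   unfolding mod_eq_tensor(1)[OF side_mod_eq(5)[of H] mod_eq_sym[OF eq]] by simp
  have "inc H (ZZ M N) H ?V ?w = LC ?X ?Q (flp N M x) (%a u. pt H ?V (T (T a)) (flp M N u))" by simp
  also have "... = Sw M N ?Q (flp N M x) (%m n. LC M ?Q m (%a m0. LC N ?Q n (%b n0. pt H ?V (T (T (a .* b))) (flp M N (pt M N m0 n0)))))"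
   by (rule tensor_LL_yd(2)[OF M N]) simp_all
  also have "... = Sw N M ?Q x (%n m. LC M ?Q m (%a m0. LC N ?Q n (%b n0. pt H ?V (T (T a) .* T (T b)) (pt N M n0 m0))))"
   by simp
  also have "... = Sw N M ?Q x (%n m. LC N ?Q n (%b n0. LC M ?Q m (%a m0. pt H ?V (T (T a) .* T (T b)) (pt N M n0 m0))))"
   by (rule Sw_eqI, rule Sw_swap) simp_all
  also have "... = sweedler ?Q x (%m n. sweedler ?Q (coact (toL T (K N)) m) (%a m0.
   sweedler ?Q (coact (toL T (K M)) n) (%b n0. pt H ?V (b .* a) (pt N M m0 n0))))"
   by (simp add: sweedler_Sw[of N M] sweedler_Sw[of H N] sweedler_Sw[of H M])
  finally have "inc H (submod R ?V ?A) H ?V ?w = ..."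
   unfolding mod_eq_Sw[OF side_mod_eq(5)[of H] mod_eq_sym[OF eq] side_mod_eq(5)[of ?Q]] .
  then show ?thesis using corestrict_inc[OF retract_id[OF H_module] rs w] unfolding e by simp
 qed
 then show ?thesis unfolding tensor_RL_def right_tensor_def side_tensor side_tensor_s side_sel Z
  by (rule right_object_toL)
qed

lemma tensor_RL_toL:
 assumes A: "yd_RR R H A" and B: "yd_RR R H B"
 shows "TRL (toL T A) (toL T B) = toL T (TRR A B)"
 using tensor_RL_K[OF RR_obj_K(1)[OF B] RR_obj_K(1)[OF A]] unfolding RR_obj_K(2)[OF A] RR_obj_K(2)[OF B] .

text \<open>The reversed category has the inverse of this arrow as its constraint; its existence is
  needed before the functor can be moved past the inversion.\<close>

lemma assoc_RR_inverse:
 assumes A: "yd_RR R H A" "yd_RR R H B" "yd_RR R H E"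
 shows "\<exists>g. inverse_arrows RR (assoc_arrow R TRR A B E) g"
proof -
 obtain P N M where o: "yd_LL R H P" "yd_LL R H N" "yd_LL R H M" "A = K P" "B = K N" "E = K M"
  using RR_obj_K(1)[OF A(1)] RR_obj_K(1)[OF A(2)] RR_obj_K(1)[OF A(3)]
   RR_obj_K(2)[OF A(1), symmetric] RR_obj_K(2)[OF A(2), symmetric] RR_obj_K(2)[OF A(3), symmetric] by (rule that)
 have o': "M \<in> Obj LL" "N \<in> Obj LL" "P \<in> Obj LL" using o by simp_all
 let ?a = "assoc_arrow R TRR (K P) (K N) (K M)"
 have a: "?a \<in> Hom (cat_bar RR) (TensO (cat_bar RR) (K M) (TensO (cat_bar RR) (K N) (K P))) (TensO (cat_bar RR) (TensO (cat_bar RR) (K M) (K N)) (K P))"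
  using assoc_RR(1)[OF o(3,2,1)] by simp
 have e: "Comp (cat_bar RR) (K.Fa (Assoc LL M N P)) (Comp (cat_bar RR) (T.L3 M N P) ?a) = T.R3 M N P"
  using assoc_RR(2)[OF o(3,2,1)] by simp
 have "T.C.iso ?a" by (rule T.assoc_from_inverse(3)[OF o' a e])
 then show ?thesis unfolding T.C.iso_def o by simp
qed

text \<open>On K N the element T(T(m_[-1])) acts as S(T(T(m_[-1]))) = T(m_[-1]), which is the
  formula of the inverse left-left braiding between flips. The right-left braiding is thus inverse
  to the right-right one.\<close>

lemma braid_RL_toL:
 assumes M: "yd_LL R H M" and N: "yd_LL R H N"
 shows "\<exists>f g. braid_RL R TRL (toL T (K M)) (toL T (K N)) = (toL T (ZZ N M), g, toL T (ZZ M N)) \<and>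
  braid_RR R TRR (K N) (K M) = (ZZ M N, f, ZZ N M) \<and> inverse_arrows RR (ZZ N M, g, ZZ M N) (ZZ M N, f, ZZ N M)"
proof -
 note fl = flp[OF yd_LL_module[OF N] yd_LL_module[OF M]] flp[OF yd_LL_module[OF M] yd_LL_module[OF N]]
 note [simp] = yd_LL_simps[OF M] yd_LL_simps[OF N] tensor_LL_simps[OF M N] tensor_LL_simps[OF N M] cLL(4)[OF M N] fl
  braid_LL_inv(1)[OF M N]
 have Z [simp]: "z .: (ZZ M N) ==> z .: (N ** M)" "z .: (ZZ M N) ==> flp N M z .: (TL M N)"
  "w .: (ZZ N M) ==> w .: (M ** N)" "w .: (ZZ N M) ==> flp M N w .: (TL N M)"
  "y .: (TL N M) ==> flp N M y .: (ZZ N M)" "x .: (TL M N) ==> flp M N x .: (ZZ M N)" for z w y x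
  using TRR_K(4)[OF M N] TRR_K(4)[OF N M] by auto
 let ?f = "restrict (%z. flp N M (cLL M N (flp N M z))) (carrier (ZZ M N))"
 define bi where "bi = brLL_inv M N"
 let ?g = "restrict (%w. flp M N (bi (flp M N w))) (carrier (ZZ N M))"
 have bi [simp]: "y .: (TL N M) ==> bi y .: (TL M N)" "y .: (TL N M) ==> cLL M N (bi y) = y"
  "x .: (TL M N) ==> bi (cLL M N x) = x" for x y
  using braid_LL_inv[OF M N] unfolding bi_def cLL_def by (simp_all del: Sw_pt)
 have f: "braid_RR R TRR (K N) (K M) = (ZZ M N, ?f, ZZ N M)"
  unfolding braid_RR(1)[OF M N] cLL(1)[OF M N] K_Fa phiRR_def phiRR'_def by (auto simp: compose_def intro!: restrict_ext)
 have inv: "inverse_arrows LL (braid_LL R TL M N) (TL N M, restrict bi (carrier (TL N M)), TL M N)"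
  unfolding bi_def by (rule braid_LL_iso(2)[OF M N])
 then have biLL: "arrLL (TL N M) (restrict bi (carrier (TL N M))) (TL M N)"
  unfolding inverse_arrows_def Hom_def arrLL_def by blast
 have g: "(ZZ N M, ?g, ZZ M N) = yd_comp (phiRR' M N) (yd_comp (K (TL N M), restrict bi (carrier (TL N M)), K (TL M N)) (phiRR N M))"
  unfolding phiRR_def phiRR'_def by (auto simp: compose_def intro!: restrict_ext)
 have gH: "(ZZ N M, ?g, ZZ M N) \<in> Hom RR (ZZ N M) (ZZ M N)"
  unfolding g by (rule RR_comp[OF RR_comp[OF phiRR(1)[OF N M] K_hom[OF biLL]] phiRR(2)[OF M N]])
 have "braid_RR R TRR (K N) (K M) \<in> Hom RR (ZZ M N) (ZZ N M)"
  unfolding braid_RR(1)[OF M N] cLL(1)[OF M N] K_Fa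
  by (rule RR_comp[OF RR_comp[OF phiRR(1)[OF M N] K_hom[OF cLL(2)[OF M N]]] phiRR(2)[OF N M]])
 then have fH: "(ZZ M N, ?f, ZZ N M) \<in> Hom RR (ZZ M N) (ZZ N M)" unfolding f .
 have i: "inverse_arrows RR (ZZ N M, ?g, ZZ M N) (ZZ M N, ?f, ZZ N M)"
  unfolding inverse_arrows_def using gH fH
  by (auto simp: RR_Hom_iff yd_id_def compose_def intro!: restrict_ext)
 have p: "flp M N (bi (flp M N w)) = sweedler (N ** M) w (%m n. sweedler (N ** M) (coact (toL T (K M)) m) (%a m0. pt N M (act (K N) n a) m0))"
  if w: "w .: (ZZ N M)" for w
 proof -
  have "flp M N (bi (flp M N w)) = Sw M N (N ** M) w (%m n. LC M (N ** M) m (%a m0. pt N M (act N (T a) n) m0))"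
   unfolding bi_def flp_def[of M N "brLL_inv M N _"] using w by simp
  also have "... = sweedler (N ** M) w (%m n. sweedler (N ** M) (coact (toL T (K M)) m) (%a m0. pt N M (act (K N) n a) m0))"
   using w by (simp add: sweedler_Sw[of M N] sweedler_Sw[of H M])
  finally show ?thesis .
 qed
 have b: "braid_RL R TRL (toL T (K M)) (toL T (K N)) = (toL T (ZZ N M), ?g, toL T (ZZ M N))"
  unfolding braid_RL_def tensor_RL_K[OF M N] tensor_RL_K[OF N M] side_tensor side_sel
  by (auto simp: p[unfolded side_tensor side_sel] intro!: restrict_ext simp del: side_act)
 show ?thesis using b f i by blast
qed

text \<open>Passing to the reverse and to the inverse braiding each swaps the arguments, so the
  braiding of (A, B) on the right is the inverse of the right-left braiding of (A, B). The
  associativity constraints are inverses on both sides and match through their inverses.\<close>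

lemma strict_RR_RL: "strict_yd_link (cat_bar RR) (cat_in (cat_bar RL)) (toL T)"
proof -
 interpret B: braided_monoidal_category "cat_bar RR" by (rule braided_bar_RR)
 interpret yd_link "cat_bar RR" "cat_in (cat_bar RL)" "toL T"
  by unfold_locales (auto simp: arr_toL obj_bij(3), auto simp: YD_RL_def yd_arrows_iff)
 show ?thesis
 proof (rule strict_yd_link.intro[OF yd_link_axioms strict_yd_link_axioms.intro[OF braided_bar_RR]])
  show "Unit (cat_in (cat_bar RL)) = toL T (Unit (cat_bar RR))" by (simp add: unit_RL_toL)
  fix M N assume "M \<in> Obj (cat_bar RR)" "N \<in> Obj (cat_bar RR)"
  then show "TensO (cat_in (cat_bar RL)) (toL T M) (toL T N) = toL T (TensO (cat_bar RR) M N)"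
   by (simp add: tensor_RL_toL)
 next
  fix \<phi> \<psi> assume a: "\<phi> \<in> Arr (cat_bar RR)" "\<psi> \<in> Arr (cat_bar RR)"
  obtain M f M' N g N' where e: "\<phi> = (M, f, M')" "\<psi> = (N, g, N')" by (metis prod_cases3)
  then have o: "yd_RR R H M" "yd_RR R H M'" "yd_RR R H N" "yd_RR R H N'"
   using D_arr[of M f M'] D_arr[of N g N'] a by simp_all
  show "TensA (cat_in (cat_bar RL)) (Fa \<phi>) (Fa \<psi>) = Fa (TensA (cat_bar RR) \<phi> \<psi>)"
   by (simp add: e tensor_arrow_def tensor_RL_toL[OF o(3,1)] tensor_RL_toL[OF o(4,2)])
 next
  fix M N P assume "M \<in> Obj (cat_bar RR)" "N \<in> Obj (cat_bar RR)" "P \<in> Obj (cat_bar RR)"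
  then have o: "yd_RR R H M" "yd_RR R H N" "yd_RR R H P" by simp_all
  have a: "assoc_arrow R TRL (toL T P) (toL T N) (toL T M) = Fa (assoc_arrow R TRR P N M)"
   by (simp add: assoc_arrow_def corestrict_def tensor_RL_toL[OF o(3,2)] tensor_RL_toL[OF o(2,1)]
    tensor_RL_toL[OF TRR_RR(1)[OF o(3,2)] o(1)] tensor_RL_toL[OF o(3) TRR_RR(1)[OF o(2,1)]])
  obtain g where "inverse_arrows RR (assoc_arrow R TRR P N M) g" using assoc_RR_inverse[OF o(3,2,1)] by (elim exE)
  then have i: "inverse_arrows (cat_bar RR) (assoc_arrow R TRR P N M) g" by simp
  show "Assoc (cat_in (cat_bar RL)) (toL T M) (toL T N) (toL T P) = Fa (Assoc (cat_bar RR) M N P)"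
   using Fa_inverse(2,3)[OF i] by (simp add: a)
 next
  fix M assume "M \<in> Obj (cat_bar RR)"
  then have o: "yd_RR R H M" by simp
  note t = tensor_RL_toL[OF URR_K(1) o] tensor_RL_toL[OF o URR_K(1)]
  show "LUnit (cat_in (cat_bar RL)) (toL T M) = Fa (LUnit (cat_bar RR) M)" "RUnit (cat_in (cat_bar RL)) (toL T M) = Fa (RUnit (cat_bar RR) M)"
   by (simp_all add: right_lunit_def right_runit_def unit_RL_toL t)
 next
  fix A B assume "A \<in> Obj (cat_bar RR)" "B \<in> Obj (cat_bar RR)"
  then have o: "yd_RR R H A" "yd_RR R H B" by simp_all
  obtain f g where b: "braid_RL R TRL (toL T A) (toL T B) = (toL T (TRR A B), g, toL T (TRR B A))"
   "braid_RR R TRR B A = (TRR B A, f, TRR A B)" "inverse_arrows RR (TRR A B, g, TRR B A) (TRR B A, f, TRR A B)"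
   using braid_RL_toL[OF RR_obj_K(1)[OF o(1)] RR_obj_K(1)[OF o(2)]] unfolding RR_obj_K(2)[OF o(1)] RR_obj_K(2)[OF o(2)]
   by (elim exE conjE)
  then have i: "inverse_arrows (cat_bar RR) (TRR A B, g, TRR B A) (TRR B A, f, TRR A B)" by simp
  show "Braid (cat_in (cat_bar RL)) (toL T A) (toL T B) = Fa (Braid (cat_bar RR) A B)"
   using Fa_inverse(2)[OF i] by (simp add: b)
 qed
qed

lemma iso_RR_RL: "cat_bar RR \<cong>\<^sub>b\<^sub>r cat_in (cat_bar RL)"
 by (rule strict_yd_link.iso[OF strict_RR_RL])

end

theorem theorem2p12:
 fixes R :: "'k ring" and H :: "('k, 'u) weak_hopf"
 assumes "infinite (UNIV :: 'u set)"
  and "weak_hopf_algebra R H"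
  and "bij_betw (antipode H) (carrier H) (carrier H)"
 shows "YD_LL R H \<cong>\<^sub>b\<^sub>r cat_in (YD_LR R H)
  \<and> cat_in (YD_LR R H) \<cong>\<^sub>b\<^sub>r cat_bar (YD_RR R H)
  \<and> cat_bar (YD_RR R H) \<cong>\<^sub>b\<^sub>r cat_in (cat_bar (YD_RL R H))"
proof -
 interpret W: weak_hopf_algebra R H by (rule assms(2))
 interpret weak_hopf_bij R H
  by unfold_locales (use assms in simp_all)
 show ?thesis using strict_yd_link.iso[OF strict_LL_LR] iso_LR_RR iso_RR_RL by (intro conjI)
qed

end
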